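(* Let $p\ge 1$ and $k\ge 1$ be integers. Let $\beta^{(1)}$ and $\beta^{(2)}$ be two kernels, each even with total integral $1$, such that: (i) there are constants $c_1,c_2>0$ with $c_1^2\le \widehat{\beta^{(i)}}(\xi)\le c_2^2$ for all $\xi\in\mathbb{R}$ and $i=1,2$; (ii) $\int x^{j}\beta^{(1)}(x)\,dx=\int x^{j}\beta^{(2)}(x)\,dx$ for all integers $0\le j<2k-1$; (iii) $x^{2k}\beta^{(i)}(x)\in L^1(\mathbb{R})$ for $i=1,2$. Let $D>3$, $P>P_{\min}$ where $P_{\min}=3+\frac{D}{D-3}\left(\sqrt{3}+\sqrt{2D}\right)^2$, let $s>\frac{7}{2}$, and let $\varphi,\psi\in H^{s+P+2k+1}(\mathbb{R})$. Then there are constants $\epsilon_0>0$, $C>0$ and $T>0$, independent of $\epsilon$ and $\delta$, such that for all $0<\epsilon<\epsilon_0$ and all values of the parameter $\delta>0$ the solutions $u_i^{\epsilon,\delta}$ ($i=1,2$) of the Cauchy problems $$u_{tt}=\beta^{(i)}_\delta * \left(u+\epsilon^p u^{p+1}\right)_{xx},\qquad x\in\mathbb{R},\ t>0,$$ $$u(x,0)=\varphi(x),\qquad u_t(x,0)=\psi_x(x),\qquad x\in\mathbb{R},$$ are defined for all $t\in\left[0,\frac{T}{\epsilon^p}\right]$ and satisfy $$\left\Vert u_1^{\epsilon,\delta}(t)-u_2^{\epsilon,\delta}(t)\right\Vert_{H^{s+D}}\le C\delta^{2k}(1+t)\qquad\text{for all } t\le \frac{T}{\epsilon^p}.$$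
   Context: The unknown $u=u(x,t)$ is real-valued, $*$ denotes convolution in the $x$-variable, and subscripts $x,t$ denote partial derivatives. The Fourier transform is $\widehat{u}(\xi)=\int_{\mathbb{R}}u(x)e^{-i\xi x}\,dx$. $H^{s}=H^s(\mathbb{R})$ is the $L^2$-based Sobolev space with norm $\Vert u\Vert_{H^s}=\left(\int_{\mathbb{R}}(1+\xi^2)^s|\widehat{u}(\xi)|^2\,d\xi\right)^{1/2}$. A kernel $\beta$ is real and is either a function or, more generally, a finite measure $\mu$ on $\mathbb{R}$. When $\beta=\mu$ is a finite measure, moment integrals $\int x^j\beta(x)\,dx$ are read as $\int x^j\,d\mu$, and the condition $x^{2k}\beta\in L^1(\mathbb{R})$ is read as $\int x^{2k}\,d|\mu|<\infty$. For $\delta>0$, the scaled kernel is $\beta_\delta(x)=\frac{1}{\delta}\beta\left(\frac{x}{\delta}\right)$, equivalently $\widehat{\beta_\delta}(\xi)=\widehat{\beta}(\delta\xi)$ (which also defines $\beta_\delta$ when $\beta$ is a measure). The solutions referred to are the unique solutions in $C\left([0,\frac{T}{\epsilon^p}];H^{s+D}\right)\cap C^1\left([0,\frac{T}{\epsilon^p}];H^{s+D-1}\right)$. The constants $\epsilon_0,C,T$ may depend on the data $\varphi,\psi$, the kernels, and $p,k,s,P,D$. *)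

theory Defs
  imports "HOL-Analysis.Analysis"
begin

section \<open>Kernels: finite signed Borel measures on the line\<close>

text \<open>
  A finite signed measure is represented by its Jordan decomposition: the pair of its
  positive and negative parts, two finite Borel measures that are mutually singular.
  By the Jordan decomposition theorem this is a bijection between such pairs and finite
  signed measures. A kernel given by an integrable function is the special case
  of the pair of densities (see \<open>signed_measure_function\<close> below).
\<close>

type_synonym signed_measure = "real measure \<times> real measure"

definition signed_measure :: "signed_measure \<Rightarrow> bool" where
  "signed_measure \<mu> \<longleftrightarrow>
     finite_measure (fst \<mu>) \<and> sets (fst \<mu>) = sets borel \<and>
     finite_measure (snd \<mu>) \<and> sets (snd \<mu>) = sets borel \<and>
     (\<exists>A\<in>sets borel. emeasure (fst \<mu>) (- A) = 0 \<and> emeasure (snd \<mu>) A = 0)"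

definition sm_value :: "signed_measure \<Rightarrow> real set \<Rightarrow> real" where
  "sm_value \<mu> A = measure (fst \<mu>) A - measure (snd \<mu>) A"

definition total_variation :: "signed_measure \<Rightarrow> real measure" where
  "total_variation \<mu> =
     measure_of UNIV (sets borel) (\<lambda>A. emeasure (fst \<mu>) A + emeasure (snd \<mu>) A)"

definition sm_integral ::
    "signed_measure \<Rightarrow> (real \<Rightarrow> 'a) \<Rightarrow> 'a :: {banach, second_countable_topology}" where
  "sm_integral \<mu> f = (\<integral>x. f x \<partial>fst \<mu>) - (\<integral>x. f x \<partial>snd \<mu>)"

definition even_kernel :: "signed_measure \<Rightarrow> bool" where
  "even_kernel \<mu> \<longleftrightarrow> (\<forall>A\<in>sets borel. sm_value \<mu> (uminus ` A) = sm_value \<mu> A)"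

text \<open>
  Real-valued when \<open>\<mu>\<close> is even, so bounds on it are stated for its real part.
\<close>

definition kernel_fourier :: "signed_measure \<Rightarrow> real \<Rightarrow> complex" where
  "kernel_fourier \<mu> \<xi> = sm_integral \<mu> (\<lambda>x. exp (- \<i> * of_real (\<xi> * x)))"

text \<open>
  For a function, the push-forward under \<open>x \<mapsto> \<delta> x\<close> has density \<open>\<beta> (x / \<delta>) / \<delta>\<close>.
\<close>

definition scale_kernel :: "real \<Rightarrow> signed_measure \<Rightarrow> signed_measure" where
  "scale_kernel \<delta> \<mu> = (distr (fst \<mu>) borel (\<lambda>x. \<delta> * x), distr (snd \<mu>) borel (\<lambda>x. \<delta> * x))"

definition kernel_conv :: "signed_measure \<Rightarrow> (real \<Rightarrow> real) \<Rightarrow> real \<Rightarrow> real" where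
  "kernel_conv \<mu> f x = sm_integral \<mu> (\<lambda>y. f (x - y))"

lemma emeasure_total_variation:
  assumes "signed_measure \<mu>" "A \<in> sets borel"
  shows "emeasure (total_variation \<mu>) A = emeasure (fst \<mu>) A + emeasure (snd \<mu>) A"
proof -
  have s: "sets (fst \<mu>) = sets borel" "sets (snd \<mu>) = sets borel"
    using assms(1) by (auto simp: signed_measure_def)
  show ?thesis
  proof (rule emeasure_measure_of[OF total_variation_def])
    show "sets (borel :: real measure) \<subseteq> Pow UNIV" by simp
    show "A \<in> sets (total_variation \<mu>)"
      using assms(2) by (simp add: total_variation_def sigma_algebra.sigma_sets_eq[of UNIV] sets.sigma_algebra_axioms[of "borel :: real measure", simplified])
    show "positive (sets (total_variation \<mu>)) (\<lambda>A. emeasure (fst \<mu>) A + emeasure (snd \<mu>) A)"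
      by (simp add: positive_def)
    show "countably_additive (sets (total_variation \<mu>))
            (\<lambda>A. emeasure (fst \<mu>) A + emeasure (snd \<mu>) A)"
    proof (rule countably_additiveI)
      fix F :: "nat \<Rightarrow> real set"
      assume F: "range F \<subseteq> sets (total_variation \<mu>)" "disjoint_family F"
      have "range F \<subseteq> sets borel"
        using F(1) by (simp add: total_variation_def sigma_algebra.sigma_sets_eq[of UNIV] sets.sigma_algebra_axioms[of "borel :: real measure", simplified])
      then show "(\<Sum>i. emeasure (fst \<mu>) (F i) + emeasure (snd \<mu>) (F i)) =
          emeasure (fst \<mu>) (\<Union> (range F)) + emeasure (snd \<mu>) (\<Union> (range F))"
        using s F(2) by (simp add: suminf_add[symmetric] suminf_emeasure)
    qed
  qed
qed

lemma signed_measure_function: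
  fixes f :: "real \<Rightarrow> real"
  assumes "integrable lborel f"
  shows "signed_measure (density lborel (\<lambda>x. ennreal (f x)), density lborel (\<lambda>x. ennreal (- f x)))"
proof -
  have m [measurable]: "f \<in> borel_measurable borel"
    using borel_measurable_integrable[OF assms] by simp
  have fin: "finite_measure (density lborel (\<lambda>x. ennreal (g x)))"
    if "integrable lborel g" for g :: "real \<Rightarrow> real"
  proof (rule finite_measureI)
    have [measurable]: "g \<in> borel_measurable borel"
      using borel_measurable_integrable[OF that] by simp
    have "(\<integral>\<^sup>+x. ennreal (g x) \<partial>lborel) < \<infinity>"
      using that by (simp add: real_integrable_def less_top)
    then show "emeasure (density lborel (\<lambda>x. ennreal (g x)))
        (space (density lborel (\<lambda>x. ennreal (g x)))) \<noteq> \<infinity>"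
      by (simp add: emeasure_density)
  qed
  have "emeasure (density lborel (\<lambda>x. ennreal (f x))) (- {x. 0 \<le> f x}) = 0"
    by (subst emeasure_density)
       (auto simp: nn_integral_0_iff_AE indicator_def ennreal_neg)
  moreover have "emeasure (density lborel (\<lambda>x. ennreal (- f x))) {x. 0 \<le> f x} = 0"
    by (subst emeasure_density)
       (auto simp: nn_integral_0_iff_AE indicator_def ennreal_neg)
  moreover have "{x. 0 \<le> f x} \<in> sets borel" by measurable
  ultimately show ?thesis
    using fin[OF assms] fin[of "\<lambda>x. - f x"] assms
    unfolding signed_measure_def by auto
qed

lemma kernel_fourier_scale:
  assumes "signed_measure \<mu>"
  shows "kernel_fourier (scale_kernel \<delta> \<mu>) \<xi> = kernel_fourier \<mu> (\<delta> * \<xi>)"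
proof -
  have s [measurable_cong]: "sets (fst \<mu>) = sets borel" "sets (snd \<mu>) = sets borel"
    using assms by (auto simp: signed_measure_def)
  show ?thesis
    unfolding kernel_fourier_def sm_integral_def scale_kernel_def fst_conv snd_conv
    by (subst (1 2) integral_distr) (auto simp: algebra_simps)
qed

section \<open>Sobolev spaces\<close>

text \<open>
  Elements of $L^2$ and $H^s$ are represented by Borel functions; two of them are the same
  element when they agree almost everywhere.
\<close>

definition sq_integrable :: "(real \<Rightarrow> 'a :: {real_normed_vector, second_countable_topology}) \<Rightarrow> bool" where
  "sq_integrable f \<longleftrightarrow> f \<in> borel_measurable borel \<and> integrable lborel (\<lambda>x. (norm (f x))\<^sup>2)"

text \<open>
  The Fourier transform on $L^2$: the integral over the line is the limit in the mean of
  the integrals over \<open>{-R..R}\<close>. By Plancherel's theorem such a \<open>g\<close> exists for every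
  square-integrable \<open>f\<close> and is unique up to null sets.
\<close>

definition is_fourier :: "(real \<Rightarrow> real) \<Rightarrow> (real \<Rightarrow> complex) \<Rightarrow> bool" where
  "is_fourier f g \<longleftrightarrow> sq_integrable g \<and>
     ((\<lambda>R. \<integral>\<^sup>+\<xi>. ennreal ((cmod ((LINT x:{-R..R}|lborel.
          of_real (f x) * exp (- \<i> * of_real (\<xi> * x))) - g \<xi>))\<^sup>2) \<partial>lborel) \<longlongrightarrow> 0) at_top"

definition fourier :: "(real \<Rightarrow> real) \<Rightarrow> real \<Rightarrow> complex" where
  "fourier f = (SOME g. is_fourier f g)"

text \<open>
  Only for \<open>s \<ge> 0\<close>, where $H^s$ is a subspace of $L^2$.
\<close>

definition sobolev :: "real \<Rightarrow> (real \<Rightarrow> real) set" where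
  "sobolev s = {f. sq_integrable f \<and>
     integrable lborel (\<lambda>\<xi>. (1 + \<xi>\<^sup>2) powr s * (cmod (fourier f \<xi>))\<^sup>2)}"

definition sobolev_norm :: "real \<Rightarrow> (real \<Rightarrow> real) \<Rightarrow> real" where
  "sobolev_norm s f = sqrt (\<integral>\<xi>. (1 + \<xi>\<^sup>2) powr s * (cmod (fourier f \<xi>))\<^sup>2 \<partial>lborel)"

definition sobolev_continuous_on :: "real \<Rightarrow> real set \<Rightarrow> (real \<Rightarrow> real \<Rightarrow> real) \<Rightarrow> bool" where
  "sobolev_continuous_on s I u \<longleftrightarrow> (\<forall>t\<in>I. u t \<in> sobolev s) \<and>
     (\<forall>t\<in>I. ((\<lambda>r. sobolev_norm s (\<lambda>x. u r x - u t x)) \<longlongrightarrow> 0) (at t within I))"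

definition sobolev_has_deriv ::
    "real \<Rightarrow> real set \<Rightarrow> (real \<Rightarrow> real \<Rightarrow> real) \<Rightarrow> real \<Rightarrow> (real \<Rightarrow> real) \<Rightarrow> bool" where
  "sobolev_has_deriv s I u t w \<longleftrightarrow> (\<forall>r\<in>I. u r \<in> sobolev s) \<and> w \<in> sobolev s \<and>
     ((\<lambda>r. sobolev_norm s (\<lambda>x. (u r x - u t x) / (r - t) - w x)) \<longlongrightarrow> 0) (at t within I)"

definition test_function :: "(real \<Rightarrow> real) \<Rightarrow> bool" where
  "test_function \<theta> \<longleftrightarrow> (\<forall>n. (deriv ^^ n) \<theta> differentiable_on UNIV) \<and>
     (\<exists>R. \<forall>x. R < \<bar>x\<bar> \<longrightarrow> \<theta> x = 0)"

definition weak_deriv :: "nat \<Rightarrow> (real \<Rightarrow> real) \<Rightarrow> (real \<Rightarrow> real) \<Rightarrow> bool" where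
  "weak_deriv n f g \<longleftrightarrow> sq_integrable f \<and> sq_integrable g \<and>
     (\<forall>\<theta>. test_function \<theta> \<longrightarrow>
        (\<integral>x. f x * (deriv ^^ n) \<theta> x \<partial>lborel) = (-1) ^ n * (\<integral>x. g x * \<theta> x \<partial>lborel))"

section \<open>The Cauchy problem\<close>

text \<open>
  \<open>cauchy_solution \<mu> \<epsilon> p \<phi> \<psi> r \<tau> u\<close>: the function \<open>u\<close>, with \<open>u t x\<close> the value at time \<open>t\<close> and
  position \<open>x\<close>, lies in $C([0,\tau];H^r) \cap C^1([0,\tau];H^{r-1})$ and solves the problem with
  kernel \<open>\<mu>\<close> on $[0,\tau]$. Here \<open>v\<close> is $u_t$. The equation is an identity in $H^{r-2}$:
  \<open>q\<close> is the spatial derivative $(u + \epsilon^p u^{p+1})_{xx}$ at time \<open>t\<close>, and $u_{tt}$ is the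
  derivative of \<open>v\<close> as a curve in $H^{r-2}$.
\<close>

definition cauchy_solution ::
    "signed_measure \<Rightarrow> real \<Rightarrow> nat \<Rightarrow> (real \<Rightarrow> real) \<Rightarrow> (real \<Rightarrow> real) \<Rightarrow> real \<Rightarrow> real \<Rightarrow>
     (real \<Rightarrow> real \<Rightarrow> real) \<Rightarrow> bool" where
  "cauchy_solution \<mu> \<epsilon> p \<phi> \<psi> r \<tau> u \<longleftrightarrow>
     sobolev_continuous_on r {0..\<tau>} u \<and>
     (\<exists>v. sobolev_continuous_on (r - 1) {0..\<tau>} v \<and>
          (\<forall>t\<in>{0..\<tau>}. sobolev_has_deriv (r - 1) {0..\<tau>} u t (v t)) \<and>
          (\<forall>t\<in>{0<..\<tau>}. \<exists>q. weak_deriv 2 (\<lambda>x. u t x + \<epsilon> ^ p * u t x ^ (p + 1)) q \<and>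
             sobolev_has_deriv (r - 2) {0..\<tau>} v t (kernel_conv \<mu> q)) \<and>
          (AE x in lborel. u 0 x = \<phi> x) \<and>
          weak_deriv 1 \<psi> (v 0))"

definition unique_cauchy_solution ::
    "signed_measure \<Rightarrow> real \<Rightarrow> nat \<Rightarrow> (real \<Rightarrow> real) \<Rightarrow> (real \<Rightarrow> real) \<Rightarrow> real \<Rightarrow> real \<Rightarrow>
     (real \<Rightarrow> real \<Rightarrow> real) \<Rightarrow> bool" where
  "unique_cauchy_solution \<mu> \<epsilon> p \<phi> \<psi> r \<tau> u \<longleftrightarrow> cauchy_solution \<mu> \<epsilon> p \<phi> \<psi> r \<tau> u \<and>
     (\<forall>w. cauchy_solution \<mu> \<epsilon> p \<phi> \<psi> r \<tau> w \<longrightarrow>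
        (\<forall>t\<in>{0..\<tau>}. AE x in lborel. w t x = u t x))"

end

theory Submission
  imports Defs "HOL-Probability.Probability"
begin

text \<open>
  With \<open>m\<close> the symbol of the kernel, the equation is the system $u_t = v_x$,
  $v_t = m(D)(u + \epsilon^p u^{p+1})_x$. The energy
  $\langle v, m(D)^{-1} v\rangle + \langle u, u\rangle + (p+1)\epsilon^p\langle u^p u, u\rangle$ at the level of $H^s$
  symmetrizes it: its time derivative is $O(\epsilon^p)$ times itself, without loss of derivatives and
  uniformly in $\delta$, since only the bounds on \<open>m\<close> enter. This gives existence up to time $T/\epsilon^p$
  from spectrally truncated equations. The same energy for the difference of two solutions gives
  convergence of the truncations, uniqueness, and the comparison of the kernels: equal moments
  yield $|m_1 - m_2| \le C \delta^{2k} \xi^{2k}$, and the extra derivatives of the solution are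
  bounded because the data are smoother.
\<close>

text \<open>The obstacle is the term \<open>(p+1) \<epsilon>^p u^p u_x\<close>, which costs a
  derivative in an H^s estimate. Its top part is multiplication by the real function
  \<open>b = (p+1) u^p\<close>, self-adjoint on L^2; the third term of the energy produces the same
  pairing with opposite sign, so that only \<open>b_t\<close>, \<open>b_x\<close> and commutators
  remain. To have exact identities between L^2 operators, an element of H^s is replaced by its
  weighted Fourier transform, and products become convolutions with kernels dominated by a
  square-integrable weight of the lower frequency. Since \<open>b_t\<close> contains
  \<open>v_x\<close>, the coefficient is differentiated in time one level lower. One differential
  inequality for a pair of solutions, with an error term, does everything: paired with zero it
  bounds a solution, two cutoffs give a Cauchy sequence, two kernels the rate, two solutions
  uniqueness. A sharp cutoff is self-adjoint and disappears when tested against its own range, so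
  truncation keeps the energy identity. The errors of kernel and cutoff are multipliers paid for by
  2k + 2 levels of smoothness.\<close>

lemma sq_integrable_measurable [measurable_dest]:
  "sq_integrable f \<Longrightarrow> f \<in> borel_measurable borel"
  by (simp add: sq_integrable_def)

lemma sq_integrable_bound:
  fixes f :: "real \<Rightarrow> 'a :: {real_normed_vector, second_countable_topology}"
  assumes f [measurable]: "f \<in> borel_measurable borel" and g: "integrable lborel g"
    and "AE x in lborel. (norm (f x))\<^sup>2 \<le> g x"
  shows "sq_integrable f"
  unfolding sq_integrable_def
proof (intro conjI f Bochner_Integration.integrable_bound[OF g])
  show "AE x in lborel. norm ((norm (f x))\<^sup>2) \<le> norm (g x)"
    using assms(3) by eventually_elim (use abs_ge_self order_trans in force)
qed measurable

lemma sq_integrable_add: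
  fixes f g :: "real \<Rightarrow> 'a :: {real_normed_vector, second_countable_topology}"
  assumes f: "sq_integrable f" and g: "sq_integrable g"
  shows "sq_integrable (\<lambda>x. f x + g x)"
proof (rule sq_integrable_bound)
  show "(\<lambda>x. f x + g x) \<in> borel_measurable borel" using f g by measurable
  show "integrable lborel (\<lambda>x. 2 * (norm (f x))\<^sup>2 + 2 * (norm (g x))\<^sup>2)"
    using f g by (auto simp: sq_integrable_def)
  have "(norm (a + b))\<^sup>2 \<le> 2 * (norm a)\<^sup>2 + 2 * (norm b)\<^sup>2" for a b :: 'a
  proof -
    have "(norm (a + b))\<^sup>2 \<le> (norm a + norm b)\<^sup>2"
      by (intro power_mono norm_triangle_ineq) auto
    also have "\<dots> \<le> 2 * (norm a)\<^sup>2 + 2 * (norm b)\<^sup>2"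
      using sum_squares_bound[of "norm a" "norm b"] by (simp add: power2_sum)
    finally show ?thesis .
  qed
  then show "AE x in lborel. (norm (f x + g x))\<^sup>2 \<le> 2 * (norm (f x))\<^sup>2 + 2 * (norm (g x))\<^sup>2"
    by simp
qed

lemma sq_integrable_mult_bounded:
  fixes f \<sigma> :: "real \<Rightarrow> complex"
  assumes f: "sq_integrable f" and s [measurable]: "\<sigma> \<in> borel_measurable borel"
    and C: "\<And>x. cmod (\<sigma> x) \<le> C"
  shows "sq_integrable (\<lambda>x. \<sigma> x * f x)"
proof (rule sq_integrable_bound)
  show "(\<lambda>x. \<sigma> x * f x) \<in> borel_measurable borel" using f by measurable
  show "integrable lborel (\<lambda>x. C\<^sup>2 * (norm (f x))\<^sup>2)"
    using f by (auto simp: sq_integrable_def)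
  show "AE x in lborel. (norm (\<sigma> x * f x))\<^sup>2 \<le> C\<^sup>2 * (norm (f x))\<^sup>2"
    using C by (auto simp: norm_mult power_mult_distrib intro!: mult_right_mono power_mono)
qed

lemma sq_integrable_cmult:
  fixes f :: "real \<Rightarrow> complex"
  shows "sq_integrable f \<Longrightarrow> sq_integrable (\<lambda>x. c * f x)"
  by (rule sq_integrable_mult_bounded[where C="cmod c"]) auto

lemma sq_integrable_zero [simp]: "sq_integrable (\<lambda>x. 0)"
  by (simp add: sq_integrable_def)

lemma sq_integrable_uminus:
  fixes f :: "real \<Rightarrow> 'a :: {real_normed_vector, second_countable_topology}"
  shows "sq_integrable f \<Longrightarrow> sq_integrable (\<lambda>x. - f x)"
  by (auto simp: sq_integrable_def)

lemma sq_integrable_diff: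
  fixes f g :: "real \<Rightarrow> 'a :: {real_normed_vector, second_countable_topology}"
  shows "sq_integrable f \<Longrightarrow> sq_integrable g \<Longrightarrow> sq_integrable (\<lambda>x. f x - g x)"
  using sq_integrable_add[of f "\<lambda>x. - g x"] sq_integrable_uminus[of g] by simp

lemma sq_integrable_integrable_mult:
  fixes f g :: "real \<Rightarrow> complex"
  assumes f: "sq_integrable f" and g: "sq_integrable g"
  shows "integrable lborel (\<lambda>x. f x * g x)"
proof (rule Bochner_Integration.integrable_bound)
  show "integrable lborel (\<lambda>x. (cmod (f x))\<^sup>2 + (cmod (g x))\<^sup>2)"
    using f g by (auto simp: sq_integrable_def)
  show "(\<lambda>x. f x * g x) \<in> borel_measurable lborel" using f g by measurable
  have "a * b \<le> a\<^sup>2 + b\<^sup>2" if "a \<ge> 0" "b \<ge> 0" for a b :: real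
    using sum_squares_bound[of a b] mult_nonneg_nonneg[OF that] by linarith
  then show "AE x in lborel. norm (f x * g x) \<le> norm ((cmod (f x))\<^sup>2 + (cmod (g x))\<^sup>2)"
    by (auto simp: norm_mult)
qed

lemma borel_measurable_cnj [measurable]: "f \<in> borel_measurable M \<Longrightarrow> (\<lambda>x. cnj (f x)) \<in> borel_measurable M"
  by (rule borel_measurable_continuous_on[of cnj]) (intro continuous_intros)

lemma sq_integrable_cnj: "sq_integrable f \<Longrightarrow> sq_integrable (\<lambda>x. cnj (f x))"
  by (auto simp: sq_integrable_def)

\<comment> \<open>The Hilbert space L^2 of complex functions on the line\<close>
quotient_type l2 = "real \<Rightarrow> complex" / partial:
  "\<lambda>f g. sq_integrable f \<and> sq_integrable g \<and> (AE x in lborel. f x = g x)"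
proof (rule part_equivpI)
  show "\<exists>x. sq_integrable x \<and> sq_integrable x \<and> (AE xa in lborel. x xa = (x xa :: complex))"
    by (rule exI[of _ "\<lambda>x. 0"]) simp
  show "transp (\<lambda>f g. sq_integrable f \<and> sq_integrable g \<and> (AE x in lborel. f x = (g x :: complex)))"
    by (rule transpI) (auto elim: eventually_elim2)
qed (auto simp: symp_def)

abbreviation mk :: "(real \<Rightarrow> complex) \<Rightarrow> l2" where "mk \<equiv> abs_l2"
abbreviation rep :: "l2 \<Rightarrow> real \<Rightarrow> complex" where "rep \<equiv> rep_l2"

lemma sq_rep [simp, intro]: "sq_integrable (rep x)"
  using Quotient3_rep_reflp[OF Quotient3_l2, of x] by simp

lemma rep_measurable [measurable]: "rep x \<in> borel_measurable borel"
  using sq_rep[of x] by (simp add: sq_integrable_def)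

lemma mk_rep [simp]: "mk (rep x) = x"
  using Quotient3_abs_rep[OF Quotient3_l2] .

lemma mk_eq_iff: "sq_integrable f \<Longrightarrow> sq_integrable g \<Longrightarrow> mk f = mk g \<longleftrightarrow> (AE x in lborel. f x = g x)"
  using Quotient3_rel[OF Quotient3_l2, of f g] by auto

lemma mk_eqI: "sq_integrable f \<Longrightarrow> sq_integrable g \<Longrightarrow> AE x in lborel. f x = g x \<Longrightarrow> mk f = mk g"
  using mk_eq_iff by blast

lemma rep_mk: "sq_integrable f \<Longrightarrow> AE x in lborel. rep (mk f) x = f x"
  using mk_eq_iff[of "rep (mk f)" f] by simp

lemma l2_eq_iff: "x = y \<longleftrightarrow> (AE t in lborel. rep x t = rep y t)"
  using mk_eq_iff[of "rep x" "rep y"] by simp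

lemma l2_eqI: "AE t in lborel. rep x t = rep y t \<Longrightarrow> x = y"
  using l2_eq_iff by blast

instantiation l2 :: real_vector
begin
definition "0 = mk (\<lambda>t. 0)"
definition "x + y = mk (\<lambda>t. rep x t + rep y t)"
definition "- x = mk (\<lambda>t. - rep x t)"
definition "x - y = mk (\<lambda>t. rep x t - rep y t)"
definition "c *\<^sub>R x = mk (\<lambda>t. of_real c * rep x t)"

lemma rep_zero: "AE t in lborel. rep 0 t = 0"
  unfolding zero_l2_def by (rule rep_mk) simp
lemma rep_add: "AE t in lborel. rep (x + y) t = rep x t + rep y t"
  unfolding plus_l2_def by (rule rep_mk) (auto intro: sq_integrable_add)
lemma rep_uminus: "AE t in lborel. rep (- x) t = - rep x t"
  unfolding uminus_l2_def by (rule rep_mk) (auto intro: sq_integrable_uminus)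
lemma rep_diff: "AE t in lborel. rep (x - y) t = rep x t - rep y t"
  unfolding minus_l2_def by (rule rep_mk) (auto intro: sq_integrable_diff)
lemma rep_scaleR: "AE t in lborel. rep (c *\<^sub>R x) t = of_real c * rep x t"
  unfolding scaleR_l2_def by (rule rep_mk) (auto intro: sq_integrable_cmult)

instance
proof
  fix x y z :: l2 and a b :: real
  show "x + y + z = x + (y + z)"
    by (rule l2_eqI, use rep_add[of "x+y" z] rep_add[of x y] rep_add[of x "y+z"] rep_add[of y z] in eventually_elim) simp
  show "x + y = y + x"
    by (rule l2_eqI, use rep_add[of x y] rep_add[of y x] in eventually_elim) simp
  show "0 + x = x"
    by (rule l2_eqI, use rep_add[of 0 x] rep_zero in eventually_elim) simp
  show "- x + x = 0"
    by (rule l2_eqI, use rep_add[of "-x" x] rep_uminus[of x] rep_zero in eventually_elim) simp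
  show "x - y = x + - y"
    by (rule l2_eqI, use rep_add[of x "-y"] rep_uminus[of y] rep_diff[of x y] in eventually_elim) simp
  show "a *\<^sub>R (x + y) = a *\<^sub>R x + a *\<^sub>R y"
    by (rule l2_eqI, use rep_add[of x y] rep_add[of "a *\<^sub>R x" "a *\<^sub>R y"] rep_scaleR[of a x] rep_scaleR[of a y] rep_scaleR[of a "x+y"] in eventually_elim) (simp add: algebra_simps)
  show "(a + b) *\<^sub>R x = a *\<^sub>R x + b *\<^sub>R x"
    by (rule l2_eqI, use rep_add[of "a *\<^sub>R x" "b *\<^sub>R x"] rep_scaleR[of a x] rep_scaleR[of b x] rep_scaleR[of "a+b" x] in eventually_elim) (simp add: algebra_simps)
  show "a *\<^sub>R b *\<^sub>R x = (a * b) *\<^sub>R x"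
    by (rule l2_eqI, use rep_scaleR[of a "b *\<^sub>R x"] rep_scaleR[of b x] rep_scaleR[of "a*b" x] in eventually_elim) (simp add: algebra_simps)
  show "1 *\<^sub>R x = x"
    by (rule l2_eqI, use rep_scaleR[of 1 x] in eventually_elim) simp
qed
end

lemma mk_add: "sq_integrable f \<Longrightarrow> sq_integrable g \<Longrightarrow> mk (\<lambda>t. f t + g t) = mk f + mk g"
  unfolding plus_l2_def
  by (rule mk_eqI) (use rep_mk[of f] rep_mk[of g] in \<open>auto intro!: sq_integrable_add elim: eventually_elim2\<close>)
lemma mk_diff: "sq_integrable f \<Longrightarrow> sq_integrable g \<Longrightarrow> mk (\<lambda>t. f t - g t) = mk f - mk g"
  unfolding minus_l2_def
  by (rule mk_eqI) (use rep_mk[of f] rep_mk[of g] in \<open>auto intro!: sq_integrable_diff elim: eventually_elim2\<close>)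
lemma mk_scale: "sq_integrable f \<Longrightarrow> mk (\<lambda>t. of_real c * f t) = c *\<^sub>R mk f"
  unfolding scaleR_l2_def
  by (rule mk_eqI) (auto intro!: sq_integrable_cmult eventually_mono[OF rep_mk[of f]])

text \<open>Only the real part of the complex pairing is taken: energies are real and time
  derivatives live in a real Banach space. Where a complex identity is wanted, one argument is
  multiplied by \<open>\<i>\<close>.\<close>

instantiation l2 :: real_inner
begin
definition "inner x y = (\<integral>t. Re (rep x t * cnj (rep y t)) \<partial>lborel)"
definition norm_l2_def: "norm x = sqrt (inner x (x :: l2))"
definition dist_l2_def: "dist x y = norm (x - y :: l2)"
definition "sgn x = x /\<^sub>R norm (x :: l2)"
definition "(uniformity :: (l2 \<times> l2) filter) = (INF e\<in>{0<..}. principal {(x, y). dist x y < e})"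
definition "open U = (\<forall>x\<in>U. eventually (\<lambda>(x', y). x' = x \<longrightarrow> y \<in> U) (uniformity :: (l2 \<times> l2) filter))"

lemma inner_integrable: "integrable lborel (\<lambda>t. Re (rep x t * cnj (rep y t)))"
  by (intro integrable_Re sq_integrable_integrable_mult sq_integrable_cnj sq_rep)

instance
proof
  fix x y z :: l2 and r :: real
  show "inner x y = inner y x"
    unfolding inner_l2_def by (rule Bochner_Integration.integral_cong) (auto simp: mult.commute)
  show "inner (x + y) z = inner x z + inner y z"
    unfolding inner_l2_def
    apply (subst Bochner_Integration.integral_add[symmetric, OF inner_integrable inner_integrable])
    apply (rule integral_cong_AE, measurable)
    using rep_add[of x y] by eventually_elim (simp add: algebra_simps)
  show "inner (r *\<^sub>R x) y = r * inner x y"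
    unfolding inner_l2_def
    apply (subst integral_mult_right_zero[symmetric])
    apply (rule integral_cong_AE, measurable)
    using rep_scaleR[of r x] by eventually_elim (simp add: algebra_simps)
  have sq: "Re (rep x t * cnj (rep x t)) = (cmod (rep x t))\<^sup>2" for t
    by (simp add: complex_mult_cnj cmod_power2)
  show "0 \<le> inner x x" unfolding inner_l2_def sq by simp
  show "inner x x = 0 \<longleftrightarrow> x = 0"
  proof -
    have "inner x x = 0 \<longleftrightarrow> (AE t in lborel. (cmod (rep x t))\<^sup>2 = 0)"
      unfolding inner_l2_def sq
      by (rule integral_nonneg_eq_0_iff_AE) (use inner_integrable[of x x] sq in auto)
    also have "\<dots> \<longleftrightarrow> (AE t in lborel. rep x t = rep 0 t)"
    proof
      assume "AE t in lborel. (cmod (rep x t))\<^sup>2 = 0"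
      then show "AE t in lborel. rep x t = rep 0 t" using rep_zero by eventually_elim simp
    next
      assume "AE t in lborel. rep x t = rep 0 t"
      then show "AE t in lborel. (cmod (rep x t))\<^sup>2 = 0" using rep_zero by eventually_elim simp
    qed
    also have "\<dots> \<longleftrightarrow> x = 0" by (simp add: l2_eq_iff)
    finally show ?thesis .
  qed
qed (simp_all add: norm_l2_def dist_l2_def sgn_l2_def uniformity_l2_def open_l2_def)
end

lemma norm_l2_sq: "(norm x)\<^sup>2 = (\<integral>t. (cmod (rep x t))\<^sup>2 \<partial>lborel)"
proof -
  have "(norm x)\<^sup>2 = inner x x" by (simp add: power2_norm_eq_inner)
  then show ?thesis by (simp add: inner_l2_def complex_mult_cnj cmod_power2)
qed

lemma nn_norm_l2: "(\<integral>\<^sup>+t. ennreal ((cmod (rep x t))\<^sup>2) \<partial>lborel) = ennreal ((norm x)\<^sup>2)"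
  unfolding norm_l2_sq by (rule nn_integral_eq_integral) (use sq_rep[of x] in \<open>auto simp: sq_integrable_def\<close>)

lemma nn_norm_mk: "sq_integrable f \<Longrightarrow> (\<integral>\<^sup>+t. ennreal ((cmod (f t))\<^sup>2) \<partial>lborel) = ennreal ((norm (mk f))\<^sup>2)"
  unfolding nn_norm_l2[symmetric]
  by (rule nn_integral_cong_AE) (use rep_mk[of f] in \<open>auto elim: eventually_mono\<close>)

lemma norm_mk_sq: "sq_integrable f \<Longrightarrow> (norm (mk f))\<^sup>2 = (\<integral>t. (cmod (f t))\<^sup>2 \<partial>lborel)"
  unfolding norm_l2_sq
  by (rule integral_cong_AE, measurable) (use rep_mk[of f] in \<open>auto elim: eventually_mono\<close>)

lemma sq_integrable_nn:
  fixes f :: "real \<Rightarrow> complex"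
  assumes [measurable]: "f \<in> borel_measurable borel" and "(\<integral>\<^sup>+t. ennreal ((cmod (f t))\<^sup>2) \<partial>lborel) < \<infinity>"
  shows "sq_integrable f"
  unfolding sq_integrable_def using assms by (auto intro!: integrableI_bounded)

lemma norm_mk_le:
  assumes "sq_integrable f" "(\<integral>\<^sup>+t. ennreal ((cmod (f t))\<^sup>2) \<partial>lborel) \<le> ennreal (C\<^sup>2)" "C \<ge> 0"
  shows "norm (mk f) \<le> C"
proof -
  have "(norm (mk f))\<^sup>2 \<le> C\<^sup>2"
    using assms by (simp add: nn_norm_mk)
  then show ?thesis using assms(3) by (rule power2_le_imp_le)
qed

lemma inner_mk:
  assumes "sq_integrable f" "sq_integrable g"
  shows "inner (mk f) (mk g) = (\<integral>t. Re (f t * cnj (g t)) \<partial>lborel)"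
  unfolding inner_l2_def
  apply (rule integral_cong_AE)
  using assms apply measurable
  using rep_mk[OF assms(1)] rep_mk[OF assms(2)] by eventually_elim simp

text \<open>Along a subsequence with increments at most $4^{-k}$, the integral of $\sum_k 4^k |f_{k+1} - f_k|^2$
  is finite, which gives geometric convergence almost everywhere.\<close>

instance l2 :: complete_space
proof
  fix X :: "nat \<Rightarrow> l2"
  assume C: "Cauchy X"
  have "\<exists>N. \<forall>m\<ge>N. \<forall>n\<ge>N. dist (X m) (X n) < (1/4)^k" for k :: nat
    using metric_CauchyD[OF C, of "(1/4)^k"] by simp
  then obtain N where N: "\<And>k m n. m \<ge> N k \<Longrightarrow> n \<ge> N k \<Longrightarrow> dist (X m) (X n) < (1/4)^k"
    by metis
  \<comment> \<open>The sum makes \<open>r\<close> monotone and at least \<open>N k\<close>; the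
    added \<open>k\<close> makes it strictly increasing, as a subsequence must be.\<close>
  define r where "r k = (\<Sum>i\<le>k. N i) + k" for k
  have rN: "r k \<ge> N k" for k
  proof -
    have "N k \<le> (\<Sum>i\<le>k. N i)" by (rule member_le_sum) auto
    then show ?thesis by (simp add: r_def)
  qed
  have rmono: "r k \<le> r (Suc k)" for k by (simp add: r_def)
  then have rmono': "k \<le> j \<Longrightarrow> r k \<le> r j" for k j by (rule lift_Suc_mono_le)
  have dX: "norm (X (r j) - X (r k)) \<le> (1/4)^k" if "k \<le> j" for j k
    using N[of k "r j" "r k"] rN[of k] rmono'[OF that] by (simp add: dist_norm)
  define f where "f k = rep (X (r k))" for k
  have [measurable]: "f k \<in> borel_measurable borel" for k by (simp add: f_def rep_measurable)
  have fd: "(\<integral>\<^sup>+t. ennreal ((cmod (f j t - f k t))\<^sup>2) \<partial>lborel) \<le> ennreal (((1/4)^k)\<^sup>2)" if "k \<le> j" for j k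
  proof -
    have "(\<integral>\<^sup>+t. ennreal ((cmod (f j t - f k t))\<^sup>2) \<partial>lborel) = (\<integral>\<^sup>+t. ennreal ((cmod (rep (X (r j) - X (r k)) t))\<^sup>2) \<partial>lborel)"
      unfolding f_def by (rule nn_integral_cong_AE, use rep_diff[of "X (r j)" "X (r k)"] in eventually_elim) simp
    also have "\<dots> \<le> ennreal (((1/4)^k)\<^sup>2)"
      unfolding nn_norm_l2 using dX[OF that] by (intro ennreal_leI power_mono) auto
    finally show ?thesis .
  qed
  have "(\<integral>\<^sup>+t. (\<Sum>k. ennreal (4^k * (cmod (f (Suc k) t - f k t))\<^sup>2)) \<partial>lborel) =
      (\<Sum>k. \<integral>\<^sup>+t. ennreal (4^k * (cmod (f (Suc k) t - f k t))\<^sup>2) \<partial>lborel)"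
    by (rule nn_integral_suminf) measurable
  also have "\<dots> \<le> (\<Sum>k. ennreal ((1/4)^k))"
  proof (rule suminf_le)
    fix k
    have "(\<integral>\<^sup>+t. ennreal (4^k * (cmod (f (Suc k) t - f k t))\<^sup>2) \<partial>lborel) =
       ennreal (4^k) * (\<integral>\<^sup>+t. ennreal ((cmod (f (Suc k) t - f k t))\<^sup>2) \<partial>lborel)"
      by (subst nn_integral_cmult[symmetric]) (auto simp: ennreal_mult)
    also have "\<dots> \<le> ennreal (4^k) * ennreal (((1/4)^k)\<^sup>2)"
      by (intro mult_left_mono fd) auto
    also have "\<dots> = ennreal ((1/4)^k)"
    proof -
      have "4^k * (1/4::real)^k = 1" by (simp add: power_mult_distrib[symmetric])
      then have "4^k * ((1/4)^k)\<^sup>2 = (1/4::real)^k"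
        unfolding power2_eq_square mult.assoc[symmetric] by simp
      then show ?thesis by (subst ennreal_mult[symmetric]) auto
    qed
    finally show "(\<integral>\<^sup>+t. ennreal (4^k * (cmod (f (Suc k) t - f k t))\<^sup>2) \<partial>lborel) \<le> ennreal ((1/4)^k)" .
  qed auto
  also have "\<dots> < \<infinity>"
  proof -
    have "(\<Sum>k. ennreal ((1/4)^k)) = ennreal (\<Sum>k. (1/4)^k)"
      by (rule suminf_ennreal2) (auto intro: summable_geometric)
    then show ?thesis by simp
  qed
  finally have fin: "(\<integral>\<^sup>+t. (\<Sum>k. ennreal (4^k * (cmod (f (Suc k) t - f k t))\<^sup>2)) \<partial>lborel) \<noteq> \<infinity>"
    by (rule less_imp_neq)
  have "AE t in lborel. (\<Sum>k. ennreal (4^k * (cmod (f (Suc k) t - f k t))\<^sup>2)) \<noteq> \<infinity>"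
    by (rule nn_integral_PInf_AE[OF _ fin]) measurable
  then have conv: "AE t in lborel. convergent (\<lambda>k. f k t)"
  proof eventually_elim
    fix t
    assume fint: "(\<Sum>k. ennreal (4^k * (cmod (f (Suc k) t - f k t))\<^sup>2)) \<noteq> \<infinity>"
    have "\<exists>B\<ge>0. S = ennreal B" if "S \<noteq> \<infinity>" for S
      using that by (cases S) auto
    from this[OF fint] obtain B where
      B: "(\<Sum>k. ennreal (4^k * (cmod (f (Suc k) t - f k t))\<^sup>2)) = ennreal B" "B \<ge> 0" by blast
    have le: "cmod (f (Suc k) t - f k t) \<le> sqrt B * (1/2)^k" for k
    proof -
      have "ennreal (4^k * (cmod (f (Suc k) t - f k t))\<^sup>2) \<le> ennreal B"
        using sum_le_suminf[of "\<lambda>k. ennreal (4^k * (cmod (f (Suc k) t - f k t))\<^sup>2)" "{k}"]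
        unfolding B(1) by (simp del: ennreal_le_iff ennreal_le_iff2)
      then have "4^k * (cmod (f (Suc k) t - f k t))\<^sup>2 \<le> B" using B(2) by simp
      moreover have "(2^k * cmod (f (Suc k) t - f k t))\<^sup>2 = 4^k * (cmod (f (Suc k) t - f k t))\<^sup>2"
        unfolding power_mult_distrib power_mult[symmetric] mult.commute[of k 2] by (simp add: power_mult)
      ultimately have "(2^k * cmod (f (Suc k) t - f k t))\<^sup>2 \<le> B" by simp
      then have "2^k * cmod (f (Suc k) t - f k t) \<le> sqrt B" by (rule real_le_rsqrt)
      then have "(2^k * cmod (f (Suc k) t - f k t)) * (1/2)^k \<le> sqrt B * (1/2)^k"
        by (rule mult_right_mono) simp
      moreover have "(2::real)^k * (1/2)^k = 1" unfolding power_mult_distrib[symmetric] by simp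
      moreover have "(2^k * cmod (f (Suc k) t - f k t)) * (1/2)^k = (2^k * (1/2)^k) * cmod (f (Suc k) t - f k t)"
        by (simp only: ac_simps)
      ultimately show ?thesis by simp
    qed
    have "summable (\<lambda>k. f (Suc k) t - f k t)"
      by (rule summable_comparison_test'[OF summable_mult[OF summable_geometric[of "1/2::real"], of "sqrt B"], of 0])
         (use le in auto)
    then have "convergent (\<lambda>n. \<Sum>k<n. f (Suc k) t - f k t)" by (simp add: summable_iff_convergent)
    then have "convergent (\<lambda>n. (f n t - f 0 t) + f 0 t)"
      using sum_lessThan_telescope[of "\<lambda>k. f k t"] by (intro convergent_add convergent_const) simp
    then show "convergent (\<lambda>k. f k t)" by simp
  qed
  define F where "F t = lim (\<lambda>k. f k t)" for t
  have [measurable]: "F \<in> borel_measurable borel" unfolding F_def by measurable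
  have lim: "AE t in lborel. (\<lambda>k. f k t) \<longlonglongrightarrow> F t"
    using conv by eventually_elim (simp add: F_def convergent_LIMSEQ_iff)
  \<comment> \<open>Fatou's lemma carries the Cauchy bound within the subsequence over to its
    pointwise limit.\<close>
  have Fd: "(\<integral>\<^sup>+t. ennreal ((cmod (F t - f k t))\<^sup>2) \<partial>lborel) \<le> ennreal (((1/4)^k)\<^sup>2)" for k
  proof -
    have "(\<integral>\<^sup>+t. ennreal ((cmod (F t - f k t))\<^sup>2) \<partial>lborel) = (\<integral>\<^sup>+t. liminf (\<lambda>j. ennreal ((cmod (f j t - f k t))\<^sup>2)) \<partial>lborel)"
    proof (rule nn_integral_cong_AE, use lim in eventually_elim)
      fix t assume "(\<lambda>k. f k t) \<longlonglongrightarrow> F t"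
      then have "(\<lambda>j. ennreal ((cmod (f j t - f k t))\<^sup>2)) \<longlonglongrightarrow> ennreal ((cmod (F t - f k t))\<^sup>2)"
        by (intro tendsto_ennrealI tendsto_power tendsto_norm tendsto_diff tendsto_const)
      then show "ennreal ((cmod (F t - f k t))\<^sup>2) = liminf (\<lambda>j. ennreal ((cmod (f j t - f k t))\<^sup>2))"
        using lim_imp_Liminf[OF sequentially_bot] by metis
    qed
    also have "\<dots> \<le> liminf (\<lambda>j. \<integral>\<^sup>+t. ennreal ((cmod (f j t - f k t))\<^sup>2) \<partial>lborel)"
      by (rule nn_integral_liminf) measurable
    also have "\<dots> \<le> ennreal (((1/4)^k)\<^sup>2)"
    proof -
      have "eventually (\<lambda>j. (\<integral>\<^sup>+t. ennreal ((cmod (f j t - f k t))\<^sup>2) \<partial>lborel) \<le> ennreal (((1/4)^k)\<^sup>2)) sequentially"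
        by (rule eventually_sequentiallyI[of k]) (rule fd)
      then have "liminf (\<lambda>j. \<integral>\<^sup>+t. ennreal ((cmod (f j t - f k t))\<^sup>2) \<partial>lborel) \<le> liminf (\<lambda>j. ennreal (((1/4)^k)\<^sup>2))"
        by (rule Liminf_mono)
      then show ?thesis by (simp add: Liminf_const)
    qed
    finally show ?thesis .
  qed
  have sqd: "sq_integrable (\<lambda>t. F t - f k t)" for k
    by (rule sq_integrable_nn) (use Fd[of k] in \<open>auto simp: less_top[symmetric] top_unique\<close>)
  have "sq_integrable (\<lambda>t. (F t - f 0 t) + f 0 t)"
    by (rule sq_integrable_add[OF sqd]) (simp add: f_def)
  then have sqF: "sq_integrable F" by simp
  have nd: "norm (mk F - X (r k)) \<le> (1/4)^k" for k
  proof -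
    have "mk F - X (r k) = mk (\<lambda>t. F t - f k t)"
      using mk_diff[OF sqF, of "f k"] by (simp add: f_def)
    then show ?thesis using norm_mk_le[OF sqd Fd] by simp
  qed
  have p0: "(\<lambda>k. (1/4::real)^k) \<longlonglongrightarrow> 0" by (rule LIMSEQ_power_zero) simp
  have "(\<lambda>k. mk F - X (r k)) \<longlonglongrightarrow> 0"
    by (rule Lim_null_comparison[OF _ p0]) (use nd in auto)
  from tendsto_diff[OF tendsto_const[of "mk F"] this]
  have "(X \<circ> r) \<longlonglongrightarrow> mk F" by (simp add: comp_def)
  moreover have "strict_mono r" by (simp add: strict_mono_Suc_iff r_def)
  ultimately have "X \<longlonglongrightarrow> mk F" using Cauchy_converges_subseq[OF C] by blast
  then show "convergent X" by (auto simp: convergent_def)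
qed

instance l2 :: banach ..

subsection \<open>Bounded Fourier multipliers\<close>

definition bsym :: "(real \<Rightarrow> complex) \<Rightarrow> bool" where
  "bsym \<sigma> \<longleftrightarrow> \<sigma> \<in> borel_measurable borel \<and> (\<exists>C. \<forall>\<xi>. cmod (\<sigma> \<xi>) \<le> C)"

definition mulS :: "(real \<Rightarrow> complex) \<Rightarrow> l2 \<Rightarrow> l2" where
  "mulS \<sigma> x = mk (\<lambda>\<xi>. \<sigma> \<xi> * rep x \<xi>)"

lemma bsym_measurable [measurable_dest]: "bsym \<sigma> \<Longrightarrow> \<sigma> \<in> borel_measurable borel"
  by (simp add: bsym_def)

lemma bsymI: "\<sigma> \<in> borel_measurable borel \<Longrightarrow> (\<And>\<xi>. cmod (\<sigma> \<xi>) \<le> C) \<Longrightarrow> bsym \<sigma>"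
  by (auto simp: bsym_def)

lemma bsym_mult: "bsym \<sigma> \<Longrightarrow> bsym \<tau> \<Longrightarrow> bsym (\<lambda>\<xi>. \<sigma> \<xi> * \<tau> \<xi>)"
proof -
  assume s: "bsym \<sigma>" and t: "bsym \<tau>"
  then obtain C D where C: "\<And>\<xi>. cmod (\<sigma> \<xi>) \<le> C" and D: "\<And>\<xi>. cmod (\<tau> \<xi>) \<le> D"
    by (auto simp: bsym_def)
  have "cmod (\<sigma> \<xi> * \<tau> \<xi>) \<le> C * D" for \<xi>
    unfolding norm_mult by (intro mult_mono C D) (auto intro: order_trans[OF norm_ge_zero C])
  then show ?thesis using s t by (intro bsymI) auto
qed

lemma bsym_sq: "bsym \<sigma> \<Longrightarrow> sq_integrable f \<Longrightarrow> sq_integrable (\<lambda>\<xi>. \<sigma> \<xi> * f \<xi>)"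
  by (auto simp: bsym_def intro: sq_integrable_mult_bounded)

lemma rep_mulS: "bsym \<sigma> \<Longrightarrow> AE \<xi> in lborel. rep (mulS \<sigma> x) \<xi> = \<sigma> \<xi> * rep x \<xi>"
  unfolding mulS_def by (rule rep_mk) (auto intro: bsym_sq)

lemma mulS_mk: "bsym \<sigma> \<Longrightarrow> sq_integrable f \<Longrightarrow> mulS \<sigma> (mk f) = mk (\<lambda>\<xi>. \<sigma> \<xi> * f \<xi>)"
  unfolding mulS_def
  by (rule mk_eqI) (auto intro!: bsym_sq eventually_mono[OF rep_mk[of f]])

lemma mulS_mulS: "bsym \<sigma> \<Longrightarrow> bsym \<tau> \<Longrightarrow> mulS \<sigma> (mulS \<tau> x) = mulS (\<lambda>\<xi>. \<sigma> \<xi> * \<tau> \<xi>) x"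
  using mulS_mk[of \<sigma> "\<lambda>\<xi>. \<tau> \<xi> * rep x \<xi>"] bsym_sq[of \<tau> "rep x"]
  by (simp add: mulS_def mult.assoc)

lemma mulS_commute: "bsym \<sigma> \<Longrightarrow> bsym \<tau> \<Longrightarrow> mulS \<sigma> (mulS \<tau> x) = mulS \<tau> (mulS \<sigma> x)"
  by (simp add: mulS_mulS mult.commute)

lemma mulS_one [simp]: "mulS (\<lambda>\<xi>. 1) x = x"
  by (simp add: mulS_def)

lemma mulS_cong_AE:
  assumes "bsym \<sigma>" "bsym \<tau>" "AE \<xi> in lborel. \<sigma> \<xi> * rep x \<xi> = \<tau> \<xi> * rep y \<xi>"
  shows "mulS \<sigma> x = mulS \<tau> y"
  unfolding mulS_def by (rule mk_eqI) (use assms in \<open>auto intro: bsym_sq\<close>)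

lemma norm_le_rep:
  assumes "AE \<xi> in lborel. cmod (rep x \<xi>) \<le> C * cmod (rep y \<xi>)" "C \<ge> 0"
  shows "norm x \<le> C * norm y"
proof -
  have "(norm x)\<^sup>2 \<le> (\<integral>\<xi>. C\<^sup>2 * (cmod (rep y \<xi>))\<^sup>2 \<partial>lborel)"
    unfolding norm_l2_sq
  proof (rule integral_mono_AE)
    show "integrable lborel (\<lambda>\<xi>. (cmod (rep x \<xi>))\<^sup>2)" "integrable lborel (\<lambda>\<xi>. C\<^sup>2 * (cmod (rep y \<xi>))\<^sup>2)"
      using sq_rep[of x] sq_rep[of y] by (auto simp: sq_integrable_def)
    show "AE \<xi> in lborel. (cmod (rep x \<xi>))\<^sup>2 \<le> C\<^sup>2 * (cmod (rep y \<xi>))\<^sup>2"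
      using assms(1)
    proof eventually_elim
      fix \<xi> assume "cmod (rep x \<xi>) \<le> C * cmod (rep y \<xi>)"
      then have "(cmod (rep x \<xi>))\<^sup>2 \<le> (C * cmod (rep y \<xi>))\<^sup>2" by (rule power_mono) simp
      then show "(cmod (rep x \<xi>))\<^sup>2 \<le> C\<^sup>2 * (cmod (rep y \<xi>))\<^sup>2" by (simp add: power_mult_distrib)
    qed
  qed
  also have "\<dots> = (C * norm y)\<^sup>2" by (simp add: norm_l2_sq power_mult_distrib)
  finally show ?thesis by (rule power2_le_imp_le) (use assms(2) in simp)
qed

lemma norm_mulS_le:
  assumes "bsym \<sigma>" "\<And>\<xi>. cmod (\<sigma> \<xi>) \<le> C"
  shows "norm (mulS \<sigma> x) \<le> C * norm x"
proof (rule norm_le_rep)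
  show "AE \<xi> in lborel. cmod (rep (mulS \<sigma> x) \<xi>) \<le> C * cmod (rep x \<xi>)"
    using rep_mulS[OF assms(1), of x]
    by eventually_elim (auto simp: norm_mult intro: mult_right_mono assms(2))
  show "C \<ge> 0" using order_trans[OF norm_ge_zero assms(2)[of 0]] .
qed

lemma mulS_add:
  assumes "bsym \<sigma>" shows "mulS \<sigma> (x + y) = mulS \<sigma> x + mulS \<sigma> y"
proof (rule l2_eqI)
  show "AE t in lborel. rep (mulS \<sigma> (x + y)) t = rep (mulS \<sigma> x + mulS \<sigma> y) t"
    using rep_mulS[OF assms, of "x+y"] rep_mulS[OF assms, of x] rep_mulS[OF assms, of y] rep_add[of x y] rep_add[of "mulS \<sigma> x" "mulS \<sigma> y"]
    by eventually_elim (simp add: algebra_simps)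
qed

lemma mulS_scaleR:
  assumes "bsym \<sigma>" shows "mulS \<sigma> (r *\<^sub>R x) = r *\<^sub>R mulS \<sigma> x"
proof (rule l2_eqI)
  show "AE t in lborel. rep (mulS \<sigma> (r *\<^sub>R x)) t = rep (r *\<^sub>R mulS \<sigma> x) t"
    using rep_mulS[OF assms, of "r *\<^sub>R x"] rep_mulS[OF assms, of x] rep_scaleR[of r x] rep_scaleR[of r "mulS \<sigma> x"]
    by eventually_elim simp
qed

lemma bounded_linear_mulS: "bsym \<sigma> \<Longrightarrow> bounded_linear (mulS \<sigma>)"
proof -
  assume s: "bsym \<sigma>"
  then obtain C where C: "\<And>\<xi>. cmod (\<sigma> \<xi>) \<le> C" by (auto simp: bsym_def)
  show ?thesis
    by (rule bounded_linear_intro[where K=C])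
       (use norm_mulS_le[OF s C] in \<open>auto simp: mulS_add[OF s] mulS_scaleR[OF s] mult.commute\<close>)
qed

lemma mulS_diff: "bsym \<sigma> \<Longrightarrow> mulS \<sigma> (x - y) = mulS \<sigma> x - mulS \<sigma> y"
  using bounded_linear.linear[OF bounded_linear_mulS] linear_diff by blast

lemma mulS_sym_diff: "bsym \<sigma> \<Longrightarrow> bsym \<tau> \<Longrightarrow> mulS \<sigma> x - mulS \<tau> x = mulS (\<lambda>\<xi>. \<sigma> \<xi> - \<tau> \<xi>) x"
  unfolding mulS_def by (subst mk_diff[symmetric]) (auto intro: bsym_sq simp: algebra_simps)

lemma inner_AE_cong:
  assumes "AE \<xi> in lborel. rep x \<xi> * cnj (rep y \<xi>) = rep z \<xi> * cnj (rep w \<xi>)"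
  shows "inner x y = inner z w"
  unfolding inner_l2_def
  by (rule integral_cong_AE) (measurable, use assms in eventually_elim, simp)

lemma inner_mulS:
  assumes "bsym \<sigma>"
  shows "inner (mulS \<sigma> x) y = inner x (mulS (\<lambda>\<xi>. cnj (\<sigma> \<xi>)) y)"
proof (rule inner_AE_cong)
  have "bsym (\<lambda>\<xi>. cnj (\<sigma> \<xi>))" using assms by (auto simp: bsym_def)
  from rep_mulS[OF this, of y] rep_mulS[OF assms, of x]
  show "AE \<xi> in lborel. rep (mulS \<sigma> x) \<xi> * cnj (rep y \<xi>) = rep x \<xi> * cnj (rep (mulS (\<lambda>\<xi>. cnj (\<sigma> \<xi>)) y) \<xi>)"
    by eventually_elim simp
qed

lemma inner_mulS_ge:
  assumes "bsym (\<lambda>\<xi>. of_real (k \<xi>))" "\<And>\<xi>. c \<le> k \<xi>"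
  shows "c * (norm x)\<^sup>2 \<le> inner (mulS (\<lambda>\<xi>. of_real (k \<xi>)) x) x"
proof -
  have i: "integrable lborel (\<lambda>\<xi>. (cmod (rep x \<xi>))\<^sup>2)" using sq_rep[of x] by (auto simp: sq_integrable_def)
  have "c * (norm x)\<^sup>2 = (\<integral>\<xi>. c * (cmod (rep x \<xi>))\<^sup>2 \<partial>lborel)"
    by (simp add: norm_l2_sq)
  also have "\<dots> \<le> inner (mulS (\<lambda>\<xi>. of_real (k \<xi>)) x) x"
    unfolding inner_l2_def
  proof (rule integral_mono_AE)
    show "AE \<xi> in lborel. c * (cmod (rep x \<xi>))\<^sup>2 \<le> Re (rep (mulS (\<lambda>\<xi>. of_real (k \<xi>)) x) \<xi> * cnj (rep x \<xi>))"
      using rep_mulS[OF assms(1), of x]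
    proof eventually_elim
      fix \<xi> assume e: "rep (mulS (\<lambda>\<xi>. of_real (k \<xi>)) x) \<xi> = of_real (k \<xi>) * rep x \<xi>"
      have "Re (of_real (k \<xi>) * rep x \<xi> * cnj (rep x \<xi>)) = k \<xi> * (cmod (rep x \<xi>))\<^sup>2"
        unfolding cmod_power2 by (simp add: power2_eq_square algebra_simps)
      then show "c * (cmod (rep x \<xi>))\<^sup>2 \<le> Re (rep (mulS (\<lambda>\<xi>. of_real (k \<xi>)) x) \<xi> * cnj (rep x \<xi>))"
        unfolding e using mult_right_mono[OF assms(2)[of \<xi>], of "(cmod (rep x \<xi>))\<^sup>2"] by (simp only: zero_le_power2 simp_thms)
    qed
  qed (use i inner_integrable in auto)
  finally show ?thesis .
qed

subsection \<open>The weights \<open>(1 + \<xi>\<^sup>2) powr (s / 2)\<close>\<close>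

definition jp :: "real \<Rightarrow> real \<Rightarrow> real" where "jp s \<xi> = (1 + \<xi>\<^sup>2) powr (s / 2)"

abbreviation cjp :: "real \<Rightarrow> real \<Rightarrow> complex" where "cjp s \<xi> \<equiv> of_real (jp s \<xi>)"

lemma one_plus_sq_pos: "1 + x\<^sup>2 > (0::real)" by (simp add: add_pos_nonneg)

lemma jp_pos [simp]: "jp s \<xi> > 0" using one_plus_sq_pos[of \<xi>] by (simp add: jp_def)
lemma jp_ge0 [simp]: "jp s \<xi> \<ge> 0" using jp_pos[of s \<xi>] by linarith
lemma jp_nz [simp]: "jp s \<xi> \<noteq> 0" using jp_pos[of s \<xi>] by linarith
lemma jp_measurable [measurable]: "jp s \<in> borel_measurable borel" unfolding jp_def by measurable
lemma jp_add: "jp s \<xi> * jp t \<xi> = jp (s + t) \<xi>" by (simp add: jp_def powr_add[symmetric] add_divide_distrib)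
lemma jp_0 [simp]: "jp 0 \<xi> = 1" using one_plus_sq_pos[of \<xi>] by (simp add: jp_def)
lemma jp_minus [simp]: "jp s (- \<xi>) = jp s \<xi>" by (simp add: jp_def)
lemma jp_mono: "s \<le> t \<Longrightarrow> jp s \<xi> \<le> jp t \<xi>" by (simp add: jp_def powr_mono)
lemma jp_le1: "s \<le> 0 \<Longrightarrow> jp s \<xi> \<le> 1" using jp_mono[of s 0 \<xi>] by simp
lemma jp_sq: "(jp s \<xi>)\<^sup>2 = (1 + \<xi>\<^sup>2) powr s" unfolding power2_eq_square[of "jp s \<xi>"] jp_add by (simp add: jp_def)
lemma jp_1: "jp 1 \<xi> = sqrt (1 + \<xi>\<^sup>2)" using one_plus_sq_pos[of \<xi>] by (simp add: jp_def powr_half_sqrt)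
lemma abs_le_jp1: "\<bar>\<xi>\<bar> \<le> jp 1 \<xi>" unfolding jp_1 by (rule real_le_rsqrt) simp
lemma cmod_cjp [simp]: "cmod (cjp s \<xi>) = jp s \<xi>" by simp
lemma jp_inv: "jp (- s) \<xi> * jp s \<xi> = 1" by (simp add: jp_add)

lemma cjp_inv: "cjp s \<xi> * cjp (- s) \<xi> = 1"
  unfolding of_real_mult[symmetric] jp_add by simp

lemma bsym_cjp: "s \<le> 0 \<Longrightarrow> bsym (cjp s)"
  by (rule bsymI[of _ 1]) (auto simp: jp_le1)

lemma bsym_icjp: "s \<le> -1 \<Longrightarrow> bsym (\<lambda>\<xi>. \<i> * \<xi> * cjp s \<xi>)"
proof (rule bsymI[of _ 1])
  fix \<xi> assume s: "s \<le> -1"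
  have "\<bar>\<xi>\<bar> * jp s \<xi> \<le> jp 1 \<xi> * jp s \<xi>" by (rule mult_right_mono[OF abs_le_jp1]) simp
  also have "\<dots> \<le> 1" unfolding jp_add by (rule jp_le1) (use s in simp)
  finally show "cmod (\<i> * \<xi> * cjp s \<xi>) \<le> 1" by (simp add: norm_mult)
qed measurable

lemma mulS_cjp_cjp: "s \<le> 0 \<Longrightarrow> t \<le> 0 \<Longrightarrow> mulS (cjp s) (mulS (cjp t) x) = mulS (cjp (s + t)) x"
  by (subst mulS_mulS) (auto simp: bsym_cjp jp_add simp flip: of_real_mult)

lemma norm_mulS_cjp_le: "s \<le> 0 \<Longrightarrow> norm (mulS (cjp s) x) \<le> norm x"
  using norm_mulS_le[OF bsym_cjp, of s 1 x] by (simp add: jp_le1)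

subsection \<open>Differentiation on the Fourier side\<close>

text \<open>A relation rather than an operator, because differentiation is unbounded on L^2;
  \<open>isD y d\<close> also asserts that the derivative of \<open>y\<close> lies in L^2.\<close>

definition isD :: "l2 \<Rightarrow> l2 \<Rightarrow> bool" where
  "isD y dy \<longleftrightarrow> (AE \<xi> in lborel. rep dy \<xi> = \<i> * \<xi> * rep y \<xi>)"

lemma isD_unique: "isD y d \<Longrightarrow> isD y d' \<Longrightarrow> d = d'"
  unfolding isD_def by (rule l2_eqI) (auto elim: eventually_elim2)

lemma isD_zero: "isD 0 0"
  unfolding isD_def using rep_zero by eventually_elim simp

lemma isD_add:
  assumes "isD y d" "isD y' d'" shows "isD (y + y') (d + d')"
  using assms rep_add[of y y'] rep_add[of d d'] unfolding isD_def
  by eventually_elim (simp add: algebra_simps)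

lemma isD_diff:
  assumes "isD y d" "isD y' d'" shows "isD (y - y') (d - d')"
  using assms rep_diff[of y y'] rep_diff[of d d'] unfolding isD_def
  by eventually_elim (simp only: right_diff_distrib)

lemma isD_scaleR:
  assumes "isD y d" shows "isD (r *\<^sub>R y) (r *\<^sub>R d)"
  using assms rep_scaleR[of r y] rep_scaleR[of r d] unfolding isD_def
  by eventually_elim simp

lemma isD_mulS:
  assumes "bsym \<sigma>" "isD y d" shows "isD (mulS \<sigma> y) (mulS \<sigma> d)"
  using assms(2) rep_mulS[OF assms(1), of y] rep_mulS[OF assms(1), of d] unfolding isD_def
  by eventually_elim simp

lemma isD_mulS_sym:
  assumes "bsym \<sigma>" "bsym (\<lambda>\<xi>. \<i> * \<xi> * \<sigma> \<xi>)" shows "isD (mulS \<sigma> y) (mulS (\<lambda>\<xi>. \<i> * \<xi> * \<sigma> \<xi>) y)"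
  using rep_mulS[OF assms(1), of y] rep_mulS[OF assms(2), of y] unfolding isD_def
  by eventually_elim simp

lemma isD_mulS_eq: "bsym \<sigma> \<Longrightarrow> bsym (\<lambda>\<xi>. \<i> * \<xi> * \<sigma> \<xi>) \<Longrightarrow> isD y d \<Longrightarrow> mulS \<sigma> d = mulS (\<lambda>\<xi>. \<i> * \<xi> * \<sigma> \<xi>) y"
  using isD_unique[OF isD_mulS isD_mulS_sym] by blast

text \<open>Integration by parts: the symbol \<open>\<i> * \<xi>\<close> is purely
  imaginary.\<close>

lemma isD_skew:
  assumes "isD x dx" "isD y dy"
  shows "inner dx y = - inner x dy"
proof -
  have "inner dx y = inner x (- dy)"
  proof (rule inner_AE_cong)
    show "AE \<xi> in lborel. rep dx \<xi> * cnj (rep y \<xi>) = rep x \<xi> * cnj (rep (- dy) \<xi>)"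
      using assms[unfolded isD_def] rep_uminus[of dy] by eventually_elim simp
  qed
  then show ?thesis by simp
qed

text \<open>A derivative is controlled one level lower, because \<bar>\<xi>\<bar> is at most
  \<open>jp 1 \<xi>\<close>. This is how derivatives of solutions are bounded without any bound on
  their own L^2 norm.\<close>

lemma isD_low: "isD y d \<Longrightarrow> norm (mulS (cjp (-1)) d) \<le> norm y"
proof -
  assume d: "isD y d"
  have b: "bsym (\<lambda>\<xi>. \<i> * \<xi> * cjp (-1) \<xi>)" by (rule bsym_icjp) simp
  have "mulS (cjp (-1)) d = mulS (\<lambda>\<xi>. \<i> * \<xi> * cjp (-1) \<xi>) y"
    using isD_mulS_eq[OF bsym_cjp b d] by simp
  moreover have "norm (mulS (\<lambda>\<xi>. \<i> * \<xi> * cjp (-1) \<xi>) y) \<le> 1 * norm y"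
  proof (rule norm_mulS_le[OF b])
    fix \<xi>
    have "\<bar>\<xi>\<bar> * jp (-1) \<xi> \<le> jp 1 \<xi> * jp (-1) \<xi>" by (rule mult_right_mono[OF abs_le_jp1]) simp
    then show "cmod (\<i> * \<xi> * cjp (-1) \<xi>) \<le> 1" by (simp add: norm_mult jp_add)
  qed
  ultimately show ?thesis by simp
qed

subsection \<open>Weighted convolutions\<close>

lemma jp_int: "integrable lborel (\<lambda>x. (jp (-1) x)\<^sup>2)"
proof -
  have "(\<lambda>x. (jp (-1) x)\<^sup>2) = (\<lambda>x. inverse (1 + x^2))"
  proof
    fix x show "(jp (-1) x)\<^sup>2 = inverse (1 + x^2)"
      unfolding jp_sq using one_plus_sq_pos[of x] by (simp add: powr_minus)
  qed
  then show ?thesis using integrable_inverse_1_plus_square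
    by (simp add: set_integrable_def)
qed

text \<open>Twice the L^2 norm of the weight \<open>jp (-1)\<close>. The 2 comes from the two
  weights in \<open>kbd\<close>: the square of their sum integrates to at most four times the
  integral of one square.\<close>

definition cT :: real where "cT = 2 * sqrt (\<integral>x. (jp (-1) x)\<^sup>2 \<partial>lborel)"

lemma cT_ge0: "cT \<ge> 0" by (simp add: cT_def)

text \<open>Up to a factor 2 the sum is the weight of the lower of the two frequencies. Each summand
  is square integrable in \<eta> uniformly in \<xi>, which is what Cauchy-Schwarz in \<eta> asks
  for.\<close>

definition kbd :: "(real \<Rightarrow> real \<Rightarrow> complex) \<Rightarrow> real \<Rightarrow> bool" where
  "kbd \<kappa> C \<longleftrightarrow> (\<lambda>(\<xi>, \<eta>). \<kappa> \<xi> \<eta>) \<in> borel_measurable (borel \<Otimes>\<^sub>M borel) \<and>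
     (\<forall>\<xi> \<eta>. cmod (\<kappa> \<xi> \<eta>) \<le> C * (jp (-1) \<eta> + jp (-1) (\<xi> - \<eta>)))"

definition Tf :: "(real \<Rightarrow> real \<Rightarrow> complex) \<Rightarrow> (real \<Rightarrow> complex) \<Rightarrow> (real \<Rightarrow> complex) \<Rightarrow> real \<Rightarrow> complex" where
  "Tf \<kappa> f g \<xi> = (\<integral>\<eta>. \<kappa> \<xi> \<eta> * f \<eta> * g (\<xi> - \<eta>) \<partial>lborel)"

definition Tk :: "(real \<Rightarrow> real \<Rightarrow> complex) \<Rightarrow> l2 \<Rightarrow> l2 \<Rightarrow> l2" where
  "Tk \<kappa> x y = mk (Tf \<kappa> (rep x) (rep y))"

lemma kbd_measurable:
  assumes "kbd \<kappa> C" shows "(\<lambda>(\<xi>, \<eta>). \<kappa> \<xi> \<eta>) \<in> borel_measurable (borel \<Otimes>\<^sub>M borel)"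
  using assms by (simp add: kbd_def)

lemma kbd_measurable1:
  assumes "kbd \<kappa> C" shows "\<kappa> \<xi> \<in> borel_measurable borel"
  using measurable_compose[OF measurable_Pair1' kbd_measurable[OF assms], of \<xi>] by simp

lemma kbd_nonneg: assumes "kbd \<kappa> C" shows "C \<ge> 0"
proof -
  have "0 \<le> C * (jp (-1) 0 + jp (-1) (0 - 0))"
    using assms order_trans[OF norm_ge_zero] unfolding kbd_def by blast
  moreover have "jp (-1) 0 + jp (-1) (0 - 0) > 0" by (intro add_pos_pos) auto
  ultimately show ?thesis unfolding zero_le_mult_iff by linarith
qed

lemma integral_norm_bound_ennreal_any:
  "ennreal (norm (\<integral>x. f x \<partial>M)) \<le> (\<integral>\<^sup>+x. ennreal (norm (f x)) \<partial>M)"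
  by (cases "integrable M f") (auto simp: integral_norm_bound_ennreal not_integrable_integral_eq)

lemma nn_conv_sq:
  assumes f: "sq_integrable f" and g: "sq_integrable g"
  shows "(\<integral>\<^sup>+\<xi>. (\<integral>\<^sup>+\<eta>. ennreal ((cmod (f \<eta>))\<^sup>2 * (cmod (g (\<xi> - \<eta>)))\<^sup>2) \<partial>lborel) \<partial>lborel)
    = ennreal ((norm (mk f))\<^sup>2 * (norm (mk g))\<^sup>2)"
proof -
  note [measurable] = sq_integrable_measurable[OF f] sq_integrable_measurable[OF g]
  have "(\<integral>\<^sup>+\<xi>. (\<integral>\<^sup>+\<eta>. ennreal ((cmod (f \<eta>))\<^sup>2 * (cmod (g (\<xi> - \<eta>)))\<^sup>2) \<partial>lborel) \<partial>lborel)
     = (\<integral>\<^sup>+\<eta>. (\<integral>\<^sup>+\<xi>. ennreal ((cmod (f \<eta>))\<^sup>2) * ennreal ((cmod (g (\<xi> - \<eta>)))\<^sup>2) \<partial>lborel) \<partial>lborel)"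
    by (subst lborel_pair.Fubini') (auto simp: ennreal_mult)
  also have "\<dots> = (\<integral>\<^sup>+\<eta>. ennreal ((cmod (f \<eta>))\<^sup>2) * ennreal ((norm (mk g))\<^sup>2) \<partial>lborel)"
  proof (rule nn_integral_cong)
    fix \<eta>
    have "(\<integral>\<^sup>+\<xi>. ennreal ((cmod (g (\<xi> - \<eta>)))\<^sup>2) \<partial>lborel) = (\<integral>\<^sup>+\<xi>. ennreal ((cmod (g \<xi>))\<^sup>2) \<partial>lborel)"
      using nn_integral_real_affine[of "\<lambda>\<xi>. ennreal ((cmod (g \<xi>))\<^sup>2)" 1 "-\<eta>"] by simp
    then show "(\<integral>\<^sup>+\<xi>. ennreal ((cmod (f \<eta>))\<^sup>2) * ennreal ((cmod (g (\<xi> - \<eta>)))\<^sup>2) \<partial>lborel)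
       = ennreal ((cmod (f \<eta>))\<^sup>2) * ennreal ((norm (mk g))\<^sup>2)"
      by (subst nn_integral_cmult) (auto simp: nn_norm_mk[OF g])
  qed
  also have "\<dots> = ennreal ((norm (mk f))\<^sup>2 * (norm (mk g))\<^sup>2)"
    by (subst nn_integral_multc) (auto simp: nn_norm_mk[OF f] ennreal_mult)
  finally show ?thesis .
qed

text \<open>Cauchy-Schwarz in \<eta> spends the weights of \<kappa> and leaves the convolution of
  \<bar>f\<bar>^2 and \<bar>g\<bar>^2, which Tonelli integrates in \<xi>. This is the algebra
  property of Sobolev spaces in weighted form.\<close>

lemma Tf_bound:
  assumes k: "kbd \<kappa> C" and f: "sq_integrable f" and g: "sq_integrable g"
  shows "AE \<xi> in lborel. integrable lborel (\<lambda>\<eta>. \<kappa> \<xi> \<eta> * f \<eta> * g (\<xi> - \<eta>))"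
    and "sq_integrable (Tf \<kappa> f g)"
    and "norm (mk (Tf \<kappa> f g)) \<le> C * cT * norm (mk f) * norm (mk g)"
proof -
  note [measurable] = sq_integrable_measurable[OF f] sq_integrable_measurable[OF g] kbd_measurable[OF k] kbd_measurable1[OF k]
  note C0 = kbd_nonneg[OF k]
  define N where "N \<xi> = (\<integral>\<^sup>+\<eta>. ennreal ((cmod (f \<eta>))\<^sup>2 * (cmod (g (\<xi> - \<eta>)))\<^sup>2) \<partial>lborel)" for \<xi>
  define S where "S = (\<integral>x. (jp (-1) x)\<^sup>2 \<partial>lborel)"
  have S0: "S \<ge> 0" by (simp add: S_def)
  define j where "j \<xi> \<eta> = jp (-1) \<eta> + jp (-1) (\<xi> - \<eta>)" for \<xi> \<eta>
  have j0: "j \<xi> \<eta> \<ge> 0" for \<xi> \<eta> by (simp add: j_def)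
  have jm [measurable]: "j \<xi> \<in> borel_measurable borel" for \<xi> unfolding j_def by measurable
  have Nint: "integral\<^sup>N lborel N = ennreal ((norm (mk f))\<^sup>2 * (norm (mk g))\<^sup>2)"
    unfolding N_def by (rule nn_conv_sq[OF f g])
  have [measurable]: "N \<in> borel_measurable borel" unfolding N_def by measurable
  have AN: "AE \<xi> in lborel. N \<xi> \<noteq> \<infinity>"
    by (rule nn_integral_PInf_AE) (auto simp: Nint)
  have JJ: "(\<integral>\<^sup>+\<eta>. ennreal ((jp (-1) (\<xi> - \<eta>))\<^sup>2) \<partial>lborel) = ennreal S" for \<xi>
  proof -
    have "(\<integral>\<^sup>+\<eta>. ennreal ((jp (-1) (\<xi> - \<eta>))\<^sup>2) \<partial>lborel) = (\<integral>\<^sup>+\<eta>. ennreal ((jp (-1) \<eta>)\<^sup>2) \<partial>lborel)"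
      using nn_integral_real_affine[of "\<lambda>\<eta>. ennreal ((jp (-1) \<eta>)\<^sup>2)" "-1" \<xi>] by simp
    also have "\<dots> = ennreal S" unfolding S_def by (rule nn_integral_eq_integral[OF jp_int]) simp
    finally show ?thesis .
  qed
  have JJ2: "(\<integral>\<^sup>+\<eta>. ennreal ((j \<xi> \<eta>)\<^sup>2) \<partial>lborel) \<le> ennreal (4 * S)" for \<xi>
  proof -
    have "(j \<xi> \<eta>)\<^sup>2 \<le> 2 * (jp (-1) \<eta>)\<^sup>2 + 2 * (jp (-1) (\<xi> - \<eta>))\<^sup>2" for \<eta>
      using sum_squares_bound[of "jp (-1) \<eta>" "jp (-1) (\<xi> - \<eta>)"] by (simp add: j_def power2_sum)
    then have "(\<integral>\<^sup>+\<eta>. ennreal ((j \<xi> \<eta>)\<^sup>2) \<partial>lborel) \<le> (\<integral>\<^sup>+\<eta>. (ennreal 2 * ennreal ((jp (-1) (0 - \<eta>))\<^sup>2) + ennreal 2 * ennreal ((jp (-1) (\<xi> - \<eta>))\<^sup>2)) \<partial>lborel)"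
      by (intro nn_integral_mono) (simp add: ennreal_mult[symmetric] ennreal_plus[symmetric] ennreal_leI del: ennreal_plus flip: ennreal_numeral)
    also have "\<dots> = (ennreal 2 * ennreal S + ennreal 2 * ennreal S)"
      by (subst nn_integral_add, measurable, subst (1 2) nn_integral_cmult, measurable)
         (simp only: JJ)
    also have "\<dots> = ennreal (4 * S)" using S0 by (simp add: ennreal_mult[symmetric] ennreal_plus[symmetric] del: ennreal_plus flip: ennreal_numeral)
    finally show ?thesis .
  qed
  have kj: "cmod (\<kappa> \<xi> \<eta> * f \<eta> * g (\<xi> - \<eta>)) \<le> C * (j \<xi> \<eta> * (cmod (f \<eta>) * cmod (g (\<xi> - \<eta>))))" for \<xi> \<eta>
  proof -
    have "cmod (\<kappa> \<xi> \<eta>) \<le> C * j \<xi> \<eta>" using k by (simp add: kbd_def j_def)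
    then have "cmod (\<kappa> \<xi> \<eta>) * (cmod (f \<eta>) * cmod (g (\<xi> - \<eta>))) \<le> (C * j \<xi> \<eta>) * (cmod (f \<eta>) * cmod (g (\<xi> - \<eta>)))"
      by (rule mult_right_mono) simp
    then show ?thesis by (simp add: norm_mult mult.assoc)
  qed
  have sqbd: "(\<integral>\<^sup>+\<eta>. ennreal (cmod (\<kappa> \<xi> \<eta> * f \<eta> * g (\<xi> - \<eta>))) \<partial>lborel)\<^sup>2 \<le> ennreal (C\<^sup>2 * (4 * S)) * N \<xi>" for \<xi>
  proof -
    have "(\<integral>\<^sup>+\<eta>. ennreal (cmod (\<kappa> \<xi> \<eta> * f \<eta> * g (\<xi> - \<eta>))) \<partial>lborel) \<le>
        (\<integral>\<^sup>+\<eta>. ennreal C * (ennreal (j \<xi> \<eta>) * ennreal (cmod (f \<eta>) * cmod (g (\<xi> - \<eta>)))) \<partial>lborel)"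
      using C0 j0 kj by (intro nn_integral_mono) (simp add: ennreal_mult[symmetric])
    also have "\<dots> = ennreal C * (\<integral>\<^sup>+\<eta>. (ennreal (j \<xi> \<eta>) * ennreal (cmod (f \<eta>) * cmod (g (\<xi> - \<eta>)))) \<partial>lborel)"
      by (rule nn_integral_cmult) measurable
    finally have "(\<integral>\<^sup>+\<eta>. ennreal (cmod (\<kappa> \<xi> \<eta> * f \<eta> * g (\<xi> - \<eta>))) \<partial>lborel)\<^sup>2 \<le>
        (ennreal C)\<^sup>2 * (\<integral>\<^sup>+\<eta>. (ennreal (j \<xi> \<eta>) * ennreal (cmod (f \<eta>) * cmod (g (\<xi> - \<eta>)))) \<partial>lborel)\<^sup>2"
      unfolding power_mult_distrib[symmetric] by (rule power_mono) simp
    also have "\<dots> \<le> (ennreal C)\<^sup>2 * ((\<integral>\<^sup>+\<eta>. (ennreal (j \<xi> \<eta>))\<^sup>2 \<partial>lborel) * (\<integral>\<^sup>+\<eta>. (ennreal (cmod (f \<eta>) * cmod (g (\<xi> - \<eta>))))\<^sup>2 \<partial>lborel))"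
      by (intro mult_left_mono Cauchy_Schwarz_nn_integral) auto
    also have "(\<integral>\<^sup>+\<eta>. (ennreal (j \<xi> \<eta>))\<^sup>2 \<partial>lborel) = (\<integral>\<^sup>+\<eta>. ennreal ((j \<xi> \<eta>)\<^sup>2) \<partial>lborel)"
      by (simp add: ennreal_power j0)
    also have "(\<integral>\<^sup>+\<eta>. (ennreal (cmod (f \<eta>) * cmod (g (\<xi> - \<eta>))))\<^sup>2 \<partial>lborel) = N \<xi>"
      unfolding N_def by (simp add: ennreal_power power_mult_distrib)
    also have "(ennreal C)\<^sup>2 * ((\<integral>\<^sup>+\<eta>. ennreal ((j \<xi> \<eta>)\<^sup>2) \<partial>lborel) * N \<xi>) \<le> (ennreal C)\<^sup>2 * (ennreal (4 * S) * N \<xi>)"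
      by (intro mult_left_mono mult_right_mono JJ2) auto
    also have "\<dots> = ennreal (C\<^sup>2 * (4 * S)) * N \<xi>"
      using C0 S0 by (simp add: ennreal_power ennreal_mult mult.assoc)
    finally show ?thesis .
  qed
  show *: "AE \<xi> in lborel. integrable lborel (\<lambda>\<eta>. \<kappa> \<xi> \<eta> * f \<eta> * g (\<xi> - \<eta>))"
    using AN
  proof eventually_elim
    fix \<xi> assume "N \<xi> \<noteq> \<infinity>"
    then have "ennreal (C\<^sup>2 * (4 * S)) * N \<xi> < \<infinity>" by (simp add: ennreal_mult_less_top less_top)
    with sqbd[of \<xi>] have "(\<integral>\<^sup>+\<eta>. ennreal (cmod (\<kappa> \<xi> \<eta> * f \<eta> * g (\<xi> - \<eta>))) \<partial>lborel)\<^sup>2 < \<infinity>"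
      by (rule le_less_trans)
    then have "(\<integral>\<^sup>+\<eta>. ennreal (cmod (\<kappa> \<xi> \<eta> * f \<eta> * g (\<xi> - \<eta>))) \<partial>lborel) < \<infinity>"
      by (auto simp: power2_eq_square ennreal_mult_less_top)
    then show "integrable lborel (\<lambda>\<eta>. \<kappa> \<xi> \<eta> * f \<eta> * g (\<xi> - \<eta>))"
      by (intro integrableI_bounded) auto
  qed
  have [measurable]: "Tf \<kappa> f g \<in> borel_measurable borel"
    unfolding Tf_def by measurable
  have "(\<integral>\<^sup>+\<xi>. ennreal ((cmod (Tf \<kappa> f g \<xi>))\<^sup>2) \<partial>lborel) \<le> (\<integral>\<^sup>+\<xi>. ennreal (C\<^sup>2 * (4 * S)) * N \<xi> \<partial>lborel)"
  proof (rule nn_integral_mono)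
    fix \<xi>
    have "ennreal (cmod (Tf \<kappa> f g \<xi>)) \<le> (\<integral>\<^sup>+\<eta>. ennreal (cmod (\<kappa> \<xi> \<eta> * f \<eta> * g (\<xi> - \<eta>))) \<partial>lborel)"
      unfolding Tf_def by (rule integral_norm_bound_ennreal_any)
    then have "(ennreal (cmod (Tf \<kappa> f g \<xi>)))\<^sup>2 \<le> (\<integral>\<^sup>+\<eta>. ennreal (cmod (\<kappa> \<xi> \<eta> * f \<eta> * g (\<xi> - \<eta>))) \<partial>lborel)\<^sup>2"
      by (rule power_mono) simp
    then show "ennreal ((cmod (Tf \<kappa> f g \<xi>))\<^sup>2) \<le> ennreal (C\<^sup>2 * (4 * S)) * N \<xi>"
      using sqbd[of \<xi>] by (simp add: ennreal_power)
  qed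
  also have "\<dots> = ennreal (C\<^sup>2 * (4 * S)) * ennreal ((norm (mk f))\<^sup>2 * (norm (mk g))\<^sup>2)"
    by (subst nn_integral_cmult) (auto simp: Nint)
  also have "\<dots> = ennreal ((C * cT * norm (mk f) * norm (mk g))\<^sup>2)"
    using C0 S0 by (subst ennreal_mult[symmetric]) (auto simp: cT_def S_def[symmetric] power_mult_distrib)
  finally have bd: "(\<integral>\<^sup>+\<xi>. ennreal ((cmod (Tf \<kappa> f g \<xi>))\<^sup>2) \<partial>lborel) \<le> ennreal ((C * cT * norm (mk f) * norm (mk g))\<^sup>2)" .
  then show sq: "sq_integrable (Tf \<kappa> f g)"
    by (intro sq_integrable_nn) (auto simp: le_less_trans)
  show "norm (mk (Tf \<kappa> f g)) \<le> C * cT * norm (mk f) * norm (mk g)"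
    by (rule norm_mk_le[OF sq bd]) (use C0 cT_ge0 in auto)
qed

lemma rep_Tk: "kbd \<kappa> C \<Longrightarrow> AE \<xi> in lborel. rep (Tk \<kappa> x y) \<xi> = Tf \<kappa> (rep x) (rep y) \<xi>"
  unfolding Tk_def by (rule rep_mk) (auto intro: Tf_bound(2))

lemma AE_reflect:
  fixes \<xi> :: real
  assumes "AE \<eta> in lborel. P \<eta>" shows "AE \<eta> in lborel. P (\<xi> - \<eta>)"
proof -
  have "AE \<eta> in distr lborel borel (\<lambda>\<eta>. \<xi> + -1 * \<eta>). P \<eta>"
    using assms by (subst (asm) lborel_real_affine[of "-1" \<xi>]) (simp_all add: AE_density)
  from AE_distrD[OF _ this] show ?thesis by simp
qed

lemma AE_shift:
  fixes \<xi> :: real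
  assumes "AE \<eta> in lborel. P \<eta>" shows "AE \<eta> in lborel. P (\<eta> - \<xi>)"
  using AE_reflect[OF AE_reflect[OF assms, of 0], of \<xi>] by simp

lemma integral_reflect:
  fixes f :: "real \<Rightarrow> 'a :: {banach, second_countable_topology}"
  shows "(\<integral>\<eta>. f (\<xi> - \<eta>) \<partial>lborel) = (\<integral>\<eta>. f \<eta> \<partial>lborel)"
  using lborel_integral_real_affine[of "-1" f \<xi>] by simp

lemma integral_shift:
  fixes f :: "real \<Rightarrow> 'a :: {banach, second_countable_topology}"
  shows "(\<integral>\<eta>. f (\<eta> - \<xi>) \<partial>lborel) = (\<integral>\<eta>. f \<eta> \<partial>lborel)"
  using lborel_integral_real_affine[of 1 f "-\<xi>"] by simp

lemma integrable_reflect: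
  fixes f :: "real \<Rightarrow> 'a :: {banach, second_countable_topology}"
  shows "integrable lborel (\<lambda>\<eta>. f (\<xi> - \<eta>)) \<longleftrightarrow> integrable lborel f"
  using lborel_integrable_real_affine_iff[of "-1" f \<xi>] by simp

lemma Tf_cong:
  assumes k: "kbd \<kappa> C" and "sq_integrable f" "sq_integrable f'" "sq_integrable g" "sq_integrable g'"
    and a: "AE \<eta> in lborel. f \<eta> = f' \<eta>" "AE \<eta> in lborel. g \<eta> = g' \<eta>"
  shows "Tf \<kappa> f g \<xi> = Tf \<kappa> f' g' \<xi>"
proof -
  note [measurable] = assms(2-5)[THEN sq_integrable_measurable] kbd_measurable1[OF k]
  show ?thesis
    unfolding Tf_def
    by (rule integral_cong_AE) (measurable, use a(1) AE_reflect[OF a(2), of \<xi>] in eventually_elim, simp)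
qed

lemma Tk_mk:
  assumes k: "kbd \<kappa> C" and "sq_integrable f" "sq_integrable g"
  shows "Tk \<kappa> (mk f) (mk g) = mk (Tf \<kappa> f g)"
  unfolding Tk_def
  by (rule arg_cong[of _ _ mk], rule ext, rule Tf_cong[OF k])
     (use assms rep_mk in auto)

lemma norm_Tk: "kbd \<kappa> C \<Longrightarrow> norm (Tk \<kappa> x y) \<le> C * cT * norm x * norm y"
  using Tf_bound(3)[of \<kappa> C "rep x" "rep y"] by (simp add: Tk_def)

lemma Tf_integrable: "kbd \<kappa> C \<Longrightarrow> AE \<xi> in lborel. integrable lborel (\<lambda>\<eta>. \<kappa> \<xi> \<eta> * rep x \<eta> * rep y (\<xi> - \<eta>))"
  by (rule Tf_bound(1)) auto

lemma Tk_add_left: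
  assumes k: "kbd \<kappa> C" shows "Tk \<kappa> (x + x') y = Tk \<kappa> x y + Tk \<kappa> x' y"
proof (rule l2_eqI)
  show "AE \<xi> in lborel. rep (Tk \<kappa> (x + x') y) \<xi> = rep (Tk \<kappa> x y + Tk \<kappa> x' y) \<xi>"
    using rep_Tk[OF k, of "x + x'" y] rep_Tk[OF k, of x y] rep_Tk[OF k, of x' y] rep_add[of "Tk \<kappa> x y" "Tk \<kappa> x' y"]
      Tf_integrable[OF k, of x y] Tf_integrable[OF k, of x' y]
  proof eventually_elim
    fix \<xi> assume a: "rep (Tk \<kappa> (x + x') y) \<xi> = Tf \<kappa> (rep (x + x')) (rep y) \<xi>"
      "rep (Tk \<kappa> x y) \<xi> = Tf \<kappa> (rep x) (rep y) \<xi>" "rep (Tk \<kappa> x' y) \<xi> = Tf \<kappa> (rep x') (rep y) \<xi>"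
      "rep (Tk \<kappa> x y + Tk \<kappa> x' y) \<xi> = rep (Tk \<kappa> x y) \<xi> + rep (Tk \<kappa> x' y) \<xi>"
      "integrable lborel (\<lambda>\<eta>. \<kappa> \<xi> \<eta> * rep x \<eta> * rep y (\<xi> - \<eta>))"
      "integrable lborel (\<lambda>\<eta>. \<kappa> \<xi> \<eta> * rep x' \<eta> * rep y (\<xi> - \<eta>))"
    have "Tf \<kappa> (rep (x + x')) (rep y) \<xi> = Tf \<kappa> (\<lambda>\<eta>. rep x \<eta> + rep x' \<eta>) (rep y) \<xi>"
      by (rule Tf_cong[OF k]) (auto intro: sq_integrable_add rep_add)
    also have "\<dots> = Tf \<kappa> (rep x) (rep y) \<xi> + Tf \<kappa> (rep x') (rep y) \<xi>"
      unfolding Tf_def using a(5,6) by (simp add: algebra_simps)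
    finally show "rep (Tk \<kappa> (x + x') y) \<xi> = rep (Tk \<kappa> x y + Tk \<kappa> x' y) \<xi>" using a(1-4) by simp
  qed
qed

lemma kbd_swap: "kbd \<kappa> C \<Longrightarrow> kbd (\<lambda>\<xi> \<eta>. \<kappa> \<xi> (\<xi> - \<eta>)) C"
proof -
  assume k: "kbd \<kappa> C"
  have "(\<lambda>z. (\<lambda>(\<xi>, \<eta>). \<kappa> \<xi> \<eta>) ((\<lambda>(\<xi>, \<eta>). (\<xi>, \<xi> - \<eta>)) z)) \<in> borel_measurable (borel \<Otimes>\<^sub>M borel)"
    by (rule measurable_compose[OF _ kbd_measurable[OF k]]) measurable
  then have "(\<lambda>(\<xi>, \<eta>). \<kappa> \<xi> (\<xi> - \<eta>)) \<in> borel_measurable (borel \<Otimes>\<^sub>M borel)"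
    by (simp add: case_prod_unfold)
  moreover have "cmod (\<kappa> \<xi> (\<xi> - \<eta>)) \<le> C * (jp (-1) \<eta> + jp (-1) (\<xi> - \<eta>))" for \<xi> \<eta>
  proof -
    have "cmod (\<kappa> \<xi> (\<xi> - \<eta>)) \<le> C * (jp (-1) (\<xi> - \<eta>) + jp (-1) (\<xi> - (\<xi> - \<eta>)))"
      using k unfolding kbd_def by blast
    then show ?thesis by (simp add: add.commute)
  qed
  ultimately show ?thesis by (simp add: kbd_def)
qed

lemma Tk_swap: "kbd \<kappa> C \<Longrightarrow> Tk \<kappa> x y = Tk (\<lambda>\<xi> \<eta>. \<kappa> \<xi> (\<xi> - \<eta>)) y x"
  unfolding Tk_def Tf_def
  apply (rule arg_cong[of _ _ mk], rule ext)
  subgoal for \<xi> by (subst integral_reflect[of _ \<xi>, symmetric]) (simp add: mult_ac)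
  done

lemma Tk_add_right:
  assumes k: "kbd \<kappa> C" shows "Tk \<kappa> x (y + y') = Tk \<kappa> x y + Tk \<kappa> x y'"
  unfolding Tk_swap[OF k] by (rule Tk_add_left[OF kbd_swap[OF k]])

lemma Tk_scaleR_left:
  assumes k: "kbd \<kappa> C" shows "Tk \<kappa> (r *\<^sub>R x) y = r *\<^sub>R Tk \<kappa> x y"
proof -
  have "Tk \<kappa> (r *\<^sub>R x) y = Tk \<kappa> (mk (\<lambda>\<xi>. of_real r * rep x \<xi>)) (mk (rep y))"
    by (simp add: mk_scale)
  also have "\<dots> = mk (\<lambda>\<xi>. of_real r * Tf \<kappa> (rep x) (rep y) \<xi>)"
    apply (subst Tk_mk[OF k])
      apply (auto intro: sq_integrable_cmult)[2]
    apply (rule arg_cong[of _ _ mk], rule ext)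
    unfolding Tf_def
    apply (subst integral_mult_right_zero[symmetric])
    apply (simp add: mult_ac)
    done
  also have "\<dots> = r *\<^sub>R Tk \<kappa> x y"
    using mk_scale[OF Tf_bound(2)[OF k]] by (simp add: Tk_def)
  finally show ?thesis .
qed

lemma Tk_scaleR_right:
  assumes k: "kbd \<kappa> C" shows "Tk \<kappa> x (r *\<^sub>R y) = r *\<^sub>R Tk \<kappa> x y"
  unfolding Tk_swap[OF k] by (rule Tk_scaleR_left[OF kbd_swap[OF k]])

lemma bounded_bilinear_Tk: "kbd \<kappa> C \<Longrightarrow> bounded_bilinear (Tk \<kappa>)"
  by (rule bounded_bilinear.intro)
     (use norm_Tk[of \<kappa> C] in \<open>auto simp: Tk_add_left Tk_add_right Tk_scaleR_left Tk_scaleR_right mult_ac intro!: exI[of _ "C * cT"]\<close>)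

lemma mulS_Tk:
  assumes s: "bsym \<sigma>" and k: "kbd \<kappa> C"
  shows "mulS \<sigma> (Tk \<kappa> x y) = Tk (\<lambda>\<xi> \<eta>. \<sigma> \<xi> * \<kappa> \<xi> \<eta>) x y"
proof -
  have "mulS \<sigma> (Tk \<kappa> x y) = mk (\<lambda>\<xi>. \<sigma> \<xi> * Tf \<kappa> (rep x) (rep y) \<xi>)"
    unfolding Tk_def by (rule mulS_mk[OF s Tf_bound(2)[OF k]]) auto
  also have "\<dots> = Tk (\<lambda>\<xi> \<eta>. \<sigma> \<xi> * \<kappa> \<xi> \<eta>) x y"
    unfolding Tk_def Tf_def
    by (rule arg_cong[of _ _ mk], rule ext, subst integral_mult_right_zero[symmetric]) (simp add: mult_ac)
  finally show ?thesis .
qed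

lemma Tk_mulS_left:
  assumes s: "bsym \<sigma>" and k: "kbd \<kappa> C"
  shows "Tk \<kappa> (mulS \<sigma> x) y = Tk (\<lambda>\<xi> \<eta>. \<kappa> \<xi> \<eta> * \<sigma> \<eta>) x y"
  unfolding Tk_def
proof (rule arg_cong[of _ _ mk], rule ext)
  fix \<xi>
  have "Tf \<kappa> (rep (mulS \<sigma> x)) (rep y) \<xi> = Tf \<kappa> (\<lambda>\<eta>. \<sigma> \<eta> * rep x \<eta>) (rep y) \<xi>"
    by (rule Tf_cong[OF k]) (auto intro: bsym_sq[OF s] rep_mulS[OF s])
  then show "Tf \<kappa> (rep (mulS \<sigma> x)) (rep y) \<xi> = Tf (\<lambda>\<xi> \<eta>. \<kappa> \<xi> \<eta> * \<sigma> \<eta>) (rep x) (rep y) \<xi>"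
    by (simp add: Tf_def mult_ac)
qed

lemma Tk_mulS_right:
  assumes s: "bsym \<sigma>" and k: "kbd \<kappa> C"
  shows "Tk \<kappa> x (mulS \<sigma> y) = Tk (\<lambda>\<xi> \<eta>. \<kappa> \<xi> \<eta> * \<sigma> (\<xi> - \<eta>)) x y"
  unfolding Tk_def
proof (rule arg_cong[of _ _ mk], rule ext)
  fix \<xi>
  have "Tf \<kappa> (rep x) (rep (mulS \<sigma> y)) \<xi> = Tf \<kappa> (rep x) (\<lambda>\<eta>. \<sigma> \<eta> * rep y \<eta>) \<xi>"
    by (rule Tf_cong[OF k]) (auto intro: bsym_sq[OF s] rep_mulS[OF s])
  then show "Tf \<kappa> (rep x) (rep (mulS \<sigma> y)) \<xi> = Tf (\<lambda>\<xi> \<eta>. \<kappa> \<xi> \<eta> * \<sigma> (\<xi> - \<eta>)) (rep x) (rep y) \<xi>"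
    by (simp add: Tf_def mult_ac)
qed

subsection \<open>Products in Sobolev spaces\<close>

text \<open>The factor 1/(2 pi) comes from the transform of a product being 1/(2 pi) times the
  convolution of the transforms. The bracket in \<open>kR\<close> is the failure of \<xi> \<mapsto>
  \<open>\<xi> * jp s \<xi>\<close> to be additive; with it, the three kernels satisfy the Leibniz
  identity pointwise.\<close>

definition kQ :: "real \<Rightarrow> real \<Rightarrow> real \<Rightarrow> complex" where
  "kQ s \<xi> \<eta> = cjp s \<xi> * cjp (-s) \<eta> * cjp (-s) (\<xi> - \<eta>) / of_real (2 * pi)"
definition kP :: "real \<Rightarrow> real \<Rightarrow> real \<Rightarrow> complex" where
  "kP s \<xi> \<eta> = cjp (-s) \<eta> / of_real (2 * pi)"
definition kR :: "real \<Rightarrow> real \<Rightarrow> real \<Rightarrow> complex" where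
  "kR s \<xi> \<eta> = \<i> * (\<xi> * jp s \<xi> - \<eta> * jp s \<eta> - (\<xi> - \<eta>) * jp s (\<xi> - \<eta>)) * cjp (-s) \<eta> * cjp (-s) (\<xi> - \<eta>) / of_real (2 * pi)"

text \<open>In the coordinates \<open>Y = (1 + \<xi>\<^sup>2) powr (s / 2) * u^\<close> of $H^s$: \<open>Qs s\<close> is the product of two elements of $H^s$,
  \<open>Ps s y\<close> multiplies elements of $L^2$ by the function with coordinates \<open>y\<close>, and \<open>Rs s\<close> is
  the remainder in the Leibniz rule for the product.\<close>

definition Qs where "Qs s = Tk (kQ s)"
definition Ps where "Ps s = Tk (kP s)"
definition Rs where "Rs s = Tk (kR s)"

lemma jp_double:
  assumes "s \<ge> 0" "\<bar>x\<bar> \<le> 2 * \<bar>y\<bar>"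
  shows "jp s x \<le> 2 powr s * jp s y"
proof -
  have "x\<^sup>2 \<le> (2 * \<bar>y\<bar>)\<^sup>2" using assms(2) abs_le_square_iff[of x "2 * \<bar>y\<bar>"] by simp
  then have "1 + x\<^sup>2 \<le> 4 * (1 + y\<^sup>2)" by (simp add: power_mult_distrib)
  then have "(1 + x\<^sup>2) powr (s/2) \<le> (4 * (1 + y\<^sup>2)) powr (s/2)"
    using assms(1) by (intro powr_mono2) auto
  also have "\<dots> = 4 powr (s/2) * (1 + y\<^sup>2) powr (s/2)" by (rule powr_mult)
  also have "(4::real) powr (s/2) = 2 powr s" by simp
  finally show ?thesis by (simp add: jp_def)
qed

lemma jp_neg_mono: "s \<ge> 0 \<Longrightarrow> \<bar>x\<bar> \<le> \<bar>y\<bar> \<Longrightarrow> jp (-s) y \<le> jp (-s) x"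
  unfolding jp_def by (rule powr_mono2') (auto simp: one_plus_sq_pos abs_le_square_iff)

lemma inv_2pi_le: "a \<ge> 0 \<Longrightarrow> a / (2 * pi) \<le> a"
  using pi_gt3 by (simp add: divide_le_eq mult_le_cancel_left1)

text \<open>It suffices to bound by the weight of whichever of the frequencies \<eta> and \<xi> -
  \<eta> is the lower one.\<close>

lemma kbdI:
  assumes "(\<lambda>(\<xi>, \<eta>). \<kappa> \<xi> \<eta>) \<in> borel_measurable (borel \<Otimes>\<^sub>M borel)" "C \<ge> 0"
    and "\<And>\<xi> \<eta>. \<bar>\<xi> - \<eta>\<bar> \<le> \<bar>\<eta>\<bar> \<Longrightarrow> cmod (\<kappa> \<xi> \<eta>) \<le> C * jp (-1) (\<xi> - \<eta>)"
    and "\<And>\<xi> \<eta>. \<bar>\<eta>\<bar> \<le> \<bar>\<xi> - \<eta>\<bar> \<Longrightarrow> cmod (\<kappa> \<xi> \<eta>) \<le> C * jp (-1) \<eta>"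
  shows "kbd \<kappa> C"
proof -
  have "cmod (\<kappa> \<xi> \<eta>) \<le> C * (jp (-1) \<eta> + jp (-1) (\<xi> - \<eta>))" for \<xi> \<eta>
  proof (cases "\<bar>\<xi> - \<eta>\<bar> \<le> \<bar>\<eta>\<bar>")
    case True
    from assms(3)[OF this] have "cmod (\<kappa> \<xi> \<eta>) \<le> C * jp (-1) (\<xi> - \<eta>)" .
    also have "\<dots> \<le> C * (jp (-1) \<eta> + jp (-1) (\<xi> - \<eta>))" using assms(2) by (intro mult_left_mono) auto
    finally show ?thesis .
  next
    case False
    then have "cmod (\<kappa> \<xi> \<eta>) \<le> C * jp (-1) \<eta>" by (intro assms(4)) simp
    also have "\<dots> \<le> C * (jp (-1) \<eta> + jp (-1) (\<xi> - \<eta>))" using assms(2) by (intro mult_left_mono) auto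
    finally show ?thesis .
  qed
  then show ?thesis using assms(1) by (simp add: kbd_def)
qed

lemma kbd_kP: "s \<ge> 1 \<Longrightarrow> kbd (kP s) 1"
proof -
  assume s: "s \<ge> 1"
  have "cmod (kP s \<xi> \<eta>) \<le> 1 * (jp (-1) \<eta> + jp (-1) (\<xi> - \<eta>))" for \<xi> \<eta>
  proof -
    have "cmod (kP s \<xi> \<eta>) = jp (-s) \<eta> / (2 * pi)" by (simp add: kP_def norm_divide norm_mult)
    also have "\<dots> \<le> jp (-s) \<eta>" by (rule inv_2pi_le) simp
    also have "\<dots> \<le> jp (-1) \<eta>" using s by (intro jp_mono) simp
    finally show ?thesis using jp_ge0[of "-1" "\<xi> - \<eta>"] unfolding mult_1 by linarith
  qed
  moreover have "(\<lambda>(\<xi>, \<eta>). kP s \<xi> \<eta>) \<in> borel_measurable (borel \<Otimes>\<^sub>M borel)"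
    unfolding kP_def by measurable
  ultimately show ?thesis by (simp add: kbd_def)
qed

text \<open>If \<zeta> = \<xi> - \<eta> is the lower frequency, then \<bar>\<xi>\<bar> is at most
  2\<bar>\<eta>\<bar>: the weight of \<xi> is paid for by that of \<eta> at the price
  \<open>2 powr s\<close>, and the weight of \<zeta> is left over.\<close>

lemma kbd_kQ: assumes s: "s \<ge> 1" shows "kbd (kQ s) (2 powr s)"
proof (rule kbdI)
  show "(\<lambda>(\<xi>, \<eta>). kQ s \<xi> \<eta>) \<in> borel_measurable (borel \<Otimes>\<^sub>M borel)"
    unfolding kQ_def by measurable
  have n: "cmod (kQ s \<xi> \<eta>) \<le> jp s \<xi> * jp (-s) \<eta> * jp (-s) (\<xi> - \<eta>)" for \<xi> \<eta>
    using inv_2pi_le[of "jp s \<xi> * jp (-s) \<eta> * jp (-s) (\<xi> - \<eta>)"] by (simp add: kQ_def norm_divide norm_mult)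
  have b: "jp s \<xi> * jp (-s) \<eta> * jp (-s) \<zeta> \<le> 2 powr s * jp (-1) \<zeta>" if "\<bar>\<zeta>\<bar> \<le> \<bar>\<eta>\<bar>" "\<xi> = \<eta> + \<zeta>" for \<xi> \<eta> \<zeta>
  proof -
    have "jp s \<xi> \<le> 2 powr s * jp s \<eta>" using s that by (intro jp_double) auto
    then have "jp s \<xi> * jp (-s) \<eta> \<le> (2 powr s * jp s \<eta>) * jp (-s) \<eta>" by (rule mult_right_mono) simp
    also have "\<dots> = 2 powr s" using jp_inv[of s \<eta>] by (simp add: mult.assoc mult.commute)
    finally have "jp s \<xi> * jp (-s) \<eta> * jp (-s) \<zeta> \<le> 2 powr s * jp (-1) \<zeta>"
      by (rule mult_mono) (use s in \<open>auto intro: jp_mono\<close>)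
    then show ?thesis .
  qed
  show "cmod (kQ s \<xi> \<eta>) \<le> 2 powr s * jp (-1) (\<xi> - \<eta>)" if "\<bar>\<xi> - \<eta>\<bar> \<le> \<bar>\<eta>\<bar>" for \<xi> \<eta>
    using order_trans[OF n b[OF that]] by simp
  show "cmod (kQ s \<xi> \<eta>) \<le> 2 powr s * jp (-1) \<eta>" if "\<bar>\<eta>\<bar> \<le> \<bar>\<xi> - \<eta>\<bar>" for \<xi> \<eta>
    using order_trans[OF n, of \<xi> \<eta> "2 powr s * jp (-1) \<eta>"] b[OF that, of \<xi>] by (simp add: mult_ac)
qed simp

text \<open>Mean value theorem for \<open>x * jp s x\<close> on the interval of radius
  2\<bar>\<eta>\<bar>, which contains \<eta> and \<eta> + \<zeta>. The derivative is at most
  \<open>(1 + s) * jp s x\<close>.\<close>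

lemma jp_weight_diff:
  assumes s: "s \<ge> 0" and le: "\<bar>\<zeta>\<bar> \<le> \<bar>\<eta>\<bar>"
  shows "\<bar>(\<eta> + \<zeta>) * jp s (\<eta> + \<zeta>) - \<eta> * jp s \<eta>\<bar> \<le> (1 + s) * 2 powr s * jp s \<eta> * \<bar>\<zeta>\<bar>"
proof -
  define w' where "w' x = jp s x + x * (s/2 * (1 + x\<^sup>2) powr (s/2 - 1) * (2 * x))" for x
  have d: "((\<lambda>x. x * jp s x) has_field_derivative w' x) (at x within S)" for x S
  proof -
    have "((\<lambda>x. (1 + x\<^sup>2) powr (s/2)) has_field_derivative (s/2 * (1 + x\<^sup>2) powr (s/2 - of_nat 1) * (2 * x))) (at x)"
      by (rule DERIV_fun_powr) (auto intro!: derivative_eq_intros simp: one_plus_sq_pos)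
    from DERIV_mult[OF DERIV_ident this]
    show ?thesis unfolding jp_def w'_def by (simp add: has_field_derivative_at_within mult_ac)
  qed
  have b: "\<bar>w' x\<bar> \<le> (1 + s) * 2 powr s * jp s \<eta>" if x: "x \<in> {-(2 * \<bar>\<eta>\<bar>)..2 * \<bar>\<eta>\<bar>}" for x
  proof -
    have "x\<^sup>2 * (1 + x\<^sup>2) powr (s/2 - 1) \<le> (1 + x\<^sup>2) * (1 + x\<^sup>2) powr (s/2 - 1)"
      by (rule mult_right_mono) auto
    also have "\<dots> = (1 + x\<^sup>2) powr (1 + (s/2 - 1))"
      unfolding powr_add using one_plus_sq_pos[of x] by simp
    also have "\<dots> = jp s x" by (simp add: jp_def)
    finally have "s * (x\<^sup>2 * (1 + x\<^sup>2) powr (s/2 - 1)) \<le> s * jp s x" by (rule mult_left_mono) (rule s)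
    moreover have "w' x = jp s x + s * (x\<^sup>2 * (1 + x\<^sup>2) powr (s/2 - 1))"
      by (simp add: w'_def power2_eq_square)
    moreover have "0 \<le> s * (x\<^sup>2 * (1 + x\<^sup>2) powr (s/2 - 1))" using s by simp
    ultimately have "\<bar>w' x\<bar> \<le> (1 + s) * jp s x" using jp_ge0[of s x] by (simp add: algebra_simps)
    also have "\<dots> \<le> (1 + s) * (2 powr s * jp s \<eta>)"
      using s x by (intro mult_left_mono jp_double) auto
    finally show ?thesis by simp
  qed
  have "norm ((\<eta> + \<zeta>) * jp s (\<eta> + \<zeta>) - \<eta> * jp s \<eta>) \<le> ((1 + s) * 2 powr s * jp s \<eta>) * norm ((\<eta> + \<zeta>) - \<eta>)"
    by (rule field_differentiable_bound[where S="{-(2 * \<bar>\<eta>\<bar>)..2 * \<bar>\<eta>\<bar>}" and f'=w'])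
       (use d b le in auto)
  then show ?thesis by simp
qed

text \<open>The commutator gain: the two large terms differ only by \<bar>\<zeta>\<bar> times the
  weight of \<eta>, so the derivative falls on the factor of lower frequency. Its weight
  \<open>jp (-s) \<zeta>\<close> absorbs \<bar>\<zeta>\<bar> and, as \<open>s \<ge> 2\<close>, still
  leaves \<open>jp (-1) \<zeta>\<close>.\<close>

lemma kbd_kR: assumes s: "s \<ge> 2" shows "kbd (kR s) ((1 + s) * 2 powr s + 1)" (is "kbd _ ?C")
proof (rule kbdI)
  show "(\<lambda>(\<xi>, \<eta>). kR s \<xi> \<eta>) \<in> borel_measurable (borel \<Otimes>\<^sub>M borel)"
    unfolding kR_def by measurable
  have n: "cmod (kR s \<xi> \<eta>) \<le> \<bar>\<xi> * jp s \<xi> - \<eta> * jp s \<eta> - (\<xi> - \<eta>) * jp s (\<xi> - \<eta>)\<bar> * jp (-s) \<eta> * jp (-s) (\<xi> - \<eta>)" for \<xi> \<eta>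
    using inv_2pi_le[of "\<bar>\<xi> * jp s \<xi> - \<eta> * jp s \<eta> - (\<xi> - \<eta>) * jp s (\<xi> - \<eta>)\<bar> * jp (-s) \<eta> * jp (-s) (\<xi> - \<eta>)"]
    by (simp add: kR_def norm_divide norm_mult flip: of_real_mult of_real_diff)
  have b: "\<bar>\<xi> * jp s \<xi> - \<eta> * jp s \<eta> - \<zeta> * jp s \<zeta>\<bar> * jp (-s) \<eta> * jp (-s) \<zeta> \<le> ?C * jp (-1) \<zeta>"
    if le: "\<bar>\<zeta>\<bar> \<le> \<bar>\<eta>\<bar>" and x: "\<xi> = \<eta> + \<zeta>" for \<xi> \<eta> \<zeta>
  proof -
    have "\<bar>\<zeta>\<bar> * jp s \<zeta> \<le> jp s \<eta> * \<bar>\<zeta>\<bar>"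
      using jp_neg_mono[of s \<zeta> \<eta>] s le
      by (subst mult.commute, intro mult_right_mono) (auto simp: jp_def intro!: powr_mono2 simp: abs_le_square_iff)
    moreover have "\<bar>\<xi> * jp s \<xi> - \<eta> * jp s \<eta>\<bar> \<le> (1 + s) * 2 powr s * jp s \<eta> * \<bar>\<zeta>\<bar>"
      unfolding x by (rule jp_weight_diff) (use s le in auto)
    ultimately have "\<bar>\<xi> * jp s \<xi> - \<eta> * jp s \<eta> - \<zeta> * jp s \<zeta>\<bar> \<le> ?C * (jp s \<eta> * \<bar>\<zeta>\<bar>)"
      using abs_triangle_ineq4[of "\<xi> * jp s \<xi> - \<eta> * jp s \<eta>" "\<zeta> * jp s \<zeta>"]
      by (simp add: abs_mult algebra_simps)
    then have "\<bar>\<xi> * jp s \<xi> - \<eta> * jp s \<eta> - \<zeta> * jp s \<zeta>\<bar> * (jp (-s) \<eta> * jp (-s) \<zeta>) \<le> ?C * (jp s \<eta> * \<bar>\<zeta>\<bar>) * (jp (-s) \<eta> * jp (-s) \<zeta>)"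
      by (rule mult_right_mono) simp
    also have "\<dots> = ?C * ((jp (-s) \<eta> * jp s \<eta>) * (\<bar>\<zeta>\<bar> * jp (-s) \<zeta>))" by (simp only: mult_ac)
    also have "\<dots> = ?C * (\<bar>\<zeta>\<bar> * jp (-s) \<zeta>)" by (simp add: jp_inv)
    also have "\<dots> \<le> ?C * (jp 1 \<zeta> * jp (-s) \<zeta>)"
      using s by (intro mult_left_mono mult_right_mono abs_le_jp1) auto
    also have "\<dots> \<le> ?C * jp (-1) \<zeta>"
      unfolding jp_add using s by (intro mult_left_mono jp_mono) auto
    finally show ?thesis by (simp add: mult.assoc)
  qed
  show "cmod (kR s \<xi> \<eta>) \<le> ?C * jp (-1) (\<xi> - \<eta>)" if "\<bar>\<xi> - \<eta>\<bar> \<le> \<bar>\<eta>\<bar>" for \<xi> \<eta>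
    using order_trans[OF n b[OF that]] by simp
  show "cmod (kR s \<xi> \<eta>) \<le> ?C * jp (-1) \<eta>" if "\<bar>\<eta>\<bar> \<le> \<bar>\<xi> - \<eta>\<bar>" for \<xi> \<eta>
  proof -
    have "\<bar>\<xi> * jp s \<xi> - \<eta> * jp s \<eta> - (\<xi> - \<eta>) * jp s (\<xi> - \<eta>)\<bar> * jp (-s) \<eta> * jp (-s) (\<xi> - \<eta>) =
      \<bar>\<xi> * jp s \<xi> - (\<xi> - \<eta>) * jp s (\<xi> - \<eta>) - \<eta> * jp s \<eta>\<bar> * jp (-s) (\<xi> - \<eta>) * jp (-s) \<eta>"
      by (simp add: mult_ac diff_diff_eq add.commute)
    then show ?thesis using n[of \<xi> \<eta>] b[OF that, of \<xi>] by linarith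
  qed
qed (use s in simp)

lemmas bb_Qs = bounded_bilinear_Tk[OF kbd_kQ, folded Qs_def]
lemmas bb_Ps = bounded_bilinear_Tk[OF kbd_kP, folded Ps_def]
lemmas bb_Rs = bounded_bilinear_Tk[OF kbd_kR, folded Rs_def]

subsection \<open>Plancherel's theorem\<close>

definition ek :: "real \<Rightarrow> complex" where "ek z = exp (- \<i> * of_real z)"

lemma norm_ek [simp]: "cmod (ek z) = 1" by (simp add: ek_def norm_exp_eq_Re)
lemma ek_0 [simp]: "ek 0 = 1" by (simp add: ek_def)
lemma ek_add: "ek (x + y) = ek x * ek y" by (simp add: ek_def exp_add[symmetric] algebra_simps)
lemma cnj_ek [simp]: "cnj (ek z) = ek (- z)" by (simp add: ek_def exp_cnj)
lemma ek_cancel [simp]: "ek (- z) * ek z = 1" "ek z * ek (- z) = 1" by (simp_all flip: ek_add)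
lemma ek_measurable [measurable]: "ek \<in> borel_measurable borel"
  unfolding ek_def by (intro borel_measurable_continuous_onI continuous_intros)

definition hat :: "(real \<Rightarrow> complex) \<Rightarrow> real \<Rightarrow> complex" where
  "hat f \<xi> = (LINT x|lborel. f x * ek (\<xi> * x))"

text \<open>A density \<open>a\<close> against a measure \<open>M\<close>, so that one notion serves
  convolution with an integrable function (\<open>M = lborel\<close>) and with a finite measure
  (\<open>a\<close> constant 1).\<close>

definition cv :: "real measure \<Rightarrow> (real \<Rightarrow> complex) \<Rightarrow> (real \<Rightarrow> complex) \<Rightarrow> real \<Rightarrow> complex" where
  "cv M a f x = (LINT y|M. a y * f (x - y))"

lemma fubini_kernel:
  fixes a :: "'x \<Rightarrow> complex" and b :: "'y \<Rightarrow> complex"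
  assumes M: "sigma_finite_measure M1" "sigma_finite_measure M2" and a: "integrable M1 a" and b: "integrable M2 b"
    and k: "(\<lambda>(x, y). k x y) \<in> borel_measurable (M1 \<Otimes>\<^sub>M M2)" and B: "\<And>x y. cmod (k x y) \<le> B"
  shows "(LINT x|M1. a x * (LINT y|M2. b y * k x y)) = (LINT y|M2. b y * (LINT x|M1. a x * k x y))"
proof -
  interpret pair_sigma_finite M1 M2 using M by (simp add: pair_sigma_finite_def)
  note [measurable] = borel_measurable_integrable[OF a] borel_measurable_integrable[OF b] k
  have ab: "integrable (M1 \<Otimes>\<^sub>M M2) (\<lambda>(x, y). a x * b y)"
  proof (rule Fubini_integrable)
    show "(\<lambda>(x, y). a x * b y) \<in> borel_measurable (M1 \<Otimes>\<^sub>M M2)" by measurable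
    show "integrable M1 (\<lambda>x. LINT y|M2. norm (case (x, y) of (x, y) \<Rightarrow> a x * b y))"
      using a by (simp add: norm_mult)
    show "AE x in M1. integrable M2 (\<lambda>y. case (x, y) of (x, y) \<Rightarrow> a x * b y)" using b by simp
  qed
  have i: "integrable (M1 \<Otimes>\<^sub>M M2) (\<lambda>(x, y). a x * b y * k x y)"
  proof (rule Bochner_Integration.integrable_bound[OF integrable_mult_right[OF integrable_norm[OF ab], of "B"]])
    show "AE p in M1 \<Otimes>\<^sub>M M2. norm (case p of (x, y) \<Rightarrow> a x * b y * k x y) \<le> norm (B * norm (case p of (x, y) \<Rightarrow> a x * b y))"
    proof (intro AE_I2)
      fix p :: "'x \<times> 'y"
      obtain x y where p: "p = (x, y)" by (cases p)
      have "norm (a x * b y) * norm (k x y) \<le> norm (a x * b y) * \<bar>B\<bar>"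
        using B[of x y] by (intro mult_left_mono) auto
      then show "norm (case p of (x, y) \<Rightarrow> a x * b y * k x y) \<le> norm (B * norm (case p of (x, y) \<Rightarrow> a x * b y))"
        by (simp add: p norm_mult abs_mult mult_ac)
    qed
  qed measurable
  show ?thesis
    using Fubini_integral[OF i] by (simp add: mult_ac flip: integral_mult_right_zero)
qed

lemma hat_measurable [measurable (raw)]:
  assumes [measurable]: "f \<in> borel_measurable borel" shows "hat f \<in> borel_measurable borel"
  unfolding hat_def by measurable

lemma integrable_mult_ek: "integrable M f \<Longrightarrow> g \<in> borel_measurable M \<Longrightarrow> integrable M (\<lambda>x. f x * ek (g x))"
  by (rule Bochner_Integration.integrable_bound[of _ f]) (auto simp: norm_mult)

lemma hat_bound: "cmod (hat f \<xi>) \<le> (LINT x|lborel. cmod (f x))"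
  using integral_norm_bound[of lborel "\<lambda>x. f x * ek (\<xi> * x)"] by (simp add: hat_def norm_mult)

lemma hat_diff: "integrable lborel f \<Longrightarrow> integrable lborel g \<Longrightarrow> hat (\<lambda>x. f x - g x) \<xi> = hat f \<xi> - hat g \<xi>"
  unfolding hat_def by (simp add: left_diff_distrib integrable_mult_ek)

lemma cnj_hat: "cnj (hat g \<xi>) = (LINT x|lborel. cnj (g x) * ek (- (\<xi> * x)))"
  unfolding hat_def by (simp flip: Bochner_Integration.integral_cnj)

text \<open>The inner product of \<open>l2\<close> is only a real part, so a phase first rotates the
  integral onto the nonnegative half-line.\<close>

lemma cmod_integral_mult_le:
  assumes f: "sq_integrable f" and g: "sq_integrable g"
  shows "cmod (LINT x|lborel. f x * g x) \<le> norm (mk f) * norm (mk g)"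
proof -
  define I where "I = (LINT x|lborel. f x * g x)"
  obtain u where u: "cmod u = 1" "u * I = of_real (cmod I)"
  proof (cases "I = 0")
    case False
    then show ?thesis by (intro that[of "cnj I / cmod I"]) (auto simp: norm_divide complex_norm_square[symmetric] power2_eq_square mult.commute)
  qed (auto intro: that[of 1])
  have int: "integrable lborel (\<lambda>x. f x * g x)" by (rule sq_integrable_integrable_mult[OF f g])
  have "cmod I = Re (u * I)" by (simp add: u)
  also have "u * I = (LINT x|lborel. (u * f x) * cnj (cnj (g x)))" by (simp add: I_def mult.assoc)
  also have "Re \<dots> = inner (mk (\<lambda>x. u * f x)) (mk (\<lambda>x. cnj (g x)))"
  proof -
    have i: "integrable lborel (\<lambda>x. (u * f x) * cnj (cnj (g x)))" using int by (simp add: mult.assoc)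
    show ?thesis unfolding integral_Re[OF i, symmetric] by (subst inner_mk) (auto intro: sq_integrable_cmult f sq_integrable_cnj g)
  qed
  also have "\<dots> \<le> norm (mk (\<lambda>x. u * f x)) * norm (mk (\<lambda>x. cnj (g x)))" by (rule norm_cauchy_schwarz)
  also have "norm (mk (\<lambda>x. u * f x)) = norm (mk f)"
    by (rule power2_eq_imp_eq) (simp_all add: norm_mk_sq f sq_integrable_cmult norm_mult u)
  also have "norm (mk (\<lambda>x. cnj (g x))) = norm (mk g)"
    by (rule power2_eq_imp_eq) (simp_all add: norm_mk_sq g sq_integrable_cnj)
  finally show ?thesis unfolding I_def .
qed

lemma sq_integrable_translate:
  assumes f: "sq_integrable (f :: real \<Rightarrow> complex)"
  shows "sq_integrable (\<lambda>x. f (x - y))" and "norm (mk (\<lambda>x. f (x - y))) = norm (mk f)"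
proof -
  have i: "integrable lborel (\<lambda>x. (cmod (f (x - y)))\<^sup>2)"
    using lborel_integrable_real_affine_iff[of 1 "\<lambda>x. (cmod (f x))\<^sup>2" "-y"] f by (simp add: sq_integrable_def)
  show s: "sq_integrable (\<lambda>x. f (x - y))" unfolding sq_integrable_def using i sq_integrable_measurable[OF f] by simp
  show "norm (mk (\<lambda>x. f (x - y))) = norm (mk f)"
    by (rule power2_eq_imp_eq) (simp_all add: norm_mk_sq f s integral_shift[of "\<lambda>x. (cmod (f x))\<^sup>2"])
qed

text \<open>Young's inequality, from Cauchy-Schwarz with \<bar>a\<bar> split into two square
  roots.\<close>

lemma cv_sq:
  assumes M: "sigma_finite_measure M" and sM: "sets M = sets borel" and a: "integrable M a" and f: "sq_integrable f"
  shows "sq_integrable (cv M a f)" and "norm (mk (cv M a f)) \<le> (LINT y|M. cmod (a y)) * norm (mk f)"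
proof -
  interpret M: sigma_finite_measure M by (rule M)
  interpret P: pair_sigma_finite M lborel by (simp add: pair_sigma_finite_def M lborel.sigma_finite_measure_axioms)
  note [measurable_cong] = sM
  note [measurable] = borel_measurable_integrable[OF a] sq_integrable_measurable[OF f]
  define A where "A = (LINT y|M. cmod (a y))"
  have A0: "A \<ge> 0" by (simp add: A_def)
  have An: "(\<integral>\<^sup>+y. ennreal (cmod (a y)) \<partial>M) = ennreal A"
    unfolding A_def by (rule nn_integral_eq_integral) (use a in auto)
  have pt: "ennreal ((cmod (cv M a f x))\<^sup>2) \<le> ennreal A * (\<integral>\<^sup>+y. ennreal (cmod (a y) * (cmod (f (x - y)))\<^sup>2) \<partial>M)" for x
  proof -
    have "ennreal (cmod (cv M a f x)) \<le> (\<integral>\<^sup>+y. ennreal (cmod (a y * f (x - y))) \<partial>M)"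
      unfolding cv_def by (rule integral_norm_bound_ennreal_any)
    also have "\<dots> = (\<integral>\<^sup>+y. ennreal (sqrt (cmod (a y))) * ennreal (sqrt (cmod (a y)) * cmod (f (x - y))) \<partial>M)"
      by (intro nn_integral_cong) (simp add: norm_mult flip: ennreal_mult mult.assoc)
    finally have "(ennreal (cmod (cv M a f x)))\<^sup>2 \<le> (\<integral>\<^sup>+y. ennreal (sqrt (cmod (a y))) * ennreal (sqrt (cmod (a y)) * cmod (f (x - y))) \<partial>M)\<^sup>2"
      by (rule power_mono) simp
    also have "\<dots> \<le> (\<integral>\<^sup>+y. (ennreal (sqrt (cmod (a y))))\<^sup>2 \<partial>M) * (\<integral>\<^sup>+y. (ennreal (sqrt (cmod (a y)) * cmod (f (x - y))))\<^sup>2 \<partial>M)"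
      by (rule Cauchy_Schwarz_nn_integral) measurable
    also have "(\<integral>\<^sup>+y. (ennreal (sqrt (cmod (a y))))\<^sup>2 \<partial>M) = ennreal A" unfolding An[symmetric] by (simp add: ennreal_power)
    finally show ?thesis by (simp add: ennreal_power power_mult_distrib)
  qed
  have "(\<integral>\<^sup>+x. ennreal ((cmod (cv M a f x))\<^sup>2) \<partial>lborel) \<le>
      (\<integral>\<^sup>+x. ennreal A * (\<integral>\<^sup>+y. ennreal (cmod (a y) * (cmod (f (x - y)))\<^sup>2) \<partial>M) \<partial>lborel)"
    by (rule nn_integral_mono[OF pt])
  also have "\<dots> = ennreal A * (\<integral>\<^sup>+x. (\<integral>\<^sup>+y. ennreal (cmod (a y) * (cmod (f (x - y)))\<^sup>2) \<partial>M) \<partial>lborel)"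
    by (rule nn_integral_cmult) measurable
  also have "(\<integral>\<^sup>+x. (\<integral>\<^sup>+y. ennreal (cmod (a y) * (cmod (f (x - y)))\<^sup>2) \<partial>M) \<partial>lborel)
     = (\<integral>\<^sup>+y. (\<integral>\<^sup>+x. ennreal (cmod (a y) * (cmod (f (x - y)))\<^sup>2) \<partial>lborel) \<partial>M)"
    by (rule P.Fubini') measurable
  also have "\<dots> = (\<integral>\<^sup>+y. ennreal (cmod (a y)) * ennreal ((norm (mk f))\<^sup>2) \<partial>M)"
  proof (rule nn_integral_cong)
    fix y
    have "(\<integral>\<^sup>+x. ennreal (cmod (a y) * (cmod (f (x - y)))\<^sup>2) \<partial>lborel) = ennreal (cmod (a y)) * (\<integral>\<^sup>+x. ennreal ((cmod (f (x - y)))\<^sup>2) \<partial>lborel)"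
      by (subst nn_integral_cmult[symmetric]) (auto simp: ennreal_mult)
    then show "(\<integral>\<^sup>+x. ennreal (cmod (a y) * (cmod (f (x - y)))\<^sup>2) \<partial>lborel) = ennreal (cmod (a y)) * ennreal ((norm (mk f))\<^sup>2)"
      using nn_norm_mk[OF sq_integrable_translate(1)[OF f, of y]] sq_integrable_translate(2)[OF f, of y] by simp
  qed
  also have "\<dots> = ennreal A * ennreal ((norm (mk f))\<^sup>2)" by (subst nn_integral_multc) (auto simp: An)
  finally have le: "(\<integral>\<^sup>+x. ennreal ((cmod (cv M a f x))\<^sup>2) \<partial>lborel) \<le> ennreal ((A * norm (mk f))\<^sup>2)"
    using A0 by (simp add: ennreal_mult power_mult_distrib power2_eq_square[of A] mult.assoc)
  have [measurable]: "cv M a f \<in> borel_measurable borel" unfolding cv_def by measurable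
  show sq: "sq_integrable (cv M a f)" by (rule sq_integrable_nn) (use le in \<open>auto intro: le_less_trans\<close>)
  show "norm (mk (cv M a f)) \<le> A * norm (mk f)" by (rule norm_mk_le[OF sq le]) (use A0 in simp)
qed

lemma cv_fubini:
  assumes M: "sigma_finite_measure M" and sM: "sets M = sets borel" and a: "integrable M a" and f: "sq_integrable f" and g: "sq_integrable g"
  shows "(LINT x|lborel. cv M a f x * g x) = (LINT y|M. a y * (LINT x|lborel. f (x - y) * g x))"
proof -
  interpret M: sigma_finite_measure M by (rule M)
  interpret P: pair_sigma_finite M lborel by (simp add: pair_sigma_finite_def M lborel.sigma_finite_measure_axioms)
  note [measurable_cong] = sM
  note [measurable] = borel_measurable_integrable[OF a] sq_integrable_measurable[OF f] sq_integrable_measurable[OF g]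
  have ab: "integrable (M \<Otimes>\<^sub>M lborel) (\<lambda>(y, x). a y * f (x - y) * g x)"
  proof (rule P.Fubini_integrable)
    show "(\<lambda>(y, x). a y * f (x - y) * g x) \<in> borel_measurable (M \<Otimes>\<^sub>M lborel)" by measurable
    have i: "integrable lborel (\<lambda>x. f (x - y) * g x)" for y
      by (rule sq_integrable_integrable_mult[OF sq_integrable_translate(1)[OF f] g])
    show "AE y in M. integrable lborel (\<lambda>x. case (y, x) of (y, x) \<Rightarrow> a y * f (x - y) * g x)"
      using i by (simp add: mult.assoc)
    show "integrable M (\<lambda>y. LINT x|lborel. norm (case (y, x) of (y, x) \<Rightarrow> a y * f (x - y) * g x))"
    proof (rule Bochner_Integration.integrable_bound[OF integrable_mult_left[OF integrable_norm[OF a], of "norm (mk f) * norm (mk g)"]])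
      show "AE y in M. norm (LINT x|lborel. norm (case (y, x) of (y, x) \<Rightarrow> a y * f (x - y) * g x)) \<le> norm (cmod (a y) * (norm (mk f) * norm (mk g)))"
      proof (intro AE_I2)
        fix y
        have sf: "sq_integrable (\<lambda>x. complex_of_real (cmod (f (x - y))))" and sg: "sq_integrable (\<lambda>x. complex_of_real (cmod (g x)))"
          using sq_integrable_translate(1)[OF f, of y] g by (simp_all add: sq_integrable_def)
        have n: "norm (mk (\<lambda>x. complex_of_real (cmod (f (x - y))))) = norm (mk f)" "norm (mk (\<lambda>x. complex_of_real (cmod (g x)))) = norm (mk g)"
          using norm_mk_sq[OF sf] norm_mk_sq[OF sg] norm_mk_sq[OF sq_integrable_translate(1)[OF f, of y]] norm_mk_sq[OF g] sq_integrable_translate(2)[OF f, of y]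
          by (auto intro: power2_eq_imp_eq)
        have "(LINT x|lborel. cmod (f (x - y)) * cmod (g x)) = cmod (LINT x|lborel. complex_of_real (cmod (f (x - y))) * complex_of_real (cmod (g x)))"
          by (simp flip: of_real_mult add: integral_complex_of_real)
        also have "\<dots> \<le> norm (mk f) * norm (mk g)" using cmod_integral_mult_le[OF sf sg] by (simp add: n)
        finally have "cmod (a y) * (LINT x|lborel. cmod (f (x - y)) * cmod (g x)) \<le> cmod (a y) * (norm (mk f) * norm (mk g))"
          by (rule mult_left_mono) simp
        then show "norm (LINT x|lborel. norm (case (y, x) of (y, x) \<Rightarrow> a y * f (x - y) * g x)) \<le> norm (cmod (a y) * (norm (mk f) * norm (mk g)))"
          by (simp add: norm_mult mult.assoc abs_mult)
      qed
    qed measurable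
  qed
  have "(LINT x|lborel. cv M a f x * g x) = (LINT x|lborel. LINT y|M. a y * f (x - y) * g x)"
    unfolding cv_def by (simp flip: integral_mult_left_zero)
  also have "\<dots> = (LINT y|M. LINT x|lborel. a y * f (x - y) * g x)" by (rule P.Fubini_integral[OF ab])
  also have "\<dots> = (LINT y|M. a y * (LINT x|lborel. f (x - y) * g x))" by (simp add: mult.assoc)
  finally show ?thesis .
qed

text \<open>The transform of the Gaussian density dilated by \<open>e\<close>. Its mass is sqrt(2
  pi) rather than 1, since the density carries the normalizing factor.\<close>

definition Gk :: "real \<Rightarrow> real \<Rightarrow> real" where "Gk e y = exp (- (y / e)\<^sup>2 / 2) / e"

lemma gauss_ek: "(LINT \<xi>|lborel. of_real (std_normal_density \<xi>) * ek (\<xi> * z)) = of_real (exp (- z\<^sup>2 / 2))"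
proof -
  have "char std_normal_distribution (- z) = (LINT \<xi>|lborel. std_normal_density \<xi> *\<^sub>R ek (\<xi> * z))"
    unfolding char_def by (subst integral_density) (auto simp: ek_def mult_ac)
  then show ?thesis unfolding char_std_normal_distribution by (simp add: scaleR_conv_of_real)
qed

lemma gauss_ek_scaled:
  assumes "e > 0"
  shows "(LINT \<xi>|lborel. of_real (std_normal_density (e * \<xi>)) * ek (\<xi> * z)) = of_real (Gk e z)"
proof -
  have "of_real (exp (- (z / e)\<^sup>2 / 2)) = (LINT \<xi>|lborel. of_real (std_normal_density \<xi>) * ek (\<xi> * (z / e)))"
    by (rule gauss_ek[symmetric])
  also have "\<dots> = \<bar>e\<bar> *\<^sub>R (LINT \<xi>|lborel. of_real (std_normal_density (0 + e * \<xi>)) * ek ((0 + e * \<xi>) * (z / e)))"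
    using assms by (intro lborel_integral_real_affine) simp
  also have "\<dots> = of_real e * (LINT \<xi>|lborel. of_real (std_normal_density (e * \<xi>)) * ek (\<xi> * z))"
    using assms by (simp add: scaleR_conv_of_real)
  finally show ?thesis using assms by (simp add: Gk_def field_simps)
qed

lemma integrable_std_scaled: "e > 0 \<Longrightarrow> integrable lborel (\<lambda>\<xi>. std_normal_density (e * \<xi>))"
  using lborel_integrable_real_affine_iff[of e std_normal_density 0] by simp

lemma Gk_eq: "e > 0 \<Longrightarrow> Gk e y = sqrt (2 * pi) / e * std_normal_density (y / e)"
  by (simp add: Gk_def std_normal_density_def)

lemma Gk_ge0: "e > 0 \<Longrightarrow> Gk e y \<ge> 0" by (simp add: Gk_def)

lemma Gk_integrable: "e > 0 \<Longrightarrow> integrable lborel (Gk e)"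
  using integrable_std_scaled[of "1 / e"] by (simp add: Gk_eq cong: Bochner_Integration.integrable_cong)

lemma Gk_integral: assumes "e > 0" shows "(LINT y|lborel. Gk e y) = sqrt (2 * pi)"
proof -
  have "1 = (LINT y|lborel. std_normal_density y)" by simp
  also have "\<dots> = \<bar>1 / e\<bar> *\<^sub>R (LINT y|lborel. std_normal_density (0 + (1 / e) * y))"
    using assms by (intro lborel_integral_real_affine) simp
  finally show ?thesis using assms by (simp add: Gk_eq[OF assms])
qed

text \<open>The Gaussian weight makes the triple integral absolutely convergent, so that Fubini
  applies and the frequency integral collapses to \<open>Gk\<close>. Plancherel's theorem is the
  limit of \<open>e\<close> to 0.\<close>

lemma gauss_plancherel:
  assumes f: "integrable lborel f" and g: "integrable lborel g" and e: "e > 0"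
  shows "(LINT \<xi>|lborel. of_real (std_normal_density (e * \<xi>)) * hat f \<xi> * cnj (hat g \<xi>)) =
    (LINT x|lborel. f x * cv lborel (\<lambda>y. of_real (Gk e y)) (\<lambda>y. cnj (g y)) x)"
proof -
  note [measurable] = borel_measurable_integrable[OF f] borel_measurable_integrable[OF g]
  define w where "w \<xi> = complex_of_real (std_normal_density (e * \<xi>))" for \<xi>
  have w: "integrable lborel w" unfolding w_def using integrable_std_scaled[OF e] by simp
  have [measurable]: "w \<in> borel_measurable borel" using borel_measurable_integrable[OF w] by simp
  have b: "integrable lborel (\<lambda>\<xi>. w \<xi> * cnj (hat g \<xi>))"
  proof (rule Bochner_Integration.integrable_bound[OF integrable_mult_left[OF integrable_norm[OF w], of "LINT x|lborel. cmod (g x)"]])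
    show "AE \<xi> in lborel. norm (w \<xi> * cnj (hat g \<xi>)) \<le> norm (norm (w \<xi>) * (LINT x|lborel. cmod (g x)))"
      using hat_bound[of g] by (auto simp: norm_mult intro!: mult_left_mono)
  qed measurable
  have sf: "sigma_finite_measure (lborel :: real measure)" by (rule lborel.sigma_finite_measure_axioms)
  have "(LINT \<xi>|lborel. w \<xi> * hat f \<xi> * cnj (hat g \<xi>)) = (LINT \<xi>|lborel. (w \<xi> * cnj (hat g \<xi>)) * (LINT x|lborel. f x * ek (\<xi> * x)))"
    by (simp add: hat_def mult_ac)
  also have "\<dots> = (LINT x|lborel. f x * (LINT \<xi>|lborel. (w \<xi> * cnj (hat g \<xi>)) * ek (\<xi> * x)))"
    by (rule fubini_kernel[OF sf sf b f, of _ 1]) (auto simp: split_beta')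
  also have "\<dots> = (LINT x|lborel. f x * cv lborel (\<lambda>y. of_real (Gk e y)) (\<lambda>y. cnj (g y)) x)"
  proof (intro Bochner_Integration.integral_cong refl arg_cong2[of _ _ _ _ "(*)"])
    fix x
    have "(LINT \<xi>|lborel. (w \<xi> * cnj (hat g \<xi>)) * ek (\<xi> * x)) = (LINT \<xi>|lborel. (w \<xi> * ek (\<xi> * x)) * (LINT y|lborel. cnj (g y) * ek (- (\<xi> * y))))"
      by (simp add: cnj_hat mult_ac)
    also have "\<dots> = (LINT y|lborel. cnj (g y) * (LINT \<xi>|lborel. (w \<xi> * ek (\<xi> * x)) * ek (- (\<xi> * y))))"
      by (rule fubini_kernel[OF sf sf integrable_mult_ek[OF w] integrable_cnj[OF g], of _ _ 1]) (auto simp: split_beta')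
    also have "\<dots> = (LINT y|lborel. cnj (g y) * of_real (Gk e (x - y)))"
      unfolding gauss_ek_scaled[OF e, symmetric] w_def
      by (simp add: mult.assoc right_diff_distrib flip: ek_add)
    also have "\<dots> = (LINT y|lborel. cnj (g (x - y)) * of_real (Gk e (x - (x - y))))"
      by (rule integral_reflect[symmetric])
    finally show "(LINT \<xi>|lborel. (w \<xi> * cnj (hat g \<xi>)) * ek (\<xi> * x)) = cv lborel (\<lambda>y. of_real (Gk e y)) (\<lambda>y. cnj (g y)) x"
      by (simp add: cv_def mult.commute)
  qed
  finally show ?thesis unfolding w_def .
qed

text \<open>Convolution with \<open>Gk\<close> has norm at most sqrt(2 pi), and Fatou's lemma
  removes the weight, whose limit 1/sqrt(2 pi) contributes the second such factor to the square.
  Only this inequality is needed to extend the transform to L^2; equality comes from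
  \<open>Fl_adjoint\<close>.\<close>

lemma hat_sq:
  assumes f: "integrable lborel f" and sf: "sq_integrable f"
  shows "sq_integrable (hat f)" and "norm (mk (hat f)) \<le> sqrt (2 * pi) * norm (mk f)"
proof -
  note [measurable] = sq_integrable_measurable[OF sf]
  define w where "w n \<xi> = std_normal_density ((1 / real (Suc n)) * \<xi>)" for n \<xi>
  have [measurable]: "w n \<in> borel_measurable borel" for n unfolding w_def by measurable
  have w0: "w n \<xi> \<ge> 0" for n \<xi> by (simp add: w_def)
  have lim: "(\<lambda>n. w n \<xi>) \<longlonglongrightarrow> 1 / sqrt (2 * pi)" for \<xi>
  proof -
    have "(\<lambda>n. 1 / real (Suc n)) \<longlonglongrightarrow> 0" using LIMSEQ_inverse_real_of_nat by (simp add: inverse_eq_divide)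
    then have "(\<lambda>n. w n \<xi>) \<longlonglongrightarrow> 1 / sqrt (2 * pi) * exp (- (0 * \<xi>)\<^sup>2 / 2)"
      unfolding w_def std_normal_density_def by (intro tendsto_intros) auto
    then show ?thesis by simp
  qed
  define A where "A = sqrt (2 * pi) * (norm (mk f))\<^sup>2"
  have b: "(\<integral>\<^sup>+\<xi>. ennreal (w n \<xi> * (cmod (hat f \<xi>))\<^sup>2) \<partial>lborel) \<le> ennreal A" for n
  proof -
    define e where "e = 1 / real (Suc n)"
    have e: "e > 0" by (simp add: e_def)
    have we: "w n \<xi> = std_normal_density (e * \<xi>)" for \<xi> by (simp add: w_def e_def)
    have G: "integrable lborel (\<lambda>y. complex_of_real (Gk e y))" using Gk_integrable[OF e] by simp
    have i: "integrable lborel (\<lambda>\<xi>. w n \<xi> * (cmod (hat f \<xi>))\<^sup>2)"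
    proof (rule Bochner_Integration.integrable_bound[OF integrable_mult_left[OF integrable_std_scaled[OF e], of "(LINT x|lborel. cmod (f x))\<^sup>2"]])
      show "AE \<xi> in lborel. norm (w n \<xi> * (cmod (hat f \<xi>))\<^sup>2) \<le> norm (std_normal_density (e * \<xi>) * (LINT x|lborel. cmod (f x))\<^sup>2)"
        using hat_bound[of f] by (auto simp: we intro!: mult_left_mono power_mono)
    qed measurable
    have "(LINT \<xi>|lborel. w n \<xi> * (cmod (hat f \<xi>))\<^sup>2) = cmod (LINT \<xi>|lborel. complex_of_real (w n \<xi> * (cmod (hat f \<xi>))\<^sup>2))"
      using w0 by (simp only: integral_complex_of_real) (auto intro!: abs_of_nonneg[symmetric] Bochner_Integration.integral_nonneg)
    also have "(LINT \<xi>|lborel. complex_of_real (w n \<xi> * (cmod (hat f \<xi>))\<^sup>2)) = (LINT x|lborel. f x * cv lborel (\<lambda>y. of_real (Gk e y)) (\<lambda>y. cnj (f y)) x)"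
      unfolding gauss_plancherel[OF f f e, symmetric] we by (simp only: of_real_mult complex_norm_square mult.assoc)
    also have "cmod \<dots> \<le> norm (mk f) * norm (mk (cv lborel (\<lambda>y. of_real (Gk e y)) (\<lambda>y. cnj (f y))))"
      by (rule cmod_integral_mult_le[OF sf cv_sq(1)]) (auto intro: G sq_integrable_cnj sf lborel.sigma_finite_measure_axioms)
    also have "\<dots> \<le> norm (mk f) * ((LINT y|lborel. cmod (complex_of_real (Gk e y))) * norm (mk (\<lambda>y. cnj (f y))))"
      by (intro mult_left_mono cv_sq(2)) (auto intro: G sq_integrable_cnj sf lborel.sigma_finite_measure_axioms)
    also have "(LINT y|lborel. cmod (complex_of_real (Gk e y))) = sqrt (2 * pi)"
      using Gk_integral[OF e] Gk_ge0[OF e] by simp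
    also have "norm (mk (\<lambda>y. cnj (f y))) = norm (mk f)"
      by (rule power2_eq_imp_eq) (simp_all add: norm_mk_sq sf sq_integrable_cnj)
    finally have "(LINT \<xi>|lborel. w n \<xi> * (cmod (hat f \<xi>))\<^sup>2) \<le> A" by (simp add: A_def power2_eq_square mult_ac)
    then show ?thesis using w0 by (subst nn_integral_eq_integral[OF i]) (auto intro: ennreal_leI)
  qed
  have "(\<integral>\<^sup>+\<xi>. ennreal (1 / sqrt (2 * pi) * (cmod (hat f \<xi>))\<^sup>2) \<partial>lborel) = (\<integral>\<^sup>+\<xi>. liminf (\<lambda>n. ennreal (w n \<xi> * (cmod (hat f \<xi>))\<^sup>2)) \<partial>lborel)"
    by (intro nn_integral_cong lim_imp_Liminf[symmetric] tendsto_ennrealI tendsto_mult lim) auto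
  also have "\<dots> \<le> liminf (\<lambda>n. \<integral>\<^sup>+\<xi>. ennreal (w n \<xi> * (cmod (hat f \<xi>))\<^sup>2) \<partial>lborel)"
    by (rule nn_integral_liminf) measurable
  also have "\<dots> \<le> ennreal A" by (rule Liminf_le) (use b in auto)
  finally have "ennreal (sqrt (2 * pi)) * (\<integral>\<^sup>+\<xi>. ennreal (1 / sqrt (2 * pi) * (cmod (hat f \<xi>))\<^sup>2) \<partial>lborel) \<le> ennreal (sqrt (2 * pi)) * ennreal A"
    by (rule mult_left_mono) simp
  also have "ennreal (sqrt (2 * pi)) * (\<integral>\<^sup>+\<xi>. ennreal (1 / sqrt (2 * pi) * (cmod (hat f \<xi>))\<^sup>2) \<partial>lborel) = (\<integral>\<^sup>+\<xi>. ennreal ((cmod (hat f \<xi>))\<^sup>2) \<partial>lborel)"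
    by (subst nn_integral_cmult[symmetric]) (auto simp flip: ennreal_mult)
  finally have le: "(\<integral>\<^sup>+\<xi>. ennreal ((cmod (hat f \<xi>))\<^sup>2) \<partial>lborel) \<le> ennreal ((sqrt (2 * pi) * norm (mk f))\<^sup>2)"
    by (simp add: A_def power_mult_distrib ennreal_mult[symmetric] real_sqrt_mult_self flip: mult.assoc)
  show sq: "sq_integrable (hat f)" by (rule sq_integrable_nn) (use le in \<open>auto intro: le_less_trans\<close>)
  show "norm (mk (hat f)) \<le> sqrt (2 * pi) * norm (mk f)" by (rule norm_mk_le[OF sq le]) simp
qed

definition trf :: "real \<Rightarrow> (real \<Rightarrow> complex) \<Rightarrow> real \<Rightarrow> complex" where
  "trf R f t = indicator {-R..R} t *\<^sub>R f t"

lemma trf_measurable [measurable (raw)]: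
  assumes [measurable]: "f \<in> borel_measurable borel" shows "trf R f \<in> borel_measurable borel"
  unfolding trf_def by measurable

lemma sq_integrable_indicator: "sq_integrable (\<lambda>t. indicator {a..b::real} t *\<^sub>R c :: complex)"
  unfolding sq_integrable_def
proof
  have "(\<lambda>x. (norm (indicator {a..b} x *\<^sub>R c))\<^sup>2) = (\<lambda>x. indicator {a..b} x * (norm c)\<^sup>2)"
    by (auto simp: indicator_def)
  moreover have "integrable lborel (\<lambda>x. indicator {a..b} x * (norm c)\<^sup>2)" by (intro integrable_mult_left integrable_real_indicator) (auto simp: emeasure_lborel_Icc_eq)
  ultimately show "integrable lborel (\<lambda>x. (norm (indicator {a..b} x *\<^sub>R c))\<^sup>2)" by simp
qed measurable

lemma sq_integrable_trf:
  assumes f: "sq_integrable f"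
  shows "sq_integrable (trf R f)" and "integrable lborel (trf R f)"
proof -
  note [measurable] = sq_integrable_measurable[OF f]
  have "sq_integrable (\<lambda>t. complex_of_real (indicator {-R..R} t) * f t)"
    by (rule sq_integrable_mult_bounded[OF f, of _ 1]) (auto simp: indicator_def)
  then show "sq_integrable (trf R f)" by (simp add: trf_def[abs_def] scaleR_conv_of_real)
  have "integrable lborel (\<lambda>t. (indicator {-R..R} t *\<^sub>R 1) * f t)"
    by (rule sq_integrable_integrable_mult[OF sq_integrable_indicator f])
  then show "integrable lborel (trf R f)" by (simp add: trf_def[abs_def])
qed

lemma trf_tendsto:
  assumes f: "sq_integrable f" shows "((\<lambda>R. mk (trf R f)) \<longlongrightarrow> mk f) at_top"
proof -
  note [measurable] = sq_integrable_measurable[OF f]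
  have "((\<lambda>R. LINT t|lborel. (cmod (trf R f t - f t))\<^sup>2) \<longlongrightarrow> (LINT t|(lborel :: real measure). (0::real))) at_top"
  proof (rule integral_dominated_convergence_at_top[where w="\<lambda>t. (cmod (f t))\<^sup>2" and s="\<lambda>R t. (cmod (trf R f t - f t))\<^sup>2"])
    show "integrable lborel (\<lambda>t. (cmod (f t))\<^sup>2)" using f by (simp add: sq_integrable_def)
    show "AE t in lborel. ((\<lambda>R. (cmod (trf R f t - f t))\<^sup>2) \<longlongrightarrow> 0) at_top"
    proof (intro AE_I2 tendsto_eventually)
      show "\<forall>\<^sub>F R in at_top. (cmod (trf R f t - f t))\<^sup>2 = 0" for t
        using eventually_ge_at_top[of "\<bar>t\<bar>"] by eventually_elim (auto simp: trf_def indicator_def)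
    qed
    show "\<forall>\<^sub>F R in at_top. AE t in lborel. norm ((cmod (trf R f t - f t))\<^sup>2) \<le> (cmod (f t))\<^sup>2"
      by (intro always_eventually allI AE_I2) (auto simp: trf_def indicator_def)
  qed measurable
  then have "((\<lambda>R. sqrt (LINT t|lborel. (cmod (trf R f t - f t))\<^sup>2)) \<longlongrightarrow> sqrt 0) at_top" by (intro tendsto_real_sqrt) simp
  moreover have "sqrt (LINT t|lborel. (cmod (trf R f t - f t))\<^sup>2) = norm (mk (trf R f) - mk f)" for R
    using norm_mk_sq[OF sq_integrable_diff[OF sq_integrable_trf(1)[OF f] f], of R]
    by (simp add: mk_diff[OF sq_integrable_trf(1)[OF f] f, symmetric] real_sqrt_unique)
  ultimately show ?thesis by (simp add: tendsto_norm_zero_iff LIM_zero_iff)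
qed

definition Fl :: "l2 \<Rightarrow> l2" where
  "Fl x = lim (\<lambda>n. mk (hat (trf (real n) (rep x))))"

lemma norm_hat_diff:
  assumes "integrable lborel f" "sq_integrable f" "integrable lborel g" "sq_integrable g"
  shows "norm (mk (hat f) - mk (hat g)) \<le> sqrt (2 * pi) * norm (mk f - mk g)"
  using hat_sq(2)[of "\<lambda>x. f x - g x"] assms
  by (simp add: mk_diff[symmetric] hat_sq(1) hat_diff[symmetric] sq_integrable_diff)

text \<open>The truncations converge in L^2, and \<open>norm_hat_diff\<close> transfers the Cauchy
  property to their transforms.\<close>

lemma Fl_tendsto: "(\<lambda>n. mk (hat (trf (real n) (rep x)))) \<longlonglongrightarrow> Fl x"
proof -
  have "(\<lambda>n. mk (trf (real n) (rep x))) \<longlonglongrightarrow> mk (rep x)"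
    by (rule filterlim_compose[OF trf_tendsto filterlim_real_sequentially]) simp
  then have "Cauchy (\<lambda>n. mk (trf (real n) (rep x)))" by (auto intro: convergent_Cauchy convergentI)
  have "Cauchy (\<lambda>n. mk (hat (trf (real n) (rep x))))"
  proof (rule CauchyI)
    fix e :: real assume "e > 0"
    then obtain M where M: "\<And>m n. m \<ge> M \<Longrightarrow> n \<ge> M \<Longrightarrow> norm (mk (trf (real m) (rep x)) - mk (trf (real n) (rep x))) < e / sqrt (2 * pi)"
      using CauchyD[OF \<open>Cauchy (\<lambda>n. mk (trf (real n) (rep x)))\<close>, of "e / sqrt (2 * pi)"] by auto
    have "norm (mk (hat (trf (real m) (rep x))) - mk (hat (trf (real n) (rep x)))) < e" if "m \<ge> M" "n \<ge> M" for m n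
      using norm_hat_diff[OF sq_integrable_trf(2,1)[OF sq_rep, of m x] sq_integrable_trf(2,1)[OF sq_rep, of n x]] M[OF that]
      by (simp add: pos_less_divide_eq mult.commute)
    then show "\<exists>M. \<forall>m\<ge>M. \<forall>n\<ge>M. norm (mk (hat (trf (real m) (rep x))) - mk (hat (trf (real n) (rep x)))) < e" by blast
  qed
  then show ?thesis unfolding Fl_def by (simp add: Cauchy_convergent_iff convergent_LIMSEQ_iff)
qed

lemma Fl_mk:
  assumes f: "integrable lborel f" "sq_integrable f"
  shows "Fl (mk f) = mk (hat f)"
proof (rule LIMSEQ_unique[OF Fl_tendsto])
  have l: "(\<lambda>n. mk (trf (real n) (rep (mk f)))) \<longlonglongrightarrow> mk f"
    using filterlim_compose[OF trf_tendsto[OF sq_rep, of "mk f"] filterlim_real_sequentially] by simp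
  have "(\<lambda>n. mk (hat (trf (real n) (rep (mk f)))) - mk (hat f)) \<longlonglongrightarrow> 0"
  proof (rule Lim_null_comparison)
    show "\<forall>\<^sub>F n in sequentially. norm (mk (hat (trf (real n) (rep (mk f)))) - mk (hat f)) \<le> sqrt (2 * pi) * norm (mk (trf (real n) (rep (mk f))) - mk f)"
      by (intro always_eventually allI norm_hat_diff sq_integrable_trf sq_rep f)
    show "(\<lambda>n. sqrt (2 * pi) * norm (mk (trf (real n) (rep (mk f))) - mk f)) \<longlonglongrightarrow> 0"
      using tendsto_mult_right[OF tendsto_norm[OF l[THEN LIM_zero]], of "sqrt (2 * pi)"] by simp
  qed
  then show "(\<lambda>n. mk (hat (trf (real n) (rep (mk f))))) \<longlonglongrightarrow> mk (hat f)" by (simp add: LIM_zero_iff)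
qed

lemma hat_cong_AE:
  assumes [measurable]: "f \<in> borel_measurable borel" "g \<in> borel_measurable borel" and "AE x in lborel. f x = g x"
  shows "hat f \<xi> = hat g \<xi>"
  unfolding hat_def by (rule integral_cong_AE) (use assms(3) in auto)

lemma bounded_linear_Fl: "bounded_linear Fl"
proof (rule bounded_linear_intro)
  fix x y
  have "hat (trf n (rep (x + y))) = (\<lambda>\<xi>. hat (trf n (rep x)) \<xi> + hat (trf n (rep y)) \<xi>)" for n
  proof
    fix \<xi>
    have "hat (trf n (rep (x + y))) \<xi> = hat (\<lambda>t. trf n (rep x) t + trf n (rep y) t) \<xi>"
      by (rule hat_cong_AE, measurable) (use rep_add[of x y] in eventually_elim, simp add: trf_def scaleR_add_right)
    then show "hat (trf n (rep (x + y))) \<xi> = hat (trf n (rep x)) \<xi> + hat (trf n (rep y)) \<xi>"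
      by (simp add: hat_def distrib_right integrable_mult_ek sq_integrable_trf(2)[OF sq_rep])
  qed
  then have "mk (hat (trf n (rep (x + y)))) = mk (hat (trf n (rep x))) + mk (hat (trf n (rep y)))" for n
    by (simp add: mk_add hat_sq(1) sq_integrable_trf)
  then show "Fl (x + y) = Fl x + Fl y"
    using LIMSEQ_unique[OF Fl_tendsto[of "x + y"]] tendsto_add[OF Fl_tendsto[of x] Fl_tendsto[of y]] by simp
next
  fix r x
  have "hat (trf n (rep (r *\<^sub>R x))) = (\<lambda>\<xi>. of_real r * hat (trf n (rep x)) \<xi>)" for n
  proof
    fix \<xi>
    have "hat (trf n (rep (r *\<^sub>R x))) \<xi> = hat (\<lambda>t. of_real r * trf n (rep x) t) \<xi>"
      by (rule hat_cong_AE, measurable) (use rep_scaleR[of r x] in eventually_elim, simp add: trf_def)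
    then show "hat (trf n (rep (r *\<^sub>R x))) \<xi> = of_real r * hat (trf n (rep x)) \<xi>" by (simp add: hat_def mult.assoc)
  qed
  then have "mk (hat (trf n (rep (r *\<^sub>R x)))) = r *\<^sub>R mk (hat (trf n (rep x)))" for n
    by (simp add: mk_scale hat_sq(1) sq_integrable_trf)
  then show "Fl (r *\<^sub>R x) = r *\<^sub>R Fl x"
    using LIMSEQ_unique[OF Fl_tendsto[of "r *\<^sub>R x"]] tendsto_scaleR[OF tendsto_const Fl_tendsto[of x]] by simp
next
  fix x
  show "norm (Fl x) \<le> norm x * sqrt (2 * pi)"
  proof (rule LIMSEQ_le[OF tendsto_norm[OF Fl_tendsto]])
    show "(\<lambda>n. norm (mk (trf (real n) (rep x))) * sqrt (2 * pi)) \<longlonglongrightarrow> norm x * sqrt (2 * pi)"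
      using filterlim_compose[OF trf_tendsto[OF sq_rep, of x] filterlim_real_sequentially] by (intro tendsto_intros) simp
    show "\<exists>N. \<forall>n\<ge>N. norm (mk (hat (trf (real n) (rep x)))) \<le> norm (mk (trf (real n) (rep x))) * sqrt (2 * pi)"
      using hat_sq(2)[OF sq_integrable_trf(2,1)[OF sq_rep]] by (auto simp: mult.commute)
  qed
qed

lemmas Fl_add = linear_add[OF bounded_linear.linear[OF bounded_linear_Fl]]
lemmas Fl_diff = linear_diff[OF bounded_linear.linear[OF bounded_linear_Fl]]
lemmas Fl_scaleR = linear_scale[OF bounded_linear.linear[OF bounded_linear_Fl]]

definition Cj :: "l2 \<Rightarrow> l2" where "Cj x = mk (\<lambda>t. cnj (rep x t))"

lemma rep_Cj: "AE t in lborel. rep (Cj x) t = cnj (rep x t)"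
  unfolding Cj_def by (rule rep_mk) (simp add: sq_integrable_cnj)

lemma Cj_mk: "sq_integrable f \<Longrightarrow> Cj (mk f) = mk (\<lambda>t. cnj (f t))"
  unfolding Cj_def by (rule mk_eqI) (use rep_mk[of f] in \<open>auto intro: sq_integrable_cnj\<close>)

lemma Cj_Cj [simp]: "Cj (Cj x) = x"
  by (rule l2_eqI) (use rep_Cj[of x] rep_Cj[of "Cj x"] in eventually_elim, simp)

lemma inner_Cj: "inner (Cj x) (Cj y) = inner x y"
  unfolding inner_l2_def by (rule integral_cong_AE, measurable) (use rep_Cj[of x] rep_Cj[of y] in eventually_elim, simp)

lemma bounded_linear_Cj: "bounded_linear Cj"
proof (rule bounded_linear_intro)
  show "Cj (x + y) = Cj x + Cj y" for x y
    by (rule l2_eqI) (use rep_Cj[of x] rep_Cj[of y] rep_Cj[of "x + y"] rep_add[of x y] rep_add[of "Cj x" "Cj y"] in eventually_elim, simp)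
  show "Cj (r *\<^sub>R x) = r *\<^sub>R Cj x" for r x
    by (rule l2_eqI) (use rep_Cj[of x] rep_Cj[of "r *\<^sub>R x"] rep_scaleR[of r x] rep_scaleR[of r "Cj x"] in eventually_elim, simp)
  show "norm (Cj x) \<le> norm x * 1" for x by (simp add: norm_eq_sqrt_inner inner_Cj)
qed

lemma inner_mk_complex:
  assumes "sq_integrable f" "sq_integrable g"
  shows "inner (mk f) (mk g) = Re (LINT t|lborel. f t * cnj (g t))"
  unfolding inner_mk[OF assms]
  by (rule integral_Re[OF sq_integrable_integrable_mult[OF assms(1) sq_integrable_cnj[OF assms(2)]]])

lemma l2_approx:
  obtains f where "\<And>n. integrable lborel (f n)" "\<And>n. sq_integrable (f n)" "(\<lambda>n. mk (f n)) \<longlonglongrightarrow> x"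
  using that[of "\<lambda>n. trf (real n) (rep x)"] sq_integrable_trf[OF sq_rep, of _ x]
    filterlim_compose[OF trf_tendsto[OF sq_rep, of x] filterlim_real_sequentially] by simp

text \<open>The symmetric formula that moves the transform from one factor of an integral to the
  other. The conjugations \<open>Cj\<close> undo the one built into the inner product; Fubini gives
  it for integrable functions and density does the rest.\<close>

lemma Fl_mult_formula: "inner (Fl x) (Cj y) = inner x (Cj (Fl y))"
proof -
  obtain f where f: "\<And>n. integrable lborel (f n)" "\<And>n. sq_integrable (f n)" "(\<lambda>n. mk (f n)) \<longlonglongrightarrow> x" using l2_approx[of x] by blast
  obtain g where g: "\<And>n. integrable lborel (g n)" "\<And>n. sq_integrable (g n)" "(\<lambda>n. mk (g n)) \<longlonglongrightarrow> y" using l2_approx[of y] by blast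
  have e: "inner (Fl (mk (f n))) (Cj (mk (g n))) = inner (mk (f n)) (Cj (Fl (mk (g n))))" for n
  proof -
    note sf = lborel.sigma_finite_measure_axioms
    have "inner (Fl (mk (f n))) (Cj (mk (g n))) = Re (LINT t|lborel. hat (f n) t * g n t)"
      by (simp only: Fl_mk[OF f(1,2)] Fl_mk[OF g(1,2)] Cj_mk[OF g(2)] Cj_mk[OF hat_sq(1)[OF g(1,2)]]
          inner_mk_complex[OF hat_sq(1)[OF f(1,2)] sq_integrable_cnj[OF g(2)]] inner_mk_complex[OF f(2) sq_integrable_cnj[OF hat_sq(1)[OF g(1,2)]]] complex_cnj_cnj)
    also have "(LINT t|lborel. hat (f n) t * g n t) = (LINT t|lborel. g n t * (LINT x|lborel. f n x * ek (t * x)))"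
      by (simp add: hat_def mult.commute)
    also have "\<dots> = (LINT x|lborel. f n x * (LINT t|lborel. g n t * ek (t * x)))"
      by (rule fubini_kernel[OF sf sf g(1) f(1), of _ 1]) (auto simp: split_beta')
    also have "\<dots> = (LINT x|lborel. f n x * hat (g n) x)" by (simp add: hat_def mult.commute)
    also have "Re \<dots> = inner (mk (f n)) (Cj (Fl (mk (g n))))"
      by (simp only: Fl_mk[OF f(1,2)] Fl_mk[OF g(1,2)] Cj_mk[OF g(2)] Cj_mk[OF hat_sq(1)[OF g(1,2)]]
          inner_mk_complex[OF hat_sq(1)[OF f(1,2)] sq_integrable_cnj[OF g(2)]] inner_mk_complex[OF f(2) sq_integrable_cnj[OF hat_sq(1)[OF g(1,2)]]] complex_cnj_cnj)
    finally show ?thesis .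
  qed
  note cF = bounded_linear.tendsto[OF bounded_linear_Fl] and cC = bounded_linear.tendsto[OF bounded_linear_Cj]
  show ?thesis
    using LIMSEQ_unique[OF tendsto_inner[OF cF[OF f(3)] cC[OF g(3)]] tendsto_inner[OF f(3) cC[OF cF[OF g(3)]], folded e]] .
qed

lemma cv_Gk:
  assumes e: "e > 0"
  shows "cv lborel (\<lambda>y. of_real (Gk e y)) h x = (LINT z|lborel. of_real (sqrt (2 * pi) * std_normal_density z) * h (x - e * z))"
proof -
  have "cv lborel (\<lambda>y. of_real (Gk e y)) h x = \<bar>e\<bar> *\<^sub>R (LINT z|lborel. of_real (Gk e (0 + e * z)) * h (x - (0 + e * z)))"
    unfolding cv_def using e by (intro lborel_integral_real_affine) simp
  also have "\<dots> = (LINT z|lborel. of_real e * (of_real (Gk e (e * z)) * h (x - e * z)))"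
    using e by (simp add: scaleR_conv_of_real)
  also have "\<dots> = (LINT z|lborel. of_real (sqrt (2 * pi) * std_normal_density z) * h (x - e * z))"
    using e by (intro Bochner_Integration.integral_cong) (auto simp: Gk_eq field_simps)
  finally show ?thesis .
qed

text \<open>Indicators of intervals are the test functions for the isometry: their Gaussian averages converge
  pointwise off the two end points.\<close>

lemma plancherel_interval:
  fixes a b :: real and c :: complex
  assumes f: "integrable lborel f" "sq_integrable f"
  defines "g \<equiv> \<lambda>t. indicator {a..b} t *\<^sub>R c"
  shows "(LINT \<xi>|lborel. hat f \<xi> * cnj (hat g \<xi>)) = 2 * pi * (LINT t|lborel. f t * cnj (g t))"
proof -
  note [measurable] = sq_integrable_measurable[OF f(2)]
  have g2: "sq_integrable g" unfolding g_def by (rule sq_integrable_indicator)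
  have g1: "integrable lborel g" unfolding g_def by (intro integrable_scaleR_left integrable_real_indicator) (auto simp: emeasure_lborel_Icc_eq)
  have [measurable]: "g \<in> borel_measurable borel" using g2 by (rule sq_integrable_measurable)
  define w where "w n \<xi> = std_normal_density ((1 / real (Suc n)) * \<xi>)" for n \<xi>
  have [measurable]: "w n \<in> borel_measurable borel" for n unfolding w_def by measurable
  have lim0: "(\<lambda>n. 1 / real (Suc n)) \<longlonglongrightarrow> 0" using LIMSEQ_inverse_real_of_nat by (simp add: inverse_eq_divide)
  have lim: "(\<lambda>n. w n \<xi>) \<longlonglongrightarrow> 1 / sqrt (2 * pi)" for \<xi>
  proof -
    have "(\<lambda>n. w n \<xi>) \<longlonglongrightarrow> 1 / sqrt (2 * pi) * exp (- (0 * \<xi>)\<^sup>2 / 2)"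
      unfolding w_def std_normal_density_def by (intro tendsto_intros lim0) auto
    then show ?thesis by simp
  qed
  have wle: "w n \<xi> \<le> 1 / sqrt (2 * pi)" "w n \<xi> \<ge> 0" for n \<xi>
    unfolding w_def std_normal_density_def by (auto intro!: divide_right_mono)
  have L: "(\<lambda>n. LINT \<xi>|lborel. of_real (w n \<xi>) * hat f \<xi> * cnj (hat g \<xi>)) \<longlonglongrightarrow> (LINT \<xi>|lborel. of_real (1 / sqrt (2 * pi)) * hat f \<xi> * cnj (hat g \<xi>))"
  proof (rule integral_dominated_convergence)
    show "integrable lborel (\<lambda>\<xi>. 1 / sqrt (2 * pi) * cmod (hat f \<xi> * cnj (hat g \<xi>)))"
      by (intro integrable_mult_right integrable_norm sq_integrable_integrable_mult hat_sq f sq_integrable_cnj g1 g2)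
    show "AE \<xi> in lborel. (\<lambda>n. of_real (w n \<xi>) * hat f \<xi> * cnj (hat g \<xi>)) \<longlonglongrightarrow> of_real (1 / sqrt (2 * pi)) * hat f \<xi> * cnj (hat g \<xi>)"
      by (intro AE_I2 tendsto_intros tendsto_of_real lim)
    show "AE \<xi> in lborel. norm (of_real (w n \<xi>) * hat f \<xi> * cnj (hat g \<xi>)) \<le> 1 / sqrt (2 * pi) * cmod (hat f \<xi> * cnj (hat g \<xi>))" for n
    proof (intro AE_I2)
      fix \<xi>
      have "w n \<xi> * cmod (hat f \<xi> * cnj (hat g \<xi>)) \<le> 1 / sqrt (2 * pi) * cmod (hat f \<xi> * cnj (hat g \<xi>))"
        by (intro mult_right_mono wle) simp
      then show "norm (of_real (w n \<xi>) * hat f \<xi> * cnj (hat g \<xi>)) \<le> 1 / sqrt (2 * pi) * cmod (hat f \<xi> * cnj (hat g \<xi>))"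
        using wle(2)[of n \<xi>] by (simp add: norm_mult mult.assoc)
    qed
  qed measurable
  have gb: "cmod (g t) \<le> cmod c" for t by (simp add: g_def indicator_def)
  define K where "K n x = cv lborel (\<lambda>y. of_real (Gk (1 / real (Suc n)) y)) (\<lambda>y. cnj (g y)) x" for n x
  have Ke: "K n x = (LINT z|lborel. of_real (sqrt (2 * pi) * std_normal_density z) * cnj (g (x - (1 / real (Suc n)) * z)))" for n x
    unfolding K_def by (rule cv_Gk) simp
  have Kb: "cmod (K n x) \<le> sqrt (2 * pi) * cmod c" for n x
  proof -
    have "cmod (K n x) \<le> (LINT z|lborel. sqrt (2 * pi) * std_normal_density z * cmod c)"
      unfolding Ke
    proof (rule Bochner_Integration.integral_norm_bound_integral)
      show i: "integrable lborel (\<lambda>z. sqrt (2 * pi) * std_normal_density z * cmod c)" by simp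
      have le: "norm (of_real (sqrt (2 * pi) * std_normal_density z) * cnj (g (x - 1 / real (Suc n) * z))) \<le> sqrt (2 * pi) * std_normal_density z * cmod c" for z
        by (simp add: norm_mult gb mult_left_mono)
      show "integrable lborel (\<lambda>z. of_real (sqrt (2 * pi) * std_normal_density z) * cnj (g (x - 1 / real (Suc n) * z)))"
        by (rule Bochner_Integration.integrable_bound[OF i]) (use le in \<open>auto intro!: AE_I2 order_trans[OF le]\<close>)
      show "norm (of_real (sqrt (2 * pi) * std_normal_density z) * cnj (g (x - 1 / real (Suc n) * z))) \<le> sqrt (2 * pi) * std_normal_density z * cmod c" for z
        by (rule le)
    qed
    then show ?thesis by simp
  qed
  have Kl: "(\<lambda>n. K n x) \<longlonglongrightarrow> of_real (sqrt (2 * pi)) * cnj (g x)" if x: "x \<noteq> a" "x \<noteq> b" for x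
  proof -
    have "(\<lambda>n. K n x) \<longlonglongrightarrow> (LINT z|lborel. of_real (sqrt (2 * pi) * std_normal_density z) * cnj (g x))"
      unfolding Ke
    proof (rule integral_dominated_convergence)
      show "integrable lborel (\<lambda>z. sqrt (2 * pi) * std_normal_density z * cmod c)" by simp
      show "AE z in lborel. norm (of_real (sqrt (2 * pi) * std_normal_density z) * cnj (g (x - (1 / real (Suc n)) * z))) \<le> sqrt (2 * pi) * std_normal_density z * cmod c" for n
        by (auto simp: norm_mult gb intro!: mult_left_mono)
      show "AE z in lborel. (\<lambda>n. of_real (sqrt (2 * pi) * std_normal_density z) * cnj (g (x - (1 / real (Suc n)) * z))) \<longlonglongrightarrow> of_real (sqrt (2 * pi) * std_normal_density z) * cnj (g x)"
      proof (intro AE_I2 tendsto_mult tendsto_const tendsto_cnj)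
        fix z
        have l: "(\<lambda>n. x - (1 / real (Suc n)) * z) \<longlonglongrightarrow> x - 0 * z" by (intro tendsto_intros lim0)
        have "\<forall>\<^sub>F n in sequentially. g (x - (1 / real (Suc n)) * z) = g x"
        proof (cases "x \<in> {a..b}")
          case True
          then have "x \<in> {a<..<b}" using x by auto
          then have "\<forall>\<^sub>F n in sequentially. x - (1 / real (Suc n)) * z \<in> {a<..<b}" using l by (intro topological_tendstoD[of _ x]) simp_all
          then show ?thesis by eventually_elim (use True in \<open>auto simp: g_def\<close>)
        next
          case False
          then have "\<forall>\<^sub>F n in sequentially. x - (1 / real (Suc n)) * z \<in> - {a..b}" using l by (intro topological_tendstoD[of _ x]) (simp_all add: open_Compl)
          then show ?thesis by eventually_elim (use False in \<open>auto simp: g_def\<close>)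
        qed
        then show "(\<lambda>n. g (x - (1 / real (Suc n)) * z)) \<longlonglongrightarrow> g x" by (rule tendsto_eventually)
      qed
    qed measurable
    also have "(LINT z|lborel. of_real (sqrt (2 * pi) * std_normal_density z) * cnj (g x)) = of_real (LINT z|lborel. sqrt (2 * pi) * std_normal_density z) * cnj (g x)"
      by (simp only: integral_mult_left_zero integral_complex_of_real)
    finally show ?thesis by simp
  qed
  have [measurable]: "K n \<in> borel_measurable borel" for n unfolding K_def cv_def Gk_def by measurable
  have R: "(\<lambda>n. LINT x|lborel. f x * K n x) \<longlonglongrightarrow> (LINT x|lborel. f x * (of_real (sqrt (2 * pi)) * cnj (g x)))"
  proof (rule integral_dominated_convergence)
    show "integrable lborel (\<lambda>x. cmod (f x) * (sqrt (2 * pi) * cmod c))" using f(1) by simp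
    show "AE x in lborel. norm (f x * K n x) \<le> cmod (f x) * (sqrt (2 * pi) * cmod c)" for n
      unfolding norm_mult by (intro AE_I2 mult_left_mono Kb) simp
    show "AE x in lborel. (\<lambda>n. f x * K n x) \<longlonglongrightarrow> f x * (of_real (sqrt (2 * pi)) * cnj (g x))"
      using AE_lborel_singleton[of a] AE_lborel_singleton[of b] by eventually_elim (intro tendsto_mult tendsto_const Kl)
  qed measurable
  have "(LINT \<xi>|lborel. of_real (w n \<xi>) * hat f \<xi> * cnj (hat g \<xi>)) = (LINT x|lborel. f x * K n x)" for n
    unfolding w_def K_def by (rule gauss_plancherel[OF f(1) g1]) simp
  then have "(LINT \<xi>|lborel. of_real (1 / sqrt (2 * pi)) * hat f \<xi> * cnj (hat g \<xi>)) = (LINT x|lborel. f x * (of_real (sqrt (2 * pi)) * cnj (g x)))"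
    using LIMSEQ_unique[OF L] R by simp
  then have "of_real (sqrt (2 * pi)) * (of_real (1 / sqrt (2 * pi)) * (LINT \<xi>|lborel. hat f \<xi> * cnj (hat g \<xi>)))
      = of_real (sqrt (2 * pi)) * (of_real (sqrt (2 * pi)) * (LINT x|lborel. f x * cnj (g x)))"
    by (simp add: mult.assoc mult.left_commute[of "f _"])
  then show ?thesis by (simp flip: mult.assoc of_real_mult add: real_sqrt_mult_self del: of_real_sqrt)
qed

text \<open>The positive and the negative part are densities of two measures that agree on
  half-lines, hence everywhere. So the two parts are equal almost everywhere, and this forces both
  to vanish.\<close>

lemma AE_zero_halflines:
  fixes g :: "real \<Rightarrow> real"
  assumes g: "integrable lborel g" and z: "\<And>u. (LINT t|lborel. indicator {u<..} t * g t) = 0"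
  shows "AE t in lborel. g t = 0"
proof -
  note [measurable] = borel_measurable_integrable[OF g]
  have i: "integrable lborel (\<lambda>t. indicator {u<..} t * g t)" for u
    by (rule Bochner_Integration.integrable_bound[OF g]) (auto simp: indicator_def)
  have em: "emeasure (density lborel (\<lambda>t. ennreal (h t))) {u<..} = (\<integral>\<^sup>+t. ennreal (indicator {u<..} t * h t) \<partial>lborel)"
    if [measurable]: "h \<in> borel_measurable borel" for h :: "real \<Rightarrow> real" and u
    by (subst emeasure_density) (auto intro!: nn_integral_cong simp: indicator_def)
  have fin: "(\<integral>\<^sup>+t. ennreal (indicator {u<..} t * g t) \<partial>lborel) < \<infinity>" "(\<integral>\<^sup>+t. ennreal (indicator {u<..} t * - g t) \<partial>lborel) < \<infinity>" for u
    using i[of u] by (auto simp: real_integrable_def top.not_eq_extremum)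
  have "density lborel (\<lambda>t. ennreal (g t)) = density lborel (\<lambda>t. ennreal (- g t))"
  proof (rule measure_eqI_lessThan)
    fix u
    show "emeasure (density lborel (\<lambda>t. ennreal (g t))) {u<..} < \<infinity>" using fin by (simp add: em)
    have "enn2real (\<integral>\<^sup>+t. ennreal (indicator {u<..} t * g t) \<partial>lborel) = enn2real (\<integral>\<^sup>+t. ennreal (indicator {u<..} t * - g t) \<partial>lborel)"
      using real_lebesgue_integral_def[OF i[of u]] z[of u] by simp
    then show "emeasure (density lborel (\<lambda>t. ennreal (g t))) {u<..} = emeasure (density lborel (\<lambda>t. ennreal (- g t))) {u<..}"
      using fin[of u] by (subst (1 2) em) (auto simp: less_top, metis ennreal_enn2real)
  qed auto
  then have "AE t in lborel. ennreal (g t) = ennreal (- g t)" by (intro sigma_finite_measure.density_unique[OF lborel.sigma_finite_measure_axioms]) auto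
  then show ?thesis by eventually_elim (metis ennreal_eq_0_iff ennreal_neg linear neg_0_le_iff_le neg_le_0_iff_le order_antisym)
qed

text \<open>The constants \<open>c = 1\<close> and \<open>c = \<i>\<close> recover the real and the
  imaginary part, which a real inner product sees only separately.\<close>

lemma l2_zero_intervals:
  assumes z: "\<And>a b c. inner w (mk (\<lambda>t. indicator {a..b::real} t *\<^sub>R c)) = 0"
  shows "w = 0"
proof -
  have A: "AE t in lborel. Re (rep w t * cnj c) = 0" for c
  proof -
    have "AE t in lborel. indicator {- real n..real n} t * Re (rep w t * cnj c) = 0" for n
    proof (rule AE_zero_halflines)
      have "integrable lborel (\<lambda>t. Re (rep w t * cnj (indicator {- real n..real n} t *\<^sub>R c)))"
        by (intro integrable_Re sq_integrable_integrable_mult sq_rep sq_integrable_cnj sq_integrable_indicator)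
      then show "integrable lborel (\<lambda>t. indicator {- real n..real n} t * Re (rep w t * cnj c))"
        by (rule Bochner_Integration.integrable_cong[THEN iffD1, rotated -1]) (auto simp: indicator_def)
      fix u
      have "(LINT t|lborel. indicator {u<..} t * (indicator {- real n..real n} t * Re (rep w t * cnj c)))
         = (LINT t|lborel. Re (rep w t * cnj (indicator {max u (- real n)..real n} t *\<^sub>R c)))"
        by (rule integral_cong_AE, measurable) (use AE_lborel_singleton[of u] in eventually_elim, auto simp: indicator_def)
      also have "\<dots> = inner w (mk (\<lambda>t. indicator {max u (- real n)..real n} t *\<^sub>R c))"
        using inner_mk[OF sq_rep[of w] sq_integrable_indicator[of "max u (- real n)" "real n" c]] by simp
      finally show "(LINT t|lborel. indicator {u<..} t * (indicator {- real n..real n} t * Re (rep w t * cnj c))) = 0"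
        using z by simp
    qed
    then have "AE t in lborel. \<forall>n. indicator {- real n..real n} t * Re (rep w t * cnj c) = 0" unfolding AE_all_countable by blast
    then show ?thesis
    proof eventually_elim
      case (elim t)
      obtain n where "\<bar>t\<bar> \<le> real n" using real_arch_simple by blast
      then show ?case using elim[rule_format, of n] by (auto simp: indicator_def)
    qed
  qed
  show ?thesis
    by (rule l2_eqI) (use A[of 1] A[of \<i>] rep_zero in eventually_elim, simp add: complex_eq_iff)
qed

text \<open>Tested against the indicator of an interval, the left side becomes a pairing of two
  transforms by \<open>Fl_mult_formula\<close>, and \<open>plancherel_interval\<close> evaluates it.
  The identity contains both the isometry and the inversion formula.\<close>

lemma Fl_adjoint: "Cj (Fl (Cj (Fl x))) = (2 * pi) *\<^sub>R x"
proof -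
  have "inner (Cj (Fl (Cj (Fl x))) - (2 * pi) *\<^sub>R x) (mk (\<lambda>t. indicator {a..b::real} t *\<^sub>R c)) = 0" for a b c
  proof -
    define g where "g t = indicator {a..b} t *\<^sub>R c" for t
    have g2: "sq_integrable g" unfolding g_def by (rule sq_integrable_indicator)
    have g1: "integrable lborel g" unfolding g_def by (intro integrable_scaleR_left integrable_real_indicator) (auto simp: emeasure_lborel_Icc_eq)
    obtain f where f: "\<And>n. integrable lborel (f n)" "\<And>n. sq_integrable (f n)" "(\<lambda>n. mk (f n)) \<longlonglongrightarrow> x" using l2_approx[of x] by blast
    have e: "inner (Fl (mk (f n))) (Fl (mk g)) = 2 * pi * inner (mk (f n)) (mk g)" for n
      unfolding Fl_mk[OF f(1,2)] Fl_mk[OF g1 g2] inner_mk_complex[OF hat_sq(1)[OF f(1,2)] hat_sq(1)[OF g1 g2]] inner_mk_complex[OF f(2) g2]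
      using plancherel_interval[OF f(1,2), of n a b c] by (simp add: g_def[abs_def])
    have "inner (Fl x) (Fl (mk g)) = 2 * pi * inner x (mk g)"
      using LIMSEQ_unique[OF tendsto_inner[OF bounded_linear.tendsto[OF bounded_linear_Fl f(3)] tendsto_const[of "Fl (mk g)"], unfolded e]
        tendsto_mult_left[OF tendsto_inner[OF f(3) tendsto_const]]] .
    moreover have "inner (Cj (Fl (Cj (Fl x)))) (mk g) = inner (Fl x) (Fl (mk g))"
      using inner_Cj[of "Fl (Cj (Fl x))" "Cj (mk g)"] Fl_mult_formula[of "Cj (Fl x)" "mk g"] inner_Cj[of "Fl x" "Fl (mk g)"] by simp
    ultimately show ?thesis unfolding g_def[symmetric] by (simp add: inner_diff_left)
  qed
  then show ?thesis using l2_zero_intervals[of "Cj (Fl (Cj (Fl x))) - (2 * pi) *\<^sub>R x"] by simp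
qed

lemma inner_Fl: "inner (Fl x) (Fl y) = 2 * pi * inner x y"
  using Fl_mult_formula[of x "Cj (Fl y)"] by (simp add: Fl_adjoint)

lemma norm_Fl: "norm (Fl x) = sqrt (2 * pi) * norm x"
  unfolding norm_eq_sqrt_inner inner_Fl by (rule real_sqrt_mult)

lemma Fl_inject: "Fl x = Fl y \<longleftrightarrow> x = y"
  using norm_Fl[of "x - y"] by (auto simp: Fl_diff)

definition Fi :: "l2 \<Rightarrow> l2" where "Fi y = (1 / (2 * pi)) *\<^sub>R Cj (Fl (Cj y))"

lemma Fi_Fl [simp]: "Fi (Fl x) = x" unfolding Fi_def Fl_adjoint by simp

lemma Fl_Fi [simp]: "Fl (Fi y) = y"
proof -
  have "Fl (Cj (Fl (Cj y))) = Cj (Cj (Fl (Cj (Fl (Cj y)))))" by (simp only: Cj_Cj)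
  also have "\<dots> = Cj ((2 * pi) *\<^sub>R Cj y)" by (simp only: Fl_adjoint)
  also have "\<dots> = (2 * pi) *\<^sub>R y" by (simp only: linear_scale[OF bounded_linear.linear[OF bounded_linear_Cj]] Cj_Cj)
  finally show ?thesis unfolding Fi_def Fl_scaleR by simp
qed

section \<open>Leibniz rules and change of the Sobolev level\<close>

lemma Leibniz_Qs:
  assumes s: "s \<ge> 2" and D1: "isD y1 d1" and D2: "isD y2 d2"
  shows "isD (Qs s y1 y2) (Ps s y1 d2 + Ps s y2 d1 + Rs s y1 y2)"
proof -
  have s1: "s \<ge> 1" using s by simp
  note kQ = kbd_kQ[OF s1] and kP = kbd_kP[OF s1] and kR = kbd_kR[OF s]
  note i1 = Tf_integrable[OF kQ, of y1 y2] and i2 = Tf_integrable[OF kP, of y1 d2]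
    and i3 = Tf_integrable[OF kbd_swap[OF kP], of d1 y2] and i4 = Tf_integrable[OF kR, of y1 y2]
  have P2: "Ps s y2 d1 = Tk (\<lambda>\<xi> \<eta>. kP s \<xi> (\<xi> - \<eta>)) d1 y2"
    unfolding Ps_def by (rule Tk_swap[OF kP])
  show ?thesis
    unfolding isD_def
    using i1 i2 i3 i4 rep_Tk[OF kQ, of y1 y2, folded Qs_def] rep_Tk[OF kP, of y1 d2, folded Ps_def]
      rep_Tk[OF kbd_swap[OF kP], of d1 y2, folded P2] rep_Tk[OF kR, of y1 y2, folded Rs_def]
      rep_add[of "Ps s y1 d2" "Ps s y2 d1"] rep_add[of "Ps s y1 d2 + Ps s y2 d1" "Rs s y1 y2"]
  proof eventually_elim
    fix \<xi>
    assume i: "integrable lborel (\<lambda>\<eta>. kQ s \<xi> \<eta> * rep y1 \<eta> * rep y2 (\<xi> - \<eta>))"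
      "integrable lborel (\<lambda>\<eta>. kP s \<xi> \<eta> * rep y1 \<eta> * rep d2 (\<xi> - \<eta>))"
      "integrable lborel (\<lambda>\<eta>. kP s \<xi> (\<xi> - \<eta>) * rep d1 \<eta> * rep y2 (\<xi> - \<eta>))"
      "integrable lborel (\<lambda>\<eta>. kR s \<xi> \<eta> * rep y1 \<eta> * rep y2 (\<xi> - \<eta>))"
    assume e: "rep (Qs s y1 y2) \<xi> = Tf (kQ s) (rep y1) (rep y2) \<xi>"
      "rep (Ps s y1 d2) \<xi> = Tf (kP s) (rep y1) (rep d2) \<xi>"
      "rep (Ps s y2 d1) \<xi> = Tf (\<lambda>\<xi> \<eta>. kP s \<xi> (\<xi> - \<eta>)) (rep d1) (rep y2) \<xi>"
      "rep (Rs s y1 y2) \<xi> = Tf (kR s) (rep y1) (rep y2) \<xi>"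
      "rep (Ps s y1 d2 + Ps s y2 d1) \<xi> = rep (Ps s y1 d2) \<xi> + rep (Ps s y2 d1) \<xi>"
      "rep (Ps s y1 d2 + Ps s y2 d1 + Rs s y1 y2) \<xi> = rep (Ps s y1 d2 + Ps s y2 d1) \<xi> + rep (Rs s y1 y2) \<xi>"
    have "rep (Ps s y1 d2 + Ps s y2 d1 + Rs s y1 y2) \<xi> =
      (\<integral>\<eta>. (kP s \<xi> \<eta> * rep y1 \<eta> * rep d2 (\<xi> - \<eta>) + kP s \<xi> (\<xi> - \<eta>) * rep d1 \<eta> * rep y2 (\<xi> - \<eta>))
         + kR s \<xi> \<eta> * rep y1 \<eta> * rep y2 (\<xi> - \<eta>) \<partial>lborel)"
      unfolding e Tf_def using i by simp
    also have "\<dots> = (\<integral>\<eta>. \<i> * \<xi> * (kQ s \<xi> \<eta> * rep y1 \<eta> * rep y2 (\<xi> - \<eta>)) \<partial>lborel)"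
    proof (rule integral_cong_AE)
      note [measurable] = kbd_measurable1[OF kQ] kbd_measurable1[OF kP] kbd_measurable1[OF kbd_swap[OF kP]] kbd_measurable1[OF kR]
      show "(\<lambda>\<eta>. (kP s \<xi> \<eta> * rep y1 \<eta> * rep d2 (\<xi> - \<eta>) + kP s \<xi> (\<xi> - \<eta>) * rep d1 \<eta> * rep y2 (\<xi> - \<eta>))
         + kR s \<xi> \<eta> * rep y1 \<eta> * rep y2 (\<xi> - \<eta>)) \<in> borel_measurable lborel" by measurable
      show "(\<lambda>\<eta>. \<i> * \<xi> * (kQ s \<xi> \<eta> * rep y1 \<eta> * rep y2 (\<xi> - \<eta>))) \<in> borel_measurable lborel" by measurable
      show "AE \<eta> in lborel. (kP s \<xi> \<eta> * rep y1 \<eta> * rep d2 (\<xi> - \<eta>) + kP s \<xi> (\<xi> - \<eta>) * rep d1 \<eta> * rep y2 (\<xi> - \<eta>))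
         + kR s \<xi> \<eta> * rep y1 \<eta> * rep y2 (\<xi> - \<eta>) = \<i> * \<xi> * (kQ s \<xi> \<eta> * rep y1 \<eta> * rep y2 (\<xi> - \<eta>))"
        using D1[unfolded isD_def] AE_reflect[OF D2[unfolded isD_def], of \<xi>]
      proof eventually_elim
        fix \<eta> assume d: "rep d1 \<eta> = \<i> * \<eta> * rep y1 \<eta>" "rep d2 (\<xi> - \<eta>) = \<i> * (\<xi> - \<eta>) * rep y2 (\<xi> - \<eta>)"
        have w: "cjp s \<eta> * cjp (-s) \<eta> = 1" "cjp s (\<xi> - \<eta>) * cjp (-s) (\<xi> - \<eta>) = 1"
          by (rule cjp_inv)+
        \<comment> \<open>The last two terms vanish by \<open>w\<close>; written out, they make this
          a polynomial identity in the weights.\<close>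
        have "(cjp (-s) \<eta>) * (\<xi> - \<eta>) + cjp (-s) (\<xi> - \<eta>) * \<eta> + (\<xi> * cjp s \<xi> - \<eta> * cjp s \<eta> - (\<xi> - \<eta>) * cjp s (\<xi> - \<eta>)) * cjp (-s) \<eta> * cjp (-s) (\<xi> - \<eta>)
          = \<xi> * (cjp s \<xi> * cjp (-s) \<eta> * cjp (-s) (\<xi> - \<eta>))
            + cjp (-s) (\<xi> - \<eta>) * \<eta> * (1 - cjp s \<eta> * cjp (-s) \<eta>) + cjp (-s) \<eta> * (\<xi> - \<eta>) * (1 - cjp s (\<xi> - \<eta>) * cjp (-s) (\<xi> - \<eta>))"
          by (simp add: algebra_simps)
        then have k: "(cjp (-s) \<eta>) * (\<xi> - \<eta>) + cjp (-s) (\<xi> - \<eta>) * \<eta> + (\<xi> * cjp s \<xi> - \<eta> * cjp s \<eta> - (\<xi> - \<eta>) * cjp s (\<xi> - \<eta>)) * cjp (-s) \<eta> * cjp (-s) (\<xi> - \<eta>)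
          = \<xi> * (cjp s \<xi> * cjp (-s) \<eta> * cjp (-s) (\<xi> - \<eta>))"
          unfolding w by simp
        have "(kP s \<xi> \<eta> * rep y1 \<eta> * rep d2 (\<xi> - \<eta>) + kP s \<xi> (\<xi> - \<eta>) * rep d1 \<eta> * rep y2 (\<xi> - \<eta>))
         + kR s \<xi> \<eta> * rep y1 \<eta> * rep y2 (\<xi> - \<eta>)
         = \<i> * ((cjp (-s) \<eta>) * (\<xi> - \<eta>) + cjp (-s) (\<xi> - \<eta>) * \<eta> + (\<xi> * cjp s \<xi> - \<eta> * cjp s \<eta> - (\<xi> - \<eta>) * cjp s (\<xi> - \<eta>)) * cjp (-s) \<eta> * cjp (-s) (\<xi> - \<eta>))
            / of_real (2 * pi) * rep y1 \<eta> * rep y2 (\<xi> - \<eta>)"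
          unfolding d kP_def kR_def by (simp add: add_divide_distrib diff_divide_distrib algebra_simps)
        also have "\<dots> = \<i> * \<xi> * (kQ s \<xi> \<eta> * rep y1 \<eta> * rep y2 (\<xi> - \<eta>))"
          unfolding k kQ_def by simp
        finally show "(kP s \<xi> \<eta> * rep y1 \<eta> * rep d2 (\<xi> - \<eta>) + kP s \<xi> (\<xi> - \<eta>) * rep d1 \<eta> * rep y2 (\<xi> - \<eta>))
         + kR s \<xi> \<eta> * rep y1 \<eta> * rep y2 (\<xi> - \<eta>) = \<i> * \<xi> * (kQ s \<xi> \<eta> * rep y1 \<eta> * rep y2 (\<xi> - \<eta>))" .
      qed
    qed
    also have "\<dots> = \<i> * \<xi> * rep (Qs s y1 y2) \<xi>"
      unfolding e Tf_def by (rule integral_mult_right_zero)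
    finally show "rep (Ps s y1 d2 + Ps s y2 d1 + Rs s y1 y2) \<xi> = \<i> * \<xi> * rep (Qs s y1 y2) \<xi>" .
  qed
qed

text \<open>There is no remainder: \<open>kP\<close> carries no weight in the output frequency, so
  \<xi> = \<eta> + (\<xi> - \<eta>) splits the derivative exactly.\<close>

lemma Leibniz_Ps:
  assumes s: "s \<ge> 1" and D1: "isD b db" and D2: "isD h dh"
  shows "isD (Ps s b h) (Ps s b dh + Ps s db h)"
proof -
  note kP = kbd_kP[OF s]
  show ?thesis
    unfolding isD_def
    using Tf_integrable[OF kP, of b dh] Tf_integrable[OF kP, of db h]
      rep_Tk[OF kP, of b dh, folded Ps_def] rep_Tk[OF kP, of db h, folded Ps_def] rep_Tk[OF kP, of b h, folded Ps_def]
      rep_add[of "Ps s b dh" "Ps s db h"]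
  proof eventually_elim
    fix \<xi>
    assume i: "integrable lborel (\<lambda>\<eta>. kP s \<xi> \<eta> * rep b \<eta> * rep dh (\<xi> - \<eta>))"
      "integrable lborel (\<lambda>\<eta>. kP s \<xi> \<eta> * rep db \<eta> * rep h (\<xi> - \<eta>))"
    assume e: "rep (Ps s b dh) \<xi> = Tf (kP s) (rep b) (rep dh) \<xi>"
      "rep (Ps s db h) \<xi> = Tf (kP s) (rep db) (rep h) \<xi>"
      "rep (Ps s b h) \<xi> = Tf (kP s) (rep b) (rep h) \<xi>"
      "rep (Ps s b dh + Ps s db h) \<xi> = rep (Ps s b dh) \<xi> + rep (Ps s db h) \<xi>"
    have "rep (Ps s b dh + Ps s db h) \<xi> =
      (\<integral>\<eta>. kP s \<xi> \<eta> * rep b \<eta> * rep dh (\<xi> - \<eta>) + kP s \<xi> \<eta> * rep db \<eta> * rep h (\<xi> - \<eta>) \<partial>lborel)"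
      unfolding e Tf_def using i by simp
    also have "\<dots> = (\<integral>\<eta>. \<i> * \<xi> * (kP s \<xi> \<eta> * rep b \<eta> * rep h (\<xi> - \<eta>)) \<partial>lborel)"
    proof (rule integral_cong_AE)
      note [measurable] = kbd_measurable1[OF kP]
      show "(\<lambda>\<eta>. kP s \<xi> \<eta> * rep b \<eta> * rep dh (\<xi> - \<eta>) + kP s \<xi> \<eta> * rep db \<eta> * rep h (\<xi> - \<eta>)) \<in> borel_measurable lborel"
        by measurable
      show "(\<lambda>\<eta>. \<i> * \<xi> * (kP s \<xi> \<eta> * rep b \<eta> * rep h (\<xi> - \<eta>))) \<in> borel_measurable lborel" by measurable
      show "AE \<eta> in lborel. kP s \<xi> \<eta> * rep b \<eta> * rep dh (\<xi> - \<eta>) + kP s \<xi> \<eta> * rep db \<eta> * rep h (\<xi> - \<eta>)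
         = \<i> * \<xi> * (kP s \<xi> \<eta> * rep b \<eta> * rep h (\<xi> - \<eta>))"
        using D1[unfolded isD_def] AE_reflect[OF D2[unfolded isD_def], of \<xi>]
      proof eventually_elim
        fix \<eta> assume d: "rep db \<eta> = \<i> * \<eta> * rep b \<eta>" "rep dh (\<xi> - \<eta>) = \<i> * (\<xi> - \<eta>) * rep h (\<xi> - \<eta>)"
        show "kP s \<xi> \<eta> * rep b \<eta> * rep dh (\<xi> - \<eta>) + kP s \<xi> \<eta> * rep db \<eta> * rep h (\<xi> - \<eta>)
         = \<i> * \<xi> * (kP s \<xi> \<eta> * rep b \<eta> * rep h (\<xi> - \<eta>))"
          unfolding d by (simp add: algebra_simps)
      qed
    qed
    also have "\<dots> = \<i> * \<xi> * rep (Ps s b h) \<xi>"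
      unfolding e Tf_def by (rule integral_mult_right_zero)
    finally show "rep (Ps s b dh + Ps s db h) \<xi> = \<i> * \<xi> * rep (Ps s b h) \<xi>" .
  qed
qed

text \<open>Multiplication by \<open>cjp (t - s)\<close> turns coordinates at level \<open>s\<close>
  into coordinates at level \<open>t\<close>, and the underlying product of functions does not
  depend on the level.\<close>

lemma Qs_low:
  assumes "1 \<le> t" "t \<le> s"
  shows "mulS (cjp (t - s)) (Qs s a b) = Qs t (mulS (cjp (t - s)) a) (mulS (cjp (t - s)) b)"
proof -
  have s: "s \<ge> 1" using assms by simp
  have bs: "bsym (cjp (t - s))" using assms by (intro bsym_cjp) simp
  have c: "cjp s \<xi> * cjp t \<xi> = cjp (s + t) \<xi>" for s t \<xi> by (simp add: jp_add flip: of_real_mult)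
  have e: "cjp (t - s) \<xi> * kQ s \<xi> \<eta> = kQ t \<xi> \<eta> * cjp (t - s) (\<xi> - \<eta>) * cjp (t - s) \<eta>" for \<xi> \<eta>
  proof -
    have "cjp (t - s) \<xi> * kQ s \<xi> \<eta> = (cjp (t - s) \<xi> * cjp s \<xi>) * cjp (-s) \<eta> * cjp (-s) (\<xi> - \<eta>) / of_real (2 * pi)"
      by (simp add: kQ_def)
    moreover have "kQ t \<xi> \<eta> * cjp (t - s) (\<xi> - \<eta>) * cjp (t - s) \<eta> =
       cjp t \<xi> * (cjp (-t) \<eta> * cjp (t - s) \<eta>) * (cjp (-t) (\<xi> - \<eta>) * cjp (t - s) (\<xi> - \<eta>)) / of_real (2 * pi)"
      by (simp add: kQ_def mult_ac)
    ultimately show ?thesis unfolding c by simp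
  qed
  have kb: "kbd (\<lambda>\<xi> \<eta>. kQ t \<xi> \<eta> * cjp (t - s) (\<xi> - \<eta>)) (2 powr t)"
  proof -
    have "cmod (kQ t \<xi> \<eta> * cjp (t - s) (\<xi> - \<eta>)) \<le> 2 powr t * (jp (-1) \<eta> + jp (-1) (\<xi> - \<eta>))" for \<xi> \<eta>
    proof -
      have "cmod (kQ t \<xi> \<eta> * cjp (t - s) (\<xi> - \<eta>)) \<le> cmod (kQ t \<xi> \<eta>) * 1"
        unfolding norm_mult using assms by (intro mult_left_mono) (auto intro: jp_le1)
      also have "\<dots> \<le> 2 powr t * (jp (-1) \<eta> + jp (-1) (\<xi> - \<eta>))"
        using kbd_kQ[OF assms(1)] by (simp add: kbd_def)
      finally show ?thesis .
    qed
    then show ?thesis unfolding kbd_def kQ_def by simp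
  qed
  show ?thesis
    unfolding Qs_def
    by (subst mulS_Tk[OF bs kbd_kQ[OF s]], subst Tk_mulS_right[OF bs kbd_kQ[OF assms(1)]],
        subst Tk_mulS_left[OF bs kb]) (simp add: e)
qed

lemma Ps_low:
  assumes "1 \<le> t" "t \<le> s"
  shows "Ps s a c = Ps t (mulS (cjp (t - s)) a) c"
proof -
  have bs: "bsym (cjp (t - s))" using assms by (intro bsym_cjp) simp
  have e: "kP s \<xi> \<eta> = kP t \<xi> \<eta> * cjp (t - s) \<eta>" for \<xi> \<eta>
    by (simp add: kP_def jp_add flip: of_real_mult)
  show ?thesis
    unfolding Ps_def by (subst Tk_mulS_left[OF bs kbd_kP[OF assms(1)]]) (simp add: e[symmetric])
qed

subsection \<open>Hermitian symmetry\<close>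

text \<open>Complex conjugation seen from the Fourier side; its fixed points, the
  \<open>herm\<close> elements, are the coordinates of real functions.\<close>

definition Sop :: "l2 \<Rightarrow> l2" where "Sop x = mk (\<lambda>\<xi>. cnj (rep x (- \<xi>)))"

definition herm :: "l2 \<Rightarrow> bool" where "herm x \<longleftrightarrow> Sop x = x"

lemma sq_integrable_reflect:
  fixes f :: "real \<Rightarrow> complex"
  assumes "sq_integrable f" shows "sq_integrable (\<lambda>\<xi>. cnj (f (- \<xi>)))"
proof -
  note [measurable] = sq_integrable_measurable[OF assms]
  show ?thesis
    using assms integrable_reflect[of "\<lambda>\<xi>. (cmod (f \<xi>))\<^sup>2" 0] unfolding sq_integrable_def by simp
qed

lemma rep_Sop: "AE \<xi> in lborel. rep (Sop x) \<xi> = cnj (rep x (- \<xi>))"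
  unfolding Sop_def by (rule rep_mk) (auto intro: sq_integrable_reflect)

lemma herm_AE: "herm x \<longleftrightarrow> (AE \<xi> in lborel. rep x (- \<xi>) = cnj (rep x \<xi>))"
proof
  assume "herm x"
  then have "Sop x = x" by (simp add: herm_def)
  then have "AE \<xi> in lborel. rep x \<xi> = cnj (rep x (- \<xi>))" using rep_Sop[of x] by simp
  then show "AE \<xi> in lborel. rep x (- \<xi>) = cnj (rep x \<xi>)" by eventually_elim simp
next
  assume a: "AE \<xi> in lborel. rep x (- \<xi>) = cnj (rep x \<xi>)"
  show "herm x" unfolding herm_def
    by (rule l2_eqI) (use a rep_Sop[of x] in eventually_elim, simp)
qed

lemma Sop_Sop [simp]: "Sop (Sop x) = x"
proof (rule l2_eqI)
  show "AE t in lborel. rep (Sop (Sop x)) t = rep x t"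
    using rep_Sop[of "Sop x"] AE_reflect[OF rep_Sop[of x], of 0] by eventually_elim simp
qed

lemma norm_Sop [simp]: "norm (Sop x) = norm x"
proof -
  have "(norm (Sop x))\<^sup>2 = (\<integral>t. (cmod (rep x (- t)))\<^sup>2 \<partial>lborel)"
    unfolding Sop_def by (subst norm_mk_sq) (auto intro: sq_integrable_reflect)
  also have "\<dots> = (norm x)\<^sup>2"
    using integral_reflect[of "\<lambda>t. (cmod (rep x t))\<^sup>2" 0] by (simp add: norm_l2_sq)
  finally show ?thesis by (simp add: power2_eq_iff_nonneg)
qed

lemma Sop_add: "Sop (x + y) = Sop x + Sop y"
proof (rule l2_eqI)
  show "AE t in lborel. rep (Sop (x + y)) t = rep (Sop x + Sop y) t"
    using rep_Sop[of "x + y"] rep_Sop[of x] rep_Sop[of y] rep_add[of "Sop x" "Sop y"] AE_reflect[OF rep_add[of x y], of 0]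
    by eventually_elim simp
qed

lemma Sop_scaleR: "Sop (r *\<^sub>R x) = r *\<^sub>R Sop x"
proof (rule l2_eqI)
  show "AE t in lborel. rep (Sop (r *\<^sub>R x)) t = rep (r *\<^sub>R Sop x) t"
    using rep_Sop[of "r *\<^sub>R x"] rep_Sop[of x] rep_scaleR[of r "Sop x"] AE_reflect[OF rep_scaleR[of r x], of 0]
    by eventually_elim simp
qed

lemma bounded_linear_Sop: "bounded_linear Sop"
  by (rule bounded_linear_intro[where K=1]) (auto simp: Sop_add Sop_scaleR)

lemma Sop_mulS:
  assumes s: "bsym \<sigma>" and h: "\<And>\<xi>. \<sigma> (- \<xi>) = cnj (\<sigma> \<xi>)"
  shows "Sop (mulS \<sigma> x) = mulS \<sigma> (Sop x)"
proof (rule l2_eqI)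
  show "AE t in lborel. rep (Sop (mulS \<sigma> x)) t = rep (mulS \<sigma> (Sop x)) t"
    using rep_Sop[of "mulS \<sigma> x"] rep_Sop[of x] rep_mulS[OF s, of "Sop x"] AE_reflect[OF rep_mulS[OF s, of x], of 0]
    by eventually_elim (simp add: h)
qed

lemma Sop_Tk:
  assumes k: "kbd \<kappa> C" and h: "\<And>\<xi> \<eta>. \<kappa> (- \<xi>) (- \<eta>) = cnj (\<kappa> \<xi> \<eta>)"
  shows "Sop (Tk \<kappa> x y) = Tk \<kappa> (Sop x) (Sop y)"
proof (rule l2_eqI)
  have e: "Tf \<kappa> (rep (Sop x)) (rep (Sop y)) \<xi> = cnj (Tf \<kappa> (rep x) (rep y) (- \<xi>))" for \<xi>
  proof -
    have "Tf \<kappa> (rep (Sop x)) (rep (Sop y)) \<xi> = Tf \<kappa> (\<lambda>\<xi>. cnj (rep x (- \<xi>))) (\<lambda>\<xi>. cnj (rep y (- \<xi>))) \<xi>"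
      by (rule Tf_cong[OF k]) (auto intro: rep_Sop sq_integrable_reflect)
    also have "\<dots> = (\<integral>\<eta>. cnj (\<kappa> (-\<xi>) (-\<eta>) * rep x (-\<eta>) * rep y (- \<xi> - (-\<eta>))) \<partial>lborel)"
      unfolding Tf_def h by simp
    also have "\<dots> = cnj (\<integral>\<eta>. \<kappa> (-\<xi>) (-\<eta>) * rep x (-\<eta>) * rep y (- \<xi> - (-\<eta>)) \<partial>lborel)"
      by (rule Bochner_Integration.integral_cnj)
    also have "\<dots> = cnj (Tf \<kappa> (rep x) (rep y) (- \<xi>))"
      unfolding Tf_def using integral_reflect[of "\<lambda>\<eta>. \<kappa> (-\<xi>) \<eta> * rep x \<eta> * rep y (- \<xi> - \<eta>)" 0] by simp
    finally show ?thesis .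
  qed
  show "AE t in lborel. rep (Sop (Tk \<kappa> x y)) t = rep (Tk \<kappa> (Sop x) (Sop y)) t"
    using rep_Sop[of "Tk \<kappa> x y"] AE_reflect[OF rep_Tk[OF k, of x y], of 0] rep_Tk[OF k, of "Sop x" "Sop y"]
    by eventually_elim (simp add: e)
qed

lemma kQ_reflect: "kQ s (- \<xi>) (- \<eta>) = cnj (kQ s \<xi> \<eta>)"
  using jp_minus[of "-s" "\<xi> - \<eta>"] by (simp add: kQ_def)

lemma Sop_Qs: "s \<ge> 1 \<Longrightarrow> Sop (Qs s x y) = Qs s (Sop x) (Sop y)"
  unfolding Qs_def by (rule Sop_Tk[OF kbd_kQ kQ_reflect])

section \<open>The Fourier transform of translates, convolutions and products\<close>

lemma l2_operator_eq:
  assumes A: "bounded_linear A" and B: "bounded_linear B"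
    and e: "\<And>f. integrable lborel f \<Longrightarrow> sq_integrable f \<Longrightarrow> A (mk f) = B (mk f)"
  shows "A x = (B x :: l2)"
proof -
  obtain f where f: "\<And>n. integrable lborel (f n)" "\<And>n. sq_integrable (f n)" "(\<lambda>n. mk (f n)) \<longlonglongrightarrow> x" using l2_approx[of x] by blast
  show ?thesis
    using LIMSEQ_unique[OF bounded_linear.tendsto[OF A f(3)] bounded_linear.tendsto[OF B f(3), folded e[OF f(1,2)]]] .
qed

lemma bsym_const: "bsym (\<lambda>_. c)" by (rule bsymI[of _ "cmod c"]) auto

lemma Fl_const: "Fl (mulS (\<lambda>_. c) x) = mulS (\<lambda>_. c) (Fl x)"
proof (rule l2_operator_eq[of "\<lambda>x. Fl (mulS (\<lambda>_. c) x)"])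
  fix f :: "real \<Rightarrow> complex" assume f: "integrable lborel f" "sq_integrable f"
  have "hat (\<lambda>t. c * f t) \<xi> = c * hat f \<xi>" for \<xi> by (simp add: hat_def mult.assoc)
  then have "hat (\<lambda>t. c * f t) = (\<lambda>\<xi>. c * hat f \<xi>)" by blast
  then show "Fl (mulS (\<lambda>_. c) (mk f)) = mulS (\<lambda>_. c) (Fl (mk f))"
    using f by (simp add: mulS_mk bsym_const Fl_mk sq_integrable_cmult hat_sq)
qed (intro bounded_linear_compose[OF bounded_linear_Fl] bounded_linear_compose[OF bounded_linear_mulS] bounded_linear_mulS bounded_linear_Fl bsym_const)+

lemma Fl_Cj: "Fl (Cj x) = Sop (Fl x)"
proof (rule l2_operator_eq[of "\<lambda>x. Fl (Cj x)"])
  fix f :: "real \<Rightarrow> complex" assume f: "integrable lborel f" "sq_integrable f"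
  have "hat (\<lambda>t. cnj (f t)) \<xi> = cnj (hat f (- \<xi>))" for \<xi> unfolding cnj_hat by (simp add: hat_def)
  then have h: "hat (\<lambda>t. cnj (f t)) = (\<lambda>\<xi>. cnj (hat f (- \<xi>)))" by blast
  have "Sop (mk (hat f)) = mk (\<lambda>\<xi>. cnj (hat f (- \<xi>)))"
    unfolding Sop_def using rep_mk[OF hat_sq(1)[OF f]]
    by (intro mk_eqI) (use f AE_reflect[OF rep_mk[OF hat_sq(1)[OF f]], of 0] in \<open>auto intro!: sq_integrable_reflect hat_sq\<close>)
  then show "Fl (Cj (mk f)) = Sop (Fl (mk f))"
    using f by (simp add: Cj_mk Fl_mk sq_integrable_cnj h)
qed (intro bounded_linear_compose[OF bounded_linear_Fl] bounded_linear_compose[OF bounded_linear_Sop] bounded_linear_Cj bounded_linear_Fl)+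

text \<open>\<open>inner_Fl\<close> is the real part; the imaginary part follows by replacing
  \<open>y\<close> by \<open>\<i>\<close> times \<open>y\<close>, with which the transform
  commutes.\<close>

lemma parseval_complex: "(LINT \<xi>|lborel. rep (Fl x) \<xi> * cnj (rep (Fl y) \<xi>)) = 2 * pi * (LINT t|lborel. rep x t * cnj (rep y t))"
proof -
  have R: "Re (LINT \<xi>|lborel. rep (Fl x) \<xi> * cnj (rep (Fl y) \<xi>)) = 2 * pi * Re (LINT t|lborel. rep x t * cnj (rep y t))" for y
    using inner_Fl[of x y] inner_mk_complex[OF sq_rep sq_rep, of "Fl x" "Fl y"] inner_mk_complex[OF sq_rep sq_rep, of x y] by simp
  have I: "(LINT t|lborel. rep x t * cnj (rep (mulS (\<lambda>_. \<i>) y) t)) = - \<i> * (LINT t|lborel. rep x t * cnj (rep y t))" for x y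
  proof -
    have "(LINT t|lborel. rep x t * cnj (rep (mulS (\<lambda>_. \<i>) y) t)) = (LINT t|lborel. - \<i> * (rep x t * cnj (rep y t)))"
      by (rule integral_cong_AE, measurable) (use rep_mulS[OF bsym_const[of \<i>], of y] in eventually_elim, simp)
    then show ?thesis by simp
  qed
  show ?thesis using R[of y] R[of "mulS (\<lambda>_. \<i>) y"] unfolding Fl_const I by (simp add: complex_eq_iff)
qed

lemma parseval_mk:
  assumes "sq_integrable f" "sq_integrable g" "sq_integrable f'" "sq_integrable g'" "Fl (mk f) = mk f'" "Fl (mk g) = mk g'"
  shows "(LINT \<xi>|lborel. f' \<xi> * cnj (g' \<xi>)) = 2 * pi * (LINT t|lborel. f t * cnj (g t))"
proof -
  have e: "(LINT t|lborel. rep (mk f) t * cnj (rep (mk g) t)) = (LINT t|lborel. f t * cnj (g t))"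
    if [measurable]: "sq_integrable f" "sq_integrable g" for f g
    by (rule integral_cong_AE, measurable) (use rep_mk[OF that(1)] rep_mk[OF that(2)] in eventually_elim, simp)
  show ?thesis using parseval_complex[of "mk f" "mk g"] unfolding assms(5,6) by (simp add: e assms)
qed

lemma bsym_ek: "bsym (\<lambda>\<xi>. ek (\<xi> * y))" by (rule bsymI[of _ 1]) auto

lemma hat_translate: "hat (\<lambda>t. f (t - y)) \<xi> = ek (\<xi> * y) * hat f \<xi>"
proof -
  have "hat (\<lambda>t. f (t - y)) \<xi> = (LINT t|lborel. ek (\<xi> * y) * (f (t - y) * ek (\<xi> * (t - y))))"
    unfolding hat_def by (intro Bochner_Integration.integral_cong refl) (simp add: mult.left_commute flip: ek_add, simp add: algebra_simps)
  also have "\<dots> = ek (\<xi> * y) * (LINT t|lborel. f (t - y) * ek (\<xi> * (t - y)))" by (rule integral_mult_right_zero)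
  also have "(LINT t|lborel. f (t - y) * ek (\<xi> * (t - y))) = hat f \<xi>"
    unfolding hat_def by (rule integral_shift)
  finally show ?thesis .
qed

lemma Fl_translate:
  assumes f: "sq_integrable f"
  shows "Fl (mk (\<lambda>t. f (t - y))) = mulS (\<lambda>\<xi>. ek (\<xi> * y)) (Fl (mk f))"
proof -
  define \<tau> where "\<tau> x = mk (\<lambda>t. rep x (t - y))" for x
  have rt: "AE t in lborel. rep (\<tau> x) t = rep x (t - y)" for x
    unfolding \<tau>_def by (rule rep_mk) (simp add: sq_integrable_translate)
  have \<tau>mk: "\<tau> (mk f) = mk (\<lambda>t. f (t - y))" if "sq_integrable f" for f
    unfolding \<tau>_def by (rule mk_eqI) (use that AE_shift[OF rep_mk[OF that], of y] in \<open>auto intro: sq_integrable_translate\<close>)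
  have bl: "bounded_linear \<tau>"
  proof (rule bounded_linear_intro)
    show "\<tau> (x + z) = \<tau> x + \<tau> z" for x z
      by (rule l2_eqI) (use rt[of x] rt[of z] rt[of "x + z"] AE_shift[OF rep_add[of x z], of y] rep_add[of "\<tau> x" "\<tau> z"] in eventually_elim, simp)
    show "\<tau> (r *\<^sub>R x) = r *\<^sub>R \<tau> x" for r x
      by (rule l2_eqI) (use rt[of x] rt[of "r *\<^sub>R x"] AE_shift[OF rep_scaleR[of r x], of y] rep_scaleR[of r "\<tau> x"] in eventually_elim, simp)
    show "norm (\<tau> x) \<le> norm x * 1" for x unfolding \<tau>_def by (simp add: sq_integrable_translate)
  qed
  have "Fl (\<tau> x) = mulS (\<lambda>\<xi>. ek (\<xi> * y)) (Fl x)" for x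
  proof (rule l2_operator_eq[of "\<lambda>x. Fl (\<tau> x)"])
    fix f :: "real \<Rightarrow> complex" assume f: "integrable lborel f" "sq_integrable f"
    have i: "integrable lborel (\<lambda>t. f (t - y))" using lborel_integrable_real_affine_iff[of 1 f "-y"] f by simp
    have "hat (\<lambda>t. f (t - y)) = (\<lambda>\<xi>. ek (\<xi> * y) * hat f \<xi>)" using hat_translate by blast
    then show "Fl (\<tau> (mk f)) = mulS (\<lambda>\<xi>. ek (\<xi> * y)) (Fl (mk f))"
      using f by (simp add: \<tau>mk Fl_mk i sq_integrable_translate mulS_mk bsym_ek hat_sq)
  qed (intro bounded_linear_compose[OF bounded_linear_Fl] bounded_linear_compose[OF bounded_linear_mulS] bl bounded_linear_Fl bsym_ek)+
  then show ?thesis using \<tau>mk[OF f] by metis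
qed

text \<open>Proved weakly: paired with \<open>w\<close>, Parseval and Fubini reduce the convolution
  to translates under the integral over \<open>M\<close>, and the transform of a translate is a
  modulation.\<close>

lemma Fl_cv:
  assumes M: "sigma_finite_measure M" and sM: "sets M = sets borel" and a: "integrable M a" and f: "sq_integrable f"
  defines "A \<equiv> \<lambda>\<xi>. LINT y|M. a y * ek (\<xi> * y)"
  shows "bsym A" and "Fl (mk (cv M a f)) = mulS A (Fl (mk f))"
proof -
  interpret M: sigma_finite_measure M by (rule M)
  note [measurable_cong] = sM
  note [measurable] = borel_measurable_integrable[OF a] sq_integrable_measurable[OF f]
  show bA: "bsym A"
  proof (rule bsymI)
    show "A \<in> borel_measurable borel" unfolding A_def by measurable
    show "cmod (A \<xi>) \<le> (LINT y|M. cmod (a y))" for \<xi>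
      using integral_norm_bound[of M "\<lambda>y. a y * ek (\<xi> * y)"] by (simp add: A_def norm_mult)
  qed
  define c where "c = cv M a f"
  have c: "sq_integrable c" unfolding c_def by (rule cv_sq[OF M sM a f])
  define F where "F = rep (Fl (mk f))"
  have F: "sq_integrable F" "mk F = Fl (mk f)" by (simp_all add: F_def)
  have "inner (Fl (mk c)) w = inner (mulS A (Fl (mk f))) w" for w
  proof -
    define z where "z = rep (Fi w)"
    have z: "sq_integrable z" "mk z = Fi w" by (simp_all add: z_def)
    have i: "integrable lborel (\<lambda>\<xi>. F \<xi> * cnj (rep w \<xi>))" by (intro sq_integrable_integrable_mult F sq_integrable_cnj sq_rep)
    have "(LINT \<xi>|lborel. rep (Fl (mk c)) \<xi> * cnj (rep w \<xi>)) = 2 * pi * (LINT t|lborel. c t * cnj (z t))"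
      by (rule parseval_mk[OF c z(1)]) (simp_all add: z)
    also have "(LINT t|lborel. c t * cnj (z t)) = (LINT y|M. a y * (LINT x|lborel. f (x - y) * cnj (z x)))"
      unfolding c_def by (rule cv_fubini[OF M sM a f sq_integrable_cnj[OF z(1)]])
    also have "of_real (2 * pi) * \<dots> = (LINT y|M. a y * (2 * pi * (LINT x|lborel. f (x - y) * cnj (z x))))"
      by (simp add: mult.left_commute flip: integral_mult_right_zero)
    also have "\<dots> = (LINT y|M. a y * (LINT \<xi>|lborel. (F \<xi> * cnj (rep w \<xi>)) * ek (\<xi> * y)))"
    proof (intro Bochner_Integration.integral_cong refl arg_cong2[of _ _ _ _ "(*)"])
      fix y
      have "(LINT \<xi>|lborel. (ek (\<xi> * y) * F \<xi>) * cnj (rep w \<xi>)) = 2 * pi * (LINT x|lborel. f (x - y) * cnj (z x))"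
        by (rule parseval_mk[OF sq_integrable_translate(1)[OF f] z(1) bsym_sq[OF bsym_ek F(1)] sq_rep])
          (simp_all add: Fl_translate[OF f] mulS_def F_def z)
      then show "of_real (2 * pi) * (LINT x|lborel. f (x - y) * cnj (z x)) = (LINT \<xi>|lborel. (F \<xi> * cnj (rep w \<xi>)) * ek (\<xi> * y))"
        by (simp add: mult_ac)
    qed
    also have "\<dots> = (LINT \<xi>|lborel. (F \<xi> * cnj (rep w \<xi>)) * A \<xi>)"
      unfolding A_def by (rule fubini_kernel[OF M lborel.sigma_finite_measure_axioms a i, of _ 1]) (auto simp: split_beta')
    finally have "(LINT \<xi>|lborel. rep (Fl (mk c)) \<xi> * cnj (rep w \<xi>)) = (LINT \<xi>|lborel. (A \<xi> * F \<xi>) * cnj (rep w \<xi>))"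
      by (simp add: mult_ac)
    then show ?thesis
      using inner_mk_complex[OF sq_rep sq_rep, of "Fl (mk c)" w] inner_mk_complex[OF bsym_sq[OF bA F(1)] sq_rep[of w]]
      by (simp add: mulS_def F_def)
  qed
  then have "inner (Fl (mk c) - mulS A (Fl (mk f))) (Fl (mk c) - mulS A (Fl (mk f))) = 0" by (simp add: inner_diff_left)
  then show "Fl (mk (cv M a f)) = mulS A (Fl (mk f))" by (simp add: c_def)
qed


text \<open>Conjugation exchanges the inverse transform with the transform, so this is
  \<open>Fl_cv\<close> applied to conjugates.\<close>

lemma Fi_cv:
  assumes a: "integrable lborel a" "sq_integrable a" and f: "sq_integrable f"
  defines "A \<equiv> \<lambda>x. cnj (hat (\<lambda>\<eta>. cnj (a \<eta>)) x)"
  shows "bsym A" and "Fi (mk (cv lborel a f)) = mulS A (Fi (mk f))" and "mk A = (2 * pi) *\<^sub>R Fi (mk a)"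
proof -
  note lb = lborel.sigma_finite_measure_axioms
  have ca: "integrable lborel (\<lambda>\<eta>. cnj (a \<eta>))" "sq_integrable (\<lambda>\<eta>. cnj (a \<eta>))" and cf: "sq_integrable (\<lambda>\<eta>. cnj (f \<eta>))"
    using a f by (auto intro: sq_integrable_cnj)
  have N: "sq_integrable (cv lborel a f)" by (rule cv_sq[OF lb _ a(1) f]) simp
  define H where "H = hat (\<lambda>\<eta>. cnj (a \<eta>))"
  have H: "bsym H" and FH: "Fl (mk (cv lborel (\<lambda>\<eta>. cnj (a \<eta>)) (\<lambda>\<eta>. cnj (f \<eta>)))) = mulS H (Fl (mk (\<lambda>\<eta>. cnj (f \<eta>))))"
    using Fl_cv[OF lb _ ca(1) cf] by (simp_all add: H_def hat_def[abs_def])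
  show A: "bsym A" using H by (auto simp: bsym_def A_def H_def[symmetric])
  have CN: "Cj (mk (cv lborel a f)) = mk (cv lborel (\<lambda>\<eta>. cnj (a \<eta>)) (\<lambda>\<eta>. cnj (f \<eta>)))"
    unfolding Cj_mk[OF N] by (rule arg_cong[of _ _ mk], rule ext) (simp add: cv_def flip: Bochner_Integration.integral_cnj)
  have G: "Cj (mulS H v) = mulS A (Cj v)" for v
    by (rule l2_eqI) (use rep_Cj[of "mulS H v"] rep_mulS[OF H, of v] rep_mulS[OF A, of "Cj v"] rep_Cj[of v] in eventually_elim, simp add: A_def H_def)
  show "Fi (mk (cv lborel a f)) = mulS A (Fi (mk f))"
    unfolding Fi_def CN FH G Cj_mk[OF f] mulS_scaleR[OF A] ..
  show "mk A = (2 * pi) *\<^sub>R Fi (mk a)"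
    unfolding Fi_def Cj_mk[OF a(2)] Fl_mk[OF ca] Cj_mk[OF hat_sq(1)[OF ca]] by (simp add: A_def)
qed

text \<open>On the physical side \<open>Ps s b\<close> is multiplication by the bounded function \<open>phi s b\<close>.\<close>

definition phi :: "real \<Rightarrow> l2 \<Rightarrow> real \<Rightarrow> complex" where
  "phi s b x = of_real (1 / (2 * pi)) * cnj (hat (\<lambda>\<eta>. cnj (cjp (- s) \<eta> * rep b \<eta>)) x)"

text \<open>The weighted coefficients \<open>cjp (- s) \<eta> * rep b \<eta>\<close> are a product
  of two square-integrable functions, hence integrable. So the function they represent is bounded,
  as in the Sobolev embedding, and convolution with them is multiplication by it.\<close>

lemma phi:
  assumes s: "s \<ge> 1"
  shows "bsym (phi s b)" and "sq_integrable (phi s b)" and "mk (phi s b) = Fi (mulS (cjp (- s)) b)" and "Fi (Ps s b c) = mulS (phi s b) (Fi c)"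
proof -
  have bs: "bsym (cjp (- s))" using s by (intro bsym_cjp) simp
  define a where "a \<eta> = cjp (- s) \<eta> * rep b \<eta>" for \<eta>
  have a2: "sq_integrable a" unfolding a_def by (rule bsym_sq[OF bs sq_rep])
  have a1: "integrable lborel a" unfolding a_def
  proof (rule sq_integrable_integrable_mult[OF sq_integrable_bound[OF _ jp_int] sq_rep])
    show "AE x in lborel. (cmod (cjp (- s) x))\<^sup>2 \<le> (jp (- 1) x)\<^sup>2"
      using s by (auto intro!: power_mono jp_mono)
  qed measurable
  note F = Fi_cv[OF a1 a2 sq_rep[of c]]
  define A where "A x = cnj (hat (\<lambda>\<eta>. cnj (a \<eta>)) x)" for x
  note F = F[folded A_def]
  have p: "phi s b = (\<lambda>x. of_real (1 / (2 * pi)) * A x)" by (simp add: phi_def[abs_def] A_def a_def)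
  have Asq: "sq_integrable A" unfolding A_def by (intro sq_integrable_cnj hat_sq a1 a2 integrable_cnj)
  show "bsym (phi s b)" unfolding p by (rule bsym_mult[OF bsym_const F(1)])
  show "sq_integrable (phi s b)" unfolding p by (rule sq_integrable_cmult[OF Asq])
  have "mk (phi s b) = (1 / (2 * pi)) *\<^sub>R mk A" unfolding p by (rule mk_scale[OF Asq])
  also have "\<dots> = Fi (mulS (cjp (- s)) b)" using F(3) by (simp add: mulS_def a_def[abs_def])
  finally show "mk (phi s b) = Fi (mulS (cjp (- s)) b)" .
  have "Ps s b c = mk (\<lambda>\<xi>. of_real (1 / (2 * pi)) * cv lborel a (rep c) \<xi>)"
    unfolding Ps_def Tk_def Tf_def cv_def a_def kP_def
    by (rule arg_cong[of _ _ mk], rule ext) (simp add: mult.assoc flip: integral_mult_right_zero)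
  also have "\<dots> = (1 / (2 * pi)) *\<^sub>R mk (cv lborel a (rep c))"
    by (rule mk_scale[OF cv_sq(1)[OF lborel.sigma_finite_measure_axioms _ a1 sq_rep]]) simp
  finally have "Fi (Ps s b c) = (1 / (2 * pi)) *\<^sub>R mulS A (Fi c)" using F(2)
    by (simp add: Fi_def linear_scale[OF bounded_linear.linear[OF bounded_linear_Fl]] linear_scale[OF bounded_linear.linear[OF bounded_linear_Cj]])
  also have "\<dots> = mulS (phi s b) (Fi c)"
    unfolding p mulS_def by (subst mk_scale[symmetric]) (auto simp: mult.assoc intro!: bsym_sq F)
  finally show "Fi (Ps s b c) = mulS (phi s b) (Fi c)" .
qed

lemma Qs_Ps: assumes s: "s \<ge> 1" shows "mulS (cjp (- s)) (Qs s a b) = Ps s a (mulS (cjp (- s)) b)"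
proof -
  have bs: "bsym (cjp (- s))" using s by (intro bsym_cjp) simp
  have "cjp (- s) \<xi> * kQ s \<xi> \<eta> = kP s \<xi> \<eta> * cjp (- s) (\<xi> - \<eta>)" for \<xi> \<eta>
    using cjp_inv[of "- s" \<xi>] by (simp add: kQ_def kP_def flip: mult.assoc)
  then show ?thesis unfolding Qs_def Ps_def mulS_Tk[OF bs kbd_kQ[OF s]] Tk_mulS_right[OF bs kbd_kP[OF s]] by simp
qed

lemma Fi_Qs: "s \<ge> 1 \<Longrightarrow> Fi (mulS (cjp (- s)) (Qs s a b)) = mulS (phi s a) (Fi (mulS (cjp (- s)) b))"
  by (simp add: Qs_Ps phi(4))

text \<open>On the physical side both sides multiply by the product of the functions
  \<open>phi s a\<close> and \<open>phi s b\<close>.\<close>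

lemma Ps_assoc:
  assumes s: "s \<ge> 1" shows "Ps s (Qs s a b) c = Ps s a (Ps s b c)"
proof -
  note p = phi(1)[OF s]
  have "mk (\<lambda>x. phi s a x * phi s b x) = mk (phi s (Qs s a b))"
    unfolding mulS_mk[OF p phi(2)[OF s], symmetric] phi(3)[OF s] Fi_Qs[OF s] ..
  then have "AE x in lborel. phi s a x * phi s b x = phi s (Qs s a b) x"
    by (subst (asm) mk_eq_iff) (auto intro: bsym_sq p phi(2)[OF s])
  then have "mulS (phi s (Qs s a b)) (Fi c) = mulS (phi s a) (mulS (phi s b) (Fi c))"
    unfolding mulS_mulS[OF p p] by (intro mulS_cong_AE p bsym_mult) (auto elim: eventually_mono)
  then have "Fi (Ps s (Qs s a b) c) = Fi (Ps s a (Ps s b c))" by (simp add: phi(4)[OF s])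
  then show ?thesis by (metis Fl_Fi)
qed

text \<open>For Hermitian \<open>b\<close> the function \<open>phi s b\<close> is real, and
  multiplication by a real function is symmetric.\<close>

lemma Ps_self_adjoint:
  assumes s: "s \<ge> 1" and h: "herm b" shows "inner (Ps s b x) y = inner x (Ps s b y)"
proof -
  have r: "cnj (phi s b x) = phi s b x" for x
  proof -
    define a where "a \<eta> = cjp (- s) \<eta> * rep b \<eta>" for \<eta>
    have [measurable]: "a \<in> borel_measurable borel" unfolding a_def by measurable
    have "AE \<eta> in lborel. cnj (a \<eta>) * ek (x * \<eta>) = a (0 - \<eta>) * ek (- (x * (0 - \<eta>)))"
      using h unfolding herm_AE by eventually_elim (simp add: a_def)
    then have "hat (\<lambda>\<eta>. cnj (a \<eta>)) x = (LINT \<eta>|lborel. a (0 - \<eta>) * ek (- (x * (0 - \<eta>))))"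
      unfolding hat_def by (intro integral_cong_AE) auto
    also have "\<dots> = cnj (hat (\<lambda>\<eta>. cnj (a \<eta>)) x)" unfolding cnj_hat by (subst integral_reflect) simp
    finally show ?thesis by (simp add: phi_def a_def)
  qed
  have i: "inner (Fi u) (Fi v) = inner u v / (2 * pi)" for u v using inner_Fl[of "Fi u" "Fi v"] by simp
  have "inner (mulS (phi s b) (Fi x)) (Fi y) = inner (Fi x) (mulS (phi s b) (Fi y))"
    using inner_mulS[OF phi(1)[OF s], of b "Fi x" "Fi y"] by (simp add: r)
  then show ?thesis by (simp add: i flip: phi(4)[OF s])
qed

text \<open>An index shift: \<open>pw s y j\<close> is the power $u^{j+1}$, so that $u^{p+1}$ is \<open>pw s y (Suc q)\<close> with \<open>p = Suc q\<close>.\<close>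

primrec pw :: "real \<Rightarrow> l2 \<Rightarrow> nat \<Rightarrow> l2" where
  "pw s y 0 = y"
| "pw s y (Suc j) = Qs s y (pw s y j)"

text \<open>The part of the derivative of \<open>pw s y j\<close> that contains no derivative of
  \<open>y\<close>: Leibniz remainders, each a bounded multilinear expression in
  \<open>y\<close>.\<close>

primrec RR :: "real \<Rightarrow> l2 \<Rightarrow> nat \<Rightarrow> l2" where
  "RR s y 0 = 0"
| "RR s y (Suc j) = Ps s y (RR s y j) + Rs s y (pw s y j)"

text \<open>\<open>Ps_assoc\<close> merges the nested multiplications into a single coefficient, so
  the top order of the derivative of the flux is one multiplication operator acting on
  \<open>dy\<close>. This is the form in which the energy can cancel it.\<close>

lemma isD_pw_Suc:
  assumes s: "s \<ge> 2" and D: "isD y dy"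
  shows "isD (pw s y (Suc j)) (real (j + 2) *\<^sub>R Ps s (pw s y j) dy + RR s y (Suc j))"
proof (induction j)
  case 0
  have s1: "s \<ge> 1" using s by simp
  have "real (0 + 2) *\<^sub>R Ps s y dy = Ps s y dy + Ps s y dy" by (simp add: scaleR_2)
  then show ?case
    using Leibniz_Qs[OF s D D] bounded_bilinear.zero_right[OF bb_Ps[OF s1]] by simp
next
  case (Suc j)
  have s1: "s \<ge> 1" using s by simp
  note B = bb_Ps[OF s1]
  have "Ps s y (real (j + 2) *\<^sub>R Ps s (pw s y j) dy + RR s y (Suc j)) + Ps s (pw s y (Suc j)) dy + Rs s y (pw s y (Suc j))
    = (real (j + 2) + 1) *\<^sub>R Ps s (pw s y (Suc j)) dy + RR s y (Suc (Suc j))"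
    unfolding bounded_bilinear.add_right[OF B] bounded_bilinear.scaleR_right[OF B] scaleR_add_left scaleR_one
      Ps_assoc[OF s1, of y "pw s y j" dy, folded pw.simps(2), symmetric] RR.simps(2)[of s y "Suc j"]
    by (simp only: add_ac)
  moreover have "real (j + 2) + 1 = real (Suc j + 2)" by simp
  ultimately show ?case
    using Leibniz_Qs[OF s D Suc, folded pw.simps(2)] by (simp only:)
qed

lemma isD_pw_ex: "s \<ge> 2 \<Longrightarrow> isD y dy \<Longrightarrow> \<exists>d. isD (pw s y j) d"
  by (cases j) (auto simp del: pw.simps(2) intro: isD_pw_Suc)

text \<open>Boundedness and Lipschitz continuity on balls are kept together because a Lipschitz
  estimate for a product uses both. The class is closed under sums and bounded bilinear maps, hence
  contains all powers and remainders.\<close>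

definition lipb :: "('a::real_normed_vector \<Rightarrow> 'b::real_normed_vector) \<Rightarrow> bool" where
  "lipb f \<longleftrightarrow> (\<forall>M\<ge>0. \<exists>C\<ge>0. \<forall>x y. norm x \<le> M \<longrightarrow> norm y \<le> M \<longrightarrow> norm (f x) \<le> C \<and> norm (f x - f y) \<le> C * norm (x - y))"

lemma lipb_id: "lipb (\<lambda>x. x)"
  unfolding lipb_def
proof (intro allI impI)
  fix M :: real assume "M \<ge> 0"
  then show "\<exists>C\<ge>0. \<forall>x y :: 'a. norm x \<le> M \<longrightarrow> norm y \<le> M \<longrightarrow> norm x \<le> C \<and> norm (x - y) \<le> C * norm (x - y)"
    by (intro exI[of _ "max M 1"]) (auto intro: order_trans[OF _ mult_right_mono[of 1]])
qed

lemma lipb_const: "lipb (\<lambda>x. c)"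
  unfolding lipb_def by (intro allI impI exI[of _ "norm c"]) auto

lemma lipb_add:
  assumes "lipb f" "lipb g" shows "lipb (\<lambda>x. f x + g x)"
  unfolding lipb_def
proof (intro allI impI)
  fix M :: real assume "M \<ge> 0"
  then obtain C D where C: "C \<ge> 0" "\<And>x y. norm x \<le> M \<Longrightarrow> norm y \<le> M \<Longrightarrow> norm (f x) \<le> C \<and> norm (f x - f y) \<le> C * norm (x - y)"
    and D: "D \<ge> 0" "\<And>x y. norm x \<le> M \<Longrightarrow> norm y \<le> M \<Longrightarrow> norm (g x) \<le> D \<and> norm (g x - g y) \<le> D * norm (x - y)"
    using assms unfolding lipb_def by metis
  have "norm (f x + g x) \<le> C + D \<and> norm (f x + g x - (f y + g y)) \<le> (C + D) * norm (x - y)"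
    if "norm x \<le> M" "norm y \<le> M" for x y
  proof
    show "norm (f x + g x) \<le> C + D"
      using C(2)[OF that] D(2)[OF that] norm_triangle_ineq[of "f x" "g x"] by linarith
    have "f x + g x - (f y + g y) = (f x - f y) + (g x - g y)" by simp
    then have "norm (f x + g x - (f y + g y)) \<le> norm (f x - f y) + norm (g x - g y)"
      by (metis norm_triangle_ineq)
    then show "norm (f x + g x - (f y + g y)) \<le> (C + D) * norm (x - y)"
      using C(2)[OF that] D(2)[OF that] unfolding distrib_right by linarith
  qed
  then show "\<exists>C\<ge>0. \<forall>x y. norm x \<le> M \<longrightarrow> norm y \<le> M \<longrightarrow> norm (f x + g x) \<le> C \<and> norm (f x + g x - (f y + g y)) \<le> C * norm (x - y)"
    using C(1) D(1) by (intro exI[of _ "C + D"]) auto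
qed

lemma lipb_bilinear:
  assumes B: "bounded_bilinear B" and "lipb f" "lipb g" shows "lipb (\<lambda>x. B (f x) (g x))"
  unfolding lipb_def
proof (intro allI impI)
  interpret bounded_bilinear B by fact
  obtain K where K: "K \<ge> 0" "\<And>a b. norm (B a b) \<le> norm a * norm b * K" using nonneg_bounded by blast
  fix M :: real assume "M \<ge> 0"
  then obtain C D where C: "C \<ge> 0" "\<And>x y. norm x \<le> M \<Longrightarrow> norm y \<le> M \<Longrightarrow> norm (f x) \<le> C \<and> norm (f x - f y) \<le> C * norm (x - y)"
    and D: "D \<ge> 0" "\<And>x y. norm x \<le> M \<Longrightarrow> norm y \<le> M \<Longrightarrow> norm (g x) \<le> D \<and> norm (g x - g y) \<le> D * norm (x - y)"
    using assms(2,3) unfolding lipb_def by metis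
  have "norm (B (f x) (g x)) \<le> C * D * K + C * D * K \<and> norm (B (f x) (g x) - B (f y) (g y)) \<le> (C * D * K + C * D * K) * norm (x - y)"
    if xy: "norm x \<le> M" "norm y \<le> M" for x y
  proof
    have "norm (B (f x) (g x)) \<le> norm (f x) * norm (g x) * K" by (rule K)
    also have "\<dots> \<le> C * D * K"
      using C(1) D(1) K(1) C(2)[OF xy] D(2)[OF xy] by (intro mult_right_mono mult_mono) auto
    finally show "norm (B (f x) (g x)) \<le> C * D * K + C * D * K"
      using C(1) D(1) K(1) by (smt (verit) mult_nonneg_nonneg)
    have "B (f x) (g x) - B (f y) (g y) = B (f x - f y) (g x) + B (f y) (g x - g y)"
      by (simp add: diff_left diff_right)
    also have "norm \<dots> \<le> norm (f x - f y) * norm (g x) * K + norm (f y) * norm (g x - g y) * K"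
      by (intro norm_triangle_mono K)
    also have "\<dots> \<le> (C * norm (x - y)) * D * K + C * (D * norm (x - y)) * K"
      using C(1) D(1) K(1) C(2)[OF xy] D(2)[OF xy] C(2)[OF xy(2,1)]
      by (intro add_mono mult_right_mono mult_mono) auto
    finally show "norm (B (f x) (g x) - B (f y) (g y)) \<le> (C * D * K + C * D * K) * norm (x - y)"
      by (simp add: algebra_simps)
  qed
  then show "\<exists>C\<ge>0. \<forall>x y. norm x \<le> M \<longrightarrow> norm y \<le> M \<longrightarrow> norm (B (f x) (g x)) \<le> C \<and> norm (B (f x) (g x) - B (f y) (g y)) \<le> C * norm (x - y)"
    using C(1) D(1) K(1) by (intro exI[of _ "C * D * K + C * D * K"]) auto
qed

lemma lipb_pw: "s \<ge> 1 \<Longrightarrow> lipb (\<lambda>y. pw s y j)"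
  by (induction j) (auto intro: lipb_id lipb_bilinear[OF bb_Qs])

lemma lipb_RR: "s \<ge> 2 \<Longrightarrow> lipb (\<lambda>y. RR s y j)"
  by (induction j) (auto intro!: lipb_const lipb_add lipb_bilinear[OF bb_Ps] lipb_bilinear[OF bb_Rs] lipb_id lipb_pw)

text \<open>Linear in the norm of \<open>y'\<close> at the same level; it is applied one level below
  the energy, where the time derivative of the solution is bounded.\<close>

lemma pw_deriv:
  assumes s: "s \<ge> 1" and M: "M \<ge> 0"
  shows "\<exists>C\<ge>0. \<forall>y y' t S. norm (y t) \<le> M \<longrightarrow> (y has_vector_derivative y') (at t within S) \<longrightarrow>
     (\<exists>b'. ((\<lambda>r. pw s (y r) j) has_vector_derivative b') (at t within S) \<and> norm b' \<le> C * norm y')"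
proof (induction j)
  case 0
  show ?case by (intro exI[of _ 1]) auto
next
  case (Suc j)
  then obtain C where C: "C \<ge> 0" "\<And>y y' t S. norm (y t) \<le> M \<Longrightarrow> (y has_vector_derivative y') (at t within S) \<Longrightarrow>
     (\<exists>b'. ((\<lambda>r. pw s (y r) j) has_vector_derivative b') (at t within S) \<and> norm b' \<le> C * norm y')"
    by metis
  obtain D where D: "D \<ge> 0" "\<And>x. norm x \<le> M \<Longrightarrow> norm (pw s x j) \<le> D"
    using lipb_pw[OF s, of j] M unfolding lipb_def by metis
  interpret bounded_bilinear "Qs s" using bb_Qs[OF s] .
  obtain K where K: "K \<ge> 0" "\<And>a b. norm (Qs s a b) \<le> norm a * norm b * K" using nonneg_bounded by blast
  show ?case
  proof (intro exI[of _ "M * C * K + D * K"] conjI allI impI)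
    show "0 \<le> M * C * K + D * K" using M C(1) K(1) D(1) by simp
    fix y :: "real \<Rightarrow> l2" and y' t S
    assume y: "norm (y t) \<le> M" "(y has_vector_derivative y') (at t within S)"
    obtain b' where b: "((\<lambda>r. pw s (y r) j) has_vector_derivative b') (at t within S)" "norm b' \<le> C * norm y'"
      using C(2)[OF y] by blast
    have "norm (Qs s (y t) b' + Qs s y' (pw s (y t) j)) \<le> norm (y t) * norm b' * K + norm y' * norm (pw s (y t) j) * K"
      by (intro norm_triangle_mono K)
    also have "\<dots> \<le> M * (C * norm y') * K + norm y' * D * K"
      using y(1) b(2) K(1) D(2)[OF y(1)] M by (intro add_mono mult_right_mono mult_mono mult_left_mono) auto
    finally have "norm (Qs s (y t) b' + Qs s y' (pw s (y t) j)) \<le> (M * C * K + D * K) * norm y'"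
      by (simp add: algebra_simps)
    then show "\<exists>b'. ((\<lambda>r. pw s (y r) (Suc j)) has_vector_derivative b') (at t within S) \<and> norm b' \<le> (M * C * K + D * K) * norm y'"
      using has_vector_derivative[OF y(2) b(1)] by auto
  qed
qed

lemma pw_low:
  assumes "1 \<le> t" "t \<le> s"
  shows "mulS (cjp (t - s)) (pw s y j) = pw t (mulS (cjp (t - s)) y) j"
  by (induction j) (simp_all add: Qs_low[OF assms])

lemma Sop_pw: "s \<ge> 1 \<Longrightarrow> Sop (pw s y j) = pw s (Sop y) j"
  by (induction j) (simp_all add: Sop_Qs)

lemma herm_pw: "s \<ge> 1 \<Longrightarrow> herm y \<Longrightarrow> herm (pw s y j)"
  by (simp add: herm_def Sop_pw)

lemma herm_scaleR: "herm y \<Longrightarrow> herm (r *\<^sub>R y)"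
  by (simp add: herm_def Sop_scaleR)

subsection \<open>The energy estimate\<close>

text \<open>With \<open>p = q + 1\<close> these are the coordinates of \<open>(p + 1) u^p\<close>,
  the derivative of the nonlinearity.\<close>

definition bco :: "real \<Rightarrow> nat \<Rightarrow> l2 \<Rightarrow> l2" where
  "bco s q y = real (q + 2) *\<^sub>R pw s y q"

text \<open>Three separate slots: \<open>y\<close> supplies the coefficient, while \<open>h\<close>
  and \<open>l\<close> are the differences of the two unknowns. In use \<open>k\<close> is the
  reciprocal symbol and \<open>lam\<close> is \<open>\<epsilon>^p\<close>.\<close>

definition energy :: "(real \<Rightarrow> real) \<Rightarrow> real \<Rightarrow> nat \<Rightarrow> real \<Rightarrow> l2 \<Rightarrow> l2 \<Rightarrow> l2 \<Rightarrow> real" where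
  "energy k s q lam y h l = inner (mulS (\<lambda>\<xi>. of_real (k \<xi>)) l) l + inner h h + lam * inner (Ps s (bco s q y) h) h"

lemma norm_Ps_le: "s \<ge> 1 \<Longrightarrow> norm (Ps s b c) \<le> cT * norm b * norm c"
  using norm_Tk[OF kbd_kP, of s b c] by (simp add: Ps_def)

lemma norm_Ps_low_le:
  assumes s: "s \<ge> 2" shows "norm (Ps s b c) \<le> cT * norm (mulS (cjp (-1)) b) * norm c"
proof -
  have "Ps s b c = Ps (s - 1) (mulS (cjp ((s - 1) - s)) b) c" by (rule Ps_low) (use s in auto)
  then show ?thesis using norm_Ps_le[of "s - 1" "mulS (cjp (-1)) b" c] s by simp
qed

lemma energy_bounds:
  assumes s: "s \<ge> 1" and M: "M \<ge> 0"
  shows "\<exists>C\<ge>0. \<forall>y h. norm y \<le> M \<longrightarrow> \<bar>inner (Ps s (bco s q y) h) h\<bar> \<le> C * (norm h)\<^sup>2"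
proof -
  obtain D where D: "D \<ge> 0" "\<And>x. norm x \<le> M \<Longrightarrow> norm (pw s x q) \<le> D"
    using lipb_pw[OF s, of q] M unfolding lipb_def by metis
  have "\<bar>inner (Ps s (bco s q y) h) h\<bar> \<le> cT * (real (q + 2) * D) * (norm h)\<^sup>2" if "norm y \<le> M" for y h
  proof -
    have "\<bar>inner (Ps s (bco s q y) h) h\<bar> \<le> norm (Ps s (bco s q y) h) * norm h" by (rule Cauchy_Schwarz_ineq2)
    also have "\<dots> \<le> (cT * norm (bco s q y) * norm h) * norm h" by (intro mult_right_mono norm_Ps_le s) auto
    also have "\<dots> \<le> (cT * (real (q + 2) * D) * norm h) * norm h"
      using D(2)[OF that] cT_ge0 by (intro mult_right_mono mult_left_mono) (auto simp: bco_def intro!: mult_left_mono)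
    finally show ?thesis by (simp add: power2_eq_square mult.assoc)
  qed
  then show ?thesis using D(1) cT_ge0 by (intro exI[of _ "cT * (real (q + 2) * D)"]) auto
qed

text \<open>The constant depends only on \<open>s\<close>, \<open>q\<close> and \<open>M\<close>,
  hence is uniform in the symbol, in \<open>lam\<close> and in the cutoff. The second equation
  enters only through its pairing with \<open>z1 t - z2 t\<close>, since for truncated systems it
  holds in this form only after testing; \<open>\<Phi>\<close> is the amount by which the second
  pair fails the equation of the first. The bound on \<open>dy2\<close> asks the second solution to
  be one derivative smoother than the level of the estimate.\<close>

definition ebound :: "real \<Rightarrow> nat \<Rightarrow> real \<Rightarrow> real \<Rightarrow> bool" where
  "ebound s q M C \<longleftrightarrow> (\<forall>k lam S t y1 y2 z1 z2 dy1 dy2 dz1 dz2 dF1 dF2 l' \<Phi>.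
    lam \<ge> 0 \<longrightarrow> bsym (\<lambda>\<xi>. of_real (k \<xi>)) \<longrightarrow>
    (y1 has_vector_derivative dz1) (at t within S) \<longrightarrow> (y2 has_vector_derivative dz2) (at t within S) \<longrightarrow>
    isD (z1 t) dz1 \<longrightarrow> isD (z2 t) dz2 \<longrightarrow> isD (y1 t) dy1 \<longrightarrow> isD (y2 t) dy2 \<longrightarrow>
    ((\<lambda>r. z1 r - z2 r) has_vector_derivative l') (at t within S) \<longrightarrow>
    isD (pw s (y1 t) (Suc q)) dF1 \<longrightarrow> isD (pw s (y2 t) (Suc q)) dF2 \<longrightarrow>
    inner (mulS (\<lambda>\<xi>. of_real (k \<xi>)) l') (z1 t - z2 t) = inner (dy1 - dy2 + lam *\<^sub>R (dF1 - dF2) + \<Phi>) (z1 t - z2 t) \<longrightarrow>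
    herm (y1 t) \<longrightarrow> norm (y1 t) \<le> M \<longrightarrow> norm (y2 t) \<le> M \<longrightarrow> norm (z1 t) \<le> M \<longrightarrow> norm dy2 \<le> M \<longrightarrow>
    (\<exists>E'. ((\<lambda>r. energy k s q lam (y1 r) (y1 r - y2 r) (z1 r - z2 r)) has_vector_derivative E') (at t within S) \<and>
       E' \<le> lam * C * ((norm (y1 t - y2 t))\<^sup>2 + (norm (z1 t - z2 t))\<^sup>2) + 2 * norm \<Phi> * norm (z1 t - z2 t)))"

lemma eboundD:
  assumes "ebound s q M C" "lam \<ge> 0" "bsym (\<lambda>\<xi>. of_real (k \<xi>))"
    "(y1 has_vector_derivative dz1) (at t within S)" "(y2 has_vector_derivative dz2) (at t within S)"
    "isD (z1 t) dz1" "isD (z2 t) dz2" "isD (y1 t) dy1" "isD (y2 t) dy2"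
    "((\<lambda>r. z1 r - z2 r) has_vector_derivative l') (at t within S)"
    "isD (pw s (y1 t) (Suc q)) dF1" "isD (pw s (y2 t) (Suc q)) dF2"
    "inner (mulS (\<lambda>\<xi>. of_real (k \<xi>)) l') (z1 t - z2 t) = inner (dy1 - dy2 + lam *\<^sub>R (dF1 - dF2) + \<Phi>) (z1 t - z2 t)"
    "herm (y1 t)" "norm (y1 t) \<le> M" "norm (y2 t) \<le> M" "norm (z1 t) \<le> M" "norm dy2 \<le> M"
  obtains E' where "((\<lambda>r. energy k s q lam (y1 r) (y1 r - y2 r) (z1 r - z2 r)) has_vector_derivative E') (at t within S)"
    "E' \<le> lam * C * ((norm (y1 t - y2 t))\<^sup>2 + (norm (z1 t - z2 t))\<^sup>2) + 2 * norm \<Phi> * norm (z1 t - z2 t)"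
proof -
  note assms(1)[unfolded ebound_def, THEN spec[of _ "k"], THEN spec[of _ "lam"], THEN spec[of _ "S"], THEN spec[of _ "t"], THEN spec[of _ "y1"], THEN spec[of _ "y2"], THEN spec[of _ "z1"], THEN spec[of _ "z2"], THEN spec[of _ "dy1"], THEN spec[of _ "dy2"], THEN spec[of _ "dz1"], THEN spec[of _ "dz2"], THEN spec[of _ "dF1"], THEN spec[of _ "dF2"], THEN spec[of _ "l'"], THEN spec[of _ "\<Phi>"]]
  from this[rule_format, OF assms(2-18)] show thesis using that by blast
qed

text \<open>Every term with a derivative of the differences cancels: \<open>inner dh (l t)\<close>
  against \<open>inner (h t) dl\<close> by skewness, and the pairings of \<open>b\<close> with
  \<open>dh\<close> and with \<open>dl\<close> by the Leibniz rule and self-adjointness. What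
  survives, in \<open>E'eq\<close>, is \<open>b_t\<close>, \<open>b_x\<close>, the remainder of the
  flux and the error.\<close>

lemma energy_deriv:
  assumes s: "s \<ge> 2" and M: "M \<ge> 0"
  shows "\<exists>C\<ge>0. ebound s q M C"
proof -
  have s1: "s \<ge> 1" and s1': "s - 1 \<ge> 1" using s by simp_all
  interpret P: bounded_bilinear "Ps s" using bb_Ps[OF s1] .
  obtain D where D: "D \<ge> 0" "\<And>x y. norm x \<le> M \<Longrightarrow> norm y \<le> M \<Longrightarrow> norm (pw s x q) \<le> D \<and> norm (pw s x q - pw s y q) \<le> D * norm (x - y)"
    using lipb_pw[OF s1, of q] M unfolding lipb_def by metis
  obtain R where R: "R \<ge> 0" "\<And>x y. norm x \<le> M \<Longrightarrow> norm y \<le> M \<Longrightarrow> norm (RR s x (Suc q) - RR s y (Suc q)) \<le> R * norm (x - y)"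
    using lipb_RR[OF s, of "Suc q"] M unfolding lipb_def by metis
  obtain B where B: "B \<ge> 0" "\<And>y y' t S. norm (y t) \<le> M \<Longrightarrow> (y has_vector_derivative y') (at t within S) \<Longrightarrow>
     (\<exists>b'. ((\<lambda>r. pw (s - 1) (y r) q) has_vector_derivative b') (at t within S) \<and> norm b' \<le> B * norm y')"
    using pw_deriv[OF s1' M, of q] by metis
  define n where "n = real (q + 2)"
  have n0: "n \<ge> 0" by (simp add: n_def)
  define c1 where "c1 = cT * (n * (B * M))"
  define c2 where "c2 = cT * (n * D)"
  define c3 where "c3 = n * (cT * D * M) + R"
  define C where "C = c1 + 2 * c2 + 2 * c3"
  have c0: "c1 \<ge> 0" "c2 \<ge> 0" "c3 \<ge> 0"
    using n0 M B(1) D(1) R(1) cT_ge0 by (auto simp: c1_def c2_def c3_def)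
  show ?thesis
    unfolding ebound_def
  proof (rule exI[of _ C], intro conjI allI impI)
    show "C \<ge> 0" using c0 by (simp add: C_def)
    fix k :: "real \<Rightarrow> real" and lam :: real and S t and y1 y2 z1 z2 :: "real \<Rightarrow> l2" and dy1 dy2 dz1 dz2 dF1 dF2 l' \<Phi> :: l2
    assume lam0: "lam \<ge> 0" and K: "bsym (\<lambda>\<xi>. of_real (k \<xi>))"
      and y1': "(y1 has_vector_derivative dz1) (at t within S)" and y2': "(y2 has_vector_derivative dz2) (at t within S)"
      and Dz1: "isD (z1 t) dz1" and Dz2: "isD (z2 t) dz2" and Dy1: "isD (y1 t) dy1" and Dy2: "isD (y2 t) dy2"
      and l': "((\<lambda>r. z1 r - z2 r) has_vector_derivative l') (at t within S)"
      and DF1: "isD (pw s (y1 t) (Suc q)) dF1" and DF2: "isD (pw s (y2 t) (Suc q)) dF2"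
      and eq: "inner (mulS (\<lambda>\<xi>. of_real (k \<xi>)) l') (z1 t - z2 t) = inner (dy1 - dy2 + lam *\<^sub>R (dF1 - dF2) + \<Phi>) (z1 t - z2 t)"
      and hy: "herm (y1 t)" and bd: "norm (y1 t) \<le> M" "norm (y2 t) \<le> M" "norm (z1 t) \<le> M" "norm dy2 \<le> M"
    define h where "h r = y1 r - y2 r" for r
    define l where "l r = z1 r - z2 r" for r
    define dh where "dh = dy1 - dy2"
    define dl where "dl = dz1 - dz2"
    define b where "b r = bco s q (y1 r)" for r
    have h': "(h has_vector_derivative dl) (at t within S)"
      unfolding h_def dl_def by (rule has_vector_derivative_diff[OF y1' y2'])
    have ll: "(l has_vector_derivative l') (at t within S)" using l' unfolding l_def .
    have Dh: "isD (h t) dh" and Dl: "isD (l t) dl"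
      unfolding h_def dh_def l_def dl_def by (intro isD_diff Dy1 Dy2 Dz1 Dz2)+
    obtain dp where dp: "isD (pw s (y1 t) q) dp" using isD_pw_ex[OF s Dy1] by blast
    define db where "db = n *\<^sub>R dp"
    have Db: "isD (b t) db" unfolding b_def bco_def db_def n_def by (rule isD_scaleR[OF dp])
    have nb: "norm (b t) \<le> n * D"
      using D(2)[OF bd(1) bd(1)] n0 unfolding b_def bco_def n_def[symmetric] by (simp add: mult_left_mono)
    have hb: "herm (b t)" unfolding b_def bco_def by (intro herm_scaleR herm_pw s1 hy)
    \<comment> \<open>The time derivative \<open>dz1\<close> of \<open>y1\<close> has no bound at
      level \<open>s\<close>, but it has one at level \<open>s - 1\<close>. The same multiplication
      operator is therefore written with coefficients of that lower level before it is
      differentiated in time.\<close>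
    define yl where "yl r = mulS (cjp (-1)) (y1 r)" for r
    have bj: "bsym (cjp (-1))" by (rule bsym_cjp) simp
    have yl': "(yl has_vector_derivative mulS (cjp (-1)) dz1) (at t within S)"
      unfolding yl_def by (rule bounded_linear.has_vector_derivative[OF bounded_linear_mulS[OF bj] y1'])
    have "norm (yl t) \<le> M" unfolding yl_def using norm_mulS_cjp_le[of "-1" "y1 t"] bd(1) by simp
    from B(2)[OF this yl'] obtain p' where
      p': "((\<lambda>r. pw (s - 1) (yl r) q) has_vector_derivative p') (at t within S)" "norm p' \<le> B * norm (mulS (cjp (-1)) dz1)"
      by blast
    define b' where "b' = n *\<^sub>R p'"
    have bl': "((\<lambda>r. n *\<^sub>R pw (s - 1) (yl r) q) has_vector_derivative b') (at t within S)"
      unfolding b'_def by (rule bounded_linear.has_vector_derivative[OF bounded_linear_scaleR_right p'(1)])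
    have "norm p' \<le> B * M"
      using p'(2) mult_left_mono[OF order_trans[OF isD_low[OF Dz1] bd(3)] B(1)] by simp
    then have nb': "norm b' \<le> n * (B * M)" unfolding b'_def using n0 by (simp add: mult_left_mono)
    have Pb: "Ps s (b r) c = Ps (s - 1) (n *\<^sub>R pw (s - 1) (yl r) q) c" for r c
    proof -
      have "Ps s (b r) c = Ps (s - 1) (mulS (cjp ((s - 1) - s)) (b r)) c" by (rule Ps_low) (use s in auto)
      also have "mulS (cjp ((s - 1) - s)) (b r) = n *\<^sub>R pw (s - 1) (yl r) q"
        using pw_low[of "s - 1" s "y1 r" q] s by (simp add: b_def bco_def n_def yl_def mulS_scaleR[OF bj])
      finally show ?thesis .
    qed
    have K': "mulS (\<lambda>\<xi>. of_real (k \<xi>)) = mulS (\<lambda>\<xi>. cnj (of_real (k \<xi>)))" by simp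
    note V = bounded_bilinear.has_vector_derivative[OF bounded_bilinear_inner]
    define KK where "KK = mulS (\<lambda>\<xi>. of_real (k \<xi>))"
    have e1: "((\<lambda>r. inner (KK (l r)) (l r)) has_vector_derivative (inner (KK (l t)) l' + inner (KK l') (l t))) (at t within S)"
      unfolding KK_def by (rule V[OF bounded_linear.has_vector_derivative[OF bounded_linear_mulS[OF K] ll] ll])
    have e2: "((\<lambda>r. inner (h r) (h r)) has_vector_derivative (inner (h t) dl + inner dl (h t))) (at t within S)"
      by (rule V[OF h' h'])
    have e3: "((\<lambda>r. inner (Ps s (b r) (h r)) (h r)) has_vector_derivative
       (inner (Ps s (b t) (h t)) dl + inner (Ps s (b t) dl + Ps (s - 1) b' (h t)) (h t))) (at t within S)"
      unfolding Pb by (rule V[OF bounded_bilinear.has_vector_derivative[OF bb_Ps[OF s1'] bl' h'] h'])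
    define E' where "E' = (inner (KK (l t)) l' + inner (KK l') (l t)) + (inner (h t) dl + inner dl (h t))
      + lam * (inner (Ps s (b t) (h t)) dl + inner (Ps s (b t) dl + Ps (s - 1) b' (h t)) (h t))"
    have E: "((\<lambda>r. energy k s q lam (y1 r) (y1 r - y2 r) (z1 r - z2 r)) has_vector_derivative E') (at t within S)"
      unfolding energy_def E'_def h_def[symmetric] l_def[symmetric] b_def[symmetric] KK_def[symmetric]
      by (intro has_vector_derivative_add e1 e2 has_vector_derivative_mult_right e3)
    \<comment> \<open>The difference of the fluxes, apart from the coefficient of the first solution
      acting on \<open>dh\<close>. The other coefficient difference multiplies \<open>dy2\<close>,
      which is bounded by assumption.\<close>
    define Rem where "Rem = n *\<^sub>R Ps s (pw s (y1 t) q - pw s (y2 t) q) dy2 + (RR s (y1 t) (Suc q) - RR s (y2 t) (Suc q))"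
    have dF: "dF1 - dF2 = Ps s (b t) dh + Rem"
    proof -
      have "dF1 = n *\<^sub>R Ps s (pw s (y1 t) q) dy1 + RR s (y1 t) (Suc q)" "dF2 = n *\<^sub>R Ps s (pw s (y2 t) q) dy2 + RR s (y2 t) (Suc q)"
        using isD_unique[OF DF1 isD_pw_Suc[OF s Dy1]] isD_unique[OF DF2 isD_pw_Suc[OF s Dy2]] by (simp_all add: n_def)
      moreover have "b t = n *\<^sub>R pw s (y1 t) q" by (simp only: b_def bco_def n_def)
      ultimately show ?thesis
        unfolding Rem_def dh_def by (simp only: P.scaleR_left P.diff_left P.diff_right scaleR_diff_right) simp
    qed
    have kl: "inner (KK (l t)) l' = inner (KK l') (l t)"
      using inner_mulS[OF K, of "l t" l'] by (simp add: KK_def inner_commute)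
    have kl2: "inner (KK l') (l t) = inner dh (l t) + lam * (inner (Ps s (b t) dh) (l t) + inner Rem (l t)) + inner \<Phi> (l t)"
      using eq[folded l_def dh_def KK_def] unfolding dF by (simp add: inner_add_left)
    have s2: "inner dh (l t) = - inner (h t) dl" by (rule isD_skew[OF Dh Dl])
    have s3: "inner (Ps s (b t) dh) (l t) = - inner (Ps s (b t) (h t)) dl - inner (Ps s db (h t)) (l t)"
      using isD_skew[OF Leibniz_Ps[OF s1 Db Dh] Dl] by (simp add: inner_add_left)
    have s4: "inner (Ps s (b t) dl) (h t) = inner (Ps s (b t) (h t)) dl"
      using Ps_self_adjoint[OF s1 hb, of dl "h t"] by (simp add: inner_commute)
    have E'eq: "E' = lam * (inner (Ps (s - 1) b' (h t)) (h t) - 2 * inner (Ps s db (h t)) (l t) + 2 * inner Rem (l t)) + 2 * inner \<Phi> (l t)"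
      unfolding E'_def kl kl2 s2 s3 inner_add_left s4 by (simp add: inner_commute[of dl "h t"] algebra_simps)
    define X where "X = (norm (h t))\<^sup>2 + (norm (l t))\<^sup>2"
    have X: "norm (h t) * norm (h t) \<le> X" "norm (h t) * norm (l t) \<le> X"
    proof -
      show "norm (h t) * norm (h t) \<le> X" by (simp add: X_def power2_eq_square)
      have "2 * (norm (h t) * norm (l t)) \<le> X" unfolding X_def using sum_squares_bound[of "norm (h t)" "norm (l t)"] by simp
      then show "norm (h t) * norm (l t) \<le> X"
        using mult_nonneg_nonneg[OF norm_ge_zero[of "h t"] norm_ge_zero[of "l t"]] by linarith
    qed
    have i1: "inner (Ps (s - 1) b' (h t)) (h t) \<le> c1 * X"
    proof -
      have "inner (Ps (s - 1) b' (h t)) (h t) \<le> (cT * norm b' * norm (h t)) * norm (h t)"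
        by (rule order_trans[OF norm_cauchy_schwarz mult_right_mono[OF norm_Ps_le[OF s1']]]) simp
      also have "\<dots> \<le> (cT * (n * (B * M)) * norm (h t)) * norm (h t)"
        using nb' cT_ge0 by (intro mult_right_mono mult_left_mono) auto
      also have "\<dots> = c1 * (norm (h t) * norm (h t))" by (simp only: c1_def mult.assoc)
      also have "\<dots> \<le> c1 * X" using X(1) c0(1) by (rule mult_left_mono)
      finally show ?thesis .
    qed
    have i2: "- inner (Ps s db (h t)) (l t) \<le> c2 * X"
    proof -
      have "- inner (Ps s db (h t)) (l t) \<le> norm (Ps s db (h t)) * norm (l t)"
        using Cauchy_Schwarz_ineq2[of "Ps s db (h t)" "l t"] by linarith
      \<comment> \<open>\<open>db\<close> is a full derivative of the coefficient, so only its norm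
        one level lower is available; multiplication needs no more.\<close>
      also have "\<dots> \<le> (cT * norm (mulS (cjp (-1)) db) * norm (h t)) * norm (l t)"
        by (intro mult_right_mono norm_Ps_low_le s) simp
      also have "\<dots> \<le> (cT * (n * D) * norm (h t)) * norm (l t)"
        using order_trans[OF isD_low[OF Db] nb] cT_ge0 by (intro mult_right_mono mult_left_mono) auto
      also have "\<dots> = c2 * (norm (h t) * norm (l t))" by (simp add: c2_def)
      also have "\<dots> \<le> c2 * X" using X(2) c0(2) by (rule mult_left_mono)
      finally show ?thesis .
    qed
    have i3: "inner Rem (l t) \<le> c3 * X"
    proof -
      have "norm (Ps s (pw s (y1 t) q - pw s (y2 t) q) dy2) \<le> cT * (D * norm (h t)) * M"
      proof -
        have "norm (Ps s (pw s (y1 t) q - pw s (y2 t) q) dy2) \<le> cT * norm (pw s (y1 t) q - pw s (y2 t) q) * norm dy2"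
          by (rule norm_Ps_le[OF s1])
        also have "\<dots> \<le> cT * (D * norm (h t)) * M"
          using D(2)[OF bd(1,2)] D(1) bd(4) cT_ge0 by (intro mult_mono) (auto simp: h_def)
        finally show ?thesis .
      qed
      then have "norm Rem \<le> n * (cT * (D * norm (h t)) * M) + R * norm (h t)"
        unfolding Rem_def using R(2)[OF bd(1,2)] n0
        by (intro norm_triangle_mono) (auto simp: h_def intro: mult_left_mono)
      also have "\<dots> = c3 * norm (h t)" by (simp add: c3_def algebra_simps)
      finally have "norm Rem * norm (l t) \<le> (c3 * norm (h t)) * norm (l t)" by (rule mult_right_mono) simp
      also have "\<dots> \<le> c3 * X" unfolding mult.assoc using X(2) c0(3) by (rule mult_left_mono)
      finally show ?thesis using norm_cauchy_schwarz[of Rem "l t"] by linarith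
    qed
    have "E' \<le> lam * (C * X) + 2 * (norm \<Phi> * norm (l t))"
      unfolding E'eq
    proof (intro add_mono mult_left_mono lam0)
      show "inner (Ps (s - 1) b' (h t)) (h t) - 2 * inner (Ps s db (h t)) (l t) + 2 * inner Rem (l t) \<le> C * X"
        using i1 i2 i3 by (simp add: C_def algebra_simps)
      show "inner \<Phi> (l t) \<le> norm \<Phi> * norm (l t)" by (rule norm_cauchy_schwarz)
    qed simp
    then show "\<exists>E'. ((\<lambda>r. energy k s q lam (y1 r) (y1 r - y2 r) (z1 r - z2 r)) has_vector_derivative E') (at t within S) \<and>
       E' \<le> lam * C * ((norm (y1 t - y2 t))\<^sup>2 + (norm (z1 t - z2 t))\<^sup>2) + 2 * norm \<Phi> * norm (z1 t - z2 t)"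
      using E unfolding X_def h_def l_def by (auto simp: mult.assoc)
  qed
qed

section \<open>Differential inequalities, continuation, and ordinary differential equations\<close>

lemma nonpos_vector_deriv_le:
  fixes f :: "real \<Rightarrow> real"
  assumes "0 \<le> t" "t \<le> \<tau>"
    and d: "\<And>r. r \<in> {0..\<tau>} \<Longrightarrow> (f has_vector_derivative f' r) (at r within {0..\<tau>})"
    and n: "\<And>r. r \<in> {0..\<tau>} \<Longrightarrow> f' r \<le> 0"
  shows "f t \<le> f 0"
proof (rule DERIV_nonpos_imp_decreasing_open[OF assms(1)])
  fix r assume r: "0 < r" "r < t"
  then have "(f has_real_derivative f' r) (at r within {0..\<tau>})"
    using d[of r] assms(2) by (simp add: has_real_derivative_iff_has_vector_derivative)
  moreover have "at r within {0..\<tau>} = at r"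
    using r assms(2) by (intro at_within_interior) auto
  ultimately show "\<exists>y. DERIV f r :> y \<and> y \<le> 0" using n[of r] r assms(2) by auto
next
  have "continuous_on {0..\<tau>} f"
    using d by (intro continuous_on_vector_derivative) auto
  then show "continuous_on {0..t} f" by (rule continuous_on_subset) (use assms in auto)
qed

text \<open>Stated for the square root of the energy, so that a constant forcing \<beta> contributes
  linearly in time. This is the origin of the factor \<open>1 + t\<close> in the final
  estimate.\<close>

lemma sqrt_gronwall:
  fixes E :: "real \<Rightarrow> real"
  assumes t: "0 \<le> t" "t \<le> \<tau>"
    and d: "\<And>r. r \<in> {0..\<tau>} \<Longrightarrow> (E has_vector_derivative E' r) (at r within {0..\<tau>})"
    and E0: "\<And>r. r \<in> {0..\<tau>} \<Longrightarrow> 0 \<le> E r"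
    and b: "\<And>r. r \<in> {0..\<tau>} \<Longrightarrow> E' r \<le> 2 * \<alpha> * E r + 2 * \<beta> * sqrt (E r)"
    and \<alpha>: "\<alpha> \<ge> 0" and \<beta>: "\<beta> \<ge> 0"
  shows "sqrt (E t) \<le> exp (\<alpha> * t) * (sqrt (E 0) + \<beta> * t)"
proof -
  have *: "sqrt (E t) \<le> exp (\<alpha> * t) * (sqrt (E 0) + \<eta> + \<beta> * t)" if \<eta>: "\<eta> > 0" for \<eta>
  proof -
    \<comment> \<open>Adding \<open>\<eta>\<^sup>2\<close> keeps the square root differentiable
      where the energy vanishes; \<eta> is sent to 0 at the end.\<close>
    define G where "G r = sqrt (E r + \<eta>\<^sup>2)" for r
    define H where "H r = exp (- (\<alpha> * r)) * G r - \<beta> * r" for r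
    define H' where "H' r = (exp (- (\<alpha> * r)) * (E' r / (2 * G r)) + - \<alpha> * exp (- (\<alpha> * r)) * G r) - \<beta>" for r
    have pos: "E r + \<eta>\<^sup>2 > 0" if "r \<in> {0..\<tau>}" for r using E0[OF that] \<eta> by (simp add: add_nonneg_pos)
    have Gpos: "G r > 0" if "r \<in> {0..\<tau>}" for r using pos[OF that] by (simp add: G_def)
    have dH: "(H has_vector_derivative H' r) (at r within {0..\<tau>})" if r: "r \<in> {0..\<tau>}" for r
    proof -
      have "(E has_real_derivative E' r) (at r within {0..\<tau>})"
        using d[OF r] by (simp add: has_real_derivative_iff_has_vector_derivative)
      then have "(G has_real_derivative (E' r / (2 * G r))) (at r within {0..\<tau>})"
        unfolding G_def using pos[OF r]
        by (auto intro!: derivative_eq_intros simp: divide_simps)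
      then have "(H has_real_derivative H' r) (at r within {0..\<tau>})"
        unfolding H_def H'_def by (auto intro!: derivative_eq_intros)
      then show ?thesis by (simp add: has_real_derivative_iff_has_vector_derivative)
    qed
    have "H t \<le> H 0"
    proof (rule nonpos_vector_deriv_le[OF t dH])
      fix r assume r: "r \<in> {0..\<tau>}"
      have G2: "(G r)\<^sup>2 = E r + \<eta>\<^sup>2" unfolding G_def using pos[OF r] by simp
      have sG: "sqrt (E r) \<le> G r" unfolding G_def by simp
      have "E' r \<le> 2 * \<alpha> * E r + 2 * \<beta> * sqrt (E r)" by (rule b[OF r])
      also have "\<dots> \<le> 2 * \<alpha> * (G r)\<^sup>2 + 2 * \<beta> * G r"
        using G2 sG \<alpha> \<beta> by (intro add_mono mult_left_mono) auto
      also have "\<dots> = (\<alpha> * G r + \<beta>) * (2 * G r)" by (simp add: power2_eq_square algebra_simps)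
      finally have "E' r / (2 * G r) \<le> \<alpha> * G r + \<beta>"
        using Gpos[OF r] by (simp add: pos_divide_le_eq)
      then have "exp (- (\<alpha> * r)) * (E' r / (2 * G r)) \<le> exp (- (\<alpha> * r)) * (\<alpha> * G r + \<beta>)"
        by (rule mult_left_mono) simp
      moreover have "exp (- (\<alpha> * r)) * \<beta> \<le> 1 * \<beta>"
        using \<alpha> \<beta> r by (intro mult_right_mono) auto
      ultimately show "H' r \<le> 0" by (simp add: H'_def algebra_simps)
    qed
    then have "exp (- (\<alpha> * t)) * G t \<le> G 0 + \<beta> * t" by (simp add: H_def)
    then have "exp (\<alpha> * t) * (exp (- (\<alpha> * t)) * G t) \<le> exp (\<alpha> * t) * (G 0 + \<beta> * t)" by (rule mult_left_mono) simp
    then have "G t \<le> exp (\<alpha> * t) * (G 0 + \<beta> * t)" by (simp add: mult.assoc[symmetric] exp_add[symmetric])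
    moreover have "G 0 \<le> sqrt (E 0) + \<eta>"
      unfolding G_def using sqrt_add_le_add_sqrt[of "E 0" "\<eta>\<^sup>2"] E0[of 0] t \<eta> by simp
    moreover have "sqrt (E t) \<le> G t" unfolding G_def by simp
    moreover have "exp (\<alpha> * t) * (G 0 + \<beta> * t) \<le> exp (\<alpha> * t) * (sqrt (E 0) + \<eta> + \<beta> * t)"
      using \<open>G 0 \<le> sqrt (E 0) + \<eta>\<close> by (intro mult_left_mono) auto
    ultimately show ?thesis by linarith
  qed
  show ?thesis
  proof (rule field_le_epsilon)
    fix e :: real assume "e > 0"
    then have "e / exp (\<alpha> * t) > 0" by simp
    from *[OF this] show "sqrt (E t) \<le> exp (\<alpha> * t) * (sqrt (E 0) + \<beta> * t) + e"
      by (simp add: algebra_simps)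
  qed
qed

text \<open>At the first time \<open>t0\<close> when \<open>f\<close> reaches \<open>M\<close>, the
  bound \<open>M\<close> still holds on \<open>{0..t0}\<close>, and the hypothesis improves it to a
  strict one.\<close>

lemma bootstrap:
  fixes f :: "real \<Rightarrow> real"
  assumes c: "continuous_on {0..\<tau>} f" and "f 0 < M"
    and imp: "\<And>t. t \<in> {0..\<tau>} \<Longrightarrow> (\<And>r. r \<in> {0..t} \<Longrightarrow> f r \<le> M) \<Longrightarrow> f t < M"
    and t: "t \<in> {0..\<tau>}"
  shows "f t < M"
proof (rule ccontr)
  assume nt: "\<not> f t < M"
  define A where "A = {r \<in> {0..\<tau>}. M \<le> f r}"
  have "A = {0..\<tau>} \<inter> f -` {M..}" by (auto simp: A_def)
  then have "closed A" using continuous_closed_preimage[OF c closed_atLeastAtMost closed_atLeast[of M]] by simp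
  have ne: "A \<noteq> {}" and bA: "bdd_below A" using nt t by (auto simp: A_def intro: bdd_belowI[of _ 0])
  define t0 where "t0 = Inf A"
  have t0A: "t0 \<in> A" unfolding t0_def using \<open>closed A\<close> ne bA by (simp add: closed_contains_Inf)
  have t0m: "t0 \<le> r" if "r \<in> A" for r unfolding t0_def using that bA by (rule cInf_lower)
  have t0: "0 \<le> t0" "t0 \<le> \<tau>" "M \<le> f t0" using t0A by (auto simp: A_def)
  have c0: "continuous_on {0..t0} f" by (rule continuous_on_subset[OF c]) (use t0 in auto)
  obtain t1 where t1: "0 \<le> t1" "t1 \<le> t0" "f t1 = M"
    using IVT'[of f 0 M t0] assms(2) t0 c0 by auto
  have "t1 \<in> A" using t1 t0 by (simp add: A_def)
  then have "t1 = t0" using t0m t1 by force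
  have below: "f r \<le> M" if "r \<in> {0..t0}" for r
  proof (cases "r = t0")
    case True then show ?thesis using t1 \<open>t1 = t0\<close> by simp
  next
    case False
    show ?thesis
    proof (rule ccontr)
      assume "\<not> f r \<le> M"
      then have "r \<in> A" using that t0 by (simp add: A_def)
      then show False using t0m[of r] that False by simp
    qed
  qed
  have "f t0 < M" by (rule imp) (use below t0 in auto)
  then show False using t0 by simp
qed

lemma has_vector_derivative_limit:
  fixes f :: "nat \<Rightarrow> real \<Rightarrow> 'b::banach"
  assumes d: "\<And>n t. t \<in> {0..\<tau>} \<Longrightarrow> (f n has_vector_derivative f' n t) (at t within {0..\<tau>})"
    and u: "\<And>e. e > 0 \<Longrightarrow> \<forall>\<^sub>F n in sequentially. \<forall>t\<in>{0..\<tau>}. norm (f' n t - g' t) \<le> e"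
    and l: "\<And>t. t \<in> {0..\<tau>} \<Longrightarrow> (\<lambda>n. f n t) \<longlonglongrightarrow> g t"
    and t: "t \<in> {0..\<tau>}"
  shows "(g has_vector_derivative g' t) (at t within {0..\<tau>})"
proof -
  have "\<exists>g0. \<forall>x\<in>{0..\<tau>}. (\<lambda>n. f n x) \<longlonglongrightarrow> g0 x \<and> (g0 has_derivative (\<lambda>h. h *\<^sub>R g' x)) (at x within {0..\<tau>})"
  proof (rule has_derivative_sequence[where f'="\<lambda>n x h. h *\<^sub>R f' n x"])
    show "t \<in> {0..\<tau>}" "(\<lambda>n. f n t) \<longlonglongrightarrow> g t" using t l by auto
    fix e :: real assume "e > 0"
    from u[OF this] show "\<forall>\<^sub>F n in sequentially. \<forall>x\<in>{0..\<tau>}. \<forall>h. norm (h *\<^sub>R f' n x - h *\<^sub>R g' x) \<le> e * norm h"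
    proof eventually_elim
      fix n assume "\<forall>t\<in>{0..\<tau>}. norm (f' n t - g' t) \<le> e"
      then show "\<forall>x\<in>{0..\<tau>}. \<forall>h. norm (h *\<^sub>R f' n x - h *\<^sub>R g' x) \<le> e * norm h"
        by (auto simp: scaleR_diff_right[symmetric] mult.commute[of e] intro: mult_left_mono)
    qed
  qed (use d in \<open>auto simp: has_vector_derivative_def\<close>)
  then obtain g0 where g0: "\<And>x. x \<in> {0..\<tau>} \<Longrightarrow> (\<lambda>n. f n x) \<longlonglongrightarrow> g0 x"
    "\<And>x. x \<in> {0..\<tau>} \<Longrightarrow> (g0 has_derivative (\<lambda>h. h *\<^sub>R g' x)) (at x within {0..\<tau>})" by blast
  have "g x = g0 x" if "x \<in> {0..\<tau>}" for x using LIMSEQ_unique[OF l[OF that] g0(1)[OF that]] .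
  then show ?thesis
    using has_vector_derivative_transform[OF t, of g g0 "g' t"] g0(2)[OF t] by (simp add: has_vector_derivative_def)
qed

text \<open>Picard iteration on the whole interval at once: measured with the weight
  \<open>exp (2 * L * t)\<close>, each step contracts by 1/2, so no short intervals have to be
  glued.\<close>

lemma ode_exists:
  fixes G :: "'a::banach \<Rightarrow> 'a"
  assumes \<tau>: "\<tau> \<ge> 0" and lip: "\<And>x y. norm (G x - G y) \<le> L * norm (x - y)" and L: "L > 0"
  shows "\<exists>x. x 0 = x0 \<and> (\<forall>t\<in>{0..\<tau>}. (x has_vector_derivative G (x t)) (at t within {0..\<tau>}))"
proof -
  define X :: "nat \<Rightarrow> real \<Rightarrow> 'a" where "X = rec_nat (\<lambda>t. x0) (\<lambda>_ X t. x0 + integral {0..t} (\<lambda>r. G (X r)))"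
  have X0: "X 0 = (\<lambda>t. x0)" and XS: "X (Suc k) = (\<lambda>t. x0 + integral {0..t} (\<lambda>r. G (X k r)))" for k
    by (simp_all add: X_def)
  have cG: "continuous_on S G" for S
  proof (rule continuous_onI)
    fix x e :: real and y assume "e > 0"
    show "\<exists>d>0. \<forall>x'\<in>S. dist x' y < d \<longrightarrow> dist (G x') (G y) \<le> e"
    proof (intro exI[of _ "e / L"] conjI ballI impI)
      fix x' assume "dist x' y < e / L"
      then have "L * norm (x' - y) \<le> e" using L by (simp add: dist_norm field_simps)
      then show "dist (G x') (G y) \<le> e" using lip[of x' y] by (simp add: dist_norm)
    qed (use \<open>e > 0\<close> L in simp)
  qed
  have cX: "continuous_on {0..\<tau>} (X k)" for k
  proof (induction k)
    case 0 show ?case by (simp add: X0)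
  next
    case (Suc k)
    have "continuous_on {0..\<tau>} (\<lambda>r. G (X k r))"
      by (rule continuous_on_compose2[OF cG[of UNIV] Suc]) auto
    then show ?case unfolding XS
      by (intro continuous_intros indefinite_integral_continuous_1 integrable_continuous_interval)
  qed
  have cGX: "continuous_on {0..t} (\<lambda>r. G (X k r))" if "t \<le> \<tau>" for k t
  proof -
    have "continuous_on {0..\<tau>} (\<lambda>r. G (X k r))"
      by (rule continuous_on_compose2[OF cG[of UNIV] cX]) auto
    then show ?thesis by (rule continuous_on_subset) (use that in auto)
  qed
  have dX: "(X (Suc k) has_vector_derivative G (X k t)) (at t within {0..\<tau>})" if t: "t \<in> {0..\<tau>}" for k t
    unfolding XS using has_vector_derivative_add[OF has_vector_derivative_const integral_has_vector_derivative[OF cGX[of \<tau> k] t]]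
    by simp
  obtain D where D: "D \<ge> 0" "\<And>t. t \<in> {0..\<tau>} \<Longrightarrow> norm (X 1 t - X 0 t) \<le> D"
  proof -
    have "bounded ((\<lambda>t. X 1 t - X 0 t) ` {0..\<tau>})"
      by (intro compact_imp_bounded compact_continuous_image continuous_on_diff cX compact_Icc)
    then obtain D where D: "\<And>t. t \<in> {0..\<tau>} \<Longrightarrow> norm (X 1 t - X 0 t) \<le> D" unfolding bounded_iff by blast
    have "norm (X 1 t - X 0 t) \<le> max D 0" if "t \<in> {0..\<tau>}" for t using D[OF that] by linarith
    then show thesis using that[of "max D 0"] by simp
  qed
  \<comment> \<open>Integrating the Lipschitz bound against \<open>exp (2 * L * r)\<close> gains the
    factor 1/(2L), which together with \<open>L\<close> is the contraction factor 1/2.\<close>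
  have inc: "norm (X (Suc k) t - X k t) \<le> D * (1/2)^k * exp (2 * L * t)" if "t \<in> {0..\<tau>}" for k t
    using that
  proof (induction k arbitrary: t)
    case 0
    have "D * 1 \<le> D * exp (2 * L * t)" using D(1) L 0 by (intro mult_left_mono) auto
    then show ?case using D(2)[OF 0] by simp
  next
    case (Suc k)
    have t: "0 \<le> t" "t \<le> \<tau>" using Suc by auto
    have i: "((\<lambda>r. 2 * L * exp (2 * L * r)) has_integral (exp (2 * L * t) - exp (2 * L * 0))) {0..t}"
      by (rule fundamental_theorem_of_calculus[OF t(1)])
         (auto intro!: derivative_eq_intros simp: has_real_derivative_iff_has_vector_derivative[symmetric])
    have i2: "((\<lambda>r. (D * (1/2)^(Suc k)) * (2 * L * exp (2 * L * r))) has_integral ((D * (1/2)^(Suc k)) * (exp (2 * L * t) - exp (2 * L * 0)))) {0..t}"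
      by (rule has_integral_mult_right[OF i])
    have "X (Suc (Suc k)) t - X (Suc k) t = integral {0..t} (\<lambda>r. G (X (Suc k) r) - G (X k r))"
      unfolding XS[of "Suc k"] XS[of k, THEN fun_cong, of t]
      by (subst Henstock_Kurzweil_Integration.integral_diff) (auto intro!: integrable_continuous_interval cGX t)
    also have "norm \<dots> \<le> integral {0..t} (\<lambda>r. (D * (1/2)^(Suc k)) * (2 * L * exp (2 * L * r)))"
    proof (rule Henstock_Kurzweil_Integration.integral_norm_bound_integral)
      show "(\<lambda>r. G (X (Suc k) r) - G (X k r)) integrable_on {0..t}"
        by (intro integrable_continuous_interval continuous_on_diff cGX t)
      show "(\<lambda>r. (D * (1/2)^(Suc k)) * (2 * L * exp (2 * L * r))) integrable_on {0..t}" using i2 by blast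
      fix r assume r: "r \<in> {0..t}"
      have "norm (G (X (Suc k) r) - G (X k r)) \<le> L * norm (X (Suc k) r - X k r)" by (rule lip)
      also have "\<dots> \<le> L * (D * (1/2)^k * exp (2 * L * r))"
        using Suc.IH[of r] r t L by (intro mult_left_mono) auto
      finally show "norm (G (X (Suc k) r) - G (X k r)) \<le> (D * (1/2)^(Suc k)) * (2 * L * exp (2 * L * r))"
        by (simp only: power_Suc) (simp add: mult_ac)
    qed
    also have "\<dots> = (D * (1/2)^(Suc k)) * (exp (2 * L * t) - 1)" using integral_unique[OF i2] by simp
    also have "\<dots> \<le> (D * (1/2)^(Suc k)) * exp (2 * L * t)" using D(1) by (intro mult_left_mono) auto
    finally show ?case .
  qed
  define E where "E = D * exp (2 * L * \<tau>)"
  have E0: "E \<ge> 0" using D(1) by (simp add: E_def)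
  have inc': "norm (X (Suc k) t - X k t) \<le> E * (1/2)^k" if t: "t \<in> {0..\<tau>}" for k t
  proof -
    have "D * (1/2)^k * exp (2 * L * t) \<le> D * (1/2)^k * exp (2 * L * \<tau>)"
      using D(1) t L by (intro mult_left_mono) auto
    then show ?thesis using inc[OF t, of k] by (simp add: E_def mult_ac)
  qed
  define x where "x t = (if t \<in> {0..\<tau>} then lim (\<lambda>k. X k t) else x0)" for t
  have dist: "norm (X (k + j) t - X k t) \<le> 2 * E * (1/2)^k" if t: "t \<in> {0..\<tau>}" for j k t
  proof -
    have "norm (X (k + j) t - X k t) \<le> E * (1/2)^k * (2 - 2 * (1/2)^j)"
    proof (induction j)
      case (Suc j)
      have "norm (X (k + Suc j) t - X k t) \<le> norm (X (Suc (k + j)) t - X (k + j) t) + norm (X (k + j) t - X k t)"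
        using norm_triangle_ineq[of "X (Suc (k + j)) t - X (k + j) t" "X (k + j) t - X k t"] by simp
      also have "\<dots> \<le> E * (1/2)^(k + j) + E * (1/2)^k * (2 - 2 * (1/2)^j)"
        by (intro add_mono inc'[OF t] Suc)
      also have "\<dots> = E * (1/2)^k * (2 - 2 * (1/2)^(Suc j))" by (simp add: power_add algebra_simps)
      finally show ?case .
    qed simp
    also have "\<dots> \<le> E * (1/2)^k * 2" using E0 by (intro mult_left_mono) auto
    finally show ?thesis by (simp add: mult_ac)
  qed
  have half: "(\<lambda>k. 2 * E * (1/2::real)^k) \<longlonglongrightarrow> 0"
    using tendsto_mult_right_zero[OF LIMSEQ_power_zero[of "1/2::real"], of "2 * E"] by simp
  have lim: "(\<lambda>k. X k t) \<longlonglongrightarrow> x t" if t: "t \<in> {0..\<tau>}" for t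
  proof -
    have "Cauchy (\<lambda>k. X k t)"
    proof (rule CauchyI')
      fix e :: real assume "e > 0"
      then obtain N where N: "2 * E * (1/2::real)^N < e"
        using order_tendstoD(2)[OF half] by (auto simp: eventually_sequentially)
      have "dist (X m t) (X (m + (n - m)) t) < e" if "m \<ge> N" "n > m" for m n
      proof -
        have "2 * E * (1/2::real)^m \<le> 2 * E * (1/2)^N" using that E0 by (intro mult_left_mono power_decreasing) auto
        then show ?thesis using dist[OF t, of m "n - m"] N by (simp add: dist_norm norm_minus_commute)
      qed
      then show "\<exists>M. \<forall>m\<ge>M. \<forall>n>m. dist (X m t) (X n t) < e" by (metis add_diff_inverse_nat less_imp_le_nat not_less)
    qed
    then show ?thesis using t by (simp add: x_def Cauchy_convergent_iff convergent_LIMSEQ_iff)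
  qed
  have xd: "norm (x t - X k t) \<le> 2 * E * (1/2)^k" if t: "t \<in> {0..\<tau>}" for k t
  proof (rule LIMSEQ_le_const2)
    show "(\<lambda>j. norm (X (j + k) t - X k t)) \<longlonglongrightarrow> norm (x t - X k t)"
      by (intro tendsto_intros LIMSEQ_ignore_initial_segment lim t)
    show "\<exists>N. \<forall>j\<ge>N. norm (X (j + k) t - X k t) \<le> 2 * E * (1/2)^k"
      using dist[OF t, of k] by (auto simp: add.commute)
  qed
  have "(x has_vector_derivative G (x t)) (at t within {0..\<tau>})" if t: "t \<in> {0..\<tau>}" for t
  proof (rule has_vector_derivative_limit[where f="\<lambda>k. X (Suc k)" and f'="\<lambda>k t. G (X k t)" and g'="\<lambda>t. G (x t)", OF dX _ _ t])
    show "(\<lambda>n. X (Suc n) t) \<longlonglongrightarrow> x t" if "t \<in> {0..\<tau>}" for t using lim[OF that] by (rule LIMSEQ_Suc)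
    fix e :: real assume "e > 0"
    then have "e / L > 0" using L by simp
    from order_tendstoD(2)[OF half this]
    show "\<forall>\<^sub>F n in sequentially. \<forall>t\<in>{0..\<tau>}. norm (G (X n t) - G (x t)) \<le> e"
    proof eventually_elim
      fix n assume n: "2 * E * (1/2)^n < e / L"
      show "\<forall>t\<in>{0..\<tau>}. norm (G (X n t) - G (x t)) \<le> e"
      proof
        fix t assume t: "t \<in> {0..\<tau>}"
        have "norm (G (X n t) - G (x t)) \<le> L * norm (x t - X n t)" using lip[of "X n t" "x t"] by (simp add: norm_minus_commute)
        also have "\<dots> \<le> L * (e / L)" using xd[OF t, of n] n L by (intro mult_left_mono) auto
        finally show "norm (G (X n t) - G (x t)) \<le> e" using L by simp
      qed
    qed
  qed
  moreover have "x 0 = x0"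
  proof -
    have "X k 0 = x0" for k by (cases k) (simp_all add: X0 XS)
    then have "(\<lambda>k. X k 0) \<longlonglongrightarrow> x0" by simp
    then show ?thesis using lim[of 0] \<tau> LIMSEQ_unique by auto
  qed
  ultimately show ?thesis by blast
qed

subsection \<open>Truncated equations\<close>

text \<open>The only features of a symbol on which later constants depend are its two bounds. They
  are preserved by \<xi> \<mapsto> \<delta>\<xi>, which is the source of uniformity in
  \<delta>.\<close>

definition mclass :: "real \<Rightarrow> real \<Rightarrow> (real \<Rightarrow> real) \<Rightarrow> bool" where
  "mclass c1 c2 m \<longleftrightarrow> 0 < c1 \<and> m \<in> borel_measurable borel \<and> (\<forall>\<xi>. c1 \<le> m \<xi> \<and> m \<xi> \<le> c2 \<and> m (- \<xi>) = m \<xi>)"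

text \<open>A sharp cutoff, because it is idempotent, self-adjoint, even, and commutes with every
  multiplier; \<open>Dn n\<close> is then a bounded derivative on its range.\<close>

definition Jn :: "real \<Rightarrow> real \<Rightarrow> complex" where "Jn n \<xi> = (if \<bar>\<xi>\<bar> \<le> n then 1 else 0)"
definition Dn :: "real \<Rightarrow> real \<Rightarrow> complex" where "Dn n \<xi> = \<i> * \<xi> * Jn n \<xi>"

abbreviation csym :: "(real \<Rightarrow> real) \<Rightarrow> real \<Rightarrow> complex" where "csym m \<equiv> (\<lambda>\<xi>. complex_of_real (m \<xi>))"

lemma Jn_measurable [measurable]: "Jn n \<in> borel_measurable borel" unfolding Jn_def by measurable
lemma bsym_Jn: "bsym (Jn n)" by (rule bsymI[of _ 1]) (auto simp: Jn_def)
lemma cmod_Dn: "cmod (Dn n \<xi>) \<le> \<bar>n\<bar>" by (auto simp: Dn_def Jn_def norm_mult)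
lemma bsym_Dn: "bsym (Dn n)" by (rule bsymI[OF _ cmod_Dn]) (unfold Dn_def, measurable)
lemma Jn_Dn: "Jn n \<xi> * Dn n \<xi> = Dn n \<xi>" by (simp add: Dn_def Jn_def)
lemma Jn_idem: "Jn n \<xi> * Jn n \<xi> = Jn n \<xi>" by (simp add: Jn_def)

lemma mclass_pos: "mclass c1 c2 m \<Longrightarrow> m \<xi> > 0" unfolding mclass_def by (meson less_le_trans)
lemma mclass_c2: "mclass c1 c2 m \<Longrightarrow> 0 < c2"
  unfolding mclass_def by (meson less_le_trans order_trans)

lemma mclass_measurable [measurable_dest]: "mclass c1 c2 m \<Longrightarrow> m \<in> borel_measurable borel"
  by (simp add: mclass_def)

lemma cmod_m_le: assumes "mclass c1 c2 m" shows "cmod (csym m \<xi>) \<le> c2"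
  using assms mclass_pos[OF assms, of \<xi>] by (simp add: mclass_def)

lemma cmod_inv_m_le: assumes "mclass c1 c2 m" shows "cmod (csym (\<lambda>\<xi>. 1 / m \<xi>) \<xi>) \<le> 1 / c1"
  using assms mclass_pos[OF assms, of \<xi>] by (simp add: mclass_def norm_divide frac_le)

lemma bsym_m: assumes "mclass c1 c2 m" shows "bsym (csym m)"
  by (rule bsymI[OF _ cmod_m_le[OF assms]]) (use assms in measurable)

lemma bsym_inv_m: assumes "mclass c1 c2 m" shows "bsym (csym (\<lambda>\<xi>. 1 / m \<xi>))"
  by (rule bsymI[OF _ cmod_inv_m_le[OF assms]]) (use assms in measurable)

lemma isD_Jn: "mulS (Jn n) x = x \<Longrightarrow> isD x (mulS (Dn n) x)"
proof -
  assume J: "mulS (Jn n) x = x"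
  have "isD (mulS (Jn n) x) (mulS (\<lambda>\<xi>. \<i> * \<xi> * Jn n \<xi>) x)"
    by (rule isD_mulS_sym[OF bsym_Jn]) (use bsym_Dn[of n] in \<open>simp add: Dn_def[abs_def]\<close>)
  then show ?thesis unfolding J by (simp add: Dn_def[abs_def])
qed

text \<open>Composing the nonlinearity with this retraction onto a ball makes it globally Lipschitz,
  so the truncated system has a solution for all times. The a priori bound later shows that the
  retraction never acts.\<close>

definition retr :: "real \<Rightarrow> 'a::real_normed_vector \<Rightarrow> 'a" where
  "retr M x = (if norm x \<le> M then x else (M / norm x) *\<^sub>R x)"

lemma norm_retr: "M \<ge> 0 \<Longrightarrow> norm (retr M x) \<le> M" by (auto simp: retr_def)

lemma retr_lipschitz:
  assumes M: "M \<ge> 0" shows "norm (retr M x - retr M y) \<le> 2 * norm (x - y)"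
proof -
  have 1: "norm (retr M x - retr M y) \<le> 2 * norm (x - y)" if "norm x > M" "norm y \<le> M" for x y :: 'a
  proof -
    have x0: "norm x > 0" using that M by linarith
    have "retr M x - retr M y = (x - y) - (1 - M / norm x) *\<^sub>R x" using that by (simp add: retr_def algebra_simps)
    also have "norm \<dots> \<le> norm (x - y) + \<bar>1 - M / norm x\<bar> * norm x"
      by (rule order_trans[OF norm_triangle_ineq4]) simp
    also have "\<bar>1 - M / norm x\<bar> * norm x = norm x - M"
      using that M x0 by (simp add: abs_if field_simps)
    also have "norm (x - y) + (norm x - M) \<le> 2 * norm (x - y)"
      using that norm_triangle_ineq2[of x y] by simp
    finally show ?thesis .
  qed
  consider "norm x \<le> M" "norm y \<le> M" | "norm x > M" "norm y \<le> M" | "norm x \<le> M" "norm y > M" | "norm x > M" "norm y > M"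
    by linarith
  then show ?thesis
  proof cases
    case 1 then show ?thesis using norm_ge_zero[of "x - y"] by (simp add: retr_def)
  next
    case 2 then show ?thesis by (rule 1)
  next
    case 3 then show ?thesis using 1[of y x] by (simp add: norm_minus_commute)
  next
    case 4
    then have x0: "norm x > 0" "norm y > 0" using M by linarith+
    have "retr M x - retr M y = (M / norm x) *\<^sub>R (x - y) + (M / norm x - M / norm y) *\<^sub>R y"
      using 4 by (simp add: retr_def algebra_simps)
    also have "norm \<dots> \<le> (M / norm x) * norm (x - y) + \<bar>M / norm x - M / norm y\<bar> * norm y"
      using M by (intro order_trans[OF norm_triangle_ineq]) simp
    also have "\<bar>M / norm x - M / norm y\<bar> * norm y = (M / norm x) * \<bar>norm y - norm x\<bar>"
    proof -
      have "M / norm x - M / norm y = (M / norm x) * ((norm y - norm x) / norm y)"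
        using x0 by (simp add: field_simps)
      then show ?thesis using x0 M by (simp add: abs_mult)
    qed
    also have "(M / norm x) * norm (x - y) + (M / norm x) * \<bar>norm y - norm x\<bar> \<le> 1 * norm (x - y) + 1 * norm (x - y)"
    proof (intro add_mono mult_mono)
      show "M / norm x \<le> 1" "M / norm x \<le> 1" using 4 x0 by simp_all
      show "\<bar>norm y - norm x\<bar> \<le> norm (x - y)" using norm_triangle_ineq3[of y x] by (simp add: norm_minus_commute)
    qed (use M in auto)
    finally show ?thesis by simp
  qed
qed

text \<open>Invariance under the cutoff is part of the notion: it provides the derivatives of
  \<open>y\<close> and \<open>z\<close> and lets the cutoff be dropped in pairings with
  them.\<close>

definition gal :: "(real \<Rightarrow> real) \<Rightarrow> real \<Rightarrow> nat \<Rightarrow> real \<Rightarrow> real \<Rightarrow> real \<Rightarrow> (real \<Rightarrow> l2) \<Rightarrow> (real \<Rightarrow> l2) \<Rightarrow> bool" where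
  "gal m s q lam n \<tau> y z \<longleftrightarrow> (\<forall>t\<in>{0..\<tau>}.
     (y has_vector_derivative mulS (Dn n) (z t)) (at t within {0..\<tau>}) \<and>
     (z has_vector_derivative mulS (csym m) (mulS (Dn n) (y t + lam *\<^sub>R pw s (y t) (Suc q)))) (at t within {0..\<tau>}) \<and>
     mulS (Jn n) (y t) = y t \<and> mulS (Jn n) (z t) = z t \<and> herm (y t))"

lemma gal_truncated_exists:
  assumes s: "s \<ge> 1" and m: "mclass c1 c2 m" and M: "M \<ge> 0" and \<tau>: "\<tau> \<ge> 0"
    and h0: "herm Y0" "herm Z0" and lam0: "lam \<ge> 0"
  obtains y z where "y 0 = mulS (Jn n) Y0" "z 0 = mulS (Jn n) Z0"
    "\<And>t. t \<in> {0..\<tau>} \<Longrightarrow> (y has_vector_derivative mulS (Dn n) (z t)) (at t within {0..\<tau>})"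
    "\<And>t. t \<in> {0..\<tau>} \<Longrightarrow> (z has_vector_derivative mulS (csym m) (mulS (Dn n) (y t + lam *\<^sub>R pw s (retr M (y t)) (Suc q)))) (at t within {0..\<tau>})"
    "\<And>t. t \<in> {0..\<tau>} \<Longrightarrow> mulS (Jn n) (y t) = y t" "\<And>t. t \<in> {0..\<tau>} \<Longrightarrow> mulS (Jn n) (z t) = z t"
    "\<And>t. t \<in> {0..\<tau>} \<Longrightarrow> herm (y t)"
proof -
  obtain C where C: "C \<ge> 0" "\<And>x y. norm x \<le> M \<Longrightarrow> norm y \<le> M \<Longrightarrow> norm (pw s x (Suc q) - pw s y (Suc q)) \<le> C * norm (x - y)"
    using lipb_pw[OF s, of "Suc q"] M unfolding lipb_def by metis
  define G :: "l2 \<times> l2 \<Rightarrow> l2 \<times> l2" where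
    "G x = (mulS (Dn n) (snd x), mulS (csym m) (mulS (Dn n) (fst x + lam *\<^sub>R pw s (retr M (fst x)) (Suc q))))" for x
  note bm = bsym_m[OF m] and bD = bsym_Dn[of n]
  have c2: "c2 > 0" using mclass_c2[OF m] .
  have nD: "norm (mulS (Dn n) v) \<le> \<bar>n\<bar> * norm v" for v by (rule norm_mulS_le[OF bD cmod_Dn])
  have nm: "norm (mulS (csym m) v) \<le> c2 * norm v" for v
    by (rule norm_mulS_le[OF bm cmod_m_le[OF m]])
  define L where "L = \<bar>n\<bar> + c2 * (\<bar>n\<bar> * (1 + lam * (C * 2))) + 1"
  have L0: "L > 0" using c2 C(1) lam0 by (simp add: L_def add_nonneg_pos)
  have lip: "norm (G x - G x') \<le> L * norm (x - x')" for x x'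
  proof -
    have f: "norm (fst x - fst x') \<le> norm (x - x')" and sn: "norm (snd x - snd x') \<le> norm (x - x')"
      by (cases x; cases x'; simp add: norm_fst_le norm_snd_le)+
    have 1: "norm (fst (G x - G x')) \<le> \<bar>n\<bar> * norm (x - x')"
    proof -
      have "fst (G x - G x') = mulS (Dn n) (snd x - snd x')" by (simp add: G_def mulS_diff[OF bD])
      then show ?thesis using nD[of "snd x - snd x'"] mult_left_mono[OF sn, of "\<bar>n\<bar>"] by simp
    qed
    have 2: "norm (snd (G x - G x')) \<le> c2 * (\<bar>n\<bar> * (1 + lam * (C * 2))) * norm (x - x')"
    proof -
      have "snd (G x - G x') = mulS (csym m) (mulS (Dn n) ((fst x - fst x') + lam *\<^sub>R (pw s (retr M (fst x)) (Suc q) - pw s (retr M (fst x')) (Suc q))))"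
        unfolding G_def minus_prod_def snd_conv by (subst mulS_diff[OF bm, symmetric], subst mulS_diff[OF bD, symmetric]) (simp del: pw.simps add: scaleR_diff_right add_diff_add)
      also have "norm \<dots> \<le> c2 * (\<bar>n\<bar> * norm ((fst x - fst x') + lam *\<^sub>R (pw s (retr M (fst x)) (Suc q) - pw s (retr M (fst x')) (Suc q))))"
        using c2 by (intro order_trans[OF nm] mult_left_mono nD) auto
      finally have a: "norm (snd (G x - G x')) \<le> c2 * (\<bar>n\<bar> * norm ((fst x - fst x') + lam *\<^sub>R (pw s (retr M (fst x)) (Suc q) - pw s (retr M (fst x')) (Suc q))))" .
      have "norm ((fst x - fst x') + lam *\<^sub>R (pw s (retr M (fst x)) (Suc q) - pw s (retr M (fst x')) (Suc q)))
        \<le> norm (x - x') + lam * (C * (2 * norm (x - x')))"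
      proof (rule norm_triangle_mono[OF f])
        have "norm (pw s (retr M (fst x)) (Suc q) - pw s (retr M (fst x')) (Suc q)) \<le> C * norm (retr M (fst x) - retr M (fst x'))"
          by (intro C(2) norm_retr M)
        also have "\<dots> \<le> C * (2 * norm (fst x - fst x'))" by (intro mult_left_mono retr_lipschitz M C)
        also have "\<dots> \<le> C * (2 * norm (x - x'))" using f C(1) by (intro mult_left_mono) auto
        finally show "norm (lam *\<^sub>R (pw s (retr M (fst x)) (Suc q) - pw s (retr M (fst x')) (Suc q))) \<le> lam * (C * (2 * norm (x - x')))"
          using lam0 by (simp add: mult_left_mono)
      qed
      then have "c2 * (\<bar>n\<bar> * norm ((fst x - fst x') + lam *\<^sub>R (pw s (retr M (fst x)) (Suc q) - pw s (retr M (fst x')) (Suc q))))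
        \<le> c2 * (\<bar>n\<bar> * (norm (x - x') + lam * (C * (2 * norm (x - x')))))"
        using c2 by (intro mult_left_mono) auto
      also have "\<dots> = c2 * (\<bar>n\<bar> * (1 + lam * (C * 2))) * norm (x - x')" by (simp add: algebra_simps)
      finally show ?thesis using a by linarith
    qed
    have "norm (G x - G x') \<le> norm (fst (G x - G x')) + norm (snd (G x - G x'))"
      by (cases "G x - G x'") (simp add: norm_Pair_le)
    also have "\<dots> \<le> L * norm (x - x')" using 1 2 norm_ge_zero[of "x - x'"] unfolding L_def distrib_right by linarith
    finally show ?thesis .
  qed
  obtain x where x0: "x 0 = (mulS (Jn n) Y0, mulS (Jn n) Z0)" and x: "\<And>t. t \<in> {0..\<tau>} \<Longrightarrow> (x has_vector_derivative G (x t)) (at t within {0..\<tau>})"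
    using ode_exists[OF \<tau> lip L0, of "(mulS (Jn n) Y0, mulS (Jn n) Z0)"] by blast
  define y where "y t = fst (x t)" for t
  define z where "z t = snd (x t)" for t
  have y': "(y has_vector_derivative mulS (Dn n) (z t)) (at t within {0..\<tau>})" if "t \<in> {0..\<tau>}" for t
    using bounded_linear.has_vector_derivative[OF bounded_linear_fst x[OF that]] by (simp add: y_def[abs_def] z_def G_def)
  have z': "(z has_vector_derivative mulS (csym m) (mulS (Dn n) (y t + lam *\<^sub>R pw s (retr M (y t)) (Suc q)))) (at t within {0..\<tau>})" if "t \<in> {0..\<tau>}" for t
    using bounded_linear.has_vector_derivative[OF bounded_linear_snd x[OF that]] by (simp add: y_def z_def[abs_def] G_def)
  have JD: "mulS (Jn n) (mulS (Dn n) v) = mulS (Dn n) v" for v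
    by (simp add: mulS_mulS[OF bsym_Jn bD] Jn_Dn)
  have JmD: "mulS (Jn n) (mulS (csym m) (mulS (Dn n) v)) = mulS (csym m) (mulS (Dn n) v)" for v
  proof -
    have "mulS (Jn n) (mulS (csym m) w) = mulS (csym m) (mulS (Jn n) w)" for w
      by (simp add: mulS_mulS bsym_Jn bm mult.commute)
    then show ?thesis by (simp add: JD)
  qed
  \<comment> \<open>The right-hand sides lie in the range of the cutoff, so the component outside
    that range is constant in time, and it starts at 0.\<close>
  have inv: "mulS (Jn n) (w t) = w t" if w: "\<And>t. t \<in> {0..\<tau>} \<Longrightarrow> (w has_vector_derivative w' t) (at t within {0..\<tau>})"
    and w': "\<And>t. mulS (Jn n) (w' t) = w' t" and w0: "mulS (Jn n) (w 0) = w 0" and t: "t \<in> {0..\<tau>}" for w w' :: "real \<Rightarrow> l2" and t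
  proof -
    have "((\<lambda>t. w t - mulS (Jn n) (w t)) has_vector_derivative 0) (at t within {0..\<tau>})" if "t \<in> {0..\<tau>}" for t
      using has_vector_derivative_diff[OF w[OF that] bounded_linear.has_vector_derivative[OF bounded_linear_mulS[OF bsym_Jn[of n]] w[OF that]]]
      by (simp add: w')
    then obtain c where c: "\<And>t. t \<in> {0..\<tau>} \<Longrightarrow> w t - mulS (Jn n) (w t) = c"
      by (rule has_vector_derivative_zero_constant[rotated]) auto
    have "c = 0" using c[of 0] w0 \<tau> by simp
    then show ?thesis using c[OF t] by simp
  qed
  have J0: "mulS (Jn n) (mulS (Jn n) v) = mulS (Jn n) v" for v by (simp add: mulS_mulS bsym_Jn Jn_idem)
  have Jy: "mulS (Jn n) (y t) = y t" if "t \<in> {0..\<tau>}" for t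
    by (rule inv[OF y' _ _ that]) (auto simp: JD y_def x0 J0)
  have Jz: "mulS (Jn n) (z t) = z t" if "t \<in> {0..\<tau>}" for t
    by (rule inv[OF z' _ _ that]) (auto simp: JmD z_def x0 J0)
  define S where "S x = (Sop (fst x), Sop (snd x))" for x
  have blS: "bounded_linear S"
    unfolding S_def[abs_def]
    by (intro bounded_linear_Pair bounded_linear_compose[OF bounded_linear_Sop] bounded_linear_fst bounded_linear_snd)
  have SDn: "Sop (mulS (Dn n) v) = mulS (Dn n) (Sop v)" for v
    by (rule Sop_mulS[OF bD]) (simp add: Dn_def Jn_def)
  have Sm: "Sop (mulS (csym m) v) = mulS (csym m) (Sop v)" for v
    by (rule Sop_mulS[OF bm]) (use m in \<open>simp add: mclass_def\<close>)
  have SJ: "Sop (mulS (Jn n) v) = mulS (Jn n) (Sop v)" for v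
    by (rule Sop_mulS[OF bsym_Jn]) (simp add: Jn_def)
  have Sretr: "Sop (retr M v) = retr M (Sop v)" for v
    by (simp add: retr_def Sop_scaleR)
  have SG: "S (G x) = G (S x)" for x
    by (simp add: S_def G_def SDn Sm Sop_add Sop_scaleR Sop_pw[OF s] Sretr del: pw.simps)
  \<comment> \<open>The reflected curve \<open>S (x t)\<close> solves the same system with the same
    initial value, so Gronwall's inequality gives \<open>w = 0\<close>: the truncated solutions stay
    Hermitian, that is, real.\<close>
  define w where "w t = x t - S (x t)" for t
  have w': "(w has_vector_derivative (G (x t) - G (S (x t)))) (at t within {0..\<tau>})" if "t \<in> {0..\<tau>}" for t
    unfolding w_def using has_vector_derivative_diff[OF x[OF that] bounded_linear.has_vector_derivative[OF blS x[OF that]]]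
    by (simp add: SG)
  have "w t = 0" if t: "t \<in> {0..\<tau>}" for t
  proof -
    have "sqrt (inner (w t) (w t)) \<le> exp (L * t) * (sqrt (inner (w 0) (w 0)) + 0 * t)"
    proof (rule sqrt_gronwall[where E="\<lambda>t. inner (w t) (w t)" and E'="\<lambda>t. inner (w t) (G (x t) - G (S (x t))) + inner (G (x t) - G (S (x t))) (w t)"])
      show "0 \<le> t" "t \<le> \<tau>" using t by auto
      fix r assume r: "r \<in> {0..\<tau>}"
      show "((\<lambda>t. inner (w t) (w t)) has_vector_derivative inner (w r) (G (x r) - G (S (x r))) + inner (G (x r) - G (S (x r))) (w r)) (at r within {0..\<tau>})"
        by (rule bounded_bilinear.has_vector_derivative[OF bounded_bilinear_inner w'[OF r] w'[OF r]])
      have "inner (w r) (G (x r) - G (S (x r))) \<le> norm (w r) * norm (G (x r) - G (S (x r)))" by (rule norm_cauchy_schwarz)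
      also have "\<dots> \<le> norm (w r) * (L * norm (w r))"
        using lip[of "x r" "S (x r)"] by (intro mult_left_mono) (auto simp: w_def)
      also have "\<dots> = L * inner (w r) (w r)" by (simp add: power2_norm_eq_inner[symmetric] power2_eq_square)
      finally show "inner (w r) (G (x r) - G (S (x r))) + inner (G (x r) - G (S (x r))) (w r) \<le> 2 * L * inner (w r) (w r) + 2 * 0 * sqrt (inner (w r) (w r))"
        by (simp add: inner_commute)
    qed (use L0 in auto)
    moreover have "w 0 = 0" using h0 by (simp add: w_def x0 S_def SJ herm_def zero_prod_def)
    ultimately have "norm (w t) \<le> 0" by (simp add: norm_eq_sqrt_inner)
    then show ?thesis by simp
  qed
  then have hy: "herm (y t)" if "t \<in> {0..\<tau>}" for t
    using that unfolding w_def S_def herm_def y_def by (metis eq_iff_diff_eq_0 fst_conv)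
  show thesis
    by (rule that[OF _ _ y' z' Jy Jz hy]) (simp_all add: y_def z_def x0)
qed

lemma Qs_zero: "s \<ge> 1 \<Longrightarrow> Qs s 0 y = 0"
  using bounded_bilinear.zero_left[OF bb_Qs] by blast

lemma inner_inv_m:
  assumes m: "mclass c1 c2 m"
  shows "mulS (csym (\<lambda>\<xi>. 1 / m \<xi>)) (mulS (csym m) v) = v"
proof -
  have "csym (\<lambda>\<xi>. 1 / m \<xi>) \<xi> * csym m \<xi> = 1" for \<xi>
    using mclass_pos[OF m, of \<xi>] by simp
  then show ?thesis by (simp only: mulS_mulS[OF bsym_inv_m[OF m] bsym_m[OF m]] mulS_one)
qed

text \<open>The cutoff is self-adjoint. This removes it from the energy identity, where everything
  is paired with an element of its range.\<close>

lemma inner_Jn: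
  assumes "mulS (Jn n) l = l" shows "inner (mulS (Jn n) v) l = inner v l"
proof -
  have "inner (mulS (Jn n) v) l = inner v (mulS (\<lambda>\<xi>. cnj (Jn n \<xi>)) l)" by (rule inner_mulS[OF bsym_Jn])
  also have "(\<lambda>\<xi>. cnj (Jn n \<xi>)) = Jn n" by (auto simp: Jn_def)
  finally show ?thesis using assms by simp
qed

lemma mulS_Dn_isD: "isD X dX \<Longrightarrow> mulS (Dn n) X = mulS (Jn n) dX"
proof -
  assume d: "isD X dX"
  have "mulS (Jn n) dX = mulS (\<lambda>\<xi>. \<i> * \<xi> * Jn n \<xi>) X"
    by (rule isD_mulS_eq[OF bsym_Jn _ d]) (use bsym_Dn[of n] in \<open>simp add: Dn_def[abs_def]\<close>)
  then show ?thesis by (simp add: Dn_def[abs_def])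
qed

text \<open>The condition \<open>lam * Cb \<le> 1/2\<close> keeps the indefinite third term below
  half of \<open>inner h h\<close>, so the energy is equivalent to the squared norms. This is where
  \<epsilon> has to be small.\<close>

lemma energy_lower:
  assumes m: "mclass c1 c2 m" and lam0: "lam \<ge> 0"
    and b: "\<bar>inner (Ps s (bco s q y) h) h\<bar> \<le> Cb * (norm h)\<^sup>2" and l: "lam * Cb \<le> 1/2"
  shows "(1 / c2) * (norm l)\<^sup>2 + (1/2) * (norm h)\<^sup>2 \<le> energy (\<lambda>\<xi>. 1 / m \<xi>) s q lam y h l"
    and "energy (\<lambda>\<xi>. 1 / m \<xi>) s q lam y h l \<le> (1 / c1) * (norm l)\<^sup>2 + 2 * (norm h)\<^sup>2"
proof -
  have "lam * \<bar>inner (Ps s (bco s q y) h) h\<bar> \<le> lam * (Cb * (norm h)\<^sup>2)" using b lam0 by (rule mult_left_mono)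
  also have "\<dots> \<le> (1/2) * (norm h)\<^sup>2" using mult_right_mono[OF l, of "(norm h)\<^sup>2"] by (simp add: mult.assoc)
  finally have 1: "\<bar>lam * inner (Ps s (bco s q y) h) h\<bar> \<le> (1/2) * (norm h)\<^sup>2" using lam0 by (simp add: abs_mult)
  have "(1 / c2) * (norm l)\<^sup>2 \<le> inner (mulS (csym (\<lambda>\<xi>. 1 / m \<xi>)) l) l"
  proof (rule inner_mulS_ge[OF bsym_inv_m[OF m]])
    show "1 / c2 \<le> 1 / m \<xi>" for \<xi> using m mclass_pos[OF m, of \<xi>] by (intro divide_left_mono) (auto simp: mclass_def mclass_c2[OF m])
  qed
  then show "(1 / c2) * (norm l)\<^sup>2 + (1/2) * (norm h)\<^sup>2 \<le> energy (\<lambda>\<xi>. 1 / m \<xi>) s q lam y h l"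
    using 1 by (simp add: energy_def power2_norm_eq_inner[symmetric] abs_le_iff)
  have "inner (mulS (csym (\<lambda>\<xi>. 1 / m \<xi>)) l) l \<le> norm (mulS (csym (\<lambda>\<xi>. 1 / m \<xi>)) l) * norm l" by (rule norm_cauchy_schwarz)
  also have "\<dots> \<le> ((1 / c1) * norm l) * norm l"
    by (intro mult_right_mono norm_mulS_le[OF bsym_inv_m[OF m] cmod_inv_m_le[OF m]]) simp
  finally have "inner (mulS (csym (\<lambda>\<xi>. 1 / m \<xi>)) l) l \<le> (1 / c1) * (norm l)\<^sup>2" by (simp add: power2_eq_square mult.assoc)
  then show "energy (\<lambda>\<xi>. 1 / m \<xi>) s q lam y h l \<le> (1 / c1) * (norm l)\<^sup>2 + 2 * (norm h)\<^sup>2"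
    using 1 by (simp add: energy_def power2_norm_eq_inner[symmetric] abs_le_iff)
qed

text \<open>Bundles the differential hypotheses of \<open>ebound\<close> at one time, with the
  reciprocal symbol in place of \<open>k\<close> and \<open>F\<close> as a bound on the error
  term.\<close>

definition ediff :: "(real \<Rightarrow> real) \<Rightarrow> real \<Rightarrow> nat \<Rightarrow> real \<Rightarrow> real set \<Rightarrow> real \<Rightarrow> real \<Rightarrow> (real \<Rightarrow> l2) \<Rightarrow> (real \<Rightarrow> l2) \<Rightarrow> (real \<Rightarrow> l2) \<Rightarrow> (real \<Rightarrow> l2) \<Rightarrow> real \<Rightarrow> bool" where
  "ediff m s q lam S M F y1 z1 y2 z2 v \<longleftrightarrow> (\<exists>dy1 dy2 dz1 dz2 dF1 dF2 l' \<Phi>.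
     (y1 has_vector_derivative dz1) (at v within S) \<and> (y2 has_vector_derivative dz2) (at v within S) \<and>
     isD (z1 v) dz1 \<and> isD (z2 v) dz2 \<and> isD (y1 v) dy1 \<and> isD (y2 v) dy2 \<and>
     ((\<lambda>r. z1 r - z2 r) has_vector_derivative l') (at v within S) \<and>
     isD (pw s (y1 v) (Suc q)) dF1 \<and> isD (pw s (y2 v) (Suc q)) dF2 \<and>
     inner (mulS (csym (\<lambda>\<xi>. 1 / m \<xi>)) l') (z1 v - z2 v) = inner (dy1 - dy2 + lam *\<^sub>R (dF1 - dF2) + \<Phi>) (z1 v - z2 v) \<and>
     norm dy2 \<le> M \<and> norm \<Phi> \<le> F)"

text \<open>Gronwall's inequality for the energy; its equivalence with the norms costs
  \<open>sqrt (1 / c1 + 2)\<close> at time 0 and \<open>1 / sqrt k0\<close> at time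
  \<open>t\<close>. The exponent is proportional to \<open>lam * t\<close>, so the bound is uniform
  for \<open>t \<le> T / lam\<close>.\<close>

lemma energy_comparison:
  assumes m: "mclass c1 c2 m" and lam: "lam \<ge> 0" and C: "C \<ge> 0" and ED: "ebound s q M C" and F: "F \<ge> 0"
    and Cb: "\<And>v h. v \<in> {0..\<tau>} \<Longrightarrow> \<bar>inner (Ps s (bco s q (y1 v)) h) h\<bar> \<le> Cb * (norm h)\<^sup>2" "lam * Cb \<le> 1/2"
    and b: "\<And>v. v \<in> {0..\<tau>} \<Longrightarrow> herm (y1 v) \<and> norm (y1 v) \<le> M \<and> norm (y2 v) \<le> M \<and> norm (z1 v) \<le> M"
    and d: "\<And>v. v \<in> {0..\<tau>} \<Longrightarrow> ediff m s q lam {0..\<tau>} M F y1 z1 y2 z2 v"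
    and i: "norm (y1 0 - y2 0) \<le> d0" "norm (z1 0 - z2 0) \<le> d0" and t: "t \<in> {0..\<tau>}" and k: "k0 = min (1 / c2) (1 / 2)"
  shows "max (norm (y1 t - y2 t)) (norm (z1 t - z2 t)) \<le> exp (lam * C / (2 * k0) * t) * (sqrt (1 / c1 + 2) * d0 + F / sqrt k0 * t) / sqrt k0"
proof -
  have c1: "c1 > 0" using m by (simp add: mclass_def)
  have k0: "k0 > 0" "k0 \<le> 1 / c2" "k0 \<le> 1/2" using mclass_c2[OF m] by (auto simp: k)
  define h where "h v = norm (y1 v - y2 v)" for v
  define l where "l v = norm (z1 v - z2 v)" for v
  define E where "E v = energy (\<lambda>\<xi>. 1 / m \<xi>) s q lam (y1 v) (y1 v - y2 v) (z1 v - z2 v)" for v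
  have low: "k0 * (h v)\<^sup>2 + k0 * (l v)\<^sup>2 \<le> E v" "E v \<le> (1 / c1) * (l v)\<^sup>2 + 2 * (h v)\<^sup>2" if v: "v \<in> {0..\<tau>}" for v
  proof -
    note lw = energy_lower[OF m lam Cb(1)[OF v, of "y1 v - y2 v"] Cb(2), where l="z1 v - z2 v", folded E_def h_def l_def]
    show "E v \<le> (1 / c1) * (l v)\<^sup>2 + 2 * (h v)\<^sup>2" by (rule lw(2))
    have "k0 * (l v)\<^sup>2 + k0 * (h v)\<^sup>2 \<le> (1 / c2) * (l v)\<^sup>2 + (1/2) * (h v)\<^sup>2"
      using k0 by (intro add_mono mult_right_mono) auto
    then show "k0 * (h v)\<^sup>2 + k0 * (l v)\<^sup>2 \<le> E v" using lw(1) by linarith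
  qed
  have pos: "k0 * (h v)\<^sup>2 \<ge> 0" "k0 * (l v)\<^sup>2 \<ge> 0" for v using k0 by simp_all
  have E0: "E v \<ge> 0" if "v \<in> {0..\<tau>}" for v using low(1)[OF that] pos[of v] by linarith
  have hl: "h v \<le> sqrt (E v) / sqrt k0" "l v \<le> sqrt (E v) / sqrt k0" if v: "v \<in> {0..\<tau>}" for v
  proof -
    have "k0 * (h v)\<^sup>2 \<le> E v" "k0 * (l v)\<^sup>2 \<le> E v" using low(1)[OF v] pos[of v] by linarith+
    then have "(h v)\<^sup>2 \<le> E v / k0" "(l v)\<^sup>2 \<le> E v / k0" using k0 by (simp_all add: pos_le_divide_eq mult.commute)
    then have "h v \<le> sqrt (E v / k0)" "l v \<le> sqrt (E v / k0)" by (auto intro: real_le_rsqrt)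
    then show "h v \<le> sqrt (E v) / sqrt k0" "l v \<le> sqrt (E v) / sqrt k0" by (simp_all add: real_sqrt_divide)
  qed
  have "\<exists>E'. (E has_vector_derivative E') (at v within {0..\<tau>}) \<and> E' \<le> 2 * (lam * C / (2 * k0)) * E v + 2 * (F / sqrt k0) * sqrt (E v)"
    if v: "v \<in> {0..\<tau>}" for v
  proof -
    obtain dy1 dy2 dz1 dz2 dF1 dF2 l' \<Phi> where
      dd: "(y1 has_vector_derivative dz1) (at v within {0..\<tau>})" "(y2 has_vector_derivative dz2) (at v within {0..\<tau>})"
        "isD (z1 v) dz1" "isD (z2 v) dz2" "isD (y1 v) dy1" "isD (y2 v) dy2"
        "((\<lambda>r. z1 r - z2 r) has_vector_derivative l') (at v within {0..\<tau>})"
        "isD (pw s (y1 v) (Suc q)) dF1" "isD (pw s (y2 v) (Suc q)) dF2"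
        "inner (mulS (csym (\<lambda>\<xi>. 1 / m \<xi>)) l') (z1 v - z2 v) = inner (dy1 - dy2 + lam *\<^sub>R (dF1 - dF2) + \<Phi>) (z1 v - z2 v)"
      and n: "norm dy2 \<le> M" "norm \<Phi> \<le> F"
      using d[OF v] unfolding ediff_def by (elim exE conjE) (rule that)
    have b': "herm (y1 v)" "norm (y1 v) \<le> M" "norm (y2 v) \<le> M" "norm (z1 v) \<le> M" using b[OF v] by auto
    obtain E' where E': "(E has_vector_derivative E') (at v within {0..\<tau>})" "E' \<le> lam * C * ((h v)\<^sup>2 + (l v)\<^sup>2) + 2 * norm \<Phi> * l v"
      using eboundD[OF ED lam bsym_inv_m[OF m] dd b' n(1)] unfolding E_def[abs_def] h_def l_def by blast
    have "lam * C * ((h v)\<^sup>2 + (l v)\<^sup>2) \<le> lam * C * (E v / k0)"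
      using low(1)[OF v] k0 lam C by (intro mult_left_mono) (auto simp: pos_le_divide_eq algebra_simps)
    moreover have "norm \<Phi> * l v \<le> F * (sqrt (E v) / sqrt k0)" using n(2) hl(2)[OF v] F by (intro mult_mono) (auto simp: l_def)
    ultimately have "E' \<le> 2 * (lam * C / (2 * k0)) * E v + 2 * (F / sqrt k0) * sqrt (E v)" using E'(2) by simp
    then show ?thesis using E'(1) by blast
  qed
  then obtain E' where E': "\<And>v. v \<in> {0..\<tau>} \<Longrightarrow> (E has_vector_derivative E' v) (at v within {0..\<tau>})"
    "\<And>v. v \<in> {0..\<tau>} \<Longrightarrow> E' v \<le> 2 * (lam * C / (2 * k0)) * E v + 2 * (F / sqrt k0) * sqrt (E v)" by metis
  have t0: "0 \<le> t" "t \<le> \<tau>" and z: "0 \<in> {0..\<tau>}" using t by auto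
  have d0: "d0 \<ge> 0" using i(1) norm_ge_zero order_trans by blast
  have "E 0 \<le> (1 / c1) * (l 0)\<^sup>2 + 2 * (h 0)\<^sup>2" by (rule low(2)[OF z])
  also have "\<dots> \<le> (1 / c1) * d0\<^sup>2 + 2 * d0\<^sup>2" using i c1 by (intro add_mono mult_left_mono power_mono) (auto simp: h_def l_def)
  finally have "sqrt (E 0) \<le> sqrt ((1 / c1 + 2) * d0\<^sup>2)" by (simp add: algebra_simps)
  also have "\<dots> = sqrt (1 / c1 + 2) * d0" using d0 by (simp add: real_sqrt_mult)
  finally have s0: "sqrt (E 0) \<le> sqrt (1 / c1 + 2) * d0" .
  have "sqrt (E t) \<le> exp ((lam * C / (2 * k0)) * t) * (sqrt (E 0) + (F / sqrt k0) * t)"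
    by (rule sqrt_gronwall[OF t0 E'(1) E0 E'(2)]) (use lam C k0 F in auto)
  also have "\<dots> \<le> exp ((lam * C / (2 * k0)) * t) * (sqrt (1 / c1 + 2) * d0 + F / sqrt k0 * t)" using s0 by simp
  finally have "sqrt (E t) / sqrt k0 \<le> exp ((lam * C / (2 * k0)) * t) * (sqrt (1 / c1 + 2) * d0 + F / sqrt k0 * t) / sqrt k0"
    by (rule divide_right_mono) (use k0 in simp)
  then show ?thesis using hl[OF t] unfolding h_def l_def by linarith
qed

text \<open>The a priori bound is the comparison with the zero solution, for which the error
  vanishes. All constants are chosen before the symbol, \<open>lam\<close> and the cutoff.\<close>

lemma gal_exists:
  assumes s: "s \<ge> 2" and c: "0 < c1" "0 < c2" and M0: "M0 \<ge> 0"
  shows "\<exists>M>0. \<exists>T>0. \<exists>lam1>0. \<forall>m lam n Y0 Z0. mclass c1 c2 m \<longrightarrow> 0 < lam \<longrightarrow> lam \<le> lam1 \<longrightarrow> herm Y0 \<longrightarrow> herm Z0 \<longrightarrow>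
     norm Y0 \<le> M0 \<longrightarrow> norm Z0 \<le> M0 \<longrightarrow>
     (\<exists>y z. gal m s q lam n (T / lam) y z \<and> y 0 = mulS (Jn n) Y0 \<and> z 0 = mulS (Jn n) Z0 \<and>
        (\<forall>t\<in>{0..T / lam}. norm (y t) \<le> M \<and> norm (z t) \<le> M))"
proof -
  have s1: "s \<ge> 1" using s by simp
  define k0 where "k0 = min (1 / c2) (1 / 2)"
  have k0: "k0 > 0" using c by (simp add: k0_def)
  \<comment> \<open>Bound from \<open>energy_comparison\<close> when the exponential is at most 2,
    which the choice of \<open>T\<close> below guarantees.\<close>
  define B where "B = 2 * (sqrt (1 / c1 + 2) * M0) / sqrt k0"
  have B0: "B \<ge> 0" unfolding B_def using c M0 k0 by simp
  \<comment> \<open>\<open>M\<^sup>2\<close> strictly exceeds both the initial value, at most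
    \<open>2 * M0\<^sup>2\<close>, and the improved value \<open>2 * B\<^sup>2\<close>, as
    \<open>bootstrap\<close> requires.\<close>
  define M where "M = sqrt (2 * B\<^sup>2 + 2 * M0\<^sup>2 + 1)"
  have M2: "M\<^sup>2 = 2 * B\<^sup>2 + 2 * M0\<^sup>2 + 1" unfolding M_def by (rule real_sqrt_pow2) simp
  have Mp: "M > 0" unfolding M_def by (simp add: add_nonneg_pos)
  obtain C where C: "C \<ge> 0" and ED: "ebound s q M C" using energy_deriv[OF s, of M q] Mp by auto
  obtain Cb where Cb: "Cb \<ge> 0" "\<And>y h. norm y \<le> M \<Longrightarrow> \<bar>inner (Ps s (bco s q y) h) h\<bar> \<le> Cb * (norm h)\<^sup>2"
    using energy_bounds[OF s1, of M q] Mp by auto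
  \<comment> \<open>Makes \<open>C * T / (2 * k0)\<close> at most \<open>ln 2\<close>; the
    denominator \<open>C + 1\<close> also covers \<open>C = 0\<close>.\<close>
  define T where "T = 2 * k0 * ln 2 / (C + 1)"
  define lam1 where "lam1 = 1 / (2 * Cb + 1)"
  have T: "T > 0" unfolding T_def using C k0 by simp
  have l0: "lam1 > 0" unfolding lam1_def using Cb(1) by (simp add: add_nonneg_pos)
  have TC: "C * T / (2 * k0) \<le> ln 2"
  proof -
    have "C * T / (2 * k0) = C / (C + 1) * ln 2" using k0 by (simp add: T_def)
    also have "\<dots> \<le> 1 * ln 2" using C by (intro mult_right_mono) auto
    finally show ?thesis by simp
  qed
  have lC: "lam * Cb \<le> 1/2" if "lam \<le> lam1" for lam
  proof -
    have "lam * Cb \<le> lam1 * Cb" using that Cb(1) by (rule mult_right_mono)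
    also have "\<dots> \<le> 1/2" unfolding lam1_def using Cb(1) by (simp add: divide_simps)
    finally show ?thesis .
  qed
  show ?thesis
  proof (rule exI[of _ M], rule conjI[OF Mp], rule exI[of _ T], rule conjI[OF T], rule exI[of _ lam1], rule conjI[OF l0], intro allI impI)
    fix m lam n Y0 Z0
    assume m: "mclass c1 c2 m" and lam: "0 < lam" "lam \<le> lam1" and hY: "herm Y0" "herm Z0" and nY: "norm Y0 \<le> M0" "norm Z0 \<le> M0"
    define \<tau> where "\<tau> = T / lam"
    have \<tau>: "\<tau> \<ge> 0" using T lam by (simp add: \<tau>_def)
    have lam0: "lam \<ge> 0" using lam by simp
    obtain y z where y0: "y 0 = mulS (Jn n) Y0" and z0: "z 0 = mulS (Jn n) Z0"
      and y': "\<And>t. t \<in> {0..\<tau>} \<Longrightarrow> (y has_vector_derivative mulS (Dn n) (z t)) (at t within {0..\<tau>})"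
      and z': "\<And>t. t \<in> {0..\<tau>} \<Longrightarrow> (z has_vector_derivative mulS (csym m) (mulS (Dn n) (y t + lam *\<^sub>R pw s (retr M (y t)) (Suc q)))) (at t within {0..\<tau>})"
      and Jy: "\<And>t. t \<in> {0..\<tau>} \<Longrightarrow> mulS (Jn n) (y t) = y t" and Jz: "\<And>t. t \<in> {0..\<tau>} \<Longrightarrow> mulS (Jn n) (z t) = z t"
      and hy: "\<And>t. t \<in> {0..\<tau>} \<Longrightarrow> herm (y t)"
      using gal_truncated_exists[OF s1 m less_imp_le[OF Mp] \<tau> hY lam0, of n q] by blast
    have nJ: "norm (mulS (Jn n) v) \<le> norm v" for v
      using norm_mulS_le[OF bsym_Jn, of n 1 v] by (simp add: Jn_def)
    have n0: "norm (y 0) \<le> M0" "norm (z 0) \<le> M0" using y0 z0 nJ nY order_trans by fastforce+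
    define f where "f t = (norm (y t))\<^sup>2 + (norm (z t))\<^sup>2" for t
    have cf: "continuous_on {0..\<tau>} f"
      unfolding f_def
      by (intro continuous_intros continuous_on_vector_derivative) (use y' z' in auto)
    have f0: "f 0 < M\<^sup>2"
    proof -
      have "f 0 \<le> M0\<^sup>2 + M0\<^sup>2" unfolding f_def using n0 by (intro add_mono power_mono) auto
      then show ?thesis unfolding M2 using zero_le_power2[of B] by linarith
    qed
    have fb: "norm (y r) \<le> M" "norm (z r) \<le> M" if "f r \<le> M\<^sup>2" for r
    proof -
      have "(norm (y r))\<^sup>2 \<le> M\<^sup>2" "(norm (z r))\<^sup>2 \<le> M\<^sup>2"
        using that unfolding f_def by (smt (verit) zero_le_power2)+
      then show "norm (y r) \<le> M" "norm (z r) \<le> M" using Mp by (auto intro: power2_le_imp_le)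
    qed
    have F: "f t < M\<^sup>2" if t: "t \<in> {0..\<tau>}" for t
    proof (rule bootstrap[OF cf f0 _ t])
      fix t assume t: "t \<in> {0..\<tau>}" and le: "\<And>r. r \<in> {0..t} \<Longrightarrow> f r \<le> M\<^sup>2"
      have sub: "{0..t} \<subseteq> {0..\<tau>}" using t by auto
      have st: "t \<in> {0..t}" using t by simp
      have b: "herm (y r) \<and> norm (y r) \<le> M \<and> norm (0 :: l2) \<le> M \<and> norm (z r) \<le> M" if r: "r \<in> {0..t}" for r
        using fb[OF le[OF r]] hy[of r] r sub Mp by auto
      have der: "ediff m s q lam {0..t} M 0 y z (\<lambda>_. 0) (\<lambda>_. 0) r" if r: "r \<in> {0..t}" for r
      proof -
        have r': "r \<in> {0..\<tau>}" using r sub by auto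
        have re: "retr M (y r) = y r" using b[OF r] by (simp add: retr_def)
        obtain dF where dF: "isD (pw s (y r) (Suc q)) dF"
          using isD_pw_ex[OF s isD_Jn[OF Jy[OF r']]] by blast
        define X where "X = y r + lam *\<^sub>R pw s (y r) (Suc q)"
        have dX: "isD X (mulS (Dn n) (y r) + lam *\<^sub>R dF)"
          unfolding X_def by (intro isD_add isD_scaleR dF isD_Jn Jy r')
        have zz: "((\<lambda>r. z r - 0) has_vector_derivative mulS (csym m) (mulS (Dn n) X)) (at r within {0..t})"
          using has_vector_derivative_within_subset[OF z'[OF r'] sub] unfolding re X_def diff_0_right .
        have e: "inner (mulS (csym (\<lambda>\<xi>. 1 / m \<xi>)) (mulS (csym m) (mulS (Dn n) X))) (z r - 0)
           = inner (mulS (Dn n) (y r) - 0 + lam *\<^sub>R (dF - 0) + 0) (z r - 0)"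
          unfolding inner_inv_m[OF m] mulS_Dn_isD[OF dX] by (simp add: inner_Jn[OF Jz[OF r']])
        have p0: "isD (pw s 0 (Suc q)) 0" by (simp add: Qs_zero[OF s1] isD_zero)
        have n: "norm (0 :: l2) \<le> M" "norm (0 :: l2) \<le> 0" using Mp by auto
        show ?thesis unfolding ediff_def
          by (intro exI conjI) (rule has_vector_derivative_within_subset[OF y'[OF r'] sub] has_vector_derivative_const
            isD_Jn[OF Jz[OF r']] isD_Jn[OF Jy[OF r']] isD_zero zz dF p0 e n)+
      qed
      have "max (norm (y t - 0)) (norm (z t - 0)) \<le> exp (lam * C / (2 * k0) * t) * (sqrt (1 / c1 + 2) * M0 + 0 / sqrt k0 * t) / sqrt k0"
        by (rule energy_comparison[OF m lam0 C ED order_refl _ lC[OF lam(2)] b der _ _ st k0_def]) (use n0 Cb(2) b in auto)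
      also have "\<dots> \<le> B"
      proof -
        have "lam * C / (2 * k0) * t \<le> lam * C / (2 * k0) * (T / lam)" using t lam0 C k0 by (intro mult_left_mono) (auto simp: \<tau>_def)
        then have "exp (lam * C / (2 * k0) * t) \<le> exp (ln 2)" using TC lam by (simp del: exp_ln)
        then have "exp (lam * C / (2 * k0) * t) * (sqrt (1 / c1 + 2) * M0) / sqrt k0 \<le> 2 * (sqrt (1 / c1 + 2) * M0) / sqrt k0"
          using c M0 k0 by (intro divide_right_mono mult_right_mono) auto
        then show ?thesis by (simp add: B_def)
      qed
      finally have "norm (y t) \<le> B" "norm (z t) \<le> B" by simp_all
      then have "f t \<le> B\<^sup>2 + B\<^sup>2" unfolding f_def by (intro add_mono power_mono) auto
      then show "f t < M\<^sup>2" unfolding M2 using zero_le_power2[of M0] by linarith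
    qed
    have bd: "norm (y t) \<le> M" "norm (z t) \<le> M" if "t \<in> {0..\<tau>}" for t using fb[OF less_imp_le[OF F[OF that]]] by auto
    have "gal m s q lam n \<tau> y z"
      unfolding gal_def
    proof (intro ballI conjI)
      fix t assume t: "t \<in> {0..\<tau>}"
      show "(z has_vector_derivative mulS (csym m) (mulS (Dn n) (y t + lam *\<^sub>R pw s (y t) (Suc q)))) (at t within {0..\<tau>})"
        using z'[OF t] bd(1)[OF t] by (simp add: retr_def del: pw.simps)
    qed (use y' Jy Jz hy in auto)
    then show "\<exists>y z. gal m s q lam n (T / lam) y z \<and> y 0 = mulS (Jn n) Y0 \<and> z 0 = mulS (Jn n) Z0 \<and>
        (\<forall>t\<in>{0..T / lam}. norm (y t) \<le> M \<and> norm (z t) \<le> M)"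
      unfolding \<tau>_def[symmetric] using y0 z0 bd by blast
  qed
qed

section \<open>Comparison of truncated solutions for two kernels and two cutoffs\<close>

lemma isD_low2:
  assumes d: "isD y d" and \<sigma>: "\<sigma> \<le> -1"
  shows "norm (mulS (cjp \<sigma>) d) \<le> norm y"
proof -
  have "mulS (cjp \<sigma>) d = mulS (cjp (\<sigma> + 1)) (mulS (cjp (-1)) d)"
    using \<sigma> by (simp add: mulS_cjp_cjp)
  also have "norm \<dots> \<le> norm (mulS (cjp (-1)) d)" using \<sigma> by (intro norm_mulS_cjp_le) simp
  also have "\<dots> \<le> norm y" by (rule isD_low[OF d])
  finally show ?thesis .
qed

lemma herm_mulS_cjp: "\<sigma> \<le> 0 \<Longrightarrow> herm y \<Longrightarrow> herm (mulS (cjp \<sigma>) y)"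
  using Sop_mulS[OF bsym_cjp, of \<sigma> y] by (simp add: herm_def)

lemma abs_power_jp: "\<bar>\<xi>\<bar> ^ j \<le> jp (real j) \<xi>"
proof -
  have "\<bar>\<xi>\<bar> ^ j \<le> jp 1 \<xi> ^ j" by (rule power_mono[OF abs_le_jp1]) simp
  also have "jp 1 \<xi> ^ j = jp (real j) \<xi>"
    by (induction j) (simp_all add: jp_add add.commute)
  finally show ?thesis .
qed

lemma jp_neg1_le: "n > 0 \<Longrightarrow> n \<le> \<bar>\<xi>\<bar> \<Longrightarrow> jp (-1) \<xi> \<le> 1 / n"
proof -
  assume n: "n > 0" "n \<le> \<bar>\<xi>\<bar>"
  have "jp (-1) \<xi> * n \<le> jp (-1) \<xi> * jp 1 \<xi>"
    using n abs_le_jp1[of \<xi>] by (intro mult_left_mono) auto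
  then show ?thesis using n by (simp add: jp_add field_simps)
qed

text \<open>Three ranges of frequency: where both cutoffs are 1, the symbols differ by at most
  \<open>\<kappa> * \<bar>\<xi>\<bar> ^ (2 * k)\<close>; between the cutoffs the decay of the weight
  gives \<open>1 / n2\<close>; beyond both the symbol is zero. The remaining factor
  \<bar>\<xi>\<bar> is the derivative in the flux.\<close>

lemma consistency_symbol:
  assumes m1: "mclass c1 c2 m1" and m2: "mclass c1 c2 m2"
    and km: "\<And>\<xi>. \<bar>m1 \<xi> - m2 \<xi>\<bar> \<le> \<kappa> * \<bar>\<xi>\<bar> ^ (2 * k)" and \<kappa>: "\<kappa> \<ge> 0"
    and n: "0 < n2" "n2 \<le> n1" and \<sigma>: "\<sigma> \<le> - (2 * real k + 2)"
  shows "cmod (Jn n1 \<xi> - complex_of_real (m2 \<xi> / m1 \<xi>) * Jn n2 \<xi>) * (\<bar>\<xi>\<bar> * jp \<sigma> \<xi>) \<le> \<kappa> / c1 + 1 / n2"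
proof -
  have c1: "c1 > 0" using m1 by (simp add: mclass_def)
  consider "\<bar>\<xi>\<bar> \<le> n2" | "n2 < \<bar>\<xi>\<bar>" "\<bar>\<xi>\<bar> \<le> n1" | "n1 < \<bar>\<xi>\<bar>" by linarith
  then show ?thesis
  proof cases
    case 1
    have p: "m1 \<xi> > 0" "c1 \<le> m1 \<xi>" using m1 mclass_pos[OF m1] by (auto simp: mclass_def)
    have "Jn n1 \<xi> - complex_of_real (m2 \<xi> / m1 \<xi>) * Jn n2 \<xi> = complex_of_real ((m1 \<xi> - m2 \<xi>) / m1 \<xi>)"
      using 1 n p by (simp add: Jn_def diff_divide_distrib)
    then have "cmod (Jn n1 \<xi> - complex_of_real (m2 \<xi> / m1 \<xi>) * Jn n2 \<xi>) = \<bar>m1 \<xi> - m2 \<xi>\<bar> / m1 \<xi>"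
      using p by (simp only: norm_of_real) (simp add: abs_divide)
    also have "\<dots> \<le> (\<kappa> * \<bar>\<xi>\<bar> ^ (2 * k)) / c1"
      using p c1 km[of \<xi>] by (intro frac_le) auto
    finally have "cmod (Jn n1 \<xi> - complex_of_real (m2 \<xi> / m1 \<xi>) * Jn n2 \<xi>) * (\<bar>\<xi>\<bar> * jp \<sigma> \<xi>) \<le> (\<kappa> * \<bar>\<xi>\<bar> ^ (2 * k)) / c1 * (\<bar>\<xi>\<bar> * jp \<sigma> \<xi>)"
      by (rule mult_right_mono) simp
    also have "\<dots> = \<kappa> / c1 * (\<bar>\<xi>\<bar> ^ (2 * k + 1) * jp \<sigma> \<xi>)" by simp
    also have "\<dots> \<le> \<kappa> / c1 * 1"
    proof (rule mult_left_mono)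
      have "\<bar>\<xi>\<bar> ^ (2 * k + 1) * jp \<sigma> \<xi> \<le> jp (real (2 * k + 1)) \<xi> * jp \<sigma> \<xi>"
        by (intro mult_right_mono abs_power_jp) simp
      also have "\<dots> \<le> 1" unfolding jp_add by (rule jp_le1) (use \<sigma> in simp)
      finally show "\<bar>\<xi>\<bar> ^ (2 * k + 1) * jp \<sigma> \<xi> \<le> 1" .
    qed (use \<kappa> c1 in simp)
    finally show ?thesis using n by (simp add: add_increasing2)
  next
    case 2
    then have "cmod (Jn n1 \<xi> - complex_of_real (m2 \<xi> / m1 \<xi>) * Jn n2 \<xi>) * (\<bar>\<xi>\<bar> * jp \<sigma> \<xi>) = \<bar>\<xi>\<bar> * jp \<sigma> \<xi>"
      by (simp add: Jn_def)
    also have "\<dots> \<le> jp 1 \<xi> * jp \<sigma> \<xi>" by (intro mult_right_mono abs_le_jp1) simp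
    also have "\<dots> \<le> jp (-1) \<xi>" unfolding jp_add by (rule jp_mono) (use \<sigma> in simp)
    also have "\<dots> \<le> 1 / n2" by (rule jp_neg1_le) (use 2 n in auto)
    finally show ?thesis using \<kappa> c1 by (simp add: add_increasing)
  next
    case 3
    then show ?thesis using n \<kappa> c1 by (simp add: Jn_def)
  qed
qed

text \<open>The second solution is inserted into the equation of the first. The defect is the
  multiplier of \<open>consistency_symbol\<close> applied to its flux, which is bounded at the level
  \<open>N\<close>, while the difference is measured at the level \<open>r\<close>; the gap pays for
  the multiplier.\<close>

lemma gal_diff:
  assumes r: "r \<ge> 2" and N: "N \<ge> r + 2 * real k + 2" and c: "0 < c1" "0 < c2" and M: "M > 0" and T: "T \<ge> 0"
  shows "\<exists>C\<ge>0. \<exists>lam2>0. \<forall>m1 m2 \<kappa> lam n1 n2 y1 z1 y2 z2 d0.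
     mclass c1 c2 m1 \<longrightarrow> mclass c1 c2 m2 \<longrightarrow> (\<forall>\<xi>. \<bar>m1 \<xi> - m2 \<xi>\<bar> \<le> \<kappa> * \<bar>\<xi>\<bar> ^ (2 * k)) \<longrightarrow> 0 \<le> \<kappa> \<longrightarrow>
     0 < lam \<longrightarrow> lam \<le> lam2 \<longrightarrow> 0 < n2 \<longrightarrow> n2 \<le> n1 \<longrightarrow>
     gal m1 N q lam n1 (T / lam) y1 z1 \<longrightarrow> gal m2 N q lam n2 (T / lam) y2 z2 \<longrightarrow>
     (\<forall>t\<in>{0..T / lam}. norm (y1 t) \<le> M \<and> norm (z1 t) \<le> M \<and> norm (y2 t) \<le> M \<and> norm (z2 t) \<le> M) \<longrightarrow>
     norm (mulS (cjp (r - N)) (y1 0 - y2 0)) \<le> d0 \<longrightarrow> norm (mulS (cjp (r - N)) (z1 0 - z2 0)) \<le> d0 \<longrightarrow>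
     (\<forall>t\<in>{0..T / lam}. norm (mulS (cjp (r - N)) (y1 t - y2 t)) \<le> C * (d0 + (\<kappa> + 1 / n2) * t) \<and>
        norm (mulS (cjp (r - N)) (z1 t - z2 t)) \<le> C * (d0 + (\<kappa> + 1 / n2) * t))"
proof -
  have r1: "r \<ge> 1" and rN: "r \<le> N" and N2: "N \<ge> 2" and N1: "N \<ge> 1" using r N by simp_all
  have Mge: "M \<ge> 0" using M by simp
  define \<sigma> where "\<sigma> = r - N"
  have \<sigma>: "\<sigma> \<le> - (2 * real k + 2)" "\<sigma> \<le> -1" "\<sigma> \<le> 0" using N by (simp_all add: \<sigma>_def)
  obtain C where C: "C \<ge> 0" and ED: "ebound r q M C" using energy_deriv[OF r Mge, of q] by auto
  obtain Cb where Cb: "Cb \<ge> 0" "\<And>y h. norm y \<le> M \<Longrightarrow> \<bar>inner (Ps r (bco r q y) h) h\<bar> \<le> Cb * (norm h)\<^sup>2"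
    using energy_bounds[OF r1 Mge, of q] by auto
  obtain Cp where Cp: "Cp \<ge> 0" "\<And>x. norm x \<le> M \<Longrightarrow> norm (pw N x (Suc q)) \<le> Cp"
    using lipb_pw[OF N1, of "Suc q"] Mge unfolding lipb_def by metis
  define lam2 where "lam2 = min 1 (1 / (2 * Cb + 1))"
  have l2: "lam2 > 0" unfolding lam2_def using Cb(1) by (simp add: add_nonneg_pos)
  have lC: "lam * Cb \<le> 1/2" if "lam \<le> lam2" for lam
  proof -
    have "lam * Cb \<le> 1 / (2 * Cb + 1) * Cb" using that Cb(1) unfolding lam2_def by (intro mult_right_mono) auto
    also have "\<dots> \<le> 1/2" using Cb(1) by (simp add: divide_simps)
    finally show ?thesis .
  qed
  define k0 where "k0 = min (1 / c2) (1 / 2)"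
  have k0: "k0 > 0" "k0 \<le> 1 / c2" "k0 \<le> 1/2" using c by (auto simp: k0_def)
  define B where "B = M + Cp"
  have B0: "B \<ge> 0" using Mge Cp by (simp add: B_def)
  define e where "e = exp (C * T / (2 * k0))"
  define C' where "C' = (e * (sqrt (1 / c1 + 2) + (1 / c1 + 1) * B / sqrt k0)) / sqrt k0"
  have C': "C' \<ge> 0" unfolding C'_def e_def using c k0 B0 by (intro divide_nonneg_nonneg mult_nonneg_nonneg add_nonneg_nonneg) auto
  show ?thesis
  proof (rule exI[of _ C'], rule conjI[OF C'], rule exI[of _ lam2], rule conjI[OF l2], intro allI impI ballI)
    fix m1 m2 \<kappa> lam n1 n2 y1 z1 y2 z2 d0 t
    assume m1: "mclass c1 c2 m1" and m2: "mclass c1 c2 m2" and km: "\<forall>\<xi>. \<bar>m1 \<xi> - m2 \<xi>\<bar> \<le> \<kappa> * \<bar>\<xi>\<bar> ^ (2 * k)" and \<kappa>: "0 \<le> \<kappa>"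
      and lam: "0 < lam" "lam \<le> lam2" and n: "0 < n2" "n2 \<le> n1"
      and g1: "gal m1 N q lam n1 (T / lam) y1 z1" and g2: "gal m2 N q lam n2 (T / lam) y2 z2"
      and bd: "\<forall>t\<in>{0..T / lam}. norm (y1 t) \<le> M \<and> norm (z1 t) \<le> M \<and> norm (y2 t) \<le> M \<and> norm (z2 t) \<le> M"
      and d0: "norm (mulS (cjp (r - N)) (y1 0 - y2 0)) \<le> d0" "norm (mulS (cjp (r - N)) (z1 0 - z2 0)) \<le> d0"
      and t: "t \<in> {0..T / lam}"
    define \<tau> where "\<tau> = T / lam"
    define L where "L = mulS (cjp \<sigma>)"
    have bc: "bsym (cjp \<sigma>)" by (rule bsym_cjp[OF \<sigma>(3)])
    have blL: "bounded_linear L" unfolding L_def by (rule bounded_linear_mulS[OF bc])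
    have nL: "norm (L v) \<le> norm v" for v unfolding L_def by (rule norm_mulS_cjp_le[OF \<sigma>(3)])
    have Ldiff: "L (v - w) = L v - L w" for v w unfolding L_def by (rule mulS_diff[OF bc])
    have lam0: "lam \<ge> 0" using lam by simp
    have lam1: "lam \<le> 1" using lam by (simp add: lam2_def)
    note G1 = g1[unfolded gal_def, folded \<tau>_def, rule_format] and G2 = g2[unfolded gal_def, folded \<tau>_def, rule_format]
    have LJ: "mulS (Jn n) (L v) = L (mulS (Jn n) v)" for n v
      by (simp add: L_def mulS_mulS bsym_Jn bc mult.commute)
    have J12: "mulS (Jn n1) v = v" if "mulS (Jn n2) v = v" for v
    proof -
      have "mulS (Jn n1) (mulS (Jn n2) v) = mulS (Jn n2) v"
        using n by (simp add: mulS_mulS bsym_Jn) (intro arg_cong[of _ _ "\<lambda>f. mulS f v"], auto simp: Jn_def)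
      then show ?thesis using that by simp
    qed
    define k1 where "k1 = (\<lambda>\<xi>. 1 / m1 \<xi>)"
    define \<Phi>b where "\<Phi>b = (\<kappa> / c1 + 1 / n2) * B"
    have \<Phi>b0: "\<Phi>b \<ge> 0" using \<kappa> c n B0 by (simp add: \<Phi>b_def)
    have der: "ediff m1 r q lam {0..\<tau>} M \<Phi>b (\<lambda>v. L (y1 v)) (\<lambda>v. L (z1 v)) (\<lambda>v. L (y2 v)) (\<lambda>v. L (z2 v)) v"
      if v: "v \<in> {0..\<tau>}" for v
    proof -
      have b: "norm (y1 v) \<le> M" "norm (z1 v) \<le> M" "norm (y2 v) \<le> M" "norm (z2 v) \<le> M" using bd v unfolding \<tau>_def by auto
      have Jy1: "mulS (Jn n1) (y1 v) = y1 v" and Jz1: "mulS (Jn n1) (z1 v) = z1 v" and Jy2: "mulS (Jn n2) (y2 v) = y2 v" and Jz2: "mulS (Jn n2) (z2 v) = z2 v"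
        and hy: "herm (y1 v)" using G1[OF v] G2[OF v] by auto
      obtain dp1 dp2 where dp1: "isD (pw N (y1 v) (Suc q)) dp1" and dp2: "isD (pw N (y2 v) (Suc q)) dp2"
        using isD_pw_ex[OF N2 isD_Jn[OF Jy1]] isD_pw_ex[OF N2 isD_Jn[OF Jy2]] by metis
      define X1 where "X1 = y1 v + lam *\<^sub>R pw N (y1 v) (Suc q)"
      define X2 where "X2 = y2 v + lam *\<^sub>R pw N (y2 v) (Suc q)"
      define dX1 where "dX1 = mulS (Dn n1) (y1 v) + lam *\<^sub>R dp1"
      define dX2 where "dX2 = mulS (Dn n2) (y2 v) + lam *\<^sub>R dp2"
      have iX1: "isD X1 dX1" and iX2: "isD X2 dX2"
        unfolding X1_def X2_def dX1_def dX2_def by (intro isD_add isD_scaleR dp1 dp2 isD_Jn Jy1 Jy2)+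
      have nX2: "norm X2 \<le> B"
      proof -
        have "norm X2 \<le> norm (y2 v) + lam * norm (pw N (y2 v) (Suc q))"
          unfolding X2_def by (rule order_trans[OF norm_triangle_ineq]) (use lam0 in simp)
        also have "\<dots> \<le> M + 1 * Cp" using b(3) Cp(2)[OF b(3)] lam0 lam1 by (intro add_mono mult_mono) auto
        finally show ?thesis by (simp add: B_def)
      qed
      have z1': "(z1 has_vector_derivative mulS (csym m1) (mulS (Jn n1) dX1)) (at v within {0..\<tau>})"
        using G1[OF v] unfolding mulS_Dn_isD[OF iX1, symmetric] X1_def by blast
      have z2': "(z2 has_vector_derivative mulS (csym m2) (mulS (Jn n2) dX2)) (at v within {0..\<tau>})"
        using G2[OF v] unfolding mulS_Dn_isD[OF iX2, symmetric] X2_def by blast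
      define l' where "l' = L (mulS (csym m1) (mulS (Jn n1) dX1)) - L (mulS (csym m2) (mulS (Jn n2) dX2))"
      define l where "l = L (z1 v) - L (z2 v)"
      have Jl: "mulS (Jn n1) l = l"
        unfolding l_def by (simp add: mulS_diff[OF bsym_Jn] LJ Jz1 J12[OF Jz2])
      \<comment> \<open>The energy multiplies both equations by the reciprocal of the first symbol;
        on the second this leaves the quotient of the symbols.\<close>
      define \<mu> where "\<mu> \<xi> = complex_of_real (m2 \<xi> / m1 \<xi>)" for \<xi>
      have b\<mu>: "bsym \<mu>"
      proof -
        have "bsym (\<lambda>\<xi>. csym m2 \<xi> * csym (\<lambda>\<xi>. 1 / m1 \<xi>) \<xi>)" by (rule bsym_mult[OF bsym_m[OF m2] bsym_inv_m[OF m1]])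
        then show ?thesis by (simp add: \<mu>_def[abs_def])
      qed
      define \<Phi> where "\<Phi> = mulS (Jn n1) (L dX2) - mulS \<mu> (mulS (Jn n2) (L dX2))"
      have Keq: "mulS (csym k1) l' = mulS (Jn n1) (L dX1) - mulS \<mu> (mulS (Jn n2) (L dX2))"
      proof -
        have cm: "L (mulS (csym m) (mulS (Jn n) w)) = mulS (csym m) (mulS (Jn n) (L w))" if "mclass c1 c2 m" for m n w
          unfolding LJ unfolding L_def by (simp add: mulS_mulS bc bsym_m[OF that] mult.commute)
        have kk: "bsym (csym k1)" using bsym_inv_m[OF m1] by (simp add: k1_def[abs_def])
        have "mulS (csym k1) (mulS (csym m1) w) = w" for w using inner_inv_m[OF m1, of w] by (simp add: k1_def[abs_def])
        moreover have "mulS (csym k1) (mulS (csym m2) w) = mulS \<mu> w" for w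
        proof -
          have "(\<lambda>\<xi>. csym k1 \<xi> * csym m2 \<xi>) = \<mu>" by (simp add: k1_def \<mu>_def fun_eq_iff)
          then show ?thesis by (simp only: mulS_mulS[OF kk bsym_m[OF m2]])
        qed
        ultimately show ?thesis unfolding l'_def mulS_diff[OF kk] cm[OF m1] cm[OF m2] by simp
      qed
      have eq: "inner (mulS (csym k1) l') l = inner (L (mulS (Dn n1) (y1 v)) - L (mulS (Dn n2) (y2 v)) + lam *\<^sub>R (L dp1 - L dp2) + \<Phi>) l"
      proof -
        have "L dX1 - L dX2 = L (mulS (Dn n1) (y1 v)) - L (mulS (Dn n2) (y2 v)) + lam *\<^sub>R (L dp1 - L dp2)"
          unfolding dX1_def dX2_def L_def by (simp add: mulS_add[OF bc] mulS_scaleR[OF bc] scaleR_diff_right)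
        moreover have "inner (mulS (csym k1) l') l = inner (mulS (Jn n1) (L dX1 - L dX2) + \<Phi>) l"
          unfolding Keq \<Phi>_def by (simp add: mulS_diff[OF bsym_Jn])
        ultimately show ?thesis by (simp add: inner_add_left inner_Jn[OF Jl])
      qed
      have n\<Phi>: "norm \<Phi> \<le> \<Phi>b"
      proof -
        define \<rho> where "\<rho> \<xi> = (Jn n1 \<xi> - \<mu> \<xi> * Jn n2 \<xi>) * (\<i> * \<xi> * cjp \<sigma> \<xi>)" for \<xi>
        have bi: "bsym (\<lambda>\<xi>. \<i> * \<xi> * cjp \<sigma> \<xi>)" by (rule bsym_icjp[OF \<sigma>(2)])
        have LdX: "L dX2 = mulS (\<lambda>\<xi>. \<i> * \<xi> * cjp \<sigma> \<xi>) X2" unfolding L_def by (rule isD_mulS_eq[OF bc bi iX2])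
        have "norm \<Phi> = norm (mulS \<rho> X2)"
          unfolding \<Phi>_def LdX \<rho>_def mulS_mulS[OF bsym_Jn bi] mulS_mulS[OF b\<mu> bsym_mult[OF bsym_Jn bi]]
          by (subst mulS_sym_diff[OF bsym_mult[OF bsym_Jn bi] bsym_mult[OF b\<mu> bsym_mult[OF bsym_Jn bi]]])
             (simp only: left_diff_distrib mult.assoc)
        also have "\<dots> \<le> (\<kappa> / c1 + 1 / n2) * norm X2"
        proof (rule norm_mulS_le)
          have "\<rho> = (\<lambda>\<xi>. Jn n1 \<xi> * (\<i> * \<xi> * cjp \<sigma> \<xi>) - (\<mu> \<xi> * Jn n2 \<xi>) * (\<i> * \<xi> * cjp \<sigma> \<xi>))"
            by (auto simp: \<rho>_def left_diff_distrib)
          moreover have "\<rho> \<in> borel_measurable borel"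
            unfolding \<rho>_def using bsym_measurable[OF b\<mu>] by measurable
          moreover have cb: "cmod (\<rho> \<xi>) \<le> \<kappa> / c1 + 1 / n2" for \<xi>
            using consistency_symbol[OF m1 m2 km[rule_format] \<kappa> n \<sigma>(1), of \<xi>] by (simp add: \<rho>_def norm_mult \<mu>_def)
          ultimately show "bsym \<rho>" by (intro bsymI) auto
          show "cmod (\<rho> \<xi>) \<le> \<kappa> / c1 + 1 / n2" for \<xi> by (rule cb)
        qed
        also have "\<dots> \<le> \<Phi>b" unfolding \<Phi>b_def using nX2 \<kappa> c n by (intro mult_left_mono) auto
        finally show ?thesis .
      qed
      have pwL: "pw r (L w) (Suc q) = L (pw N w (Suc q))" for w
        unfolding L_def \<sigma>_def by (rule pw_low[OF r1 rN, symmetric])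
      have 1: "((\<lambda>v. L (y1 v)) has_vector_derivative L (mulS (Dn n1) (z1 v))) (at v within {0..\<tau>})"
          "((\<lambda>v. L (y2 v)) has_vector_derivative L (mulS (Dn n2) (z2 v))) (at v within {0..\<tau>})"
        using G1[OF v] G2[OF v] by (auto intro: bounded_linear.has_vector_derivative[OF blL])
      have 2: "isD (L (z1 v)) (L (mulS (Dn n1) (z1 v)))" "isD (L (z2 v)) (L (mulS (Dn n2) (z2 v)))"
          "isD (L (y1 v)) (L (mulS (Dn n1) (y1 v)))" "isD (L (y2 v)) (L (mulS (Dn n2) (y2 v)))"
        unfolding L_def by (intro isD_mulS bc isD_Jn Jy1 Jy2 Jz1 Jz2)+
      have 3: "((\<lambda>r. L (z1 r) - L (z2 r)) has_vector_derivative l') (at v within {0..\<tau>})"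
        unfolding l'_def by (intro has_vector_derivative_diff bounded_linear.has_vector_derivative[OF blL] z1' z2')
      have 4: "isD (pw r (L (y1 v)) (Suc q)) (L dp1)" "isD (pw r (L (y2 v)) (Suc q)) (L dp2)"
        unfolding pwL unfolding L_def by (intro isD_mulS bc dp1 dp2)+
      \<comment> \<open>The bound on \<open>dy2\<close> required by \<open>ebound\<close>: the
        derivative of the second solution is controlled because \<open>r\<close> lies at least one
        level below \<open>N\<close>.\<close>
      have 5: "norm (L (mulS (Dn n2) (y2 v))) \<le> M"
        unfolding L_def by (rule order_trans[OF isD_low2[OF isD_Jn[OF Jy2] \<sigma>(2)] b(3)])
      show ?thesis
        unfolding ediff_def by (intro exI conjI) (rule 1 2 3 4 eq[unfolded k1_def l_def] 5 n\<Phi>)+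
    qed
    have bd': "herm (L (y1 v)) \<and> norm (L (y1 v)) \<le> M \<and> norm (L (y2 v)) \<le> M \<and> norm (L (z1 v)) \<le> M" if v: "v \<in> {0..\<tau>}" for v
      using bd[folded \<tau>_def, rule_format, OF v] nL[of "y1 v"] nL[of "y2 v"] nL[of "z1 v"] herm_mulS_cjp[OF \<sigma>(3), of "y1 v"] G1[OF v]
      unfolding L_def by auto
    have tt: "t \<in> {0..\<tau>}" using t by (simp add: \<tau>_def)
    have Cb': "\<bar>inner (Ps r (bco r q (L (y1 v))) h) h\<bar> \<le> Cb * (norm h)\<^sup>2" if "v \<in> {0..\<tau>}" for v h using Cb(2) bd'[OF that] by blast
    have gr: "max (norm (L (y1 t) - L (y2 t))) (norm (L (z1 t) - L (z2 t))) \<le> exp (lam * C / (2 * k0) * t) * (sqrt (1 / c1 + 2) * d0 + \<Phi>b / sqrt k0 * t) / sqrt k0"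
      by (rule energy_comparison[OF m1 lam0 C ED \<Phi>b0 Cb' lC[OF lam(2)] bd' der _ _ tt k0_def])
        (use d0 in \<open>simp_all add: \<sigma>_def L_def mulS_diff[OF bc, unfolded \<sigma>_def]\<close>)
    have t0: "0 \<le> t" using t by simp
    have e1: "exp (lam * C / (2 * k0) * t) \<le> e"
    proof -
      have "lam * C / (2 * k0) * t \<le> lam * C / (2 * k0) * (T / lam)"
        using t lam0 C k0 by (intro mult_left_mono) auto
      also have "\<dots> = C * T / (2 * k0)" using lam by simp
      finally show ?thesis by (simp add: e_def)
    qed
    have d00: "d0 \<ge> 0" using d0(1) norm_ge_zero order_trans by blast
    define a1 where "a1 = sqrt (1 / c1 + 2)"
    define a2 where "a2 = (1 / c1 + 1) * B / sqrt k0"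
    define x where "x = (\<kappa> + 1 / n2) * t"
    have a: "a1 \<ge> 0" "a2 \<ge> 0" "x \<ge> 0" using c B0 k0 \<kappa> n t0 by (auto simp: a1_def a2_def x_def)
    have "\<Phi>b / sqrt k0 * t \<le> a2 * x"
    proof -
      have "(1 / c1 + 1) * (\<kappa> + 1 / n2) = (\<kappa> / c1 + 1 / n2) + (1 / c1 * (1 / n2) + \<kappa>)" by (simp add: algebra_simps)
      moreover have "1 / c1 * (1 / n2) + \<kappa> \<ge> 0" using c n \<kappa> by simp
      ultimately have "\<kappa> / c1 + 1 / n2 \<le> (1 / c1 + 1) * (\<kappa> + 1 / n2)" by linarith
      then have "(\<kappa> / c1 + 1 / n2) * (B / sqrt k0 * t) \<le> ((1 / c1 + 1) * (\<kappa> + 1 / n2)) * (B / sqrt k0 * t)"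
        using B0 k0 t0 by (intro mult_right_mono) auto
      then show ?thesis by (simp add: \<Phi>b_def a2_def x_def mult_ac)
    qed
    then have "a1 * d0 + \<Phi>b / sqrt k0 * t \<le> (a1 + a2) * (d0 + x)"
      using mult_nonneg_nonneg[OF a(1,3)] mult_nonneg_nonneg[OF a(2) d00] unfolding distrib_left distrib_right by linarith
    then have "exp (lam * C / (2 * k0) * t) * (a1 * d0 + \<Phi>b / sqrt k0 * t) / sqrt k0 \<le> e * ((a1 + a2) * (d0 + x)) / sqrt k0"
      using e1 a d00 t0 \<Phi>b0 k0 by (intro divide_right_mono mult_mono) (auto simp: e_def)
    also have "\<dots> = C' * (d0 + x)" by (simp add: C'_def a1_def a2_def)
    finally show "norm (mulS (cjp (r - N)) (y1 t - y2 t)) \<le> C' * (d0 + (\<kappa> + 1 / n2) * t) \<and>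
        norm (mulS (cjp (r - N)) (z1 t - z2 t)) \<le> C' * (d0 + (\<kappa> + 1 / n2) * t)"
      using gr unfolding \<sigma>_def[symmetric] L_def[symmetric] Ldiff a1_def x_def by auto
  qed
qed

section \<open>Passage to the limit in the truncations\<close>

abbreviation icjp :: "real \<Rightarrow> real \<Rightarrow> complex" where "icjp s \<equiv> (\<lambda>\<xi>. \<i> * complex_of_real \<xi> * cjp s \<xi>)"

text \<open>The system is required to hold only one derivative below the level of \<open>Y, Z\<close>.\<close>

definition csol :: "(real \<Rightarrow> real) \<Rightarrow> real \<Rightarrow> nat \<Rightarrow> real \<Rightarrow> real \<Rightarrow> (real \<Rightarrow> l2) \<Rightarrow> (real \<Rightarrow> l2) \<Rightarrow> bool" where
  "csol m s q lam \<tau> Y Z \<longleftrightarrow> continuous_on {0..\<tau>} Y \<and> continuous_on {0..\<tau>} Z \<and> (\<forall>t\<in>{0..\<tau>}. herm (Y t) \<and>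
     ((\<lambda>t. mulS (cjp (-1)) (Y t)) has_vector_derivative mulS (icjp (-1)) (Z t)) (at t within {0..\<tau>}) \<and>
     ((\<lambda>t. mulS (cjp (-1)) (Z t)) has_vector_derivative
        mulS (csym m) (mulS (icjp (-1)) (Y t + lam *\<^sub>R pw s (Y t) (Suc q)))) (at t within {0..\<tau>}))"

lemma uniform_rate_limit:
  fixes u :: "nat \<Rightarrow> 'a \<Rightarrow> 'b::banach"
  assumes c: "\<And>i j t. t \<in> S \<Longrightarrow> j \<le> i \<Longrightarrow> norm (u i t - u j t) \<le> A / real (Suc j)"
  obtains U where "\<And>j t. t \<in> S \<Longrightarrow> norm (u j t - U t) \<le> A / real (Suc j)" "\<And>t. t \<in> S \<Longrightarrow> (\<lambda>j. u j t) \<longlonglongrightarrow> U t"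
proof -
  have A0: "(\<lambda>j. A / real (Suc j)) \<longlonglongrightarrow> 0"
    using tendsto_mult_right_zero[OF LIMSEQ_inverse_real_of_nat, of A] by (simp add: divide_inverse)
  define U where "U t = lim (\<lambda>j. u j t)" for t
  have conv: "(\<lambda>j. u j t) \<longlonglongrightarrow> U t" if t: "t \<in> S" for t
  proof -
    have "Cauchy (\<lambda>j. u j t)"
    proof (rule CauchyI')
      fix e :: real assume "e > 0"
      then obtain n where n: "\<And>j. j \<ge> n \<Longrightarrow> A / real (Suc j) < e"
        using order_tendstoD(2)[OF A0] by (auto simp: eventually_sequentially)
      show "\<exists>M. \<forall>m\<ge>M. \<forall>n>m. dist (u m t) (u n t) < e"
      proof (intro exI[of _ n] allI impI)
        fix i j assume "n \<le> i" "i < j"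
        then show "dist (u i t) (u j t) < e"
          using c[OF t, of i j] n[of i] by (simp add: dist_norm norm_minus_commute)
      qed
    qed
    then show ?thesis by (simp add: U_def Cauchy_convergent_iff convergent_LIMSEQ_iff)
  qed
  have "norm (u j t - U t) \<le> A / real (Suc j)" if t: "t \<in> S" for j t
  proof (rule LIMSEQ_le_const2)
    show "(\<lambda>i. norm (u j t - u i t)) \<longlonglongrightarrow> norm (u j t - U t)"
      by (intro tendsto_intros conv t)
    show "\<exists>N. \<forall>i\<ge>N. norm (u j t - u i t) \<le> A / real (Suc j)"
      using c[OF t, of j] by (intro exI[of _ j] allI impI) (simp add: norm_minus_commute)
  qed
  then show thesis using that conv by blast
qed

lemma rate_tendsto_0: "(\<lambda>j. A / real (Suc j)) \<longlonglongrightarrow> 0"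
  using tendsto_mult_right_zero[OF LIMSEQ_inverse_real_of_nat, of A] by (simp add: divide_inverse)

lemma rate_continuous:
  fixes u :: "nat \<Rightarrow> real \<Rightarrow> 'b::banach"
  assumes c: "\<And>j. continuous_on S (u j)" and r: "\<And>j t. t \<in> S \<Longrightarrow> norm (u j t - U t) \<le> A / real (Suc j)"
  shows "continuous_on S U"
proof (rule uniform_limit_theorem[where f=u and F=sequentially])
  show "uniform_limit S u U sequentially"
  proof (rule uniform_limitI)
    fix e :: real assume "e > 0"
    from order_tendstoD(2)[OF rate_tendsto_0 this]
    show "\<forall>\<^sub>F n in sequentially. \<forall>x\<in>S. dist (u n x) (U x) < e"
    proof eventually_elim
      fix n assume "A / real (Suc n) < e"
      then show "\<forall>x\<in>S. dist (u n x) (U x) < e" using r le_less_trans unfolding dist_norm by blast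
    qed
  qed
qed (use c in auto)

lemma cmod_icjp_le: "cmod (icjp (-1) \<xi>) \<le> 1"
proof -
  have "\<bar>\<xi>\<bar> * jp (-1) \<xi> \<le> jp 1 \<xi> * jp (-1) \<xi>" by (rule mult_right_mono[OF abs_le_jp1]) simp
  then show ?thesis by (simp add: norm_mult jp_add)
qed

lemma norm_icjp_le: "norm (mulS (icjp (-1)) v) \<le> norm v"
  using norm_mulS_le[OF bsym_icjp cmod_icjp_le, of v] by simp

text \<open>At level \<open>s\<close> the convergence is uniform in time with rate 1/(j+1). One
  level lower all operators in the equation are bounded, so the time derivatives converge uniformly
  as well and the system passes to the limit.\<close>

lemma gal_limit:
  assumes s: "s \<ge> 2" and sN: "s + 1 \<le> N" and m: "mclass c1 c2 m" and lam: "lam \<ge> 0" and M: "M \<ge> 0" and \<tau>: "\<tau> \<ge> 0"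
    and g: "\<And>j. gal m N q lam (real (Suc j)) \<tau> (y j) (z j)"
    and bd: "\<And>j t. t \<in> {0..\<tau>} \<Longrightarrow> norm (y j t) \<le> M \<and> norm (z j t) \<le> M"
    and rate: "\<And>i j t. t \<in> {0..\<tau>} \<Longrightarrow> j \<le> i \<Longrightarrow> norm (mulS (cjp (s - N)) (y i t - y j t)) \<le> A / real (Suc j)"
      "\<And>i j t. t \<in> {0..\<tau>} \<Longrightarrow> j \<le> i \<Longrightarrow> norm (mulS (cjp (s - N)) (z i t - z j t)) \<le> A / real (Suc j)"
  obtains Y Z where "csol m s q lam \<tau> Y Z"
    "\<And>t. t \<in> {0..\<tau>} \<Longrightarrow> (\<lambda>j. mulS (cjp (s - N)) (y j t)) \<longlonglongrightarrow> Y t"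
    "\<And>t. t \<in> {0..\<tau>} \<Longrightarrow> (\<lambda>j. mulS (cjp (s - N)) (z j t)) \<longlonglongrightarrow> Z t"
    "\<And>t. t \<in> {0..\<tau>} \<Longrightarrow> norm (Y t) \<le> M" "\<And>t. t \<in> {0..\<tau>} \<Longrightarrow> norm (Z t) \<le> M"
proof -
  have s1: "s \<ge> 1" and sN': "s \<le> N" and N1: "N \<ge> 1" and N2: "N \<ge> 2" using s sN by simp_all
  define \<sigma> where "\<sigma> = s - N"
  have \<sigma>: "\<sigma> \<le> -1" "\<sigma> \<le> 0" using sN by (simp_all add: \<sigma>_def)
  define L where "L = mulS (cjp \<sigma>)"
  have bc: "bsym (cjp \<sigma>)" by (rule bsym_cjp[OF \<sigma>(2)])
  have b1: "bsym (cjp (-1))" by (rule bsym_cjp) simp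
  have bi: "bsym (icjp (-1))" by (rule bsym_icjp) simp
  note bm = bsym_m[OF m]
  have blL: "bounded_linear L" unfolding L_def by (rule bounded_linear_mulS[OF bc])
  have nL: "norm (L v) \<le> norm v" for v unfolding L_def by (rule norm_mulS_cjp_le[OF \<sigma>(2)])
  have Ldiff: "L (v - w) = L v - L w" for v w unfolding L_def by (rule mulS_diff[OF bc])
  define u where "u j t = L (y j t)" for j t
  define w where "w j t = L (z j t)" for j t
  have ur: "norm (u i t - u j t) \<le> A / real (Suc j)" and wr: "norm (w i t - w j t) \<le> A / real (Suc j)" if "t \<in> {0..\<tau>}" "j \<le> i" for i j t
    using rate[OF that] by (simp_all add: u_def w_def Ldiff[symmetric]) (simp_all add: L_def \<sigma>_def)
  obtain Y where Y: "\<And>j t. t \<in> {0..\<tau>} \<Longrightarrow> norm (u j t - Y t) \<le> A / real (Suc j)" and uY: "\<And>t. t \<in> {0..\<tau>} \<Longrightarrow> (\<lambda>j. u j t) \<longlonglongrightarrow> Y t"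
    using uniform_rate_limit[of "{0..\<tau>}" u A, OF ur] by blast
  obtain Z where Z: "\<And>j t. t \<in> {0..\<tau>} \<Longrightarrow> norm (w j t - Z t) \<le> A / real (Suc j)" and wZ: "\<And>t. t \<in> {0..\<tau>} \<Longrightarrow> (\<lambda>j. w j t) \<longlonglongrightarrow> Z t"
    using uniform_rate_limit[of "{0..\<tau>}" w A, OF wr] by blast
  note G = g[unfolded gal_def, rule_format]
  have cu: "continuous_on {0..\<tau>} (u j)" and cw: "continuous_on {0..\<tau>} (w j)" for j
  proof -
    have "continuous_on {0..\<tau>} (y j)" "continuous_on {0..\<tau>} (z j)"
      by (rule continuous_on_vector_derivative, use G[of _ j] in blast)+
    then show "continuous_on {0..\<tau>} (u j)" "continuous_on {0..\<tau>} (w j)"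
      unfolding u_def[abs_def] w_def[abs_def] by (auto intro: bounded_linear.continuous_on[OF blL])
  qed
  have nu: "norm (u j t) \<le> M" and nw: "norm (w j t) \<le> M" if "t \<in> {0..\<tau>}" for j t
    using bd[OF that, of j] nL order_trans unfolding u_def w_def by blast+
  have nY: "norm (Y t) \<le> M" if "t \<in> {0..\<tau>}" for t
    by (rule LIMSEQ_le_const2[OF tendsto_norm[OF uY[OF that]]]) (use nu[OF that] in auto)
  have nZ: "norm (Z t) \<le> M" if "t \<in> {0..\<tau>}" for t
    by (rule LIMSEQ_le_const2[OF tendsto_norm[OF wZ[OF that]]]) (use nw[OF that] in auto)
  have hY: "herm (Y t)" if t: "t \<in> {0..\<tau>}" for t
  proof -
    have "herm (u j t)" for j
      unfolding u_def L_def by (rule herm_mulS_cjp[OF \<sigma>(2)]) (use G[OF t, of j] in blast)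
    then have "(\<lambda>j. Sop (u j t)) = (\<lambda>j. u j t)" by (simp add: herm_def)
    moreover have "(\<lambda>j. Sop (u j t)) \<longlonglongrightarrow> Sop (Y t)"
      by (rule bounded_linear.tendsto[OF bounded_linear_Sop uY[OF t]])
    ultimately show ?thesis unfolding herm_def using LIMSEQ_unique[OF _ uY[OF t]] by metis
  qed
  have isDL: "isD v d \<Longrightarrow> mulS (cjp (-1)) (L d) = mulS (icjp (-1)) (L v)" for v d
    using isD_mulS_eq[OF b1 bi isD_mulS[OF bc, of v d]] by (simp add: L_def)
  obtain Cp where Cp: "Cp \<ge> 0" "\<And>x. norm x \<le> M \<Longrightarrow> norm (pw N x (Suc q)) \<le> Cp"
    using lipb_pw[OF N1, of "Suc q"] M unfolding lipb_def by metis
  obtain Cl where Cl: "Cl \<ge> 0" "\<And>x y. norm x \<le> M \<Longrightarrow> norm y \<le> M \<Longrightarrow> norm (pw s x (Suc q) - pw s y (Suc q)) \<le> Cl * norm (x - y)"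
    using lipb_pw[OF s1, of "Suc q"] M unfolding lipb_def by metis
  define X where "X j t = y j t + lam *\<^sub>R pw N (y j t) (Suc q)" for j t
  have nX: "norm (X j t) \<le> M + lam * Cp" if t: "t \<in> {0..\<tau>}" for j t
  proof -
    have "norm (X j t) \<le> norm (y j t) + lam * norm (pw N (y j t) (Suc q))"
      unfolding X_def by (rule order_trans[OF norm_triangle_ineq]) (use lam in simp)
    also have "\<dots> \<le> M + lam * Cp" using bd[OF t, of j] Cp(2)[of "y j t"] lam by (intro add_mono mult_left_mono) auto
    finally show ?thesis .
  qed
  have LX: "L (X j t) = u j t + lam *\<^sub>R pw s (u j t) (Suc q)" for j t
    unfolding X_def u_def L_def \<sigma>_def
    using pw_low[OF s1 sN', of "y j t" "Suc q"] bc by (simp add: mulS_add mulS_scaleR \<sigma>_def del: pw.simps)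
  define A' where "A' = c2 * ((M + lam * Cp) + (A + lam * (Cl * A)))"
  have dY: "((\<lambda>t. mulS (cjp (-1)) (Y t)) has_vector_derivative mulS (icjp (-1)) (Z t)) (at t within {0..\<tau>})" if t: "t \<in> {0..\<tau>}" for t
  proof (rule has_vector_derivative_limit[where f="\<lambda>j t. mulS (cjp (-1)) (u j t)" and f'="\<lambda>j t. mulS (icjp (-1)) (w j t)" and g'="\<lambda>t. mulS (icjp (-1)) (Z t)", OF _ _ _ t])
    fix j t assume t: "t \<in> {0..\<tau>}"
    have "isD (z j t) (mulS (Dn (real (Suc j))) (z j t))" by (rule isD_Jn) (use G[OF t, of j] in blast)
    from isDL[OF this]
    show "((\<lambda>t. mulS (cjp (-1)) (u j t)) has_vector_derivative mulS (icjp (-1)) (w j t)) (at t within {0..\<tau>})"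
      using bounded_linear.has_vector_derivative[OF bounded_linear_mulS[OF b1] bounded_linear.has_vector_derivative[OF blL], of "y j"] G[OF t, of j]
      unfolding u_def w_def by force
  next
    fix t assume t: "t \<in> {0..\<tau>}"
    show "(\<lambda>j. mulS (cjp (-1)) (u j t)) \<longlonglongrightarrow> mulS (cjp (-1)) (Y t)"
      by (rule bounded_linear.tendsto[OF bounded_linear_mulS[OF b1] uY[OF t]])
  next
    fix e :: real assume "e > 0"
    from order_tendstoD(2)[OF rate_tendsto_0[of A] this]
    show "\<forall>\<^sub>F n in sequentially. \<forall>t\<in>{0..\<tau>}. norm (mulS (icjp (-1)) (w n t) - mulS (icjp (-1)) (Z t)) \<le> e"
    proof eventually_elim
      fix j assume j: "A / real (Suc j) < e"
      have "norm (mulS (icjp (-1)) (w j t - Z t)) \<le> e" if "t \<in> {0..\<tau>}" for t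
        using norm_icjp_le[of "w j t - Z t"] Z[OF that, of j] j by linarith
      then show "\<forall>t\<in>{0..\<tau>}. norm (mulS (icjp (-1)) (w j t) - mulS (icjp (-1)) (Z t)) \<le> e"
        by (simp add: mulS_diff[OF bi])
    qed
  qed
  have dZ: "((\<lambda>t. mulS (cjp (-1)) (Z t)) has_vector_derivative mulS (csym m) (mulS (icjp (-1)) (Y t + lam *\<^sub>R pw s (Y t) (Suc q)))) (at t within {0..\<tau>})" if t: "t \<in> {0..\<tau>}" for t
  proof (rule has_vector_derivative_limit[where f="\<lambda>j t. mulS (cjp (-1)) (w j t)"
        and f'="\<lambda>j t. mulS (csym m) (mulS (Jn (real (Suc j))) (mulS (icjp (-1)) (L (X j t))))"
        and g'="\<lambda>t. mulS (csym m) (mulS (icjp (-1)) (Y t + lam *\<^sub>R pw s (Y t) (Suc q)))", OF _ _ _ t])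
    fix j t assume t: "t \<in> {0..\<tau>}"
    let ?n = "real (Suc j)"
    have Jy: "mulS (Jn ?n) (y j t) = y j t" using G[OF t, of j] by blast
    obtain dp where dp: "isD (pw N (y j t) (Suc q)) dp" using isD_pw_ex[OF N2 isD_Jn[OF Jy]] by blast
    obtain dX where dX: "isD (X j t) dX"
      unfolding X_def using isD_add[OF isD_Jn[OF Jy] isD_scaleR[OF dp]] by blast
    have "(z j has_vector_derivative mulS (csym m) (mulS (Dn ?n) (X j t))) (at t within {0..\<tau>})"
      unfolding X_def using G[OF t, of j] by blast
    then have dw: "((\<lambda>t. mulS (cjp (-1)) (w j t)) has_vector_derivative mulS (cjp (-1)) (L (mulS (csym m) (mulS (Dn ?n) (X j t))))) (at t within {0..\<tau>})"
      unfolding w_def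
      by (rule bounded_linear.has_vector_derivative[OF bounded_linear_mulS[OF b1] bounded_linear.has_vector_derivative[OF blL]])
    have e1: "mulS (cjp (-1)) (L (mulS (csym m) (mulS (Dn ?n) (X j t)))) = mulS (csym m) (mulS (Jn ?n) (mulS (cjp (-1)) (L dX)))"
    proof -
      have cm: "mulS \<rho> (mulS (csym m) (mulS (Jn ?n) v)) = mulS (csym m) (mulS (Jn ?n) (mulS \<rho> v))" if "bsym \<rho>" for \<rho> v
        by (simp only: mulS_commute[OF that bm] mulS_commute[OF that bsym_Jn])
      show ?thesis unfolding mulS_Dn_isD[OF dX] L_def cm[OF bc] cm[OF b1] ..
    qed
    have e2: "mulS (cjp (-1)) (L dX) = mulS (icjp (-1)) (L (X j t))" by (rule isDL[OF dX])
    show "((\<lambda>t. mulS (cjp (-1)) (w j t)) has_vector_derivative mulS (csym m) (mulS (Jn ?n) (mulS (icjp (-1)) (L (X j t))))) (at t within {0..\<tau>})"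
      using dw unfolding e1 e2 .
  next
    fix t assume t: "t \<in> {0..\<tau>}"
    show "(\<lambda>j. mulS (cjp (-1)) (w j t)) \<longlonglongrightarrow> mulS (cjp (-1)) (Z t)"
      by (rule bounded_linear.tendsto[OF bounded_linear_mulS[OF b1] wZ[OF t]])
  next
    fix e :: real assume "e > 0"
    from order_tendstoD(2)[OF rate_tendsto_0[of A'] this]
    show "\<forall>\<^sub>F n in sequentially. \<forall>t\<in>{0..\<tau>}. norm (mulS (csym m) (mulS (Jn (real (Suc n))) (mulS (icjp (-1)) (L (X n t))))
      - mulS (csym m) (mulS (icjp (-1)) (Y t + lam *\<^sub>R pw s (Y t) (Suc q)))) \<le> e"
    proof eventually_elim
      fix j assume j: "A' / real (Suc j) < e"
      let ?n = "real (Suc j)"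
      show "\<forall>t\<in>{0..\<tau>}. norm (mulS (csym m) (mulS (Jn ?n) (mulS (icjp (-1)) (L (X j t))))
        - mulS (csym m) (mulS (icjp (-1)) (Y t + lam *\<^sub>R pw s (Y t) (Suc q)))) \<le> e"
      proof
        fix t assume t: "t \<in> {0..\<tau>}"
        define V where "V = Y t + lam *\<^sub>R pw s (Y t) (Suc q)"
        \<comment> \<open>Removing the cutoff: beyond it the weight \<open>cjp \<sigma>\<close> with
          \<open>\<sigma> \<le> -1\<close> is at most \<open>1 / ?n\<close>, so the gap between
          \<open>N\<close> and \<open>s\<close> yields the rate.\<close>
        have t1: "norm (mulS (Jn ?n) (mulS (icjp (-1)) (L (X j t))) - mulS (icjp (-1)) (L (X j t))) \<le> (M + lam * Cp) / ?n"
        proof -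
          define \<rho> where "\<rho> \<xi> = (Jn ?n \<xi> - 1) * (icjp (-1) \<xi> * cjp \<sigma> \<xi>)" for \<xi>
          have bb: "bsym (\<lambda>\<xi>. icjp (-1) \<xi> * cjp \<sigma> \<xi>)" by (rule bsym_mult[OF bi bc])
          have "mulS (Jn ?n) (mulS (icjp (-1)) (L (X j t))) - mulS (icjp (-1)) (L (X j t)) = mulS \<rho> (X j t)"
            unfolding L_def mulS_mulS[OF bi bc] mulS_mulS[OF bsym_Jn bb] \<rho>_def
            by (subst mulS_sym_diff[OF bsym_mult[OF bsym_Jn bb] bb]) (simp only: left_diff_distrib mult_1)
          also have "norm \<dots> \<le> (1 / ?n) * norm (X j t)"
          proof (rule norm_mulS_le)
            show cb: "cmod (\<rho> \<xi>) \<le> 1 / ?n" for \<xi>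
            proof (cases "\<bar>\<xi>\<bar> \<le> ?n")
              case True then show ?thesis by (simp add: \<rho>_def Jn_def)
            next
              case False
              then have "cmod (\<rho> \<xi>) = cmod (icjp (-1) \<xi>) * jp \<sigma> \<xi>" by (simp add: \<rho>_def Jn_def norm_mult)
              also have "\<dots> \<le> 1 * jp (-1) \<xi>" using \<sigma> cmod_icjp_le[of \<xi>] by (intro mult_mono jp_mono) auto
              also have "\<dots> \<le> 1 / ?n" using jp_neg1_le[of ?n \<xi>] False by simp
              finally show ?thesis .
            qed
            show "bsym \<rho>" by (rule bsymI[OF _ cb]) (unfold \<rho>_def, measurable)
          qed
          also have "\<dots> \<le> (1 / ?n) * (M + lam * Cp)" using nX[OF t, of j] by (intro mult_left_mono) auto
          finally show ?thesis by simp
        qed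
        have t2: "norm (mulS (icjp (-1)) (L (X j t) - V)) \<le> A / ?n + lam * (Cl * (A / ?n))"
        proof -
          have "norm (L (X j t) - V) = norm ((u j t - Y t) + lam *\<^sub>R (pw s (u j t) (Suc q) - pw s (Y t) (Suc q)))"
            unfolding LX V_def by (simp del: pw.simps add: scaleR_diff_right add_diff_add)
          also have "\<dots> \<le> A / ?n + lam * (Cl * (A / ?n))"
          proof (rule norm_triangle_mono[OF Y[OF t]])
            have "norm (pw s (u j t) (Suc q) - pw s (Y t) (Suc q)) \<le> Cl * norm (u j t - Y t)" by (rule Cl(2)[OF nu[OF t] nY[OF t]])
            also have "\<dots> \<le> Cl * (A / ?n)" by (rule mult_left_mono[OF Y[OF t] Cl(1)])
            finally have x: "norm (pw s (u j t) (Suc q) - pw s (Y t) (Suc q)) \<le> Cl * (A / ?n)" .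
            show "norm (lam *\<^sub>R (pw s (u j t) (Suc q) - pw s (Y t) (Suc q))) \<le> lam * (Cl * (A / ?n))"
              unfolding norm_scaleR abs_of_nonneg[OF lam] by (rule mult_left_mono[OF x lam])
          qed
          finally show ?thesis using norm_icjp_le[of "L (X j t) - V"] by linarith
        qed
        define a b where "a = mulS (Jn ?n) (mulS (icjp (-1)) (L (X j t)))" and "b = mulS (icjp (-1)) (L (X j t))"
        define d where "d = mulS (icjp (-1)) V"
        have bd: "norm (a - b) \<le> (M + lam * Cp) / ?n" "norm (b - d) \<le> A / ?n + lam * (Cl * (A / ?n))"
          using t1 t2 unfolding a_def b_def d_def mulS_diff[OF bi] by blast+
        have "norm (mulS (csym m) a - mulS (csym m) d) \<le> c2 * norm ((a - b) + (b - d))"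
          unfolding mulS_diff[OF bm, symmetric] using norm_mulS_le[OF bm cmod_m_le[OF m], of "a - d"] by simp
        also have "\<dots> \<le> c2 * ((M + lam * Cp) / ?n + (A / ?n + lam * (Cl * (A / ?n))))"
          using mclass_c2[OF m] by (intro mult_left_mono norm_triangle_mono bd) simp
        also have "\<dots> = A' / ?n" by (simp add: A'_def add_divide_distrib[symmetric] del: of_nat_Suc)
        finally have x: "norm (mulS (csym m) a - mulS (csym m) d) \<le> A' / ?n" .
        show "norm (mulS (csym m) (mulS (Jn ?n) (mulS (icjp (-1)) (L (X j t))))
          - mulS (csym m) (mulS (icjp (-1)) (Y t + lam *\<^sub>R pw s (Y t) (Suc q)))) \<le> e"
          by (rule order_trans[OF x[unfolded a_def d_def V_def] less_imp_le[OF j]])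
      qed
    qed
  qed
  have "csol m s q lam \<tau> Y Z"
    unfolding csol_def
    by (intro conjI ballI rate_continuous[OF cu Y] rate_continuous[OF cw Z] hY dY dZ) assumption+
  then show thesis
    by (rule that) (rule uY[unfolded u_def L_def \<sigma>_def] wZ[unfolded w_def L_def \<sigma>_def] nY nZ, assumption)+
qed

lemma Jn_diff_le:
  assumes n: "0 < n2" "n2 \<le> n1" and \<sigma>: "\<sigma> \<le> -1"
  shows "norm (mulS (cjp \<sigma>) (mulS (Jn n1) v - mulS (Jn n2) v)) \<le> norm v / n2"
    and "norm (mulS (cjp \<sigma>) (mulS (Jn n2) v - v)) \<le> norm v / n2"
proof -
  have bc: "bsym (cjp \<sigma>)" using \<sigma> by (intro bsym_cjp) simp
  have b1: "bsym (\<lambda>\<xi>. 1)" by (rule bsymI[of _ 1]) auto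
  have small: "jp \<sigma> \<xi> \<le> 1 / n2" if "n2 < \<bar>\<xi>\<bar>" for \<xi>
    using jp_mono[of \<sigma> "-1" \<xi>] jp_neg1_le[of n2 \<xi>] \<sigma> n that by linarith
  have g: "norm (mulS (cjp \<sigma>) (mulS \<rho> v - mulS (Jn n2) v)) \<le> norm v / n2"
    if \<rho>: "bsym \<rho>" and le: "\<And>\<xi>. \<bar>\<xi>\<bar> \<le> n2 \<Longrightarrow> \<rho> \<xi> = 1" "\<And>\<xi>. cmod (\<rho> \<xi>) \<le> 1" for \<rho>
  proof -
    define \<tau> where "\<tau> \<xi> = cjp \<sigma> \<xi> * (\<rho> \<xi> - Jn n2 \<xi>)" for \<xi>
    have cb: "cmod (\<tau> \<xi>) \<le> 1 / n2" for \<xi>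
    proof (cases "\<bar>\<xi>\<bar> \<le> n2")
      case True then show ?thesis using n le(1) by (simp add: \<tau>_def Jn_def)
    next
      case False
      then have "cmod (\<tau> \<xi>) = jp \<sigma> \<xi> * cmod (\<rho> \<xi>)" by (simp add: \<tau>_def Jn_def norm_mult)
      also have "\<dots> \<le> jp \<sigma> \<xi> * 1" by (intro mult_left_mono le) simp
      finally show ?thesis using small[of \<xi>] False by simp
    qed
    have b\<tau>: "bsym \<tau>"
    proof (rule bsymI[OF _ cb])
      note [measurable] = bsym_measurable[OF \<rho>]
      show "\<tau> \<in> borel_measurable borel" unfolding \<tau>_def by measurable
    qed
    have bd: "bsym (\<lambda>\<xi>. \<rho> \<xi> - Jn n2 \<xi>)"
    proof (rule bsymI[of _ 2])
      note [measurable] = bsym_measurable[OF \<rho>]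
      show "(\<lambda>\<xi>. \<rho> \<xi> - Jn n2 \<xi>) \<in> borel_measurable borel" by measurable
      show "cmod (\<rho> \<xi> - Jn n2 \<xi>) \<le> 2" for \<xi>
        using norm_triangle_ineq4[of "\<rho> \<xi>" "Jn n2 \<xi>"] le(2)[of \<xi>] by (auto simp: Jn_def split: if_splits)
    qed
    have "mulS (cjp \<sigma>) (mulS \<rho> v - mulS (Jn n2) v) = mulS \<tau> v"
      unfolding mulS_sym_diff[OF \<rho> bsym_Jn] mulS_mulS[OF bc bd] \<tau>_def ..
    then show ?thesis using norm_mulS_le[OF b\<tau> cb, of v] by simp
  qed
  show "norm (mulS (cjp \<sigma>) (mulS (Jn n1) v - mulS (Jn n2) v)) \<le> norm v / n2"
    by (rule g[OF bsym_Jn]) (use n in \<open>auto simp: Jn_def\<close>)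
  have "norm (mulS (cjp \<sigma>) (mulS (\<lambda>\<xi>. 1) v - mulS (Jn n2) v)) \<le> norm v / n2"
    by (rule g[OF b1]) auto
  then show "norm (mulS (cjp \<sigma>) (mulS (Jn n2) v - v)) \<le> norm v / n2"
    unfolding mulS_one mulS_diff[OF bc] by (simp add: norm_minus_commute)
qed

text \<open>The data are given as coordinates at the level \<open>N\<close> and lowered to the level
  \<open>s\<close> of the solution.\<close>

definition good_sol :: "real \<Rightarrow> nat \<Rightarrow> real \<Rightarrow> real \<Rightarrow> real \<Rightarrow> real \<Rightarrow> l2 \<Rightarrow> l2 \<Rightarrow> (real \<Rightarrow> real) \<Rightarrow> (real \<Rightarrow> l2) \<Rightarrow> (real \<Rightarrow> l2) \<Rightarrow> bool" where
  "good_sol s q lam \<tau> M N Y0 Z0 m Y Z \<longleftrightarrow> csol m s q lam \<tau> Y Z \<and> Y 0 = mulS (cjp (s - N)) Y0 \<and> Z 0 = mulS (cjp (s - N)) Z0 \<and>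
     (\<forall>t\<in>{0..\<tau>}. norm (Y t) \<le> M \<and> norm (Z t) \<le> M)"

text \<open>Truncations for one kernel (\<open>\<kappa> = 0\<close>) form a Cauchy sequence;
  truncations of equal order for two kernels are compared before the limit. The constant
  \<open>Cb\<close> at level \<open>s - 3\<close> is exported because uniqueness uses it with the
  radius \<open>M\<close> found here.\<close>

lemma coordinate_solutions:
  assumes s: "s \<ge> 5" and c: "0 < c1" "0 < c2" and M0: "M0 \<ge> 0" and N: "N = s + 2 * real k + 2"
  shows "\<exists>T>0. \<exists>lam0>0. \<exists>C\<ge>0. \<exists>M>0. \<exists>Cb\<ge>0. lam0 * Cb \<le> 1/2 \<and>
    (\<forall>y h. norm y \<le> M \<longrightarrow> \<bar>inner (Ps (s - 3) (bco (s - 3) q y) h) h\<bar> \<le> Cb * (norm h)\<^sup>2) \<and>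
    (\<forall>m1 m2 \<kappa> lam Y0 Z0. mclass c1 c2 m1 \<longrightarrow> mclass c1 c2 m2 \<longrightarrow> (\<forall>\<xi>. \<bar>m1 \<xi> - m2 \<xi>\<bar> \<le> \<kappa> * \<bar>\<xi>\<bar> ^ (2 * k)) \<longrightarrow> 0 \<le> \<kappa> \<longrightarrow>
     0 < lam \<longrightarrow> lam \<le> lam0 \<longrightarrow> herm Y0 \<longrightarrow> herm Z0 \<longrightarrow> norm Y0 \<le> M0 \<longrightarrow> norm Z0 \<le> M0 \<longrightarrow>
     (\<exists>Y1 Z1 Y2 Z2. good_sol s q lam (T / lam) M N Y0 Z0 m1 Y1 Z1 \<and> good_sol s q lam (T / lam) M N Y0 Z0 m2 Y2 Z2 \<and>
        (\<forall>t\<in>{0..T / lam}. norm (Y1 t - Y2 t) \<le> C * \<kappa> * t)))"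
proof -
  have s2: "s \<ge> 2" and N2: "N \<ge> 2" and sN: "s + 1 \<le> N" and sk: "N \<ge> s + 2 * real k + 2" and s31: "s - 3 \<ge> 1"
    using s N by simp_all
  obtain M T lam1 where M: "M > 0" and T: "T > 0" and l1: "lam1 > 0"
    and ex: "\<forall>m lam n Y0 Z0. mclass c1 c2 m \<longrightarrow> 0 < lam \<longrightarrow> lam \<le> lam1 \<longrightarrow> herm Y0 \<longrightarrow> herm Z0 \<longrightarrow>
     norm Y0 \<le> M0 \<longrightarrow> norm Z0 \<le> M0 \<longrightarrow>
     (\<exists>y z. gal m N q lam n (T / lam) y z \<and> y 0 = mulS (Jn n) Y0 \<and> z 0 = mulS (Jn n) Z0 \<and>
        (\<forall>t\<in>{0..T / lam}. norm (y t) \<le> M \<and> norm (z t) \<le> M))"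
    using gal_exists[OF N2 c M0, of q] by (elim exE conjE) (rule that)
  obtain C lam2 where C: "C \<ge> 0" and l2: "lam2 > 0" and df: "\<forall>m1 m2 \<kappa> lam n1 n2 y1 z1 y2 z2 d0.
     mclass c1 c2 m1 \<longrightarrow> mclass c1 c2 m2 \<longrightarrow> (\<forall>\<xi>. \<bar>m1 \<xi> - m2 \<xi>\<bar> \<le> \<kappa> * \<bar>\<xi>\<bar> ^ (2 * k)) \<longrightarrow> 0 \<le> \<kappa> \<longrightarrow>
     0 < lam \<longrightarrow> lam \<le> lam2 \<longrightarrow> 0 < n2 \<longrightarrow> n2 \<le> n1 \<longrightarrow>
     gal m1 N q lam n1 (T / lam) y1 z1 \<longrightarrow> gal m2 N q lam n2 (T / lam) y2 z2 \<longrightarrow>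
     (\<forall>t\<in>{0..T / lam}. norm (y1 t) \<le> M \<and> norm (z1 t) \<le> M \<and> norm (y2 t) \<le> M \<and> norm (z2 t) \<le> M) \<longrightarrow>
     norm (mulS (cjp (s - N)) (y1 0 - y2 0)) \<le> d0 \<longrightarrow> norm (mulS (cjp (s - N)) (z1 0 - z2 0)) \<le> d0 \<longrightarrow>
     (\<forall>t\<in>{0..T / lam}. norm (mulS (cjp (s - N)) (y1 t - y2 t)) \<le> C * (d0 + (\<kappa> + 1 / n2) * t) \<and>
        norm (mulS (cjp (s - N)) (z1 t - z2 t)) \<le> C * (d0 + (\<kappa> + 1 / n2) * t))"
    using gal_diff[OF s2 sk c M less_imp_le[OF T], of q] by (elim exE conjE) (rule that)
  obtain Cb where Cb: "Cb \<ge> 0" "\<forall>y h. norm y \<le> M \<longrightarrow> \<bar>inner (Ps (s - 3) (bco (s - 3) q y) h) h\<bar> \<le> Cb * (norm h)\<^sup>2"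
    using energy_bounds[OF s31 less_imp_le[OF M], of q] by blast
  \<comment> \<open>The first two entries serve existence and comparison; the last one provides the
    smallness \<open>lam0 * Cb \<le> 1/2\<close> for uniqueness.\<close>
  define lam0 where "lam0 = min lam1 (min lam2 (1 / (2 * Cb + 1)))"
  have l0: "lam0 > 0" unfolding lam0_def using l1 l2 Cb(1) by (simp add: add_nonneg_pos)
  have lCb: "lam0 * Cb \<le> 1/2"
  proof -
    have "lam0 * Cb \<le> 1 / (2 * Cb + 1) * Cb" using Cb(1) unfolding lam0_def by (intro mult_right_mono) auto
    also have "\<dots> \<le> 1/2" using Cb(1) by (simp add: divide_simps)
    finally show ?thesis .
  qed
  have main: "\<exists>Y1 Z1 Y2 Z2. good_sol s q lam (T / lam) M N Y0 Z0 m1 Y1 Z1 \<and> good_sol s q lam (T / lam) M N Y0 Z0 m2 Y2 Z2 \<and>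
        (\<forall>t\<in>{0..T / lam}. norm (Y1 t - Y2 t) \<le> C * \<kappa> * t)"
    if m12: "mclass c1 c2 m1" "mclass c1 c2 m2" and km: "\<forall>\<xi>. \<bar>m1 \<xi> - m2 \<xi>\<bar> \<le> \<kappa> * \<bar>\<xi>\<bar> ^ (2 * k)" and \<kappa>: "0 \<le> \<kappa>"
     and lam: "0 < lam" "lam \<le> lam0" and h0: "herm Y0" "herm Z0" and n0: "norm Y0 \<le> M0" "norm Z0 \<le> M0" for m1 m2 \<kappa> lam Y0 Z0
  proof -
    define \<tau> where "\<tau> = T / lam"
    have \<tau>: "\<tau> \<ge> 0" using T lam by (simp add: \<tau>_def)
    have le: "lam \<le> lam1" "lam \<le> lam2" using lam by (auto simp: lam0_def)
    have nn: "0 < real (Suc j)" for j by simp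
    have \<sigma>: "s - N \<le> -1" using sN by simp
    \<comment> \<open>This rate depends on \<tau> = \<open>T / lam\<close>, hence on \<epsilon>. It
      only establishes convergence for fixed \<epsilon> and does not enter the final
      constants.\<close>
    define A where "A = C * (M0 + \<tau>)"
    let ?L = "mulS (cjp (s - N))"
    have seq: "\<exists>y z Y Z. (\<forall>j. gal m N q lam (real (Suc j)) \<tau> (y j) (z j) \<and> y j 0 = mulS (Jn (real (Suc j))) Y0 \<and> z j 0 = mulS (Jn (real (Suc j))) Z0
       \<and> (\<forall>t\<in>{0..\<tau>}. norm (y j t) \<le> M \<and> norm (z j t) \<le> M)) \<and> good_sol s q lam \<tau> M N Y0 Z0 m Y Z
       \<and> (\<forall>t\<in>{0..\<tau>}. (\<lambda>j. ?L (y j t)) \<longlonglongrightarrow> Y t)" if m: "mclass c1 c2 m" for m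
    proof -
      have "\<forall>j. \<exists>y z. gal m N q lam (real (Suc j)) \<tau> y z \<and> y 0 = mulS (Jn (real (Suc j))) Y0 \<and> z 0 = mulS (Jn (real (Suc j))) Z0 \<and>
        (\<forall>t\<in>{0..\<tau>}. norm (y t) \<le> M \<and> norm (z t) \<le> M)"
        unfolding \<tau>_def using ex[rule_format, OF m lam(1) le(1) h0 n0] by blast
      then obtain y z where yz: "\<And>j. gal m N q lam (real (Suc j)) \<tau> (y j) (z j)" "\<And>j. y j 0 = mulS (Jn (real (Suc j))) Y0" "\<And>j. z j 0 = mulS (Jn (real (Suc j))) Z0"
        "\<And>j t. t \<in> {0..\<tau>} \<Longrightarrow> norm (y j t) \<le> M \<and> norm (z j t) \<le> M" by metis
      have r: "norm (?L (y i t - y j t)) \<le> A / real (Suc j) \<and> norm (?L (z i t - z j t)) \<le> A / real (Suc j)"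
        if t: "t \<in> {0..\<tau>}" and ij: "j \<le> i" for i j t
      proof -
        have bdd: "\<forall>t\<in>{0..T / lam}. norm (y i t) \<le> M \<and> norm (z i t) \<le> M \<and> norm (y j t) \<le> M \<and> norm (z j t) \<le> M"
          using yz(4) unfolding \<tau>_def by blast
        have i0: "norm (?L (y i 0 - y j 0)) \<le> M0 / real (Suc j)" "norm (?L (z i 0 - z j 0)) \<le> M0 / real (Suc j)"
        proof -
          have ij': "real (Suc j) \<le> real (Suc i)" using ij by simp
          show "norm (?L (y i 0 - y j 0)) \<le> M0 / real (Suc j)"
            unfolding yz(2) using Jn_diff_le(1)[OF nn ij' \<sigma>, of Y0] divide_right_mono[OF n0(1), of "real (Suc j)"] by linarith
          show "norm (?L (z i 0 - z j 0)) \<le> M0 / real (Suc j)"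
            unfolding yz(3) using Jn_diff_le(1)[OF nn ij' \<sigma>, of Z0] divide_right_mono[OF n0(2), of "real (Suc j)"] by linarith
        qed
        have ij'': "real (Suc j) \<le> real (Suc i)" using ij by simp
        have "norm (?L (y i t - y j t)) \<le> C * (M0 / real (Suc j) + (0 + 1 / real (Suc j)) * t) \<and>
          norm (?L (z i t - z j t)) \<le> C * (M0 / real (Suc j) + (0 + 1 / real (Suc j)) * t)"
          using df[rule_format, of m m 0 lam "real (Suc j)" "real (Suc i)" "y i" "z i" "y j" "z j" "M0 / real (Suc j)" t, OF m m _ order_refl lam(1) le(2) nn ij''
            yz(1)[unfolded \<tau>_def] yz(1)[unfolded \<tau>_def] bdd[rule_format] i0 t[unfolded \<tau>_def]] by simp
        moreover have "C * (M0 / real (Suc j) + (0 + 1 / real (Suc j)) * t) \<le> A / real (Suc j)"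
        proof -
          have "C * (M0 / real (Suc j) + (0 + 1 / real (Suc j)) * t) = (C * (M0 + t)) / real (Suc j)"
            by (simp add: add_divide_distrib[symmetric] del: of_nat_Suc)
          also have "\<dots> \<le> (C * (M0 + \<tau>)) / real (Suc j)"
            using t C by (intro divide_right_mono mult_left_mono) auto
          finally show ?thesis by (simp only: A_def)
        qed
        ultimately show ?thesis by linarith
      qed
      obtain Y Z where cs: "csol m s q lam \<tau> Y Z" and cY: "\<And>t. t \<in> {0..\<tau>} \<Longrightarrow> (\<lambda>j. ?L (y j t)) \<longlonglongrightarrow> Y t"
        and cZ: "\<And>t. t \<in> {0..\<tau>} \<Longrightarrow> (\<lambda>j. ?L (z j t)) \<longlonglongrightarrow> Z t"
        and nY: "\<And>t. t \<in> {0..\<tau>} \<Longrightarrow> norm (Y t) \<le> M" and nZ: "\<And>t. t \<in> {0..\<tau>} \<Longrightarrow> norm (Z t) \<le> M"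
        using gal_limit[OF s2 sN m less_imp_le[OF lam(1)] less_imp_le[OF M] \<tau> yz(1) yz(4) conjunct1[OF r] conjunct2[OF r]] by blast
      have bcs: "bsym (cjp (s - N))" using \<sigma> by (intro bsym_cjp) simp
      have lim0: "(\<lambda>j. ?L (mulS (Jn (real (Suc j))) V)) \<longlonglongrightarrow> ?L V" for V
      proof -
        have "(\<lambda>j. ?L (mulS (Jn (real (Suc j))) V) - ?L V) \<longlonglongrightarrow> 0"
        proof (rule Lim_null_comparison[OF _ rate_tendsto_0[of "norm V"]])
          show "\<forall>\<^sub>F j in sequentially. norm (?L (mulS (Jn (real (Suc j))) V) - ?L V) \<le> norm V / real (Suc j)"
            using Jn_diff_le(2)[OF nn order_refl \<sigma>, of _ V] unfolding mulS_diff[OF bcs] by (intro always_eventually) blast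
        qed
        then show ?thesis by (simp add: LIM_zero_iff)
      qed
      have Y00: "Y 0 = ?L Y0"
        using LIMSEQ_unique[OF cY[of 0] lim0[of Y0, folded yz(2)]] \<tau> by simp
      have Z00: "Z 0 = ?L Z0"
        using LIMSEQ_unique[OF cZ[of 0] lim0[of Z0, folded yz(3)]] \<tau> by simp
      have "good_sol s q lam \<tau> M N Y0 Z0 m Y Z" unfolding good_sol_def using cs Y00 Z00 nY nZ by blast
      then show ?thesis using yz cY by blast
    qed
    obtain y1 z1 Y1 Z1 where s1: "\<And>j. gal m1 N q lam (real (Suc j)) \<tau> (y1 j) (z1 j)" "\<And>j. y1 j 0 = mulS (Jn (real (Suc j))) Y0" "\<And>j. z1 j 0 = mulS (Jn (real (Suc j))) Z0"
       "\<And>j t. t \<in> {0..\<tau>} \<Longrightarrow> norm (y1 j t) \<le> M \<and> norm (z1 j t) \<le> M" and g1: "good_sol s q lam \<tau> M N Y0 Z0 m1 Y1 Z1"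
       and c1: "\<And>t. t \<in> {0..\<tau>} \<Longrightarrow> (\<lambda>j. ?L (y1 j t)) \<longlonglongrightarrow> Y1 t"
      using seq[OF m12(1)] by metis
    obtain y2 z2 Y2 Z2 where s2: "\<And>j. gal m2 N q lam (real (Suc j)) \<tau> (y2 j) (z2 j)" "\<And>j. y2 j 0 = mulS (Jn (real (Suc j))) Y0" "\<And>j. z2 j 0 = mulS (Jn (real (Suc j))) Z0"
       "\<And>j t. t \<in> {0..\<tau>} \<Longrightarrow> norm (y2 j t) \<le> M \<and> norm (z2 j t) \<le> M" and g2: "good_sol s q lam \<tau> M N Y0 Z0 m2 Y2 Z2"
       and c2': "\<And>t. t \<in> {0..\<tau>} \<Longrightarrow> (\<lambda>j. ?L (y2 j t)) \<longlonglongrightarrow> Y2 t"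
      using seq[OF m12(2)] by metis
    have bcs: "bsym (cjp (s - N))" using \<sigma> by (intro bsym_cjp) simp
    have "norm (Y1 t - Y2 t) \<le> C * \<kappa> * t" if t: "t \<in> {0..\<tau>}" for t
    proof (rule LIMSEQ_le)
      show "(\<lambda>j. norm (?L (y1 j t) - ?L (y2 j t))) \<longlonglongrightarrow> norm (Y1 t - Y2 t)"
        by (intro tendsto_norm tendsto_diff c1 c2' t)
      have "(\<lambda>j. C * \<kappa> * t + (C * t) / real (Suc j)) \<longlonglongrightarrow> C * \<kappa> * t + 0"
        by (intro tendsto_add tendsto_const rate_tendsto_0)
      then show "(\<lambda>j. C * \<kappa> * t + (C * t) / real (Suc j)) \<longlonglongrightarrow> C * \<kappa> * t" by simp
      have "norm (?L (y1 j t) - ?L (y2 j t)) \<le> C * \<kappa> * t + (C * t) / real (Suc j)" for j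
      proof -
        have bdd: "\<forall>t\<in>{0..T / lam}. norm (y1 j t) \<le> M \<and> norm (z1 j t) \<le> M \<and> norm (y2 j t) \<le> M \<and> norm (z2 j t) \<le> M"
          using s1(4) s2(4) unfolding \<tau>_def by blast
        have zz: "norm (?L (v - v)) \<le> 0" for v
          using linear_0[OF bounded_linear.linear[OF bounded_linear_mulS[OF bcs]]] by simp
        \<comment> \<open>With equal cutoffs the truncated data coincide, so the initial difference
          is 0 and only \<kappa> and the vanishing term 1/(j+1) remain.\<close>
        have "norm (?L (y1 j t - y2 j t)) \<le> C * (0 + (\<kappa> + 1 / real (Suc j)) * t)"
          using df[rule_format, of m1 m2 \<kappa> lam "real (Suc j)" "real (Suc j)" "y1 j" "z1 j" "y2 j" "z2 j" 0 t, OF m12 km[rule_format] \<kappa> lam(1) le(2) nn order_refl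
            s1(1)[unfolded \<tau>_def] s2(1)[unfolded \<tau>_def] bdd[rule_format] _ _ t[unfolded \<tau>_def]] zz unfolding s1(2,3) s2(2,3) by blast
        also have "\<dots> = C * \<kappa> * t + (C * t) / real (Suc j)" by (simp add: algebra_simps del: of_nat_Suc)
        finally show ?thesis by (simp only: mulS_diff[OF bcs])
      qed
      then show "\<exists>N'. \<forall>n\<ge>N'. norm (?L (y1 n t) - ?L (y2 n t)) \<le> C * \<kappa> * t + (C * t) / real (Suc n)" by blast
    qed
    then show ?thesis using g1 g2 unfolding \<tau>_def by blast
  qed
  show ?thesis
    by (rule exI[of _ T], rule conjI[OF T], rule exI[of _ lam0], rule conjI[OF l0], rule exI[of _ C], rule conjI[OF C],
        rule exI[of _ M], rule conjI[OF M], rule exI[of _ Cb], intro conjI allI impI Cb(1) lCb Cb(2)[rule_format] main) blast+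
qed

section \<open>Uniqueness of the limit solution\<close>

definition fsol :: "(real \<Rightarrow> real) \<Rightarrow> real \<Rightarrow> nat \<Rightarrow> real \<Rightarrow> real \<Rightarrow> real \<Rightarrow> (real \<Rightarrow> l2) \<Rightarrow> (real \<Rightarrow> l2) \<Rightarrow> bool" where
  "fsol m s q lam \<tau> M y z \<longleftrightarrow> (\<forall>t\<in>{0..\<tau>}. norm (y t) \<le> M \<and> norm (z t) \<le> M \<and>
     (\<exists>dy dz dF. norm dy \<le> M \<and> isD (y t) dy \<and> isD (z t) dz \<and> isD (pw s (y t) (Suc q)) dF \<and>
        (y has_vector_derivative dz) (at t within {0..\<tau>}) \<and>
        (z has_vector_derivative mulS (csym m) (dy + lam *\<^sub>R dF)) (at t within {0..\<tau>})))"

text \<open>\<open>energy_comparison\<close> with no initial difference and no error. The smallness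
  condition concerns only \<open>y1\<close>, whose power is the coefficient in the energy.\<close>

lemma fsol_unique:
  assumes s: "s \<ge> 2" and m: "mclass c1 c2 m" and lam: "lam \<ge> 0" and M: "M \<ge> 0"
    and f1: "fsol m s q lam \<tau> M y1 z1" and f2: "fsol m s q lam \<tau> M y2 z2"
    and h: "\<And>t. t \<in> {0..\<tau>} \<Longrightarrow> herm (y1 t)"
    and Cb: "\<And>t h. t \<in> {0..\<tau>} \<Longrightarrow> \<bar>inner (Ps s (bco s q (y1 t)) h) h\<bar> \<le> Cb * (norm h)\<^sup>2" "lam * Cb \<le> 1/2"
    and i: "y1 0 = y2 0" "z1 0 = z2 0" and t: "t \<in> {0..\<tau>}"
  shows "y1 t = y2 t"
proof -
  obtain C where C: "C \<ge> 0" and ED: "ebound s q M C" using energy_deriv[OF s M, of q] by auto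
  have der: "ediff m s q lam {0..\<tau>} M 0 y1 z1 y2 z2 v" if v: "v \<in> {0..\<tau>}" for v
  proof -
    obtain dy1 dz1 dF1 where 1: "isD (y1 v) dy1" "isD (z1 v) dz1" "isD (pw s (y1 v) (Suc q)) dF1"
      "(y1 has_vector_derivative dz1) (at v within {0..\<tau>})" "(z1 has_vector_derivative mulS (csym m) (dy1 + lam *\<^sub>R dF1)) (at v within {0..\<tau>})"
      using f1 v unfolding fsol_def by blast
    obtain dy2 dz2 dF2 where 2: "isD (y2 v) dy2" "isD (z2 v) dz2" "isD (pw s (y2 v) (Suc q)) dF2"
      "(y2 has_vector_derivative dz2) (at v within {0..\<tau>})" "(z2 has_vector_derivative mulS (csym m) (dy2 + lam *\<^sub>R dF2)) (at v within {0..\<tau>})"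
      and n2: "norm dy2 \<le> M" using f2 v unfolding fsol_def by blast
    have e: "mulS (csym (\<lambda>\<xi>. 1 / m \<xi>)) (mulS (csym m) (dy1 + lam *\<^sub>R dF1) - mulS (csym m) (dy2 + lam *\<^sub>R dF2)) = dy1 - dy2 + lam *\<^sub>R (dF1 - dF2) + 0"
      unfolding mulS_diff[OF bsym_m[OF m], symmetric] inner_inv_m[OF m] by (simp add: algebra_simps)
    have n0: "norm (0 :: l2) \<le> 0" by simp
    show ?thesis unfolding ediff_def
      by (intro exI conjI) (rule 1(1-4) 2(1-4) has_vector_derivative_diff[OF 1(5) 2(5)] arg_cong[OF e] n2 n0)+
  qed
  have b: "herm (y1 v) \<and> norm (y1 v) \<le> M \<and> norm (y2 v) \<le> M \<and> norm (z1 v) \<le> M" if "v \<in> {0..\<tau>}" for v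
    using h f1 f2 that unfolding fsol_def by blast
  have "max (norm (y1 t - y2 t)) (norm (z1 t - z2 t)) \<le> exp (lam * C / (2 * min (1 / c2) (1 / 2)) * t) * (sqrt (1 / c1 + 2) * 0 + 0 / sqrt (min (1 / c2) (1 / 2)) * t) / sqrt (min (1 / c2) (1 / 2))"
    by (rule energy_comparison[OF m lam C ED order_refl Cb b der _ _ t refl]) (simp_all add: i)
  then show ?thesis by simp
qed

lemma mulS_cjp_inject: "\<sigma> \<le> 0 \<Longrightarrow> mulS (cjp \<sigma>) x = mulS (cjp \<sigma>) y \<Longrightarrow> x = y"
proof -
  assume \<sigma>: "\<sigma> \<le> 0" and e: "mulS (cjp \<sigma>) x = mulS (cjp \<sigma>) y"
  have "AE \<xi> in lborel. rep x \<xi> = rep y \<xi>"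
    using rep_mulS[OF bsym_cjp[OF \<sigma>], of x] rep_mulS[OF bsym_cjp[OF \<sigma>], of y] unfolding e
    by eventually_elim simp
  then show ?thesis by (rule l2_eqI)
qed

lemma continuous_on_pw: "s \<ge> 1 \<Longrightarrow> continuous_on S Y \<Longrightarrow> continuous_on S (\<lambda>v. pw s (Y v) j)"
  by (induction j) (auto intro: bounded_bilinear.continuous_on[OF bb_Qs])

text \<open>The Cauchy problem imposes its equation for positive times only; continuity makes up for
  the missing derivative at time 0.\<close>

lemma has_vector_derivative_eq_imp_eq:
  fixes f g :: "real \<Rightarrow> 'a::banach"
  assumes "continuous_on {0..\<tau>} f" "continuous_on {0..\<tau>} g" "f 0 = g 0" "t \<in> {0..\<tau>}"
    and "\<And>t. t \<in> {0<..\<tau>} \<Longrightarrow> (f has_vector_derivative d t) (at t within {0..\<tau>})"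
    and "\<And>t. t \<in> {0<..\<tau>} \<Longrightarrow> (g has_vector_derivative d t) (at t within {0..\<tau>})"
  shows "f t = g t"
proof -
  have "f t - g t = f 0 - g 0"
  proof (rule has_derivative_zero_unique_strong_interval[of "{0}" 0 \<tau> "\<lambda>t. f t - g t"])
    show "((\<lambda>t. f t - g t) has_derivative (\<lambda>h. 0)) (at x within {0..\<tau>})" if "x \<in> {0..\<tau>} - {0}" for x
      using has_vector_derivative_diff[OF assms(5,6)[of x]] that by (simp add: has_vector_derivative_def)
  qed (use assms in \<open>auto intro!: continuous_intros\<close>)
  then show ?thesis using assms(3) by simp
qed

text \<open>Uniqueness is proved three derivatives below the level of the solutions; the second-order solution
  \<open>Y2, V2\<close> gets its potential \<open>z2\<close> with \<open>\<partial>\<^sub>x z2 = \<partial>\<^sub>t Y2\<close> by integrating the flux in time.\<close>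

lemma csol_unique:
  assumes s: "s \<ge> 5" and m: "mclass c1 c2 m" and lam: "lam \<ge> 0" and \<tau>: "\<tau> \<ge> 0"
    and c1: "csol m s q lam \<tau> Y1 Z1"
    and Cb: "\<And>y h. norm y \<le> M \<Longrightarrow> \<bar>inner (Ps (s - 3) (bco (s - 3) q y) h) h\<bar> \<le> Cb * (norm h)\<^sup>2" "lam * Cb \<le> 1/2"
    and bd: "\<And>t. t \<in> {0..\<tau>} \<Longrightarrow> norm (Y1 t) \<le> M"
    and cY: "continuous_on {0..\<tau>} Y2" and cV: "continuous_on {0..\<tau>} V2"
    and dY: "\<And>t. t \<in> {0..\<tau>} \<Longrightarrow> ((\<lambda>t. mulS (cjp (-1)) (Y2 t)) has_vector_derivative V2 t) (at t within {0..\<tau>})"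
    and dV: "\<And>t. t \<in> {0<..\<tau>} \<Longrightarrow> ((\<lambda>t. mulS (cjp (-1)) (V2 t)) has_vector_derivative
        mulS (csym m) (mulS (icjp (-1)) (mulS (icjp (-1)) (Y2 t + lam *\<^sub>R pw s (Y2 t) (Suc q))))) (at t within {0..\<tau>})"
    and i: "Y2 0 = Y1 0" "V2 0 = mulS (icjp (-1)) (Z1 0)" and t: "t \<in> {0..\<tau>}"
  shows "Y2 t = Y1 t"
proof -
  have s1: "s \<ge> 1" and s3: "s - 3 \<ge> 2" "1 \<le> s - 3" "s - 3 \<le> s" using s by auto
  have bi: "bsym (icjp \<sigma>)" if "\<sigma> \<le> -1" for \<sigma> using bsym_icjp[OF that] .
  have bc: "bsym (cjp \<sigma>)" if "\<sigma> \<le> 0" for \<sigma> using bsym_cjp[OF that] .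
  note bm = bsym_m[OF m]
  have cm: "mulS (cjp \<alpha>) (mulS (icjp \<beta>) x) = mulS (icjp (\<alpha> + \<beta>)) x" "mulS (icjp \<beta>) (mulS (cjp \<alpha>) x) = mulS (icjp (\<alpha> + \<beta>)) x"
    if "\<alpha> \<le> 0" "\<beta> \<le> -1" for \<alpha> \<beta> x
    unfolding mulS_mulS[OF bc[OF that(1)] bi[OF that(2)]] mulS_mulS[OF bi[OF that(2)] bc[OF that(1)]]
    by (intro arg_cong[of _ _ "\<lambda>f. mulS f x"] ext, simp add: jp_add[symmetric])+
  define X where "X y = y + lam *\<^sub>R pw s y (Suc q)" for y
  \<comment> \<open>The flux \<open>m(D) (u + \<epsilon>^p u^(p+1))_x\<close> of the competitor,
    three levels down, where its symbol is bounded.\<close>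
  define F where "F v = mulS (csym m) (mulS (icjp (-3)) (X (Y2 v)))" for v
  have cX: "continuous_on {0..\<tau>} (\<lambda>v. X (Y2 v))"
    unfolding X_def by (intro continuous_intros cY continuous_on_pw s1)
  have cF: "continuous_on {0..\<tau>} F"
    unfolding F_def[abs_def]
    by (intro bounded_linear.continuous_on[OF bounded_linear_mulS[OF bm]] bounded_linear.continuous_on[OF bounded_linear_mulS[OF bi]] cX) simp
  define z2 where "z2 v = mulS (cjp (-3)) (Z1 0) + integral {0..v} F" for v
  have dz2: "(z2 has_vector_derivative F v) (at v within {0..\<tau>})" if "v \<in> {0..\<tau>}" for v
    unfolding z2_def[abs_def] using integral_has_vector_derivative[OF cF that]
    by (simp add: has_vector_derivative_add_const add.commute)
  have z20: "z2 0 = mulS (cjp (-3)) (Z1 0)" by (simp add: z2_def)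
  \<comment> \<open>The relation \<open>\<partial>\<^sub>x z2 = \<partial>\<^sub>t Y2\<close> at the
    lower level: both sides agree at time 0 by the condition on \<open>V2 0\<close> and have the
    same time derivative afterwards.\<close>
  have key: "mulS (icjp (-1)) (z2 v) = mulS (cjp (-3)) (V2 v)" if v: "v \<in> {0..\<tau>}" for v
  proof (rule has_vector_derivative_eq_imp_eq[OF _ _ _ v])
    show "continuous_on {0..\<tau>} (\<lambda>v. mulS (icjp (-1)) (z2 v))"
      using dz2 by (intro bounded_linear.continuous_on[OF bounded_linear_mulS[OF bi]] continuous_on_vector_derivative) auto
    show "continuous_on {0..\<tau>} (\<lambda>v. mulS (cjp (-3)) (V2 v))"
      by (intro bounded_linear.continuous_on[OF bounded_linear_mulS[OF bc]] cV) simp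
    show "mulS (icjp (-1)) (z2 0) = mulS (cjp (-3)) (V2 0)" unfolding z20 i(2) by (simp add: cm)
    show "((\<lambda>v. mulS (icjp (-1)) (z2 v)) has_vector_derivative mulS (icjp (-1)) (F t)) (at t within {0..\<tau>})" if "t \<in> {0<..\<tau>}" for t
      using that by (intro bounded_linear.has_vector_derivative[OF bounded_linear_mulS[OF bi]] dz2) auto
    show "((\<lambda>v. mulS (cjp (-3)) (V2 v)) has_vector_derivative mulS (icjp (-1)) (F t)) (at t within {0..\<tau>})" if "t \<in> {0<..\<tau>}" for t
    proof -
      have "((\<lambda>v. mulS (cjp (-2)) (mulS (cjp (-1)) (V2 v))) has_vector_derivative
        mulS (cjp (-2)) (mulS (csym m) (mulS (icjp (-1)) (mulS (icjp (-1)) (X (Y2 t)))))) (at t within {0..\<tau>})"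
        unfolding X_def by (rule bounded_linear.has_vector_derivative[OF bounded_linear_mulS[OF bc] dV[OF that]]) simp
      moreover have "mulS (cjp (-2)) (mulS (csym m) (mulS (icjp (-1)) (mulS (icjp (-1)) (X (Y2 t))))) = mulS (icjp (-1)) (F t)"
        unfolding F_def mulS_commute[OF bi[of "-1", OF order_refl] bm] mulS_commute[OF bc[of "-2"] bm, simplified]
        by (simp add: cm mulS_commute[OF bi[of "-1", OF order_refl] bi[of "-3", simplified]] )
      ultimately show ?thesis by (simp add: mulS_cjp_cjp)
    qed
  qed
  define L where "L = mulS (cjp (-3))"
  have blL: "bounded_linear L" unfolding L_def by (rule bounded_linear_mulS[OF bc]) simp
  have nL: "norm (L v) \<le> norm v" for v unfolding L_def by (rule norm_mulS_cjp_le) simp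
  \<comment> \<open>A competitor is bounded only by compactness of the time interval. The Gronwall
    constant may depend on this bound because the initial difference is 0; the smallness condition
    uses the fixed radius \<open>M\<close> of \<open>Y1\<close>.\<close>
  obtain B where B: "B \<ge> 0" "\<And>v. v \<in> {0..\<tau>} \<Longrightarrow> norm (Y1 v) \<le> B \<and> norm (Y2 v) \<le> B \<and> norm (Z1 v) \<le> B \<and> norm (z2 v) \<le> B"
  proof -
    have "bounded (f ` {0..\<tau>})" if "continuous_on {0..\<tau>} f" for f :: "real \<Rightarrow> l2"
      by (intro compact_imp_bounded compact_continuous_image that) simp
    then have "\<exists>B. \<forall>v\<in>{0..\<tau>}. norm (f v) \<le> B" if "continuous_on {0..\<tau>} f" for f :: "real \<Rightarrow> l2"
      using that unfolding bounded_iff by blast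
    note * = this
    have "continuous_on {0..\<tau>} z2" using dz2 by (rule continuous_on_vector_derivative)
    then obtain B1 B2 B3 B4 where b: "\<And>v. v\<in>{0..\<tau>} \<Longrightarrow> norm (Y1 v) \<le> B1" "\<And>v. v\<in>{0..\<tau>} \<Longrightarrow> norm (Y2 v) \<le> B2"
        "\<And>v. v\<in>{0..\<tau>} \<Longrightarrow> norm (Z1 v) \<le> B3" "\<And>v. v\<in>{0..\<tau>} \<Longrightarrow> norm (z2 v) \<le> B4"
      using *[of Y1] *[of Y2] *[of Z1] *[of z2] c1 cY unfolding csol_def by metis
    show thesis
    proof (rule that[of "\<bar>B1\<bar> + \<bar>B2\<bar> + \<bar>B3\<bar> + \<bar>B4\<bar>"])
      fix v assume v: "v \<in> {0..\<tau>}"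
      show "norm (Y1 v) \<le> \<bar>B1\<bar> + \<bar>B2\<bar> + \<bar>B3\<bar> + \<bar>B4\<bar> \<and> norm (Y2 v) \<le> \<bar>B1\<bar> + \<bar>B2\<bar> + \<bar>B3\<bar> + \<bar>B4\<bar> \<and>
        norm (Z1 v) \<le> \<bar>B1\<bar> + \<bar>B2\<bar> + \<bar>B3\<bar> + \<bar>B4\<bar> \<and> norm (z2 v) \<le> \<bar>B1\<bar> + \<bar>B2\<bar> + \<bar>B3\<bar> + \<bar>B4\<bar>"
        using b[OF v] by linarith
    qed simp
  qed
  have pwL: "pw (s - 3) (L y) (Suc q) = L (pw s y (Suc q))" for y
    unfolding L_def using pw_low[OF s3(2,3), of y "Suc q"] by simp
  have ni: "norm (mulS (icjp (-3)) y) \<le> norm y" for y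
    using norm_icjp_le[of "mulS (cjp (-2)) y"] norm_mulS_cjp_le[of "-2" y] by (simp add: cm)
  have isL: "isD (L y) (mulS (icjp (-3)) y)" for y
    unfolding L_def by (rule isD_mulS_sym[OF bc bi]) auto
  have fs: "fsol m (s - 3) q lam \<tau> B (\<lambda>v. L (Y v)) z"
    if n: "\<And>v. v \<in> {0..\<tau>} \<Longrightarrow> norm (Y v) \<le> B \<and> norm (z v) \<le> B"
      and d: "\<And>v. v \<in> {0..\<tau>} \<Longrightarrow> ((\<lambda>v. mulS (cjp (-1)) (Y v)) has_vector_derivative V v) (at v within {0..\<tau>})"
        "\<And>v. v \<in> {0..\<tau>} \<Longrightarrow> isD (z v) (mulS (cjp (-2)) (V v))"
        "\<And>v. v \<in> {0..\<tau>} \<Longrightarrow> (z has_vector_derivative mulS (csym m) (mulS (icjp (-3)) (X (Y v)))) (at v within {0..\<tau>})" for Y V z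
    unfolding fsol_def
  proof (intro ballI conjI)
    fix v assume v: "v \<in> {0..\<tau>}"
    show "norm (L (Y v)) \<le> B" "norm (z v) \<le> B" using n[OF v] nL[of "Y v"] by linarith+
    have X: "mulS (icjp (-3)) (X (Y v)) = mulS (icjp (-3)) (Y v) + lam *\<^sub>R mulS (icjp (-3)) (pw s (Y v) (Suc q))"
      unfolding X_def mulS_add[OF bi[of "-3"], simplified] mulS_scaleR[OF bi[of "-3"], simplified] ..
    have 2: "((\<lambda>v. L (Y v)) has_vector_derivative mulS (cjp (-2)) (V v)) (at v within {0..\<tau>})"
      using bounded_linear.has_vector_derivative[OF bounded_linear_mulS[OF bc[of "-2"]] d(1)[OF v]] by (simp add: mulS_cjp_cjp L_def)
    have nb: "norm (mulS (icjp (-3)) (Y v)) \<le> B" using ni[of "Y v"] n[OF v] by linarith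
    show "\<exists>dy dz dF. norm dy \<le> B \<and> isD (L (Y v)) dy \<and> isD (z v) dz \<and> isD (pw (s - 3) (L (Y v)) (Suc q)) dF \<and>
        ((\<lambda>v. L (Y v)) has_vector_derivative dz) (at v within {0..\<tau>}) \<and>
        (z has_vector_derivative mulS (csym m) (dy + lam *\<^sub>R dF)) (at v within {0..\<tau>})"
      unfolding pwL by (intro exI conjI) (rule nb isL d(2)[OF v] 2 d(3)[OF v, unfolded X])+
  qed
  have f1: "fsol m (s - 3) q lam \<tau> B (\<lambda>v. L (Y1 v)) (\<lambda>v. L (Z1 v))"
  proof (rule fs[where V="\<lambda>v. mulS (icjp (-1)) (Z1 v)"])
    fix v assume v: "v \<in> {0..\<tau>}"
    show "norm (Y1 v) \<le> B \<and> norm (L (Z1 v)) \<le> B" using B(2)[OF v] nL[of "Z1 v"] by linarith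
    show "((\<lambda>v. mulS (cjp (-1)) (Y1 v)) has_vector_derivative mulS (icjp (-1)) (Z1 v)) (at v within {0..\<tau>})"
      using c1 v unfolding csol_def by blast
    show "isD (L (Z1 v)) (mulS (cjp (-2)) (mulS (icjp (-1)) (Z1 v)))" using isL[of "Z1 v"] by (simp add: cm)
    have "((\<lambda>t. mulS (cjp (-1)) (Z1 t)) has_vector_derivative mulS (csym m) (mulS (icjp (-1)) (X (Y1 v)))) (at v within {0..\<tau>})"
      using c1 v unfolding csol_def X_def by blast
    from bounded_linear.has_vector_derivative[OF bounded_linear_mulS[OF bc[of "-2"]] this]
    show "((\<lambda>v. L (Z1 v)) has_vector_derivative mulS (csym m) (mulS (icjp (-3)) (X (Y1 v)))) (at v within {0..\<tau>})"
      unfolding mulS_commute[OF bc[of "-2"] bm, simplified] by (simp add: mulS_cjp_cjp cm L_def)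
  qed
  have f2: "fsol m (s - 3) q lam \<tau> B (\<lambda>v. L (Y2 v)) z2"
  proof (rule fs[where V=V2])
    fix v assume v: "v \<in> {0..\<tau>}"
    show "norm (Y2 v) \<le> B \<and> norm (z2 v) \<le> B" using B(2)[OF v] by blast
    have e: "mulS (icjp (-1)) (z2 v) = mulS (cjp (-1)) (mulS (cjp (-2)) (V2 v))" using key[OF v] by (simp add: mulS_cjp_cjp)
    have a: "AE \<xi> in lborel. rep (mulS (icjp (-1)) (z2 v)) \<xi> = icjp (-1) \<xi> * rep (z2 v) \<xi>" by (rule rep_mulS[OF bi]) simp
    have b: "AE \<xi> in lborel. rep (mulS (icjp (-1)) (z2 v)) \<xi> = cjp (-1) \<xi> * rep (mulS (cjp (-2)) (V2 v)) \<xi>"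
      unfolding e by (rule rep_mulS[OF bc]) simp
    show "isD (z2 v) (mulS (cjp (-2)) (V2 v))" unfolding isD_def using a b by eventually_elim (simp add: mult_ac)
  qed (use dY dz2 in \<open>auto simp: F_def\<close>)
  have "L (Y1 t) = L (Y2 t)"
  proof (rule fsol_unique[OF s3(1) m lam B(1) f1 f2 _ _ Cb(2) _ _ t])
    show "herm (L (Y1 v))" if "v \<in> {0..\<tau>}" for v
      unfolding L_def using c1 that by (intro herm_mulS_cjp) (auto simp: csol_def)
    show "\<bar>inner (Ps (s - 3) (bco (s - 3) q (L (Y1 v))) h) h\<bar> \<le> Cb * (norm h)\<^sup>2" if "v \<in> {0..\<tau>}" for v h
      by (rule Cb(1)[OF order_trans[OF nL bd[OF that]]])
    show "L (Z1 0) = z2 0" "L (Y1 0) = L (Y2 0)" by (simp_all add: z20 L_def i(1))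
  qed
  then show ?thesis unfolding L_def using mulS_cjp_inject[of "-3" "Y2 t" "Y1 t"] by simp
qed

subsection \<open>Sobolev functions and their coordinates\<close>

definition ev :: "(real \<Rightarrow> real) \<Rightarrow> l2" where "ev f = mk (\<lambda>x. complex_of_real (f x))"

lemma sq_integrable_of_real: "sq_integrable f \<Longrightarrow> sq_integrable (\<lambda>x. complex_of_real (f x))"
  unfolding sq_integrable_def by auto

lemma sq_integrable_Re: "sq_integrable f \<Longrightarrow> sq_integrable (\<lambda>x. Re (f x))"
proof (rule sq_integrable_bound)
  assume f: "sq_integrable f"
  then show "(\<lambda>x. Re (f x)) \<in> borel_measurable borel" by measurable
  show "integrable lborel (\<lambda>x. (norm (f x))\<^sup>2)" using f by (simp add: sq_integrable_def)
  show "AE x in lborel. (norm (Re (f x)))\<^sup>2 \<le> (norm (f x))\<^sup>2"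
    using abs_Re_le_cmod by (auto intro!: power_mono simp del: real_norm_def simp: real_norm_def[symmetric])
qed

lemma ev_eq_iff: "sq_integrable f \<Longrightarrow> sq_integrable g \<Longrightarrow> ev f = ev g \<longleftrightarrow> (AE x in lborel. f x = g x)"
  unfolding ev_def by (simp add: mk_eq_iff sq_integrable_of_real)

lemma sq_integrable_scale: "sq_integrable (f :: real \<Rightarrow> real) \<Longrightarrow> sq_integrable (\<lambda>x. c * f x)"
  unfolding sq_integrable_def by (auto simp: power_mult_distrib)

lemma ev_linear:
  assumes "sq_integrable f" "sq_integrable g"
  shows "ev (\<lambda>x. f x + g x) = ev f + ev g" "ev (\<lambda>x. f x - g x) = ev f - ev g" "ev (\<lambda>x. c * f x) = c *\<^sub>R ev f"
  unfolding ev_def of_real_add of_real_diff of_real_mult using assms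
  by (auto simp: mk_add mk_diff mk_scale sq_integrable_of_real)

lemma hat_trf_eq: "hat (trf R (\<lambda>x. complex_of_real (f x))) \<xi> = (LINT x:{-R..R}|lborel. of_real (f x) * exp (- \<i> * of_real (\<xi> * x)))"
  by (simp add: hat_def trf_def set_lebesgue_integral_def ek_def)

text \<open>The integral in the definition is the squared L^2 distance between \<open>g\<close> and
  the transform of a truncation, and these transforms converge to \<open>Fl (ev f)\<close>.\<close>

lemma is_fourier_iff:
  assumes f: "sq_integrable f"
  shows "is_fourier f g \<longleftrightarrow> sq_integrable g \<and> mk g = Fl (ev f)"
proof -
  define F where "F x = complex_of_real (f x)" for x
  have F: "sq_integrable F" unfolding F_def using f by (rule sq_integrable_of_real)
  have "((\<lambda>R. Fl (mk (trf R F))) \<longlongrightarrow> Fl (mk F)) at_top"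
    by (rule bounded_linear.tendsto[OF bounded_linear_Fl trf_tendsto[OF F]])
  then have l: "((\<lambda>R. mk (hat (trf R F))) \<longlongrightarrow> Fl (ev f)) at_top"
    by (simp add: Fl_mk sq_integrable_trf F ev_def F_def[symmetric])
  have "((\<lambda>R. \<integral>\<^sup>+\<xi>. ennreal ((cmod (hat (trf R F) \<xi> - g \<xi>))\<^sup>2) \<partial>lborel) \<longlongrightarrow> 0) at_top \<longleftrightarrow> mk g = Fl (ev f)"
    if g: "sq_integrable g"
  proof -
    have "(\<integral>\<^sup>+\<xi>. ennreal ((cmod (hat (trf R F) \<xi> - g \<xi>))\<^sup>2) \<partial>lborel) = ennreal ((norm (mk (hat (trf R F)) - mk g))\<^sup>2)" for R
      using nn_norm_mk[OF sq_integrable_diff[OF hat_sq(1)[OF sq_integrable_trf(2,1)[OF F]] g], of R]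
      by (simp add: mk_diff hat_sq sq_integrable_trf F g)
    moreover have "((\<lambda>R. ennreal ((norm (mk (hat (trf R F)) - mk g))\<^sup>2)) \<longlongrightarrow> 0) at_top \<longleftrightarrow> ((\<lambda>R. mk (hat (trf R F))) \<longlongrightarrow> mk g) at_top"
    proof
      assume a: "((\<lambda>R. ennreal ((norm (mk (hat (trf R F)) - mk g))\<^sup>2)) \<longlongrightarrow> 0) at_top"
      have "((\<lambda>R. enn2real (ennreal ((norm (mk (hat (trf R F)) - mk g))\<^sup>2))) \<longlongrightarrow> 0) at_top"
        using a by (intro tendsto_enn2real) simp_all
      from tendsto_real_sqrt[OF this]
      have "((\<lambda>R. norm (mk (hat (trf R F)) - mk g)) \<longlongrightarrow> 0) at_top" by simp
      then show "((\<lambda>R. mk (hat (trf R F))) \<longlongrightarrow> mk g) at_top" by (simp add: tendsto_norm_zero_iff LIM_zero_iff)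
    next
      assume "((\<lambda>R. mk (hat (trf R F))) \<longlongrightarrow> mk g) at_top"
      then have "((\<lambda>R. ennreal ((norm (mk (hat (trf R F)) - mk g))\<^sup>2)) \<longlongrightarrow> ennreal ((norm (mk g - mk g))\<^sup>2)) at_top"
        by (intro tendsto_ennrealI tendsto_power tendsto_norm tendsto_diff tendsto_const)
      then show "((\<lambda>R. ennreal ((norm (mk (hat (trf R F)) - mk g))\<^sup>2)) \<longlongrightarrow> 0) at_top" by simp
    qed
    moreover have "((\<lambda>R. mk (hat (trf R F))) \<longlongrightarrow> mk g) at_top \<longleftrightarrow> mk g = Fl (ev f)"
      using l tendsto_unique[OF trivial_limit_at_top_linorder l] by metis
    ultimately show ?thesis by simp
  qed
  then show ?thesis unfolding is_fourier_def hat_trf_eq[symmetric] unfolding F_def[symmetric] by blast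
qed

lemma fourier_Fl:
  assumes f: "sq_integrable f" shows "sq_integrable (fourier f)" "mk (fourier f) = Fl (ev f)"
proof -
  have "is_fourier f (rep (Fl (ev f)))" by (simp add: is_fourier_iff[OF f])
  then have "is_fourier f (fourier f)" unfolding fourier_def by (metis someI)
  then show "sq_integrable (fourier f)" "mk (fourier f) = Fl (ev f)" by (simp_all add: is_fourier_iff[OF f])
qed

text \<open>The dictionary between functions and coordinates: \<open>Y\<close> is the transform of
  \<open>f\<close> times the weight of order \<open>s\<close>. The weight stands inverted on the
  other side because \<open>mulS\<close> takes bounded symbols.\<close>

definition cs :: "real \<Rightarrow> (real \<Rightarrow> real) \<Rightarrow> l2 \<Rightarrow> bool" where
  "cs s f Y \<longleftrightarrow> sq_integrable f \<and> Fl (ev f) = mulS (cjp (- s)) Y"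

lemma cs_unique: "s \<ge> 0 \<Longrightarrow> cs s f Y \<Longrightarrow> cs s f Z \<Longrightarrow> Y = Z"
  using mulS_cjp_inject[of "- s" Y Z] by (simp add: cs_def)

lemma cs_eq_iff: "s \<ge> 0 \<Longrightarrow> cs s f Y \<Longrightarrow> cs s g Z \<Longrightarrow> Y = Z \<longleftrightarrow> (AE x in lborel. f x = g x)"
  using mulS_cjp_inject[of "- s" Y Z] Fl_inject[of "ev f" "ev g"] ev_eq_iff[of f g] unfolding cs_def by force

lemma cs_linear:
  assumes s: "s \<ge> 0" and "cs s f Y" "cs s g Z"
  shows "cs s (\<lambda>x. f x + g x) (Y + Z)" "cs s (\<lambda>x. f x - g x) (Y - Z)" "cs s (\<lambda>x. c * f x) (c *\<^sub>R Y)"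
proof -
  have b: "bsym (cjp (- s))" using s by (intro bsym_cjp) simp
  show "cs s (\<lambda>x. f x + g x) (Y + Z)" "cs s (\<lambda>x. f x - g x) (Y - Z)" "cs s (\<lambda>x. c * f x) (c *\<^sub>R Y)"
    using assms by (auto simp: cs_def ev_linear Fl_add Fl_diff Fl_scaleR mulS_add[OF b] mulS_diff[OF b] mulS_scaleR[OF b]
       sq_integrable_add sq_integrable_diff sq_integrable_scale)
qed

lemma cs_low:
  assumes "0 \<le> t" "t \<le> s" "cs s f Y" shows "cs t f (mulS (cjp (t - s)) Y)"
  using assms by (simp add: cs_def mulS_cjp_cjp)

lemma cs_fourier:
  assumes s: "s \<ge> 0" and c: "cs s f Y"
  shows "AE \<xi> in lborel. (1 + \<xi>\<^sup>2) powr s * (cmod (fourier f \<xi>))\<^sup>2 = (cmod (rep Y \<xi>))\<^sup>2"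
proof -
  have b: "bsym (cjp (- s))" using s by (intro bsym_cjp) simp
  have sq: "sq_integrable f" using c by (simp add: cs_def)
  have "AE \<xi> in lborel. rep (mk (fourier f)) \<xi> = cjp (- s) \<xi> * rep Y \<xi>"
    using c rep_mulS[OF b, of Y] by (simp add: fourier_Fl[OF sq] cs_def)
  then show ?thesis using rep_mk[OF fourier_Fl(1)[OF sq]]
  proof eventually_elim
    case (elim \<xi>)
    have "(jp s \<xi> * jp (- s) \<xi>)\<^sup>2 = 1" by (simp add: jp_add)
    then show ?case unfolding jp_sq[symmetric] elim(2)[symmetric] elim(1) norm_mult power_mult_distrib by (simp add: power_mult_distrib)
  qed
qed

lemma fourier_measurable: "sq_integrable f \<Longrightarrow> fourier f \<in> borel_measurable borel"
  by (rule sq_integrable_measurable[OF fourier_Fl(1)])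

lemma sobolev_iff:
  assumes s: "s \<ge> 0" shows "f \<in> sobolev s \<longleftrightarrow> (\<exists>Y. cs s f Y)"
proof
  assume "f \<in> sobolev s"
  then have f: "sq_integrable f" and i: "integrable lborel (\<lambda>\<xi>. (1 + \<xi>\<^sup>2) powr s * (cmod (fourier f \<xi>))\<^sup>2)"
    by (auto simp: sobolev_def)
  note [measurable] = fourier_measurable[OF f]
  have b: "bsym (cjp (- s))" using s by (intro bsym_cjp) simp
  have sq: "sq_integrable (\<lambda>\<xi>. cjp s \<xi> * fourier f \<xi>)"
    unfolding sq_integrable_def norm_mult cmod_cjp power_mult_distrib jp_sq using i by simp
  have "mulS (cjp (- s)) (mk (\<lambda>\<xi>. cjp s \<xi> * fourier f \<xi>)) = mk (fourier f)"
    unfolding mulS_mk[OF b sq] using cjp_inv[of "- s"] by (simp flip: mult.assoc)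
  then have "cs s f (mk (\<lambda>\<xi>. cjp s \<xi> * fourier f \<xi>))" using f by (simp add: cs_def fourier_Fl)
  then show "\<exists>Y. cs s f Y" by blast
next
  assume "\<exists>Y. cs s f Y"
  then obtain Y where Y: "cs s f Y" by blast
  then have f: "sq_integrable f" by (simp add: cs_def)
  note [measurable] = fourier_measurable[OF f]
  have "integrable lborel (\<lambda>\<xi>. (cmod (rep Y \<xi>))\<^sup>2)" using sq_rep[of Y] by (simp add: sq_integrable_def)
  then have "integrable lborel (\<lambda>\<xi>. (1 + \<xi>\<^sup>2) powr s * (cmod (fourier f \<xi>))\<^sup>2)"
    by (rule integrable_cong_AE_imp) (use cs_fourier[OF s Y] in auto)
  then show "f \<in> sobolev s" using f by (simp add: sobolev_def)
qed

lemma sobolev_norm_cs: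
  assumes s: "s \<ge> 0" and c: "cs s f Y" shows "sobolev_norm s f = norm Y"
proof -
  have f: "sq_integrable f" using c by (simp add: cs_def)
  note [measurable] = fourier_measurable[OF f]
  have "(LINT \<xi>|lborel. (1 + \<xi>\<^sup>2) powr s * (cmod (fourier f \<xi>))\<^sup>2) = (norm Y)\<^sup>2"
    unfolding norm_l2_sq by (rule integral_cong_AE) (use cs_fourier[OF s c] in auto)
  then show ?thesis by (simp add: sobolev_norm_def)
qed

lemma Cj_ev: "sq_integrable f \<Longrightarrow> Cj (ev f) = ev f"
  by (simp add: ev_def Cj_mk sq_integrable_of_real)

lemma cs_herm: assumes s: "s \<ge> 0" and c: "cs s f Y" shows "herm Y"
proof -
  have b: "bsym (cjp (- s))" using s by (intro bsym_cjp) simp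
  have "mulS (cjp (- s)) (Sop Y) = Sop (mulS (cjp (- s)) Y)" by (rule Sop_mulS[OF b, symmetric]) simp
  also have "\<dots> = mulS (cjp (- s)) Y" using c Fl_Cj[of "ev f"] by (simp add: cs_def Cj_ev)
  finally show ?thesis using mulS_cjp_inject[of "- s" "Sop Y" Y] s by (simp add: herm_def)
qed

text \<open>Hermitian symmetry makes the inverse transform fixed under conjugation, so its real part
  represents the same element.\<close>

lemma cs_ex: assumes s: "s \<ge> 0" and h: "herm Y" shows "\<exists>f. cs s f Y"
proof -
  have b: "bsym (cjp (- s))" using s by (intro bsym_cjp) simp
  define x where "x = Fi (mulS (cjp (- s)) Y)"
  have Fx: "Fl x = mulS (cjp (- s)) Y" by (simp add: x_def)
  have "Fl (Cj x) = Fl x" unfolding Fl_Cj Fx using Sop_mulS[OF b, of Y] h by (simp add: herm_def)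
  then have Cx: "Cj x = x" by (simp add: Fl_inject)
  have "ev (\<lambda>t. Re (rep x t)) = mk (rep x)" unfolding ev_def
  proof (rule mk_eqI)
    show "AE t in lborel. complex_of_real (Re (rep x t)) = rep x t"
      using rep_Cj[of x] unfolding Cx by eventually_elim (simp add: complex_eq_iff)
  qed (rule sq_integrable_of_real[OF sq_integrable_Re[OF sq_rep]], rule sq_rep)
  then have "cs s (\<lambda>t. Re (rep x t)) Y" unfolding cs_def using Fx by (simp add: sq_integrable_Re)
  then show ?thesis by blast
qed

lemma bsym_diff: "bsym \<sigma> \<Longrightarrow> bsym \<tau> \<Longrightarrow> bsym (\<lambda>\<xi>. \<sigma> \<xi> - \<tau> \<xi>)"
proof -
  assume s: "bsym \<sigma>" and t: "bsym \<tau>"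
  then obtain C D where C: "\<And>\<xi>. cmod (\<sigma> \<xi>) \<le> C" and D: "\<And>\<xi>. cmod (\<tau> \<xi>) \<le> D"
    unfolding bsym_def by blast
  show ?thesis
  proof (rule bsymI)
    show "cmod (\<sigma> \<xi> - \<tau> \<xi>) \<le> C + D" for \<xi> using norm_triangle_ineq4[of "\<sigma> \<xi>" "\<tau> \<xi>"] C[of \<xi>] D[of \<xi>] by linarith
  qed (intro borel_measurable_diff bsym_measurable s t)
qed

lemma kernel_fourier_ek: "kernel_fourier \<mu> \<xi> = (LINT y|fst \<mu>. 1 * ek (\<xi> * y)) - (LINT y|snd \<mu>. 1 * ek (\<xi> * y))"
  by (simp add: kernel_fourier_def sm_integral_def ek_def)

lemma cs_kernel_conv:
  assumes \<mu>: "signed_measure \<mu>" and s: "s \<ge> 0" and c: "cs s f Y"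
  shows "bsym (kernel_fourier \<mu>)" and "cs s (kernel_conv \<mu> f) (mulS (kernel_fourier \<mu>) Y)"
proof -
  have fin: "finite_measure (fst \<mu>)" "finite_measure (snd \<mu>)" and se: "sets (fst \<mu>) = sets borel" "sets (snd \<mu>) = sets borel"
    using \<mu> by (auto simp: signed_measure_def)
  have sf: "sigma_finite_measure (fst \<mu>)" "sigma_finite_measure (snd \<mu>)" using fin by (simp_all add: finite_measure_def)
  have i: "integrable (fst \<mu>) (\<lambda>_. 1 :: complex)" "integrable (snd \<mu>) (\<lambda>_. 1 :: complex)" using fin by (simp_all add: finite_measure.integrable_const)
  have f: "sq_integrable f" using c by (simp add: cs_def)
  define F where "F x = complex_of_real (f x)" for x
  have F: "sq_integrable F" unfolding F_def by (rule sq_integrable_of_real[OF f])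
  define c1 where "c1 = cv (fst \<mu>) (\<lambda>_. 1) F"
  define c2 where "c2 = cv (snd \<mu>) (\<lambda>_. 1) F"
  have c12: "sq_integrable c1" "sq_integrable c2" unfolding c1_def c2_def by (intro cv_sq sf se i F)+
  have k: "complex_of_real (kernel_conv \<mu> f x) = c1 x - c2 x" for x
    by (simp add: kernel_conv_def sm_integral_def c1_def c2_def cv_def F_def integral_complex_of_real)
  have r: "kernel_conv \<mu> f = (\<lambda>x. Re (c1 x - c2 x))" by (rule ext) (simp flip: k)
  have sq: "sq_integrable (kernel_conv \<mu> f)" unfolding r by (intro sq_integrable_Re sq_integrable_diff c12)
  note b = Fl_cv(1)[OF sf(1) se(1) i(1) F] Fl_cv(1)[OF sf(2) se(2) i(2) F]
  have kf: "kernel_fourier \<mu> = (\<lambda>\<xi>. (LINT y|fst \<mu>. 1 * ek (\<xi> * y)) - (LINT y|snd \<mu>. 1 * ek (\<xi> * y)))"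
    by (rule ext) (rule kernel_fourier_ek)
  show bk: "bsym (kernel_fourier \<mu>)" unfolding kf by (rule bsym_diff[OF b])
  have bs: "bsym (cjp (- s))" using s by (intro bsym_cjp) simp
  have "Fl (ev (kernel_conv \<mu> f)) = Fl (mk c1) - Fl (mk c2)"
    unfolding ev_def k mk_diff[OF c12] Fl_diff ..
  also have "\<dots> = mulS (kernel_fourier \<mu>) (Fl (mk F))"
    unfolding c1_def c2_def Fl_cv(2)[OF sf(1) se(1) i(1) F] Fl_cv(2)[OF sf(2) se(2) i(2) F] kf by (rule mulS_sym_diff[OF b])
  also have "Fl (mk F) = mulS (cjp (- s)) Y" using c by (simp add: cs_def ev_def F_def[abs_def])
  finally show "cs s (kernel_conv \<mu> f) (mulS (kernel_fourier \<mu>) Y)"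
    using sq by (simp add: cs_def mulS_commute[OF bs bk])
qed

text \<open>The function \<open>phi s Y\<close> is bounded and equals \<open>f\<close> almost
  everywhere. Hence the product is square integrable, and \<open>Fi_Qs\<close> identifies its
  transform.\<close>

lemma cs_mult:
  assumes s: "s \<ge> 1" and f: "cs s f Y" and g: "cs s g Z"
  shows "cs s (\<lambda>x. f x * g x) (Qs s Y Z)"
proof -
  have sf: "sq_integrable f" and sg: "sq_integrable g" and Ff: "Fl (ev f) = mulS (cjp (- s)) Y" and Fg: "Fl (ev g) = mulS (cjp (- s)) Z"
    using f g by (auto simp: cs_def)
  note [measurable] = sq_integrable_measurable[OF sf] sq_integrable_measurable[OF sg]
  note p = phi(1,2)[OF s, of Y]
  have "mk (phi s Y) = ev f" unfolding phi(3)[OF s] Ff[symmetric] by simp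
  then have a: "AE x in lborel. phi s Y x = of_real (f x)"
    unfolding ev_def by (subst (asm) mk_eq_iff) (auto intro: p sq_integrable_of_real sf)
  have pg: "sq_integrable (\<lambda>x. phi s Y x * of_real (g x))" by (intro bsym_sq p sq_integrable_of_real sg)
  have sq: "sq_integrable (\<lambda>x. f x * g x)"
  proof (rule sq_integrable_bound)
    show "integrable lborel (\<lambda>x. (cmod (phi s Y x * of_real (g x)))\<^sup>2)" using pg by (simp add: sq_integrable_def)
    show "AE x in lborel. (norm (f x * g x))\<^sup>2 \<le> (cmod (phi s Y x * of_real (g x)))\<^sup>2"
      using a by eventually_elim (simp add: norm_mult power_mult_distrib)
  qed measurable
  have "Fi (mulS (cjp (- s)) (Qs s Y Z)) = mulS (phi s Y) (ev g)" unfolding Fi_Qs[OF s] Fg[symmetric] by simp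
  also have "\<dots> = ev (\<lambda>x. f x * g x)"
    unfolding ev_def mulS_mk[OF p(1) sq_integrable_of_real[OF sg]]
    by (rule mk_eqI[OF pg sq_integrable_of_real[OF sq]]) (use a in eventually_elim, simp)
  finally show ?thesis using sq Fl_Fi[of "mulS (cjp (- s)) (Qs s Y Z)"] by (simp add: cs_def)
qed

lemma cs_pw: "s \<ge> 1 \<Longrightarrow> cs s f Y \<Longrightarrow> cs s (\<lambda>x. f x ^ Suc j) (pw s Y j)"
  by (induction j) (simp_all add: cs_mult)

subsection \<open>Weak derivatives\<close>

text \<open>The classical smooth function vanishing on the negative half-line, divided by powers of
  \<open>x\<close>, so that the derivatives stay in the span of the family.\<close>

definition fx :: "nat \<Rightarrow> real \<Rightarrow> real" where "fx k x = (if x > 0 then exp (- 1 / x) / x ^ k else 0)"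

text \<open>With \<open>m = k + 2\<close>, the inequality
  \<open>exp (1 / (m * x)) \<ge> 1 / (m * x)\<close> raised to the power \<open>m\<close> gives
  \<open>exp (- 1 / x) \<le> (m * x) ^ m\<close>. The quadratic bound yields the derivative 0 at the
  origin.\<close>

lemma fx_le: "\<bar>fx k x\<bar> \<le> real (k + 2) ^ (k + 2) * x\<^sup>2"
proof (cases "x > 0")
  case True
  define m where "m = k + 2"
  have m: "real m > 0" by (simp add: m_def)
  have "1 / (real m * x) \<le> exp (1 / (real m * x))" using exp_ge_add_one_self[of "1 / (real m * x)"] by linarith
  then have "(1 / (real m * x)) ^ m \<le> exp (1 / (real m * x)) ^ m" using True m by (intro power_mono) auto
  also have "\<dots> = exp (1 / x)" unfolding exp_of_nat_mult[symmetric] using m by simp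
  finally have "exp (- (1 / x)) \<le> (real m * x) ^ m" using True m
    by (simp add: exp_minus power_divide divide_simps mult.commute)
  then have "exp (- 1 / x) / x ^ k \<le> (real m * x) ^ m / x ^ k" using True by (intro divide_right_mono) auto
  also have "\<dots> = real m ^ m * x\<^sup>2" using True by (simp add: m_def power_mult_distrib power_add power2_eq_square)
  finally show ?thesis using True by (simp add: fx_def m_def)
qed (simp add: fx_def)

lemma fx_deriv: "(fx k has_real_derivative - real k * fx (Suc k) x + fx (k + 2) x) (at x)"
proof -
  consider "x > 0" | "x < 0" | "x = 0" by linarith
  then show ?thesis
  proof cases
    case 1
    have "((\<lambda>x. exp (- 1 / x) / x ^ k) has_real_derivative - real k * fx (Suc k) x + fx (k + 2) x) (at x)"
    proof -
      have "((\<lambda>x. exp (- 1 / x) / x ^ k) has_real_derivative (exp (- 1 / x) * (1 / x\<^sup>2) * x ^ k - exp (- 1 / x) * (real k * x ^ (k - 1))) / (x ^ k * x ^ k)) (at x)"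
        using 1 by (auto intro!: derivative_eq_intros simp: power2_eq_square)
      moreover have "(exp (- 1 / x) * (1 / x\<^sup>2) * x ^ k - exp (- 1 / x) * (real k * x ^ (k - 1))) / (x ^ k * x ^ k) = - real k * fx (Suc k) x + fx (k + 2) x"
        using 1 by (cases k) (auto simp: fx_def field_simps power2_eq_square)
      ultimately show ?thesis by simp
    qed
    then show ?thesis by (rule has_field_derivative_transform_within_open[of _ _ _ "{0<..}"]) (use 1 in \<open>auto simp: fx_def\<close>)
  next
    case 2
    have "((\<lambda>x. 0) has_real_derivative - real k * fx (Suc k) x + fx (k + 2) x) (at x)" using 2 by (simp add: fx_def)
    then show ?thesis by (rule has_field_derivative_transform_within_open[of _ _ _ "{..<0}"]) (use 2 in \<open>auto simp: fx_def\<close>)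
  next
    case 3
    have "(\<lambda>h. (fx k (0 + h) - fx k 0) / h) \<midarrow>0\<rightarrow> 0"
    proof (rule Lim_null_comparison)
      have "\<bar>fx k h\<bar> / \<bar>h\<bar> \<le> real (k + 2) ^ (k + 2) * \<bar>h\<bar>" for h
        using fx_le[of k h] by (cases "h = 0") (auto simp: power2_eq_square pos_divide_le_eq mult.assoc)
      then show "\<forall>\<^sub>F h in at 0. norm ((fx k (0 + h) - fx k 0) / h) \<le> real (k + 2) ^ (k + 2) * \<bar>h\<bar>"
        by (intro always_eventually allI) (simp add: fx_def[of k 0])
      show "((\<lambda>h. real (k + 2) ^ (k + 2) * \<bar>h\<bar>) \<longlongrightarrow> 0) (at 0)"
        by (intro tendsto_mult_right_zero tendsto_rabs_zero tendsto_ident_at)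
    qed
    then show ?thesis using 3 by (simp add: DERIV_def fx_def[of _ 0])
  qed
qed

text \<open>An explicit class closed under differentiation, so that smoothness of all orders is one
  induction. The affine argument provides dilates and translates of the bump.\<close>

inductive bump :: "real \<Rightarrow> real \<Rightarrow> (real \<Rightarrow> real) \<Rightarrow> bool" for c d where
  base: "bump c d (\<lambda>x. fx i (c * x + d) * fx j (1 - (c * x + d)))"
| add: "bump c d f \<Longrightarrow> bump c d g \<Longrightarrow> bump c d (\<lambda>x. f x + g x)"
| scale: "bump c d f \<Longrightarrow> bump c d (\<lambda>x. r * f x)"

lemma bump_deriv: "bump c d f \<Longrightarrow> \<exists>f'. bump c d f' \<and> (\<forall>x. (f has_real_derivative f' x) (at x))"
proof (induction rule: bump.induct)
  case (base i j)
  define D where "D x = (c * (- real i)) * (fx (Suc i) (c * x + d) * fx j (1 - (c * x + d))) + c * (fx (i + 2) (c * x + d) * fx j (1 - (c * x + d)))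
     + ((c * real j) * (fx i (c * x + d) * fx (Suc j) (1 - (c * x + d))) + (- c) * (fx i (c * x + d) * fx (j + 2) (1 - (c * x + d))))" for x
  have "bump c d D" unfolding D_def[abs_def] by (intro bump.intros)
  moreover have "((\<lambda>x. fx i (c * x + d) * fx j (1 - (c * x + d))) has_real_derivative D x) (at x)" for x
    by (rule derivative_eq_intros DERIV_chain2[OF fx_deriv] refl)+ (simp add: D_def algebra_simps)
  ultimately show ?case by blast
next
  case (add f g)
  then obtain f' g' where "bump c d f'" "bump c d g'" "\<And>x. (f has_real_derivative f' x) (at x)" "\<And>x. (g has_real_derivative g' x) (at x)" by blast
  then show ?case by (intro exI[of _ "\<lambda>x. f' x + g' x"]) (auto intro: bump.add DERIV_add)
next
  case (scale f r)
  then obtain f' where "bump c d f'" "\<And>x. (f has_real_derivative f' x) (at x)" by blast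
  then show ?case by (intro exI[of _ "\<lambda>x. r * f' x"]) (auto intro: bump.scale DERIV_cmult)
qed

lemma bump_funpow: "bump c d f \<Longrightarrow> bump c d ((deriv ^^ n) f)"
proof (induction n)
  case (Suc n)
  then obtain f' where f': "bump c d f'" "\<And>x. ((deriv ^^ n) f has_real_derivative f' x) (at x)" using bump_deriv by blast
  have "(deriv ^^ Suc n) f = f'" using DERIV_imp_deriv[OF f'(2)] by (simp add: fun_eq_iff)
  then show ?case using f' by simp
qed simp

lemma bump_support: "bump c d f \<Longrightarrow> c * x + d < 0 \<or> c * x + d > 1 \<Longrightarrow> f x = 0"
  by (induction rule: bump.induct) (auto simp: fx_def)

lemma bump_test: assumes c: "c > 0" and b: "bump c d f" shows "test_function f"
  unfolding test_function_def
proof (intro conjI allI exI impI)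
  show "(deriv ^^ n) f differentiable_on UNIV" for n
    using bump_deriv[OF bump_funpow[OF b, of n]]
    by (auto simp: differentiable_on_def real_differentiable_def intro: has_field_derivative_at_within)
  fix x assume "(1 + \<bar>d\<bar>) / c < \<bar>x\<bar>"
  then have "1 + \<bar>d\<bar> < \<bar>c * x\<bar>" using c by (simp add: pos_divide_less_eq abs_mult mult.commute)
  then show "f x = 0" by (intro bump_support[OF b]) linarith
qed

lemma test_deriv:
  assumes t: "test_function \<theta>" shows "test_function (deriv \<theta>)" and "(\<theta> has_real_derivative deriv \<theta> x) (at x)"
proof -
  have d: "(\<theta> has_real_derivative deriv \<theta> x) (at x)" for x
    using t unfolding test_function_def differentiable_on_def
    by (metis DERIV_deriv_iff_real_differentiable UNIV_I funpow_0)
  then show "(\<theta> has_real_derivative deriv \<theta> x) (at x)" .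
  obtain R where R: "\<And>x. R < \<bar>x\<bar> \<Longrightarrow> \<theta> x = 0" using t unfolding test_function_def by blast
  have "deriv \<theta> x = 0" if x: "R < \<bar>x\<bar>" for x
  proof -
    have "open {y::real. R < \<bar>y\<bar>}" by (intro open_Collect_less continuous_intros)
    then have "((\<lambda>x. 0) has_real_derivative deriv \<theta> x) (at x)"
      by (rule has_field_derivative_transform_within_open[OF d]) (use x R in auto)
    then show ?thesis using DERIV_unique DERIV_const by blast
  qed
  moreover have "(deriv ^^ n) (deriv \<theta>) differentiable_on UNIV" for n
    using t[unfolded test_function_def, THEN conjunct1, rule_format, of "Suc n"] unfolding funpow_Suc_right o_def .
  ultimately show "test_function (deriv \<theta>)" unfolding test_function_def by blast
qed

lemma test_funpow: "test_function \<theta> \<Longrightarrow> test_function ((deriv ^^ n) \<theta>)"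
  by (induction n) (auto intro: test_deriv)

lemma test_continuous: "test_function \<theta> \<Longrightarrow> continuous_on S \<theta>"
  using test_deriv(2) by (meson DERIV_isCont continuous_at_imp_continuous_on)

lemma test_integrable:
  assumes t: "test_function \<theta>" shows "sq_integrable \<theta>" "integrable lborel (\<lambda>x. complex_of_real (\<theta> x))"
proof -
  obtain R where R: "\<And>x. R < \<bar>x\<bar> \<Longrightarrow> \<theta> x = 0" using t unfolding test_function_def by blast
  have i: "integrable lborel h" if "continuous_on UNIV h" "\<And>x. R < \<bar>x\<bar> \<Longrightarrow> h x = 0" for h :: "real \<Rightarrow> real"
  proof -
    have "integrable lborel (\<lambda>x. indicator {-R..R} x *\<^sub>R h x)"
      by (rule borel_integrable_compact) (auto intro: continuous_on_subset[OF that(1)])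
    moreover have "(\<lambda>x. indicator {-R..R} x *\<^sub>R h x) = h"
    proof
      show "indicator {-R..R} x *\<^sub>R h x = h x" for x
        using that(2)[of x] by (cases "R < \<bar>x\<bar>") (auto simp: indicator_def)
    qed
    ultimately show ?thesis by (simp only:)
  qed
  show "integrable lborel (\<lambda>x. complex_of_real (\<theta> x))" using i[OF test_continuous[OF t] R] by simp
  have "integrable lborel (\<lambda>x. (norm (\<theta> x))\<^sup>2)"
    by (rule i) (use R in \<open>auto intro!: continuous_on_power continuous_on_norm test_continuous[OF t]\<close>)
  then show "sq_integrable \<theta>" unfolding sq_integrable_def
    by (intro conjI borel_measurable_continuous_onI test_continuous t)
qed

lemma ek_has_vector_derivative: "((\<lambda>x. ek (\<xi> * x)) has_vector_derivative - \<i> * \<xi> * ek (\<xi> * x)) (at x within S)"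
proof -
  have "((\<lambda>z. exp (- \<i> * (\<xi> * z))) has_field_derivative - \<i> * \<xi> * exp (- \<i> * (\<xi> * of_real x))) (at (of_real x))"
    by (auto intro!: derivative_eq_intros)
  from has_vector_derivative_real_field[OF this] show ?thesis unfolding ek_def by simp
qed

lemma hat_deriv:
  assumes t: "test_function \<theta>"
  shows "hat (\<lambda>x. of_real (deriv \<theta> x)) \<xi> = \<i> * \<xi> * hat (\<lambda>x. of_real (\<theta> x)) \<xi>"
proof -
  obtain R where R: "\<And>x. R < \<bar>x\<bar> \<Longrightarrow> \<theta> x = 0" using t unfolding test_function_def by blast
  obtain R' where R': "\<And>x. R' < \<bar>x\<bar> \<Longrightarrow> deriv \<theta> x = 0" using test_deriv(1)[OF t] unfolding test_function_def by blast
  \<comment> \<open>Beyond both supports, so that the boundary terms vanish and the truncated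
    integral is the full one.\<close>
  define a where "a = \<bar>R\<bar> + \<bar>R'\<bar> + 1"
  define D where "D x = of_real (deriv \<theta> x) * ek (\<xi> * x) + of_real (\<theta> x) * (- \<i> * \<xi> * ek (\<xi> * x))" for x
  have "(LINT x|lborel. indicator {-a..a} x *\<^sub>R D x) = of_real (\<theta> a) * ek (\<xi> * a) - of_real (\<theta> (- a)) * ek (\<xi> * (- a))"
  proof (rule integral_FTC_Icc)
    show "((\<lambda>x. of_real (\<theta> x) * ek (\<xi> * x)) has_vector_derivative D x) (at x within {-a..a})" for x
    proof -
      have "((\<lambda>x. complex_of_real (\<theta> x)) has_vector_derivative of_real (deriv \<theta> x)) (at x within {-a..a})"
        using test_deriv(2)[OF t] by (intro has_vector_derivative_of_real)
          (auto simp: has_real_derivative_iff_has_vector_derivative[symmetric] intro: has_field_derivative_at_within)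
      from has_vector_derivative_mult[OF this ek_has_vector_derivative] show ?thesis unfolding D_def by (subst add.commute)
    qed
    show "continuous_on {-a..a} D" unfolding D_def ek_def
      by (intro continuous_intros test_continuous[OF t] test_continuous[OF test_deriv(1)[OF t]])
  qed (simp add: a_def)
  also have "\<dots> = 0" using R[of a] R[of "-a"] by (simp add: a_def)
  also have "(\<lambda>x. indicator {-a..a} x *\<^sub>R D x) = D"
    using R R' by (fastforce simp: indicator_def D_def a_def)
  finally have "(LINT x|lborel. D x) = 0" .
  moreover have "(LINT x|lborel. D x) = hat (\<lambda>x. of_real (deriv \<theta> x)) \<xi> + (LINT x|lborel. (- \<i> * \<xi>) * (of_real (\<theta> x) * ek (\<xi> * x)))"
    unfolding hat_def
  proof (subst Bochner_Integration.integral_add[symmetric])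
    show "integrable lborel (\<lambda>x. of_real (deriv \<theta> x) * ek (\<xi> * x))" "integrable lborel (\<lambda>x. (- \<i> * \<xi>) * (of_real (\<theta> x) * ek (\<xi> * x)))"
      by (intro integrable_mult_ek integrable_mult_right test_integrable(2) test_deriv(1) t, simp)+
  qed (simp add: D_def[abs_def] mult_ac)
  ultimately show ?thesis by (simp add: hat_def)
qed

lemma hat_funpow:
  assumes t: "test_function \<theta>"
  shows "hat (\<lambda>x. of_real ((deriv ^^ n) \<theta> x)) \<xi> = (\<i> * \<xi>) ^ n * hat (\<lambda>x. of_real (\<theta> x)) \<xi>"
  by (induction n) (simp_all add: hat_deriv test_funpow t)

lemma parseval_test:
  assumes f: "sq_integrable f" and t: "test_function \<theta>"
  shows "(LINT \<xi>|lborel. rep (Fl (ev f)) \<xi> * ((- (\<i> * \<xi>)) ^ n * cnj (hat (\<lambda>x. of_real (\<theta> x)) \<xi>))) = 2 * pi * (LINT x|lborel. f x * (deriv ^^ n) \<theta> x)"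
proof -
  note tn = test_integrable[OF test_funpow[OF t, of n]]
  have "(LINT \<xi>|lborel. rep (Fl (ev f)) \<xi> * cnj (hat (\<lambda>x. of_real ((deriv ^^ n) \<theta> x)) \<xi>)) = 2 * pi * (LINT x|lborel. of_real (f x) * cnj (of_real ((deriv ^^ n) \<theta> x)))"
    using parseval_mk[OF sq_integrable_of_real[OF f] sq_integrable_of_real[OF tn(1)] sq_rep hat_sq(1)[OF tn(2) sq_integrable_of_real[OF tn(1)]] _
      Fl_mk[OF tn(2) sq_integrable_of_real[OF tn(1)]], of "Fl (ev f)"] by (simp add: ev_def)
  then show ?thesis by (simp add: hat_funpow[OF t] integral_complex_of_real flip: of_real_mult)
qed

text \<open>The transform of a narrow bump at \<xi> is, up to scaling, the transform of a fixed bump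
  near frequency 0, where it tends to a positive integral. Countably many dilates thus detect every
  frequency, with one exceptional null set for all of them.\<close>

lemma bump_hat_nonzero:
  obtains m where "hat (\<lambda>x. complex_of_real (fx 0 (real (Suc m) * x) * fx 0 (1 - real (Suc m) * x))) \<xi> \<noteq> 0"
proof -
  define \<rho> where "\<rho> x = fx 0 x * fx 0 (1 - x)" for x
  have b: "bump 1 0 \<rho>" using bump.base[of 1 0 0 0] by (simp add: \<rho>_def[abs_def])
  note t = bump_test[OF zero_less_one b]
  note i = test_integrable(2)[OF t]
  have [measurable]: "\<rho> \<in> borel_measurable borel" by (rule sq_integrable_measurable[OF test_integrable(1)[OF t]])
  have \<rho>0: "\<rho> x \<ge> 0" for x by (simp add: \<rho>_def fx_def)
  have ir: "integrable lborel \<rho>" using integrable_Re[OF i] by simp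
  have nz: "(LINT x|lborel. \<rho> x) \<noteq> 0"
  proof
    assume "(LINT x|lborel. \<rho> x) = 0"
    then have "AE x in lborel. \<rho> x = 0" using integral_nonneg_eq_0_iff_AE[OF ir] \<rho>0 by simp
    then have "AE x in lborel. x \<notin> {0<..<1::real}" by eventually_elim (auto simp: \<rho>_def fx_def)
    then have "emeasure lborel {0<..<1::real} = 0" by (subst (asm) AE_iff_measurable[of "{0<..<1}"]) auto
    then show False by simp
  qed
  have "(\<lambda>m. LINT x|lborel. of_real (\<rho> x) * ek (\<xi> / real (Suc m) * x)) \<longlonglongrightarrow> (LINT x|lborel. of_real (\<rho> x) * 1)"
  proof (rule integral_dominated_convergence[OF _ _ ir])
    show "AE x in lborel. (\<lambda>m. of_real (\<rho> x) * ek (\<xi> / real (Suc m) * x)) \<longlonglongrightarrow> of_real (\<rho> x) * 1"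
    proof (intro AE_I2 tendsto_mult tendsto_const)
      fix x
      have "(\<lambda>m. \<xi> * (1 / real (Suc m)) * x) \<longlonglongrightarrow> \<xi> * 0 * x"
        using LIMSEQ_inverse_real_of_nat by (intro tendsto_intros) (simp add: inverse_eq_divide)
      then have "(\<lambda>m. \<xi> / real (Suc m) * x) \<longlonglongrightarrow> 0" by simp
      then have "(\<lambda>m. ek (\<xi> / real (Suc m) * x)) \<longlonglongrightarrow> exp (- \<i> * of_real 0)" unfolding ek_def by (intro tendsto_intros)
      then show "(\<lambda>m. ek (\<xi> / real (Suc m) * x)) \<longlonglongrightarrow> 1" by simp
    qed
  qed (auto simp: norm_mult \<rho>0)
  then have "\<forall>\<^sub>F m in sequentially. (LINT x|lborel. of_real (\<rho> x) * ek (\<xi> / real (Suc m) * x)) \<noteq> 0"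
    by (rule tendsto_imp_eventually_ne) (simp add: integral_complex_of_real nz)
  then obtain m where m: "(LINT x|lborel. of_real (\<rho> x) * ek (\<xi> / real (Suc m) * x)) \<noteq> 0"
    by (auto dest: eventually_happens)
  have "(LINT x|lborel. of_real (\<rho> x) * ek (\<xi> / real (Suc m) * x)) = \<bar>real (Suc m)\<bar> *\<^sub>R (LINT x|lborel. of_real (\<rho> (0 + real (Suc m) * x)) * ek (\<xi> / real (Suc m) * (0 + real (Suc m) * x)))"
    by (rule lborel_integral_real_affine) simp
  then have "hat (\<lambda>x. complex_of_real (\<rho> (real (Suc m) * x))) \<xi> \<noteq> 0" using m by (auto simp: hat_def simp del: of_nat_Suc)
  then show thesis unfolding \<rho>_def by (rule that)
qed

lemma neg1_cancel: "(-1) ^ n * ((-1) ^ n * z) = (z :: 'a :: comm_ring_1)"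
  by (simp flip: mult.assoc power_mult_distrib)

text \<open>From the right, Parseval turns the Fourier identity into the tested one. From the left,
  the tested identity for all translates of a bump says that the transform of \<open>W\<close>
  vanishes, hence \<open>W = 0\<close> almost everywhere; the dilates of
  \<open>bump_hat_nonzero\<close> then allow the transform of the bump to be cancelled.\<close>

lemma weak_deriv_iff:
  "weak_deriv n f g \<longleftrightarrow> sq_integrable f \<and> sq_integrable g \<and> (AE \<xi> in lborel. rep (Fl (ev g)) \<xi> = (\<i> * \<xi>) ^ n * rep (Fl (ev f)) \<xi>)"
proof (cases "sq_integrable f \<and> sq_integrable g")
  case True
  then have f: "sq_integrable f" and g: "sq_integrable g" by auto
  define F where "F = rep (Fl (ev f))"
  define G where "G = rep (Fl (ev g))"
  have sF: "sq_integrable F" "sq_integrable G" by (simp_all add: F_def G_def)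
  note [measurable] = sF[THEN sq_integrable_measurable]
  have sg: "(- (\<i> * of_real \<xi>)) ^ n = (-1) ^ n * (\<i> * of_real \<xi>) ^ n" for \<xi> by (rule power_minus)
  have PF: "2 * pi * ((-1) ^ n * (LINT x|lborel. f x * (deriv ^^ n) \<theta> x)) = (LINT \<xi>|lborel. (\<i> * \<xi>) ^ n * F \<xi> * cnj (hat (\<lambda>x. of_real (\<theta> x)) \<xi>))"
    if "test_function \<theta>" for \<theta>
  proof -
    have "(LINT \<xi>|lborel. (-1) ^ n * ((\<i> * \<xi>) ^ n * F \<xi> * cnj (hat (\<lambda>x. of_real (\<theta> x)) \<xi>))) = 2 * pi * (LINT x|lborel. f x * (deriv ^^ n) \<theta> x)"
    proof -
      have "F \<xi> * ((- (\<i> * \<xi>)) ^ n * cnj (hat (\<lambda>x. of_real (\<theta> x)) \<xi>)) = (-1) ^ n * ((\<i> * \<xi>) ^ n * F \<xi> * cnj (hat (\<lambda>x. of_real (\<theta> x)) \<xi>))" for \<xi>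
        by (simp only: sg mult_ac)
      then show ?thesis using parseval_test[OF f that, of n] unfolding F_def[symmetric] by (simp only:)
    qed
    then have "(-1) ^ n * ((-1) ^ n * (LINT \<xi>|lborel. (\<i> * \<xi>) ^ n * F \<xi> * cnj (hat (\<lambda>x. of_real (\<theta> x)) \<xi>))) = (-1) ^ n * complex_of_real (2 * pi * (LINT x|lborel. f x * (deriv ^^ n) \<theta> x))"
      by (simp only: integral_mult_right_zero)
    then show ?thesis unfolding neg1_cancel by simp
  qed
  have PG: "2 * pi * (LINT x|lborel. g x * \<theta> x) = (LINT \<xi>|lborel. G \<xi> * cnj (hat (\<lambda>x. of_real (\<theta> x)) \<xi>))"
    if "test_function \<theta>" for \<theta> using parseval_test[OF g that, of 0] by (simp add: G_def)
  show ?thesis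
  proof
    assume a: "sq_integrable f \<and> sq_integrable g \<and> (AE \<xi> in lborel. rep (Fl (ev g)) \<xi> = (\<i> * \<xi>) ^ n * rep (Fl (ev f)) \<xi>)"
    have "(LINT x|lborel. f x * (deriv ^^ n) \<theta> x) = (-1) ^ n * (LINT x|lborel. g x * \<theta> x)" if t: "test_function \<theta>" for \<theta>
    proof -
      have [measurable]: "(\<lambda>x. complex_of_real (\<theta> x)) \<in> borel_measurable borel" using borel_measurable_integrable[OF test_integrable(2)[OF t]] by simp
      have "(LINT \<xi>|lborel. (\<i> * \<xi>) ^ n * F \<xi> * cnj (hat (\<lambda>x. of_real (\<theta> x)) \<xi>)) = (LINT \<xi>|lborel. G \<xi> * cnj (hat (\<lambda>x. of_real (\<theta> x)) \<xi>))"
        by (rule integral_cong_AE, measurable) (use a in \<open>auto simp: F_def G_def elim: eventually_mono\<close>)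
      then have "2 * pi * ((-1) ^ n * (LINT x|lborel. f x * (deriv ^^ n) \<theta> x)) = 2 * pi * (LINT x|lborel. g x * \<theta> x)"
        unfolding PF[OF t, symmetric] PG[OF t, symmetric] of_real_eq_iff .
      then have "(-1) ^ n * ((-1) ^ n * (LINT x|lborel. f x * (deriv ^^ n) \<theta> x)) = (-1) ^ n * (LINT x|lborel. g x * \<theta> x)" by simp
      then show ?thesis unfolding neg1_cancel .
    qed
    then show "weak_deriv n f g" unfolding weak_deriv_def using f g by blast
  next
    assume w: "weak_deriv n f g"
    have "AE \<xi> in lborel. ((\<i> * \<xi>) ^ n * F \<xi> - G \<xi>) * cnj (hat (\<lambda>x. complex_of_real (fx 0 (real (Suc m) * x) * fx 0 (1 - real (Suc m) * x))) \<xi>) = 0" for m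
    proof -
      define c where "c = real (Suc m)"
      have c: "c > 0" by (simp add: c_def)
      define \<rho> where "\<rho> x = fx 0 (c * x) * fx 0 (1 - c * x)" for x
      have t: "test_function \<rho>" using bump_test[OF c bump.base[of c 0 0 0]] by (simp add: \<rho>_def[abs_def])
      define H where "H = hat (\<lambda>x. complex_of_real (\<rho> x))"
      define Hn where "Hn = hat (\<lambda>x. complex_of_real ((deriv ^^ n) \<rho> x))"
      \<comment> \<open>The power of \<xi> is absorbed by the transform of the \<open>n\<close>-th
        derivative of the bump (see \<open>We\<close>), which makes \<open>W\<close> both integrable
        and square integrable.\<close>
      define W where "W \<xi> = ((\<i> * \<xi>) ^ n * F \<xi> - G \<xi>) * cnj (H \<xi>)" for \<xi>
      have cHn: "cnj ((-1) ^ n * Hn \<xi>) = (\<i> * \<xi>) ^ n * cnj (H \<xi>)" for \<xi>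
      proof -
        have "cnj ((-1) ^ n * Hn \<xi>) = (-1) ^ n * ((- (\<i> * \<xi>)) ^ n * cnj (H \<xi>))"
          by (simp add: Hn_def H_def hat_funpow[OF t])
        then show ?thesis unfolding sg mult.assoc neg1_cancel .
      qed
      have We: "W \<xi> = cnj ((-1) ^ n * Hn \<xi>) * F \<xi> - cnj (H \<xi>) * G \<xi>" for \<xi>
        unfolding W_def cHn by (simp add: algebra_simps)
      note tn = test_integrable[OF test_funpow[OF t, of n]] test_integrable[OF t]
      have HH: "sq_integrable H" "sq_integrable Hn" "bsym H" "bsym Hn"
        unfolding H_def Hn_def using tn by (auto intro!: hat_sq sq_integrable_of_real bsymI[OF _ hat_bound])
      have b: "bsym (\<lambda>\<xi>. cnj ((-1) ^ n * Hn \<xi>))" "bsym (\<lambda>\<xi>. cnj (H \<xi>))"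
        using HH(3,4) by (auto simp: bsym_def norm_mult norm_power)
      have Wsq: "sq_integrable W" unfolding We[abs_def] by (intro sq_integrable_diff bsym_sq b sF)
      have Wi: "integrable lborel W" unfolding We[abs_def]
        by (intro Bochner_Integration.integrable_diff sq_integrable_integrable_mult sq_integrable_cnj sq_integrable_cmult HH sF)
      \<comment> \<open>Translating the test function multiplies its transform by a modulation, so
        the tested identity is the value of \<open>hat W\<close> at \<open>y\<close>.\<close>
      have "hat W y = 0" for y
      proof -
        define \<theta> where "\<theta> x = \<rho> (x - (- y))" for x
        have tt: "test_function \<theta>" using bump_test[OF c bump.base[of c "c * y" 0 0]] by (simp add: \<theta>_def[abs_def] \<rho>_def distrib_left)
        have h: "hat (\<lambda>x. complex_of_real (\<theta> x)) \<xi> = ek (\<xi> * (- y)) * H \<xi>" for \<xi>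
          unfolding \<theta>_def H_def by (rule hat_translate)
        have "(-1) ^ n * (LINT x|lborel. f x * (deriv ^^ n) \<theta> x) = (LINT x|lborel. g x * \<theta> x)"
          using w tt unfolding weak_deriv_def by (simp add: neg1_cancel)
        then have e: "(LINT \<xi>|lborel. (\<i> * \<xi>) ^ n * F \<xi> * cnj (hat (\<lambda>x. of_real (\<theta> x)) \<xi>)) = (LINT \<xi>|lborel. G \<xi> * cnj (hat (\<lambda>x. of_real (\<theta> x)) \<xi>))"
          unfolding PF[OF tt, symmetric] PG[OF tt, symmetric] by simp
        have "hat W y = (LINT \<xi>|lborel. (cnj ((-1) ^ n * Hn \<xi>) * F \<xi>) * ek (y * \<xi>) - (cnj (H \<xi>) * G \<xi>) * ek (y * \<xi>))"
          unfolding hat_def We by (simp add: left_diff_distrib)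
        also have "\<dots> = (LINT \<xi>|lborel. (cnj ((-1) ^ n * Hn \<xi>) * F \<xi>) * ek (y * \<xi>)) - (LINT \<xi>|lborel. (cnj (H \<xi>) * G \<xi>) * ek (y * \<xi>))"
          by (intro Bochner_Integration.integral_diff integrable_mult_ek sq_integrable_integrable_mult sq_integrable_cnj sq_integrable_cmult HH sF) auto
        also have "(\<lambda>\<xi>. (cnj ((-1) ^ n * Hn \<xi>) * F \<xi>) * ek (y * \<xi>)) = (\<lambda>\<xi>. (\<i> * \<xi>) ^ n * F \<xi> * cnj (hat (\<lambda>x. of_real (\<theta> x)) \<xi>))"
          unfolding h cHn by (rule ext) (simp add: mult_ac)
        also have "(\<lambda>\<xi>. (cnj (H \<xi>) * G \<xi>) * ek (y * \<xi>)) = (\<lambda>\<xi>. G \<xi> * cnj (hat (\<lambda>x. of_real (\<theta> x)) \<xi>))"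
          unfolding h by (rule ext) (simp add: mult_ac)
        finally show ?thesis using e by simp
      qed
      then have "hat W = (\<lambda>_. 0)" by blast
      then have "Fl (mk W) = Fl 0" using Fl_mk[OF Wi Wsq] linear_0[OF bounded_linear.linear[OF bounded_linear_Fl]] mk_diff[of "\<lambda>_. 0" "\<lambda>_. 0"] by simp
      then have "mk W = 0" by (simp add: Fl_inject)
      then have "AE \<xi> in lborel. rep 0 \<xi> = W \<xi>" using rep_mk[OF Wsq] by simp
      then have "AE \<xi> in lborel. W \<xi> = 0" using rep_zero by eventually_elim simp
      then show ?thesis unfolding W_def H_def \<rho>_def c_def .
    qed
    then have "AE \<xi> in lborel. \<forall>m. ((\<i> * \<xi>) ^ n * F \<xi> - G \<xi>) * cnj (hat (\<lambda>x. complex_of_real (fx 0 (real (Suc m) * x) * fx 0 (1 - real (Suc m) * x))) \<xi>) = 0"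
      unfolding AE_all_countable by blast
    then have "AE \<xi> in lborel. G \<xi> = (\<i> * \<xi>) ^ n * F \<xi>"
    proof eventually_elim
      case (elim \<xi>)
      obtain m where "hat (\<lambda>x. complex_of_real (fx 0 (real (Suc m) * x) * fx 0 (1 - real (Suc m) * x))) \<xi> \<noteq> 0" by (rule bump_hat_nonzero)
      then show ?case using elim[rule_format, of m] by simp
    qed
    then show "sq_integrable f \<and> sq_integrable g \<and> (AE \<xi> in lborel. rep (Fl (ev g)) \<xi> = (\<i> * \<xi>) ^ n * rep (Fl (ev f)) \<xi>)"
      using f g by (simp add: F_def G_def)
  qed
qed (auto simp: weak_deriv_def)

subsection \<open>Kernels\<close>

lemma signed_measureD:
  assumes "signed_measure \<mu>"
  shows "finite_measure (fst \<mu>)" "finite_measure (snd \<mu>)" "sets (fst \<mu>) = sets borel" "sets (snd \<mu>) = sets borel"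
  using assms by (auto simp: signed_measure_def)

text \<open>Since the two parts live on disjoint sets, an even kernel has even parts.\<close>

lemma even_part:
  fixes M N :: "real measure"
  assumes fin: "finite_measure M" "finite_measure N" and sm: "sets M = sets borel" "sets N = sets borel"
    and A: "A \<in> sets borel" "measure M (- A) = 0" "measure N A = 0"
    and ev: "\<And>B. B \<in> sets borel \<Longrightarrow> measure M (uminus ` B) - measure N (uminus ` B) = measure M B - measure N B"
  shows "distr M borel uminus = M"
proof (rule measure_eqI)
  interpret M: finite_measure M by (rule fin)
  interpret N: finite_measure N by (rule fin)
  have v: "uminus ` B = uminus -` B" for B :: "real set" by (rule minus_image_eq_vimage)
  have neg: "uminus ` B \<in> sets borel" if "B \<in> sets borel" for B :: "real set"
    using measurable_sets[OF borel_measurable_uminus[OF measurable_ident, unfolded id_def] that] by (simp add: v)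
  \<comment> \<open>On \<open>B \<inter> A\<close> the part \<open>N\<close> vanishes, so evenness
    gives one inequality there, while \<open>B - A\<close> is null for \<open>M\<close>. The reverse
    inequality is the same statement for the reflected set.\<close>
  have le: "measure M B \<le> measure M (uminus ` B)" if B: "B \<in> sets borel" for B
  proof -
    have b: "B \<inter> A \<in> sets borel" "B - A \<in> sets borel" "- A \<in> sets borel" using A B by auto
    have "measure M B \<le> measure M (B \<inter> A) + measure M (B - A)"
      using measure_Un_le[of "B \<inter> A" M "B - A"] b sm by (simp add: Int_Diff_Un)
    moreover have "measure M (B - A) \<le> 0" using M.finite_measure_mono[of "B - A" "- A"] b A sm by auto
    moreover have "measure N (B \<inter> A) \<le> 0" using N.finite_measure_mono[of "B \<inter> A" A] A sm by auto
    moreover have "measure M (uminus ` (B \<inter> A)) \<le> measure M (uminus ` B)"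
      by (rule M.finite_measure_mono) (auto simp: sm intro: neg B)
    ultimately show ?thesis using ev[OF b(1)] measure_nonneg[of N "uminus ` (B \<inter> A)"] measure_nonneg[of N "B \<inter> A"] by linarith
  qed
  fix B assume "B \<in> sets (distr M borel uminus)"
  then have B: "B \<in> sets borel" by simp
  have "measure M (uminus ` B) = measure M B" using le[OF B] le[OF neg[OF B]] by (simp add: image_image)
  then show "emeasure (distr M borel uminus) B = emeasure M B"
    using B sm sets_eq_imp_space_eq[OF sm(1)]
    by (subst emeasure_distr) (auto simp: v[symmetric] M.emeasure_eq_measure measurable_cong_sets[OF sm(1) refl])
qed (simp add: sm)

lemma even_kernel_parts:
  assumes \<mu>: "signed_measure \<mu>" and e: "even_kernel \<mu>"
  shows "distr (fst \<mu>) borel uminus = fst \<mu>" "distr (snd \<mu>) borel uminus = snd \<mu>"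
proof -
  note sm = signed_measureD[OF \<mu>]
  obtain A where A: "A \<in> sets borel" "measure (fst \<mu>) (- A) = 0" "measure (snd \<mu>) A = 0"
    using \<mu> by (auto simp: signed_measure_def measure_def)
  have ev: "measure (fst \<mu>) (uminus ` B) - measure (snd \<mu>) (uminus ` B) = measure (fst \<mu>) B - measure (snd \<mu>) B" if "B \<in> sets borel" for B
    using e that by (auto simp: even_kernel_def sm_value_def)
  show "distr (fst \<mu>) borel uminus = fst \<mu>" by (rule even_part[OF sm A ev])
  show "distr (snd \<mu>) borel uminus = snd \<mu>"
    by (rule even_part[OF sm(2,1,4,3), of "- A"]) (use A ev in \<open>auto simp: algebra_simps\<close>)
qed

lemma ek_integrable:
  assumes "finite_measure M" "sets M = sets borel"
  shows "integrable M (\<lambda>y. ek (\<xi> * y))" "integrable M (\<lambda>y. cos (\<xi> * y))"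
proof -
  note [measurable_cong] = assms(2)
  show "integrable M (\<lambda>y. ek (\<xi> * y))" by (rule finite_measure.integrable_const_bound[OF assms(1), of _ 1]) auto
  show "integrable M (\<lambda>y. cos (\<xi> * y))" by (rule finite_measure.integrable_const_bound[OF assms(1), of _ 1]) auto
qed

lemma integral_ek_even:
  assumes M: "finite_measure M" "sets M = sets borel" and e: "distr M borel uminus = M"
  shows "(LINT y|M. ek (\<xi> * y)) = of_real (LINT y|M. cos (\<xi> * y))"
proof -
  note [measurable_cong] = M(2)
  note i = ek_integrable(1)[OF M]
  have "(LINT y|M. ek (\<xi> * y)) = (LINT y|distr M borel uminus. ek (\<xi> * y))" by (simp only: e)
  also have "\<dots> = (LINT y|M. ek (- (\<xi> * y)))" by (subst integral_distr) auto
  finally have "(LINT y|M. ek (\<xi> * y)) + (LINT y|M. ek (\<xi> * y)) = (LINT y|M. ek (\<xi> * y) + ek (- (\<xi> * y)))"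
    using i[of \<xi>] i[of "- \<xi>"] by simp
  also have "\<dots> = (LINT y|M. complex_of_real (2 * cos (\<xi> * y)))"
    by (intro Bochner_Integration.integral_cong) (auto simp: ek_def complex_eq_iff Re_exp Im_exp)
  finally show ?thesis by (simp add: integral_complex_of_real)
qed

lemma kernel_fourier_even:
  assumes \<mu>: "signed_measure \<mu>" and e: "even_kernel \<mu>"
  shows "kernel_fourier \<mu> \<xi> = of_real (sm_integral \<mu> (\<lambda>y. cos (\<xi> * y)))"
proof -
  note sm = signed_measureD[OF \<mu>]
  show ?thesis unfolding kernel_fourier_ek sm_integral_def
    using integral_ek_even[OF sm(1,3) even_kernel_parts(1)[OF \<mu> e]] integral_ek_even[OF sm(2,4) even_kernel_parts(2)[OF \<mu> e]] by simp
qed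

lemma kernel_fourier_measurable:
  assumes \<mu>: "signed_measure \<mu>" shows "kernel_fourier \<mu> \<in> borel_measurable borel"
proof -
  note sm = signed_measureD[OF \<mu>]
  interpret M: finite_measure "fst \<mu>" by (rule sm)
  interpret N: finite_measure "snd \<mu>" by (rule sm)
  note [measurable_cong] = sm(3,4)
  show ?thesis unfolding kernel_fourier_ek[abs_def] by measurable
qed

lemma signed_measure_scale:
  assumes \<mu>: "signed_measure \<mu>" and d: "\<delta> > 0" shows "signed_measure (scale_kernel \<delta> \<mu>)"
proof -
  note sm = signed_measureD[OF \<mu>]
  note [measurable_cong] = sm(3,4)
  obtain A where A: "A \<in> sets borel" "emeasure (fst \<mu>) (- A) = 0" "emeasure (snd \<mu>) A = 0"
    using \<mu> by (auto simp: signed_measure_def)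
  define B where "B = (\<lambda>x. x / \<delta>) -` A"
  have B: "B \<in> sets borel" unfolding B_def using measurable_sets[of "\<lambda>x. x / \<delta>" borel borel A] A by simp
  have v: "(\<lambda>x. \<delta> * x) -` B = A" using d by (auto simp: B_def)
  have sp: "space (fst \<mu>) = UNIV" "space (snd \<mu>) = UNIV" using sm(3,4) by (auto dest: sets_eq_imp_space_eq)
  have "emeasure (distr (fst \<mu>) borel (\<lambda>x. \<delta> * x)) (- B) = 0" "emeasure (distr (snd \<mu>) borel (\<lambda>x. \<delta> * x)) B = 0"
    using A B v by (auto simp: emeasure_distr sp vimage_Compl)
  then show ?thesis unfolding signed_measure_def scale_kernel_def using B sm(1,2)
    by (auto intro!: finite_measure.finite_measure_distr)
qed

lemma integrable_parts:
  assumes \<mu>: "signed_measure \<mu>" and i: "integrable (total_variation \<mu>) f"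
  shows "integrable (fst \<mu>) f" "integrable (snd \<mu>) (f :: real \<Rightarrow> real)"
proof -
  note sm = signed_measureD[OF \<mu>]
  have st: "sets (total_variation \<mu>) = sets borel"
    by (simp add: total_variation_def sigma_algebra.sigma_sets_eq[of UNIV] sets.sigma_algebra_axioms[of "borel :: real measure", simplified])
  have sp: "space (total_variation \<mu>) = UNIV" "space (fst \<mu>) = UNIV" "space (snd \<mu>) = UNIV"
    using st sm(3,4) by (auto dest!: sets_eq_imp_space_eq)
  have "emeasure (fst \<mu>) X \<le> emeasure (total_variation \<mu>) X" "emeasure (snd \<mu>) X \<le> emeasure (total_variation \<mu>) X" for X
    by (cases "X \<in> sets borel"; simp add: emeasure_total_variation[OF \<mu>] emeasure_notin_sets sm)+
  then have le: "fst \<mu> \<le> total_variation \<mu>" "snd \<mu> \<le> total_variation \<mu>"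
    by (simp_all add: le_measure_iff le_fun_def sp sm st)
  have m: "f \<in> borel_measurable borel" using borel_measurable_integrable[OF i] st by (simp cong: measurable_cong_sets)
  have fin: "(\<integral>\<^sup>+x. ennreal (norm (f x)) \<partial>total_variation \<mu>) < \<infinity>" using i by (simp add: integrable_iff_bounded)
  have "(\<integral>\<^sup>+x. ennreal (norm (f x)) \<partial>fst \<mu>) < \<infinity>"
    using nn_integral_mono_measure[OF _ le(1), of "\<lambda>x. ennreal (norm (f x))"] fin sm st by (auto intro: le_less_trans)
  moreover have "(\<integral>\<^sup>+x. ennreal (norm (f x)) \<partial>snd \<mu>) < \<infinity>"
    using nn_integral_mono_measure[OF _ le(2), of "\<lambda>x. ennreal (norm (f x))"] fin sm st by (auto intro: le_less_trans)
  ultimately show "integrable (fst \<mu>) f" "integrable (snd \<mu>) f"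
    using m sm by (auto simp: integrable_iff_bounded measurable_cong_sets[OF sm(3) refl] measurable_cong_sets[OF sm(4) refl])
qed

lemma cos_taylor_bound: "\<bar>cos x - (\<Sum>m<n. cos_coeff m * x ^ m)\<bar> \<le> \<bar>x\<bar> ^ n"
proof -
  obtain t where t: "cos x = (\<Sum>m<n. cos_coeff m * x ^ m) + (cos (t + 1/2 * real n * pi) / fact n) * x ^ n"
    using Maclaurin_cos_expansion[of x n] by blast
  have "\<bar>cos (t + 1/2 * real n * pi)\<bar> \<le> fact n"
    by (rule order_trans[OF abs_cos_le_one fact_ge_1])
  then have "\<bar>cos (t + 1/2 * real n * pi) / fact n\<bar> \<le> 1" by (simp add: abs_divide)
  then have "\<bar>cos (t + 1/2 * real n * pi) / fact n\<bar> * \<bar>x ^ n\<bar> \<le> 1 * \<bar>x ^ n\<bar>" by (rule mult_right_mono) simp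
  then show ?thesis unfolding t by (simp add: abs_mult power_abs)
qed

lemma moment_bound:
  fixes M :: "real measure"
  assumes M: "finite_measure M" "sets M = sets borel" and i: "integrable M (\<lambda>x. x ^ n)" and n: "even n"
  shows "\<bar>(LINT x|M. cos (\<xi> * x)) - (\<Sum>m<n. cos_coeff m * \<xi> ^ m * (LINT x|M. x ^ m))\<bar> \<le> \<bar>\<xi>\<bar> ^ n * (LINT x|M. x ^ n)"
proof -
  note [measurable_cong] = M(2)
  \<comment> \<open>The lower moments exist because \<bar>x\<bar>^m is at most 1 + \<bar>x\<bar>^n,
    and the measure is finite.\<close>
  have im: "integrable M (\<lambda>x. x ^ m)" if m: "m < n" for m
  proof (rule Bochner_Integration.integrable_bound)
    show "integrable M (\<lambda>x. 1 + x ^ n)" by (rule Bochner_Integration.integrable_add[OF finite_measure.integrable_const[OF M(1)] i])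
    show "AE x in M. norm (x ^ m) \<le> norm (1 + x ^ n)"
    proof (intro AE_I2)
      fix x :: real
      have "\<bar>x\<bar> ^ m \<le> 1 + \<bar>x\<bar> ^ n"
      proof (cases "\<bar>x\<bar> \<le> 1")
        case True then show ?thesis using power_le_one[of "\<bar>x\<bar>" m] zero_le_power[of "\<bar>x\<bar>" n] by linarith
      next
        case False
        then have "\<bar>x\<bar> ^ m \<le> \<bar>x\<bar> ^ n" using m by (intro power_increasing) auto
        then show ?thesis by simp
      qed
      then show "norm (x ^ m) \<le> norm (1 + x ^ n)" using n zero_le_even_power[OF n, of x] by (simp add: power_abs power_even_abs)
    qed
  qed measurable
  have e: "(LINT x|M. cos (\<xi> * x)) - (\<Sum>m<n. cos_coeff m * \<xi> ^ m * (LINT x|M. x ^ m)) = (LINT x|M. cos (\<xi> * x) - (\<Sum>m<n. cos_coeff m * (\<xi> * x) ^ m))"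
  proof -
    have "(LINT x|M. (\<Sum>m<n. cos_coeff m * (\<xi> * x) ^ m)) = (\<Sum>m<n. LINT x|M. cos_coeff m * \<xi> ^ m * x ^ m)"
      unfolding power_mult_distrib mult.assoc[symmetric] by (rule Bochner_Integration.integral_sum) (auto intro: im)
    moreover have "integrable M (\<lambda>x. \<Sum>m<n. cos_coeff m * (\<xi> * x) ^ m)"
      unfolding power_mult_distrib mult.assoc[symmetric] by (rule Bochner_Integration.integrable_sum) (auto intro: im)
    ultimately show ?thesis using ek_integrable(2)[OF M] by simp
  qed
  have "norm (LINT x|M. cos (\<xi> * x) - (\<Sum>m<n. cos_coeff m * (\<xi> * x) ^ m)) \<le> (LINT x|M. \<bar>\<xi>\<bar> ^ n * x ^ n)"
  proof (rule Bochner_Integration.integral_norm_bound_integral)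
    show "integrable M (\<lambda>x. cos (\<xi> * x) - (\<Sum>m<n. cos_coeff m * (\<xi> * x) ^ m))"
      using im ek_integrable(2)[OF M] by (auto simp: power_mult_distrib intro!: Bochner_Integration.integrable_diff Bochner_Integration.integrable_sum integrable_mult_right)
    show "norm (cos (\<xi> * x) - (\<Sum>m<n. cos_coeff m * (\<xi> * x) ^ m)) \<le> \<bar>\<xi>\<bar> ^ n * x ^ n" for x
      using cos_taylor_bound[of "\<xi> * x" n] n by (simp add: abs_mult power_mult_distrib power_even_abs)
  qed (use i in simp)
  then show ?thesis unfolding e by simp
qed

text \<open>The cosine polynomials of degree below 2k coincide: an even \<open>m < 2 * k\<close>
  satisfies \<open>m < 2 * k - 1\<close>, where the moments agree, and for odd \<open>m\<close>, in
  particular \<open>2 * k - 1\<close>, the cosine coefficient is zero. What is left are the Taylor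
  remainders, bounded by the moments of order 2k.\<close>

lemma kernel_difference:
  assumes \<mu>: "signed_measure \<mu>1" "signed_measure \<mu>2" and k: "k \<ge> 1"
    and mom: "\<forall>j<2 * k - 1. sm_integral \<mu>1 (\<lambda>x. x ^ j) = sm_integral \<mu>2 (\<lambda>x. x ^ j)"
    and i: "integrable (total_variation \<mu>1) (\<lambda>x. x ^ (2 * k))" "integrable (total_variation \<mu>2) (\<lambda>x. x ^ (2 * k))"
  shows "\<exists>C\<ge>0. \<forall>\<xi>. \<bar>sm_integral \<mu>1 (\<lambda>y. cos (\<xi> * y)) - sm_integral \<mu>2 (\<lambda>y. cos (\<xi> * y))\<bar> \<le> C * \<bar>\<xi>\<bar> ^ (2 * k)"
proof -
  define I where "I M = (LINT x|M. x ^ (2 * k))" for M :: "real measure"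
  have I0: "I M \<ge> 0" for M unfolding I_def by (intro Bochner_Integration.integral_nonneg) simp
  define S where "S M \<xi> = (\<Sum>m<2 * k. cos_coeff m * \<xi> ^ m * (LINT x|M. x ^ m))" for M :: "real measure" and \<xi>
  have b: "\<bar>(LINT y|M. cos (\<xi> * y)) - S M \<xi>\<bar> \<le> I M * \<bar>\<xi>\<bar> ^ (2 * k)" if "M \<in> {fst \<mu>1, snd \<mu>1, fst \<mu>2, snd \<mu>2}" for M \<xi>
    unfolding S_def I_def mult.commute[of "integral\<^sup>L M _"] using that signed_measureD[OF \<mu>(1)] signed_measureD[OF \<mu>(2)] integrable_parts[OF \<mu>(1) i(1)] integrable_parts[OF \<mu>(2) i(2)]
    by (intro moment_bound) auto
  have S: "S (fst \<mu>1) \<xi> - S (snd \<mu>1) \<xi> = S (fst \<mu>2) \<xi> - S (snd \<mu>2) \<xi>" for \<xi>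
    unfolding S_def sum_subtractf[symmetric]
  proof (rule sum.cong[OF refl])
    fix m :: nat assume m: "m \<in> {..<2 * k}"
    show "cos_coeff m * \<xi> ^ m * (LINT x|fst \<mu>1. x ^ m) - cos_coeff m * \<xi> ^ m * (LINT x|snd \<mu>1. x ^ m)
       = cos_coeff m * \<xi> ^ m * (LINT x|fst \<mu>2. x ^ m) - cos_coeff m * \<xi> ^ m * (LINT x|snd \<mu>2. x ^ m)"
    proof (cases "even m")
      case True
      have "m < 2 * k" using m by simp
      then have "m < 2 * k - 1" using True k by presburger
      then show ?thesis using mom by (simp add: sm_integral_def flip: right_diff_distrib)
    qed (simp add: cos_coeff_def)
  qed
  show ?thesis
  proof (intro exI conjI allI)
    show "0 \<le> I (fst \<mu>1) + I (snd \<mu>1) + I (fst \<mu>2) + I (snd \<mu>2)" by (intro add_nonneg_nonneg I0)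
    show "\<bar>sm_integral \<mu>1 (\<lambda>y. cos (\<xi> * y)) - sm_integral \<mu>2 (\<lambda>y. cos (\<xi> * y))\<bar> \<le> (I (fst \<mu>1) + I (snd \<mu>1) + I (fst \<mu>2) + I (snd \<mu>2)) * \<bar>\<xi>\<bar> ^ (2 * k)" for \<xi>
    proof -
      have *: "\<bar>a1 - a2 - (a3 - a4)\<bar> \<le> b1 + b2 + b3 + b4"
        if "\<bar>a1 - s1\<bar> \<le> b1" "\<bar>a2 - s2\<bar> \<le> b2" "\<bar>a3 - s3\<bar> \<le> b3" "\<bar>a4 - s4\<bar> \<le> b4" "s1 - s2 = s3 - s4"
        for a1 a2 a3 a4 b1 b2 b3 b4 s1 s2 s3 s4 :: real using that by linarith
      show ?thesis unfolding sm_integral_def distrib_right by (rule *[OF b b b b S]) auto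
    qed
  qed
qed

section \<open>The Cauchy problem in coordinates\<close>

lemma cs_continuous_iff:
  assumes s: "s \<ge> 0" and c: "\<And>t. t \<in> I \<Longrightarrow> cs s (u t) (Y t)"
  shows "sobolev_continuous_on s I u \<longleftrightarrow> continuous_on I Y"
proof -
  have "((\<lambda>r. sobolev_norm s (\<lambda>x. u r x - u t x)) \<longlongrightarrow> 0) (at t within I) \<longleftrightarrow> (Y \<longlongrightarrow> Y t) (at t within I)" if t: "t \<in> I" for t
  proof -
    have ev: "\<forall>\<^sub>F r in at t within I. sobolev_norm s (\<lambda>x. u r x - u t x) = norm (Y r - Y t)"
      unfolding eventually_at_filter by (intro always_eventually) (simp add: sobolev_norm_cs[OF s cs_linear(2)[OF s c c[OF t]]])
    show ?thesis unfolding tendsto_cong[OF ev] by (simp add: tendsto_norm_zero_iff LIM_zero_iff)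
  qed
  then show ?thesis unfolding sobolev_continuous_on_def continuous_on_def using c sobolev_iff[OF s] by blast
qed

lemma cs_deriv_iff:
  assumes s: "s \<ge> 0" and c: "\<And>r. r \<in> I \<Longrightarrow> cs s (u r) (Y r)" and w: "cs s w W" and t: "t \<in> I"
  shows "sobolev_has_deriv s I u t w \<longleftrightarrow> (Y has_vector_derivative W) (at t within I)"
proof -
  have ev: "\<forall>\<^sub>F r in at t within I. sobolev_norm s (\<lambda>x. (u r x - u t x) / (r - t) - w x) = norm ((1 / norm (r - t)) *\<^sub>R (Y r - (Y t + (r - t) *\<^sub>R W)))"
    unfolding eventually_at_filter
  proof (intro always_eventually allI impI)
    fix r assume r: "r \<noteq> t" "r \<in> I"
    have "cs s (\<lambda>x. 1 / (r - t) * (u r x - u t x) - w x) ((1 / (r - t)) *\<^sub>R (Y r - Y t) - W)"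
      by (rule cs_linear(2)[OF s cs_linear(3)[OF s cs_linear(2)[OF s c[OF r(2)] c[OF t]]] w]) (rule w)
    then have "sobolev_norm s (\<lambda>x. (u r x - u t x) / (r - t) - w x) = norm ((1 / (r - t)) *\<^sub>R (Y r - Y t) - W)"
      using sobolev_norm_cs[OF s] by simp
    also have "(1 / (r - t)) *\<^sub>R (Y r - Y t) - W = (1 / (r - t)) *\<^sub>R (Y r - (Y t + (r - t) *\<^sub>R W))"
      using r by (simp add: scaleR_right_diff_distrib scaleR_right_distrib)
    finally show "sobolev_norm s (\<lambda>x. (u r x - u t x) / (r - t) - w x) = norm ((1 / norm (r - t)) *\<^sub>R (Y r - (Y t + (r - t) *\<^sub>R W)))"
      by (simp add: divide_inverse)
  qed
  have "w \<in> sobolev s" "\<forall>r\<in>I. u r \<in> sobolev s" using c w sobolev_iff[OF s] by blast+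
  then show ?thesis
    unfolding sobolev_has_deriv_def tendsto_cong[OF ev] has_vector_derivative_def has_derivative_within tendsto_norm_zero_iff
    by (simp add: bounded_linear_scaleR_left)
qed

lemma rep_icjp_funpow: "AE \<xi> in lborel. rep ((mulS (icjp (-1)) ^^ n) Y) \<xi> = (icjp (-1) \<xi>) ^ n * rep Y \<xi>"
proof (induction n)
  case (Suc n)
  have "AE \<xi> in lborel. rep (mulS (icjp (-1)) ((mulS (icjp (-1)) ^^ n) Y)) \<xi> = icjp (-1) \<xi> * rep ((mulS (icjp (-1)) ^^ n) Y) \<xi>"
    by (rule rep_mulS[OF bsym_icjp]) simp
  with Suc show ?case by eventually_elim simp
qed simp

text \<open>The symbol \<open>icjp (-1)\<close> is a derivative together with the lowering of the
  level by one, so its \<open>n\<close>-th power leads from level \<open>s\<close> to level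
  \<open>s - n\<close>.\<close>

lemma cs_weak_deriv:
  assumes s: "s \<ge> real n" and c: "cs s f Y"
  shows "weak_deriv n f g \<longleftrightarrow> cs (s - real n) g ((mulS (icjp (-1)) ^^ n) Y)"
proof -
  have f: "sq_integrable f" and Ff: "Fl (ev f) = mulS (cjp (- s)) Y" using c by (auto simp: cs_def)
  have j: "cjp (- (s - real n)) \<xi> * (icjp (-1) \<xi>) ^ n = (\<i> * \<xi>) ^ n * cjp (- s) \<xi>" for \<xi>
  proof -
    have "(jp (-1) \<xi>) ^ n = jp (- real n) \<xi>"
      by (induction n) (simp_all add: jp_add algebra_simps)
    then have "jp (- (s - real n)) \<xi> * (jp (-1) \<xi>) ^ n = jp (- s) \<xi>" by (simp add: jp_add)
    then have "cjp (- (s - real n)) \<xi> * cjp (-1) \<xi> ^ n = cjp (- s) \<xi>" by (simp flip: of_real_mult of_real_power)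
    then show ?thesis by (simp add: power_mult_distrib mult.left_commute)
  qed
  have b: "bsym (cjp (- (s - real n)))" "bsym (cjp (- s))" using s by (auto intro!: bsym_cjp)
  have e: "AE \<xi> in lborel. rep (mulS (cjp (- (s - real n))) ((mulS (icjp (-1)) ^^ n) Y)) \<xi> = (\<i> * \<xi>) ^ n * rep (Fl (ev f)) \<xi>"
    using rep_mulS[OF b(1), of "(mulS (icjp (-1)) ^^ n) Y"] rep_mulS[OF b(2), of Y] rep_icjp_funpow[of n Y] unfolding Ff
    by eventually_elim (simp only: mult.assoc[symmetric] j)
  have "Fl (ev g) = mulS (cjp (- (s - real n))) ((mulS (icjp (-1)) ^^ n) Y) \<longleftrightarrow> (AE \<xi> in lborel. rep (Fl (ev g)) \<xi> = (\<i> * \<xi>) ^ n * rep (Fl (ev f)) \<xi>)"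
    unfolding l2_eq_iff using e by (auto elim: eventually_elim2)
  then show ?thesis unfolding weak_deriv_iff cs_def using f by blast
qed

text \<open>The weights \<open>cjp (-1)\<close> under the time derivatives record that
  \<open>u_t\<close> lives one level below \<open>u\<close>, and \<open>u_tt\<close> one level below
  \<open>u_t\<close>.\<close>

lemma cauchy_coordinates:
  assumes c: "cauchy_solution \<mu> \<epsilon> p \<phi> \<psi> r \<tau> w" and p: "p = Suc q" and r: "r \<ge> 2" and \<tau>: "\<tau> \<ge> 0"
    and \<mu>: "signed_measure \<mu>" and m: "kernel_fourier \<mu> = csym m" and d: "cs r \<phi> \<Phi>" "cs r \<psi> \<Psi>"
  obtains Y V where "\<And>t. t \<in> {0..\<tau>} \<Longrightarrow> cs r (w t) (Y t)" "continuous_on {0..\<tau>} Y" "continuous_on {0..\<tau>} V"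
    "\<And>t. t \<in> {0..\<tau>} \<Longrightarrow> ((\<lambda>t. mulS (cjp (-1)) (Y t)) has_vector_derivative V t) (at t within {0..\<tau>})"
    "\<And>t. t \<in> {0<..\<tau>} \<Longrightarrow> ((\<lambda>t. mulS (cjp (-1)) (V t)) has_vector_derivative
        mulS (csym m) (mulS (icjp (-1)) (mulS (icjp (-1)) (Y t + \<epsilon> ^ p *\<^sub>R pw r (Y t) (Suc q))))) (at t within {0..\<tau>})"
    "Y 0 = \<Phi>" "V 0 = mulS (icjp (-1)) \<Psi>"
proof -
  obtain v where cw: "sobolev_continuous_on r {0..\<tau>} w" and cv: "sobolev_continuous_on (r - 1) {0..\<tau>} v"
    and dw: "\<And>t. t \<in> {0..\<tau>} \<Longrightarrow> sobolev_has_deriv (r - 1) {0..\<tau>} w t (v t)"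
    and dv: "\<And>t. t \<in> {0<..\<tau>} \<Longrightarrow> \<exists>g. weak_deriv 2 (\<lambda>x. w t x + \<epsilon> ^ p * w t x ^ (p + 1)) g \<and> sobolev_has_deriv (r - 2) {0..\<tau>} v t (kernel_conv \<mu> g)"
    and i: "AE x in lborel. w 0 x = \<phi> x" "weak_deriv 1 \<psi> (v 0)"
    using c unfolding cauchy_solution_def by blast
  have r0: "r \<ge> 0" "r - 1 \<ge> 0" "r - 2 \<ge> 0" "r \<ge> 1" using r by auto
  have "\<exists>Y. \<forall>t\<in>{0..\<tau>}. cs r (w t) (Y t)" using cw unfolding sobolev_continuous_on_def sobolev_iff[OF r0(1)] by (intro bchoice) blast
  then obtain Y where Y: "\<And>t. t \<in> {0..\<tau>} \<Longrightarrow> cs r (w t) (Y t)" by blast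
  have "\<exists>V. \<forall>t\<in>{0..\<tau>}. cs (r - 1) (v t) (V t)" using cv unfolding sobolev_continuous_on_def sobolev_iff[OF r0(2)] by (intro bchoice) blast
  then obtain V where V: "\<And>t. t \<in> {0..\<tau>} \<Longrightarrow> cs (r - 1) (v t) (V t)" by blast
  have Yl: "cs (r - 1) (w t) (mulS (cjp (-1)) (Y t))" if "t \<in> {0..\<tau>}" for t
    using cs_low[OF r0(2) _ Y[OF that]] by simp
  have Vl: "cs (r - 2) (v t) (mulS (cjp (-1)) (V t))" if "t \<in> {0..\<tau>}" for t
    using cs_low[OF r0(3) _ V[OF that]] by simp
  show thesis
  proof (rule that[of Y V])
    show "continuous_on {0..\<tau>} Y" using cw cs_continuous_iff[of r "{0..\<tau>}" w Y, OF r0(1) Y] by simp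
    show "continuous_on {0..\<tau>} V" using cv cs_continuous_iff[of "r - 1" "{0..\<tau>}" v V, OF r0(2) V] by simp
    show "((\<lambda>t. mulS (cjp (-1)) (Y t)) has_vector_derivative V t) (at t within {0..\<tau>})" if t: "t \<in> {0..\<tau>}" for t
      using dw[OF t] cs_deriv_iff[of "r - 1" "{0..\<tau>}" w "\<lambda>t. mulS (cjp (-1)) (Y t)", OF r0(2) Yl V[OF t] t] by simp
    show "((\<lambda>t. mulS (cjp (-1)) (V t)) has_vector_derivative
        mulS (csym m) (mulS (icjp (-1)) (mulS (icjp (-1)) (Y t + \<epsilon> ^ p *\<^sub>R pw r (Y t) (Suc q))))) (at t within {0..\<tau>})" if t: "t \<in> {0<..\<tau>}" for t
    proof -
      have t': "t \<in> {0..\<tau>}" using t by auto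
      obtain g where g: "weak_deriv 2 (\<lambda>x. w t x + \<epsilon> ^ p * w t x ^ (p + 1)) g" "sobolev_has_deriv (r - 2) {0..\<tau>} v t (kernel_conv \<mu> g)"
        using dv[OF t] by blast
      have "cs r (\<lambda>x. w t x + \<epsilon> ^ p * w t x ^ Suc (Suc q)) (Y t + \<epsilon> ^ p *\<^sub>R pw r (Y t) (Suc q))"
        by (rule cs_linear(1)[OF r0(1) Y[OF t'] cs_linear(3)[OF r0(1) cs_pw[OF r0(4) Y[OF t']] Y[OF t']]])
      then have X: "cs r (\<lambda>x. w t x + \<epsilon> ^ p * w t x ^ (p + 1)) (Y t + \<epsilon> ^ p *\<^sub>R pw r (Y t) (Suc q))" by (simp add: p)
      have "cs (r - 2) g (mulS (icjp (-1)) (mulS (icjp (-1)) (Y t + \<epsilon> ^ p *\<^sub>R pw r (Y t) (Suc q))))"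
        using g(1) cs_weak_deriv[OF _ X, of 2 g] r by (simp add: numeral_2_eq_2)
      from cs_kernel_conv(2)[OF \<mu> r0(3) this]
      show ?thesis using g(2) cs_deriv_iff[of "r - 2" "{0..\<tau>}" v "\<lambda>t. mulS (cjp (-1)) (V t)", OF r0(3) Vl _ t'] unfolding m by blast
    qed
    have z: "0 \<in> {0..\<tau>}" using \<tau> by simp
    show "Y 0 = \<Phi>" using i(1) cs_eq_iff[OF r0(1) Y[OF z] d(1)] by simp
    have "cs (r - 1) (v 0) (mulS (icjp (-1)) \<Psi>)" using i(2) cs_weak_deriv[OF _ d(2), of 1 "v 0"] r by simp
    then show "V 0 = mulS (icjp (-1)) \<Psi>" by (rule cs_unique[OF r0(2) V[OF z]])
  qed (rule Y)
qed

lemma Sop_icjp: "Sop (mulS (icjp (-1)) y) = mulS (icjp (-1)) (Sop y)"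
  by (rule Sop_mulS[OF bsym_icjp]) simp_all

lemma csol_cauchy:
  assumes c: "csol m r q (\<epsilon> ^ p) \<tau> Y Z" and p: "p = Suc q" and r: "r \<ge> 2" and \<tau>: "\<tau> > 0"
    and \<mu>: "signed_measure \<mu>" and m: "kernel_fourier \<mu> = csym m" and mc: "mclass c1 c2 m" and d: "cs r \<phi> (Y 0)" "cs r \<psi> (Z 0)"
    and u: "\<And>t. t \<in> {0..\<tau>} \<Longrightarrow> cs r (u t) (Y t)"
  shows "cauchy_solution \<mu> \<epsilon> p \<phi> \<psi> r \<tau> u"
proof -
  have r0: "r \<ge> 0" "r - 1 \<ge> 0" "r - 2 \<ge> 0" "r \<ge> 1" using r by auto
  have bi: "bsym (icjp (-1))" and bc: "bsym (cjp (-1))" by (auto intro: bsym_icjp bsym_cjp)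
  have cY: "continuous_on {0..\<tau>} Y" and cZ: "continuous_on {0..\<tau>} Z" and hY: "\<And>t. t \<in> {0..\<tau>} \<Longrightarrow> herm (Y t)"
    and dY: "\<And>t. t \<in> {0..\<tau>} \<Longrightarrow> ((\<lambda>t. mulS (cjp (-1)) (Y t)) has_vector_derivative mulS (icjp (-1)) (Z t)) (at t within {0..\<tau>})"
    and dZ: "\<And>t. t \<in> {0..\<tau>} \<Longrightarrow> ((\<lambda>t. mulS (cjp (-1)) (Z t)) has_vector_derivative
        mulS (csym m) (mulS (icjp (-1)) (Y t + \<epsilon> ^ p *\<^sub>R pw r (Y t) (Suc q)))) (at t within {0..\<tau>})"
    using c unfolding csol_def by blast+
  define V where "V t = mulS (icjp (-1)) (Z t)" for t
  \<comment> \<open>\<open>csol\<close> records the symmetry of \<open>Y\<close> only;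
    \<open>V\<close> inherits it as the derivative of a Hermitian curve, because derivatives on an
    interval of positive length are unique.\<close>
  have hV: "herm (V t)" if t: "t \<in> {0..\<tau>}" for t
  proof -
    have 1: "((\<lambda>t. Sop (mulS (cjp (-1)) (Y t))) has_vector_derivative Sop (V t)) (at t within {0..\<tau>})"
      unfolding V_def by (rule bounded_linear.has_vector_derivative[OF bounded_linear_Sop dY[OF t]])
    have "((\<lambda>t. mulS (cjp (-1)) (Y t)) has_vector_derivative Sop (V t)) (at t within {0..\<tau>})"
    proof (rule has_vector_derivative_transform[OF t _ 1])
      show "mulS (cjp (-1)) (Y x) = Sop (mulS (cjp (-1)) (Y x))" if "x \<in> {0..\<tau>}" for x
        using herm_mulS_cjp[OF _ hY[OF that], of "-1"] by (simp add: herm_def)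
    qed
    then have "Sop (V t) = V t"
      by (rule vector_derivative_unique_within_closed_interval[of 0 \<tau> t, unfolded cbox_interval, OF \<tau> t _ dY[OF t, folded V_def]])
    then show ?thesis by (simp add: herm_def)
  qed
  have "\<exists>v. \<forall>t\<in>{0..\<tau>}. cs (r - 1) (v t) (V t)" by (intro bchoice ballI cs_ex r0 hV)
  then obtain v where v: "\<And>t. t \<in> {0..\<tau>} \<Longrightarrow> cs (r - 1) (v t) (V t)" by blast
  have ul: "cs (r - 1) (u t) (mulS (cjp (-1)) (Y t))" if "t \<in> {0..\<tau>}" for t
    using cs_low[OF r0(2) _ u[OF that]] by simp
  have vl: "cs (r - 2) (v t) (mulS (cjp (-1)) (V t))" if "t \<in> {0..\<tau>}" for t
    using cs_low[OF r0(3) _ v[OF that]] by simp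
  show ?thesis unfolding cauchy_solution_def
  proof (intro conjI exI[of _ v] ballI)
    show "sobolev_continuous_on r {0..\<tau>} u" using cs_continuous_iff[of r "{0..\<tau>}" u Y, OF r0(1) u] cY by simp
    have "continuous_on {0..\<tau>} V" unfolding V_def by (rule bounded_linear.continuous_on[OF bounded_linear_mulS[OF bi] cZ])
    then show "sobolev_continuous_on (r - 1) {0..\<tau>} v" using cs_continuous_iff[of "r - 1" "{0..\<tau>}" v V, OF r0(2) v] by simp
    show "sobolev_has_deriv (r - 1) {0..\<tau>} u t (v t)" if t: "t \<in> {0..\<tau>}" for t
      using dY[OF t] cs_deriv_iff[of "r - 1" "{0..\<tau>}" u "\<lambda>t. mulS (cjp (-1)) (Y t)", OF r0(2) ul v[OF t] t] by (simp add: V_def)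
    show "\<exists>g. weak_deriv 2 (\<lambda>x. u t x + \<epsilon> ^ p * u t x ^ (p + 1)) g \<and> sobolev_has_deriv (r - 2) {0..\<tau>} v t (kernel_conv \<mu> g)" if "t \<in> {0<..\<tau>}" for t
    proof -
      have t: "t \<in> {0..\<tau>}" using that by auto
      define X where "X = Y t + \<epsilon> ^ p *\<^sub>R pw r (Y t) (Suc q)"
      have "cs r (\<lambda>x. u t x + \<epsilon> ^ p * u t x ^ Suc (Suc q)) X"
        unfolding X_def by (rule cs_linear(1)[OF r0(1) u[OF t] cs_linear(3)[OF r0(1) cs_pw[OF r0(4) u[OF t]] u[OF t]]])
      then have X: "cs r (\<lambda>x. u t x + \<epsilon> ^ p * u t x ^ (p + 1)) X" by (simp add: p)
      have "herm (mulS (icjp (-1)) (mulS (icjp (-1)) X))"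
        using cs_herm[OF r0(1) X] by (simp add: herm_def Sop_icjp)
      then obtain g where g: "cs (r - 2) g (mulS (icjp (-1)) (mulS (icjp (-1)) X))" using cs_ex[OF r0(3)] by blast
      have "weak_deriv 2 (\<lambda>x. u t x + \<epsilon> ^ p * u t x ^ (p + 1)) g"
        using g cs_weak_deriv[OF _ X, of 2 g] r by (simp add: numeral_2_eq_2)
      moreover have "((\<lambda>t. mulS (cjp (-1)) (V t)) has_vector_derivative mulS (csym m) (mulS (icjp (-1)) (mulS (icjp (-1)) X))) (at t within {0..\<tau>})"
        using bounded_linear.has_vector_derivative[OF bounded_linear_mulS[OF bi] dZ[OF t]]
        unfolding V_def X_def mulS_commute[OF bc bi] mulS_commute[OF bsym_m[OF mc] bi] .
      then have "sobolev_has_deriv (r - 2) {0..\<tau>} v t (kernel_conv \<mu> g)"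
        using cs_deriv_iff[of "r - 2" "{0..\<tau>}" v "\<lambda>t. mulS (cjp (-1)) (V t)", OF r0(3) vl cs_kernel_conv(2)[OF \<mu> r0(3) g] t] unfolding m by simp
      ultimately show ?thesis by blast
    qed
    have z: "0 \<in> {0..\<tau>}" using \<tau> by simp
    show "AE x in lborel. u 0 x = \<phi> x" using cs_eq_iff[OF r0(1) u[OF z] d(1)] by simp
    show "weak_deriv 1 \<psi> (v 0)" using v[OF z] cs_weak_deriv[OF _ d(2), of 1 "v 0"] r by (simp add: V_def)
  qed
qed

text \<open>The coordinate solution is realized by real functions through \<open>cs_ex\<close>; a
  competitor is carried back to coordinates, where \<open>csol_unique\<close> identifies it.\<close>

lemma unique_cauchy:
  assumes g: "good_sol r q (\<epsilon> ^ p) \<tau> M N \<Phi> \<Psi> m Y Z" and p: "p = Suc q" and r: "r \<ge> 5" "r \<le> N" and \<tau>: "\<tau> > 0" and \<epsilon>: "\<epsilon> > 0"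
    and \<mu>: "signed_measure \<mu>" and m: "kernel_fourier \<mu> = csym m" and mc: "mclass c1 c2 m" and d: "cs N \<phi> \<Phi>" "cs N \<psi> \<Psi>"
    and Cb: "\<And>y h. norm y \<le> M \<Longrightarrow> \<bar>inner (Ps (r - 3) (bco (r - 3) q y) h) h\<bar> \<le> Cb * (norm h)\<^sup>2" "\<epsilon> ^ p * Cb \<le> 1/2"
  obtains u where "unique_cauchy_solution \<mu> \<epsilon> p \<phi> \<psi> r \<tau> u" "\<And>t. t \<in> {0..\<tau>} \<Longrightarrow> cs r (u t) (Y t)"
proof -
  have r0: "r \<ge> 0" and r2: "r \<ge> 2" using r by auto
  have c: "csol m r q (\<epsilon> ^ p) \<tau> Y Z" and i: "Y 0 = mulS (cjp (r - N)) \<Phi>" "Z 0 = mulS (cjp (r - N)) \<Psi>"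
    and bd: "\<And>t. t \<in> {0..\<tau>} \<Longrightarrow> norm (Y t) \<le> M" using g unfolding good_sol_def by auto
  have d': "cs r \<phi> (Y 0)" "cs r \<psi> (Z 0)" unfolding i by (rule cs_low[OF r0 r(2) d(1)], rule cs_low[OF r0 r(2) d(2)])
  have "\<exists>u. \<forall>t\<in>{0..\<tau>}. cs r (u t) (Y t)" using c unfolding csol_def by (intro bchoice ballI cs_ex r0) blast
  then obtain u where u: "\<And>t. t \<in> {0..\<tau>} \<Longrightarrow> cs r (u t) (Y t)" by blast
  have "cauchy_solution \<mu> \<epsilon> p \<phi> \<psi> r \<tau> u" by (rule csol_cauchy[OF c p r2 \<tau> \<mu> m mc d' u])
  moreover have "AE x in lborel. w t x = u t x" if w: "cauchy_solution \<mu> \<epsilon> p \<phi> \<psi> r \<tau> w" and t: "t \<in> {0..\<tau>}" for w t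
  proof -
    obtain Y2 V2 where Y2: "\<And>t. t \<in> {0..\<tau>} \<Longrightarrow> cs r (w t) (Y2 t)" and cY: "continuous_on {0..\<tau>} Y2" "continuous_on {0..\<tau>} V2"
      and dY: "\<And>t. t \<in> {0..\<tau>} \<Longrightarrow> ((\<lambda>t. mulS (cjp (-1)) (Y2 t)) has_vector_derivative V2 t) (at t within {0..\<tau>})"
      and dV: "\<And>t. t \<in> {0<..\<tau>} \<Longrightarrow> ((\<lambda>t. mulS (cjp (-1)) (V2 t)) has_vector_derivative
        mulS (csym m) (mulS (icjp (-1)) (mulS (icjp (-1)) (Y2 t + \<epsilon> ^ p *\<^sub>R pw r (Y2 t) (Suc q))))) (at t within {0..\<tau>})"
      and iY: "Y2 0 = Y 0" "V2 0 = mulS (icjp (-1)) (Z 0)"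
      using cauchy_coordinates[OF w p r2 less_imp_le[OF \<tau>] \<mu> m d'] by blast
    have "Y2 t = Y t"
      by (rule csol_unique[OF r(1) mc _ less_imp_le[OF \<tau>] c Cb bd cY dY dV iY t]) (use \<epsilon> in auto)
    then show ?thesis using cs_eq_iff[OF r0 Y2[OF t] u[OF t]] by simp
  qed
  ultimately have "unique_cauchy_solution \<mu> \<epsilon> p \<phi> \<psi> r \<tau> u" unfolding unique_cauchy_solution_def by blast
  then show thesis using u by (rule that)
qed

section \<open>Uniformity in \<delta> and the estimate for two kernels\<close>

lemma scaled_kernel_class:
  assumes \<beta>: "signed_measure \<beta>" "even_kernel \<beta>" and d: "\<delta> > 0" and c: "c1 > 0"
    and b: "\<And>\<xi>. c1 \<le> Re (kernel_fourier \<beta> \<xi>) \<and> Re (kernel_fourier \<beta> \<xi>) \<le> c2"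
  defines "m \<equiv> \<lambda>\<xi>. sm_integral \<beta> (\<lambda>y. cos (\<delta> * \<xi> * y))"
  shows "kernel_fourier (scale_kernel \<delta> \<beta>) = csym m" "mclass c1 c2 m"
proof -
  show k: "kernel_fourier (scale_kernel \<delta> \<beta>) = csym m"
    by (rule ext) (simp add: kernel_fourier_scale[OF \<beta>(1)] kernel_fourier_even[OF \<beta>] m_def)
  have [measurable]: "kernel_fourier \<beta> \<in> borel_measurable borel" by (rule kernel_fourier_measurable[OF \<beta>(1)])
  have e: "m = (\<lambda>\<xi>. Re (kernel_fourier \<beta> (\<delta> * \<xi>)))" by (rule ext) (simp add: kernel_fourier_even[OF \<beta>] m_def)
  have "m \<in> borel_measurable borel" unfolding e by measurable
  moreover have "c1 \<le> m \<xi> \<and> m \<xi> \<le> c2" for \<xi> using b[of "\<delta> * \<xi>"] by (simp add: e)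
  moreover have "m (- \<xi>) = m \<xi>" for \<xi> by (simp add: m_def)
  ultimately show "mclass c1 c2 m" unfolding mclass_def using c by blast
qed

theorem theorem3p2:
  fixes p k :: nat
    and \<beta>1 \<beta>2 :: signed_measure
    and D P s :: real
    and \<phi> \<psi> :: "real \<Rightarrow> real"
  assumes "p \<ge> 1" and "k \<ge> 1"
    and "signed_measure \<beta>1" and "signed_measure \<beta>2"
    and "even_kernel \<beta>1" and "even_kernel \<beta>2"
    and "sm_value \<beta>1 UNIV = 1" and "sm_value \<beta>2 UNIV = 1"
    and "\<exists>c1>0. \<exists>c2>0. \<forall>\<xi>. \<forall>\<beta>\<in>{\<beta>1, \<beta>2}.
           c1\<^sup>2 \<le> Re (kernel_fourier \<beta> \<xi>) \<and> Re (kernel_fourier \<beta> \<xi>) \<le> c2\<^sup>2"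
    and "\<forall>j<2 * k - 1. sm_integral \<beta>1 (\<lambda>x. x ^ j) = sm_integral \<beta>2 (\<lambda>x. x ^ j)"
    and "integrable (total_variation \<beta>1) (\<lambda>x. x ^ (2 * k))"
    and "integrable (total_variation \<beta>2) (\<lambda>x. x ^ (2 * k))"
    and "D > 3"
    and "P > 3 + D / (D - 3) * (sqrt 3 + sqrt (2 * D))\<^sup>2"
    and "s > 7 / 2"
    and "\<phi> \<in> sobolev (s + P + 2 * real k + 1)"
    and "\<psi> \<in> sobolev (s + P + 2 * real k + 1)"
  shows "\<exists>\<epsilon>0>0. \<exists>C>0. \<exists>T>0. \<forall>\<epsilon> \<delta>. 0 < \<epsilon> \<and> \<epsilon> < \<epsilon>0 \<and> 0 < \<delta> \<longrightarrow>
           (\<exists>u1 u2.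
              unique_cauchy_solution (scale_kernel \<delta> \<beta>1) \<epsilon> p \<phi> \<psi> (s + D) (T / \<epsilon> ^ p) u1 \<and>
              unique_cauchy_solution (scale_kernel \<delta> \<beta>2) \<epsilon> p \<phi> \<psi> (s + D) (T / \<epsilon> ^ p) u2 \<and>
              (\<forall>t\<in>{0..T / \<epsilon> ^ p}.
                 sobolev_norm (s + D) (\<lambda>x. u1 t x - u2 t x) \<le> C * \<delta> ^ (2 * k) * (1 + t)))"
proof -
  define r where "r = s + D"
  \<comment> \<open>The solutions are built with data at this level: 2k for the difference of the
    symbols, one for the derivative in the flux, one for the rate of the cutoffs.\<close>
  define N where "N = r + 2 * real k + 2"
  define L where "L = s + P + 2 * real k + 1"
  have r5: "r \<ge> 5" and r0: "r \<ge> 0" and rN: "r \<le> N" and N0: "N \<ge> 0" using assms by (auto simp: r_def N_def)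
  obtain q where q: "p = Suc q" using assms(1) by (cases p) auto
  \<comment> \<open>The threshold for \<open>P\<close> is at least 3 + 2D, since the quotient is at
    least 1 and the square at least 2D. Hence the data are smooth enough for the level
    \<open>N\<close>.\<close>
  have NL: "N \<le> L"
  proof -
    have "1 \<le> D / (D - 3)" using assms(13) by simp
    then have "1 * (sqrt 3 + sqrt (2 * D))\<^sup>2 \<le> D / (D - 3) * (sqrt 3 + sqrt (2 * D))\<^sup>2" by (rule mult_right_mono) simp
    moreover have "2 * D \<le> (sqrt 3 + sqrt (2 * D))\<^sup>2"
    proof -
      have "(sqrt (2 * D))\<^sup>2 \<le> (sqrt 3 + sqrt (2 * D))\<^sup>2" using assms(13) by (intro power_mono) auto
      then show ?thesis using assms(13) by simp
    qed
    ultimately show ?thesis using assms(13,14) by (simp add: N_def L_def r_def)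
  qed
  have L0: "L \<ge> 0" using N0 NL by simp
  have lev: "\<exists>Y. cs N f Y" if "f \<in> sobolev L" for f
    using that cs_low[OF N0 NL] unfolding sobolev_iff[OF L0] by blast
  obtain \<Phi> \<Psi> where d: "cs N \<phi> \<Phi>" "cs N \<psi> \<Psi>"
    using lev[OF assms(16)[folded L_def]] lev[OF assms(17)[folded L_def]] by blast
  obtain c1 c2 where c0: "c1 > 0" "c2 > 0"
    and c: "\<And>\<xi>. c1\<^sup>2 \<le> Re (kernel_fourier \<beta>1 \<xi>) \<and> Re (kernel_fourier \<beta>1 \<xi>) \<le> c2\<^sup>2" "\<And>\<xi>. c1\<^sup>2 \<le> Re (kernel_fourier \<beta>2 \<xi>) \<and> Re (kernel_fourier \<beta>2 \<xi>) \<le> c2\<^sup>2"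
    using assms(9) by blast
  have cc: "c1\<^sup>2 > 0" "c2\<^sup>2 > 0" using c0 by auto
  define M0 where "M0 = max (norm \<Phi>) (norm \<Psi>)"
  have M0: "M0 \<ge> 0" "norm \<Phi> \<le> M0" "norm \<Psi> \<le> M0" by (auto simp: M0_def le_max_iff_disj)
  obtain T lam0 C M Cb where T: "T > 0" and l0: "lam0 > 0" and C: "C \<ge> 0" and Cb: "lam0 * Cb \<le> 1/2" "Cb \<ge> 0"
    and Cb': "\<forall>y h. norm y \<le> M \<longrightarrow> \<bar>inner (Ps (r - 3) (bco (r - 3) q y) h) h\<bar> \<le> Cb * (norm h)\<^sup>2"
    and sol: "\<forall>m1 m2 \<kappa> lam Y0 Z0. mclass (c1\<^sup>2) (c2\<^sup>2) m1 \<longrightarrow> mclass (c1\<^sup>2) (c2\<^sup>2) m2 \<longrightarrow> (\<forall>\<xi>. \<bar>m1 \<xi> - m2 \<xi>\<bar> \<le> \<kappa> * \<bar>\<xi>\<bar> ^ (2 * k)) \<longrightarrow> 0 \<le> \<kappa> \<longrightarrow>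
     0 < lam \<longrightarrow> lam \<le> lam0 \<longrightarrow> herm Y0 \<longrightarrow> herm Z0 \<longrightarrow> norm Y0 \<le> M0 \<longrightarrow> norm Z0 \<le> M0 \<longrightarrow>
     (\<exists>Y1 Z1 Y2 Z2. good_sol r q lam (T / lam) M N Y0 Z0 m1 Y1 Z1 \<and> good_sol r q lam (T / lam) M N Y0 Z0 m2 Y2 Z2 \<and>
        (\<forall>t\<in>{0..T / lam}. norm (Y1 t - Y2 t) \<le> C * \<kappa> * t))"
    using coordinate_solutions[OF r5 cc M0(1) N_def, of q] by (elim exE conjE) (rule that)
  obtain Ck where Ck: "Ck \<ge> 0" "\<And>\<xi>. \<bar>sm_integral \<beta>1 (\<lambda>y. cos (\<xi> * y)) - sm_integral \<beta>2 (\<lambda>y. cos (\<xi> * y))\<bar> \<le> Ck * \<bar>\<xi>\<bar> ^ (2 * k)"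
    using kernel_difference[OF assms(3,4,2,10,11,12)] by blast
  have main: "\<exists>u1 u2.
      unique_cauchy_solution (scale_kernel \<delta> \<beta>1) \<epsilon> p \<phi> \<psi> r (T / \<epsilon> ^ p) u1 \<and>
      unique_cauchy_solution (scale_kernel \<delta> \<beta>2) \<epsilon> p \<phi> \<psi> r (T / \<epsilon> ^ p) u2 \<and>
      (\<forall>t\<in>{0..T / \<epsilon> ^ p}. sobolev_norm r (\<lambda>x. u1 t x - u2 t x) \<le> (C * Ck + 1) * \<delta> ^ (2 * k) * (1 + t))"
    if \<epsilon>: "0 < \<epsilon>" "\<epsilon> < min 1 lam0" and \<delta>: "0 < \<delta>" for \<epsilon> \<delta>
  proof -
    define m1 where "m1 \<xi> = sm_integral \<beta>1 (\<lambda>y. cos (\<delta> * \<xi> * y))" for \<xi>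
    define m2 where "m2 \<xi> = sm_integral \<beta>2 (\<lambda>y. cos (\<delta> * \<xi> * y))" for \<xi>
    note k1 = scaled_kernel_class[OF assms(3,5) \<delta> cc(1) c(1), folded m1_def]
    note k2 = scaled_kernel_class[OF assms(4,6) \<delta> cc(1) c(2), folded m2_def]
    \<comment> \<open>The power of \<delta> in the result: the symbols are compared at
      \<delta>\<xi>, and the bound of \<open>kernel_difference\<close> is homogeneous of degree
      2k.\<close>
    define \<kappa> where "\<kappa> = Ck * \<delta> ^ (2 * k)"
    have \<kappa>: "\<kappa> \<ge> 0" using Ck \<delta> by (simp add: \<kappa>_def)
    have km: "\<forall>\<xi>. \<bar>m1 \<xi> - m2 \<xi>\<bar> \<le> \<kappa> * \<bar>\<xi>\<bar> ^ (2 * k)"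
    proof
      show "\<bar>m1 \<xi> - m2 \<xi>\<bar> \<le> \<kappa> * \<bar>\<xi>\<bar> ^ (2 * k)" for \<xi>
        using Ck(2)[of "\<delta> * \<xi>"] \<delta> by (simp add: m1_def m2_def \<kappa>_def abs_mult power_mult_distrib mult.assoc)
    qed
    have lam: "0 < \<epsilon> ^ p" "\<epsilon> ^ p \<le> lam0"
    proof -
      \<comment> \<open>The entry 1 in \<open>min 1 lam0\<close> is used here: for \<epsilon> below
        1 the power is at most \<epsilon> itself.\<close>
      have "\<epsilon> ^ p \<le> \<epsilon> ^ 1" using \<epsilon> assms(1) by (intro power_decreasing) auto
      then show "\<epsilon> ^ p \<le> lam0" using \<epsilon> by simp
    qed (use \<epsilon> in simp)
    have lCb: "\<epsilon> ^ p * Cb \<le> 1/2" using mult_right_mono[OF lam(2) Cb(2)] Cb(1) by linarith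
    have \<tau>: "T / \<epsilon> ^ p > 0" using T lam by simp
    obtain Y1 Z1 Y2 Z2 where g: "good_sol r q (\<epsilon> ^ p) (T / \<epsilon> ^ p) M N \<Phi> \<Psi> m1 Y1 Z1" "good_sol r q (\<epsilon> ^ p) (T / \<epsilon> ^ p) M N \<Phi> \<Psi> m2 Y2 Z2"
      and df: "\<forall>t\<in>{0..T / \<epsilon> ^ p}. norm (Y1 t - Y2 t) \<le> C * \<kappa> * t"
      using sol[rule_format, OF k1(2) k2(2) km[rule_format] \<kappa> lam cs_herm[OF N0 d(1)] cs_herm[OF N0 d(2)] M0(2,3)] by blast
    obtain u1 where u1: "unique_cauchy_solution (scale_kernel \<delta> \<beta>1) \<epsilon> p \<phi> \<psi> r (T / \<epsilon> ^ p) u1" "\<And>t. t \<in> {0..T / \<epsilon> ^ p} \<Longrightarrow> cs r (u1 t) (Y1 t)"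
      using unique_cauchy[OF g(1) q r5 rN \<tau> \<epsilon>(1) signed_measure_scale[OF assms(3) \<delta>] k1 d Cb'[rule_format] lCb] by blast
    obtain u2 where u2: "unique_cauchy_solution (scale_kernel \<delta> \<beta>2) \<epsilon> p \<phi> \<psi> r (T / \<epsilon> ^ p) u2" "\<And>t. t \<in> {0..T / \<epsilon> ^ p} \<Longrightarrow> cs r (u2 t) (Y2 t)"
      using unique_cauchy[OF g(2) q r5 rN \<tau> \<epsilon>(1) signed_measure_scale[OF assms(4) \<delta>] k2 d Cb'[rule_format] lCb] by blast
    have "sobolev_norm r (\<lambda>x. u1 t x - u2 t x) \<le> (C * Ck + 1) * \<delta> ^ (2 * k) * (1 + t)" if t: "t \<in> {0..T / \<epsilon> ^ p}" for t
    proof -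
      have "sobolev_norm r (\<lambda>x. u1 t x - u2 t x) = norm (Y1 t - Y2 t)"
        by (rule sobolev_norm_cs[OF r0 cs_linear(2)[OF r0 u1(2)[OF t] u2(2)[OF t]]])
      also have "\<dots> \<le> C * \<kappa> * t" using df t by blast
      also have "\<dots> = (C * Ck * \<delta> ^ (2 * k)) * t" by (simp add: \<kappa>_def mult.assoc)
      \<comment> \<open>The summand 1 makes the constant strictly positive, also when
        \<open>C * Ck\<close> is zero.\<close>
      also have "\<dots> \<le> ((C * Ck + 1) * \<delta> ^ (2 * k)) * (1 + t)"
        using C Ck(1) \<delta> t by (intro mult_mono mult_right_mono) auto
      finally show ?thesis .
    qed
    then show ?thesis using u1(1) u2(1) by blast
  qed
  have C1: "C * Ck + 1 > 0" using C Ck(1) by (simp add: add_nonneg_pos)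
  have e0: "min 1 lam0 > 0" using l0 by simp
  show ?thesis
    by (rule exI[of _ "min 1 lam0"], rule conjI[OF e0], rule exI[of _ "C * Ck + 1"], rule conjI[OF C1], rule exI[of _ T], rule conjI[OF T])
      (use main in \<open>unfold r_def, blast\<close>)
qed

end
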